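(* (i) If $G$ is an odd quadrangulation of a (non-orientable) surface of genus at most four, then $\psi(G)\ge 4$. (ii) Every non-orientable surface of genus at least five admits an odd quadrangulation that has a local $3$-coloring using six colors.
   Context: A surface is a compact connected 2-manifold without boundary. The genus of a non-orientable surface is its non-orientable genus $g\ge 1$ (number of crosscaps; the projective plane has genus $1$, the Klein bottle genus $2$, and the Euler characteristic is $2-g$). A quadrangulation of a surface is a (finite) loopless graph embedded on the surface such that all faces are quadrilaterals; parallel edges are allowed, and quadrilateral faces may have some of their vertices or even edges coinciding. Odd and even quadrangulations: choose an arbitrary orientation of each face, viewed as a closed walk along its boundary. Consistency is not broken at an edge if the edge is traversed in opposite directions when considering the faces at its two sides; otherwise the edge breaks consistency. The parity of the number of edges breaking consistency does not depend on the chosen orientations of the faces; the quadrangulation is called odd or even according to this parity. (All quadrangulations of orientable surfaces are even.) For a vertex $v$ of a graph $G$, $N(v)$ denotes the set of vertices adjacent to $v$. For an integer $k\ge 1$, a proper vertex-coloring $c$ of $G$ is a local $k$-coloring if $|c(N(v))|\le k-1$ for every vertex $v$ of $G$ (the total number of colors used is not restricted). The local chromatic number $\psi(G)$ is the smallest $k$ such that $G$ has a local $k$-coloring. *)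

theory Defs
  imports "HOL-Analysis.Analysis"
begin

section \<open>Local colorings\<close>

text \<open>
  Only the adjacency relation of a graph matters for colorings, so a graph is given here by its
  vertex set \<open>V\<close> and a relation \<open>adj\<close> (parallel edges are invisible).
\<close>

definition neighborhood :: "'a set \<Rightarrow> ('a \<Rightarrow> 'a \<Rightarrow> bool) \<Rightarrow> 'a \<Rightarrow> 'a set" where
  "neighborhood V adj v = {w \<in> V. adj v w}"

definition proper_coloring :: "'a set \<Rightarrow> ('a \<Rightarrow> 'a \<Rightarrow> bool) \<Rightarrow> ('a \<Rightarrow> 'c) \<Rightarrow> bool" where
  "proper_coloring V adj c \<longleftrightarrow> (\<forall>u\<in>V. \<forall>w\<in>V. adj u w \<longrightarrow> c u \<noteq> c w)"

definition local_coloring :: "'a set \<Rightarrow> ('a \<Rightarrow> 'a \<Rightarrow> bool) \<Rightarrow> nat \<Rightarrow> ('a \<Rightarrow> 'c) \<Rightarrow> bool" where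
  "local_coloring V adj k c \<longleftrightarrow>
     1 \<le> k \<and> proper_coloring V adj c \<and>
     (\<forall>v\<in>V. finite (c ` neighborhood V adj v) \<and> card (c ` neighborhood V adj v) \<le> k - 1)"

text \<open>
  The graphs considered are finite, so natural numbers suffice as colors and the set of admissible
  \<open>k\<close> is nonempty (color all vertices differently).
\<close>

definition local_chromatic_number :: "'a set \<Rightarrow> ('a \<Rightarrow> 'a \<Rightarrow> bool) \<Rightarrow> nat" where
  "local_chromatic_number V adj = (LEAST k. \<exists>c :: 'a \<Rightarrow> nat. local_coloring V adj k c)"


section \<open>Surfaces\<close>

definition closed_surface :: "'a topology \<Rightarrow> bool" where
  "closed_surface X \<longleftrightarrow>
     topspace X \<noteq> {} \<and> compact_space X \<and> connected_space X \<and>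
     Hausdorff_space X \<and> second_countable X \<and>
     (\<forall>x\<in>topspace X. \<exists>U. openin X U \<and> x \<in> U \<and>
        subtopology X U homeomorphic_space (euclidean :: (real^2) topology))"

text \<open>
  The sphere with \<open>g\<close> crosscaps is the closed unit disc with its boundary circle divided into
  \<open>2 g\<close> equal arcs and glued according to the word \<open>a\<^sub>1 a\<^sub>1 a\<^sub>2 a\<^sub>2 \<dots> a\<^sub>g a\<^sub>g\<close>: each arc of even
  index is identified with the next arc by rotation through the angle \<open>\<pi> / g\<close>. (For \<open>g = 1\<close>
  these are the antipodal identifications giving the projective plane.)
\<close>

definition crosscap_gluing :: "nat \<Rightarrow> (complex \<times> complex) set" where
  "crosscap_gluing g =
     {(cis t, cis (t + pi / real g)) | t k.
        k < g \<and> 2 * real k * pi / real g \<le> t \<and> t \<le> (2 * real k + 1) * pi / real g}"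

definition nonorientable_surface :: "nat \<Rightarrow> 'a topology \<Rightarrow> bool" where
  "nonorientable_surface g X \<longleftrightarrow>
     1 \<le> g \<and> closed_surface X \<and>
     (\<exists>q. quotient_map (top_of_set (cball (0::complex) 1)) X q \<and>
        (\<forall>x\<in>cball 0 1. \<forall>y\<in>cball 0 1.
           q x = q y \<longleftrightarrow> (x, y) \<in> (crosscap_gluing g \<union> (crosscap_gluing g)\<inverse>)\<^sup>*))"


section \<open>Graphs embedded on a surface\<close>

text \<open>
  The vertices are points of \<open>X\<close>; the edges are (images of) simple arcs meeting \<open>V\<close> and each other
  only in end points. The ends of an edge \<open>e\<close> are thus the two elements of \<open>e \<inter> V\<close>; there are
  no loops, and parallel edges are different arcs with the same ends.
\<close>

definition embedded_graph :: "'a topology \<Rightarrow> 'a set \<Rightarrow> 'a set set \<Rightarrow> bool" where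
  "embedded_graph X V E \<longleftrightarrow>
     finite V \<and> V \<subseteq> topspace X \<and> finite E \<and>
     (\<forall>e\<in>E. \<exists>p. pathin X p \<and> inj_on p {0..1} \<and> e = p ` {0..1} \<and> e \<inter> V = {p 0, p 1}) \<and>
     (\<forall>e\<in>E. \<forall>e'\<in>E. e \<noteq> e' \<longrightarrow> e \<inter> e' \<subseteq> V)"

definition adjacent :: "'a set \<Rightarrow> 'a set set \<Rightarrow> 'a \<Rightarrow> 'a \<Rightarrow> bool" where
  "adjacent V E u w \<longleftrightarrow> u \<noteq> w \<and> (\<exists>e\<in>E. e \<inter> V = {u, w})"

definition faces :: "'a topology \<Rightarrow> 'a set \<Rightarrow> 'a set set \<Rightarrow> 'a set set" where
  "faces X V E = connected_components_of (subtopology X (topspace X - (V \<union> \<Union>E)))"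


section \<open>Quadrangulations\<close>

definition quarter_circle :: "nat \<Rightarrow> complex set" where
  "quarter_circle i = cis ` {real i * pi / 2 .. (real i + 1) * pi / 2}"

text \<open>
  \<open>quad_walk X V E F w\<close>: the face \<open>F\<close> is a quadrilateral, and \<open>w = [(v\<^sub>0,e\<^sub>0), \<dots>, (v\<^sub>3,e\<^sub>3)]\<close> is the
  closed walk along its boundary, in one of its two directions and from one of its corners. It
  traverses the edge \<open>e\<^sub>i\<close> starting from \<open>v\<^sub>i\<close>. The face is an open disc, whose homeomorphism with
  the unit disc extends continuously to the boundary circle and maps its four quarters along the
  four edges. Vertices and edges may be repeated in \<open>w\<close>.
\<close>

definition quad_walk ::
  "'a topology \<Rightarrow> 'a set \<Rightarrow> 'a set set \<Rightarrow> 'a set \<Rightarrow> ('a \<times> 'a set) list \<Rightarrow> bool" where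
  "quad_walk X V E F w \<longleftrightarrow>
     length w = 4 \<and> set w \<subseteq> V \<times> E \<and>
     (\<exists>h. continuous_map (top_of_set (cball (0::complex) 1)) X h \<and>
        homeomorphic_map (top_of_set (ball (0::complex) 1)) (subtopology X F) h \<and>
        (\<forall>i<4. h (cis (real i * pi / 2)) = fst (w ! i) \<and>
               inj_on h (quarter_circle i) \<and> h ` quarter_circle i = snd (w ! i)))"

definition quadrangulation :: "'a topology \<Rightarrow> 'a set \<Rightarrow> 'a set set \<Rightarrow> bool" where
  "quadrangulation X V E \<longleftrightarrow>
     closed_surface X \<and> embedded_graph X V E \<and> (\<forall>F\<in>faces X V E. \<exists>w. quad_walk X V E F w)"

text \<open>An orientation of the faces is a choice of a boundary walk for each face.\<close>

definition face_orientation ::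
  "'a topology \<Rightarrow> 'a set \<Rightarrow> 'a set set \<Rightarrow> ('a set \<Rightarrow> ('a \<times> 'a set) list) \<Rightarrow> bool" where
  "face_orientation X V E W \<longleftrightarrow> (\<forall>F\<in>faces X V E. quad_walk X V E F (W F))"

text \<open>
  The two sides of an edge are its two occurrences in the chosen boundary walks (possibly both in
  the same walk). As there are no loops, an edge is traversed in the same direction at both sides
  iff both traversals start at the same vertex.
\<close>

definition edge_sides ::
  "'a topology \<Rightarrow> 'a set \<Rightarrow> 'a set set \<Rightarrow> ('a set \<Rightarrow> ('a \<times> 'a set) list) \<Rightarrow> 'a set \<Rightarrow>
   ('a set \<times> nat) set" where
  "edge_sides X V E W e = {(F, i). F \<in> faces X V E \<and> i < 4 \<and> snd (W F ! i) = e}"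

definition breaks_consistency ::
  "'a topology \<Rightarrow> 'a set \<Rightarrow> 'a set set \<Rightarrow> ('a set \<Rightarrow> ('a \<times> 'a set) list) \<Rightarrow> 'a set \<Rightarrow> bool" where
  "breaks_consistency X V E W e \<longleftrightarrow>
     (\<exists>(F, i) \<in> edge_sides X V E W e. \<exists>(F', i') \<in> edge_sides X V E W e.
        (F, i) \<noteq> (F', i') \<and> fst (W F ! i) = fst (W F' ! i'))"

text \<open>The parity does not depend on the orientation \<open>W\<close>, so any one of them may be used.\<close>

definition odd_quadrangulation :: "'a topology \<Rightarrow> 'a set \<Rightarrow> 'a set set \<Rightarrow> bool" where
  "odd_quadrangulation X V E \<longleftrightarrow>
     quadrangulation X V E \<and>
     (\<exists>W. face_orientation X V E W \<and> odd (card {e \<in> E. breaks_consistency X V E W e}))"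

end

theory Submission
  imports Defs "HOL-Complex_Analysis.Complex_Analysis"
begin

text \<open>
  (i) In a local 3-coloring every vertex sees at most two colors. For a pair \<open>e\<close> of colors let the
  phase be \<open>1\<close> at the vertices which see exactly \<open>e\<close> and \<open>0\<close> elsewhere; interpolating along the
  edges and coning off the faces gives a map from the surface to \<open>\<real> / 2\<int>\<close>. On the polygonal model it
  lifts to a real function, which jumps by \<open>2 m\<^sub>k\<close> between the two copies of the \<open>k\<close>-th arc, where
  \<open>\<Sum> m\<^sub>k = 0\<close>. The maps of two pairs \<open>e\<close> and \<open>f\<close> both take the value \<open>1\<close> exactly once in each face with
  diagonals colored \<open>e\<close> and \<open>f\<close>. Composing them with a section of the degree one line bundle on the
  torus that vanishes at \<open>(1, 1)\<close>, and computing the winding number along the polygon, one finds that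
  the number of these faces is \<open>\<Sum> m\<^sub>k n\<^sub>k\<close> modulo \<open>2\<close>. For \<open>g \<le> 4\<close> this alternating form has rank at
  most two, and then the number of faces whose diagonals have interleaving colors is even. The latter
  number has the parity of the quadrangulation, as one sees by orienting the edges towards the larger
  color.

  (ii) Conversely, call a color together with two other ones a type, and join two types if the color of
  each is among the two others of the other one. In this graph there are closed walks \<open>w\<^sub>1, \<dots>, w\<^sub>5\<close> of odd
  length such that \<open>w\<^sub>1 w\<^sub>1 \<dots> w\<^sub>5 w\<^sub>5\<close> can be contracted across quadrilaterals, which yields a colored
  quadrangulation of the disc with the boundary identifications of the surface of genus five. Every
  further crosscap is filled by a walk of length two, traversed twice.
\<close>

section \<open>Invariance of domain on surfaces\<close>

text \<open>Why four: modulo 2 the jump vectors are even vectors of length \<open>g\<close>, on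
  which the standard form is alternating. For \<open>g\<close> = 3 they form a plane, for
  \<open>g\<close> = 4 a three-dimensional space with the all-one vector in the radical; only for
  \<open>g\<close> = 5 does the rank reach four. Why rank two suffices: colour pairs then fall into
  a null class and three others, and two pairs lie on oddly many common faces iff their classes are
  distinct and not null. Such pairs share no colour, so the classes are graphs on separate sets of
  colours. Counting edges at the vertices of one colour shows that their degrees are even, and a
  graph with even degrees on points of a circle is crossed by a chord an even number of times. The
  obstacle is that faces and edges are given only topologically and that no orientation is
  available. Incidence facts (two sides per edge, finitely many faces, open faces) therefore rest on
  invariance of domain, and local degrees are only known to be 1 or -1, so that everything is
  counted modulo 2. In (ii) a grid in the polygon gives every face an explicit parametrization and
  leaves finite checks on a table.\<close>

lemma surface_chart:
  assumes "closed_surface X" "x \<in> topspace X"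
  obtains U \<phi> where "openin X U" "x \<in> U"
    "homeomorphic_map (subtopology X U) (euclidean :: (real^2) topology) \<phi>"
  using assms unfolding closed_surface_def homeomorphic_space
  by blast

text \<open>Invariance of domain with the surface as target. Openness is local, so near each point
  the map is followed by a chart and becomes an injective map between planes.\<close>

lemma openin_surface_injective_image:
  fixes \<Psi> :: "'b::euclidean_space \<Rightarrow> 'a"
  assumes X: "closed_surface X" and dim: "DIM('b) = 2" and S: "open S"
    and \<Psi>: "continuous_map (top_of_set S) X \<Psi>" and inj: "inj_on \<Psi> S"
  shows "openin X (\<Psi> ` S)"
proof (subst openin_subopen, intro ballI)
  fix y assume "y \<in> \<Psi> ` S"
  then obtain o' where o': "o' \<in> S" "y = \<Psi> o'" by blast
  have img: "\<Psi> ` S \<subseteq> topspace X"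
    using continuous_map_image_subset_topspace[OF \<Psi>] by simp
  obtain U \<phi> where U: "openin X U" "y \<in> U"
    and \<phi>: "homeomorphic_map (subtopology X U) (euclidean :: (real^2) topology) \<phi>"
    using surface_chart[OF X] img \<open>y \<in> \<Psi> ` S\<close> by blast
  define P where "P = {x \<in> S. \<Psi> x \<in> U}"
  have "openin (top_of_set S) P"
    unfolding P_def using openin_continuous_map_preimage[OF \<Psi> U(1)] by simp
  then have P: "open P" using S openin_open_eq by blast
  have PO: "P \<subseteq> S" by (auto simp: P_def)
  have c1: "continuous_map (top_of_set P) (subtopology X U) \<Psi>"
    using continuous_map_from_subtopology_mono[OF \<Psi> PO] PO
    by (auto simp: continuous_map_in_subtopology P_def)
  have c2: "continuous_map (subtopology X U) euclidean \<phi>"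
    using \<phi> homeomorphic_imp_continuous_map by blast
  have cont: "continuous_on P (\<phi> \<circ> \<Psi>)"
    using continuous_map_compose[OF c1 c2] by simp
  have Usub: "U \<subseteq> topspace X" using U(1) openin_subset by blast
  have injX: "inj_on \<phi> U"
    using homeomorphic_imp_injective_map[OF \<phi>] Usub by (simp add: inf_absorb2)
  have injP: "inj_on (\<phi> \<circ> \<Psi>) P"
    using inj_on_subset[OF inj PO] injX by (auto simp: P_def inj_on_def)
  have op: "open ((\<phi> \<circ> \<Psi>) ` P)"
    by (rule invariance_of_domain_gen[OF P cont injP]) (simp add: dim)
  \<comment> \<open>Inside \<open>U\<close> the chart is injective, so the image of \<open>P\<close>
    is exactly the preimage of an open planar set.\<close>
  have eq: "\<Psi> ` P = {x \<in> U. \<phi> x \<in> (\<phi> \<circ> \<Psi>) ` P}"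
    using injX by (auto simp: P_def inj_on_def)
  have "openin (subtopology X U) (\<Psi> ` P)"
    unfolding eq using openin_continuous_map_preimage[OF c2, of "(\<phi> \<circ> \<Psi>) ` P"] op Usub
    by (simp add: inf_absorb2)
  then have "openin X (\<Psi> ` P)" using U(1) openin_trans_full by blast
  moreover have "y \<in> \<Psi> ` P" "\<Psi> ` P \<subseteq> \<Psi> ` S" using o' U PO by (auto simp: P_def)
  ultimately show "\<exists>T. openin X T \<and> y \<in> T \<and> T \<subseteq> \<Psi> ` S" by blast
qed

text \<open>Invariance of domain with the surface as source. It will refute neighbourhoods that
  embed into a line or into a half disc.\<close>

lemma open_surface_injective_image:
  fixes f :: "'a \<Rightarrow> 'b::euclidean_space"
  assumes X: "closed_surface X" and dim: "DIM('b) = 2" and N: "openin X N"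
    and f: "continuous_map (subtopology X N) euclidean f" and inj: "inj_on f N"
  shows "open (f ` N)"
proof (subst open_subopen, intro ballI)
  fix y assume "y \<in> f ` N"
  then obtain x where x: "x \<in> N" "y = f x" by blast
  have NX: "N \<subseteq> topspace X" using N openin_subset by blast
  obtain U \<phi> where U: "openin X U" "x \<in> U"
    and \<phi>: "homeomorphic_map (subtopology X U) (euclidean :: (real^2) topology) \<phi>"
    using surface_chart[OF X] NX x by blast
  have Usub: "U \<subseteq> topspace X" using U(1) openin_subset by blast
  obtain \<xi> where \<xi>: "homeomorphic_maps (subtopology X U) euclidean \<phi> \<xi>"
    using \<phi> homeomorphic_map_maps by blast
  have \<xi>c: "continuous_map (euclidean :: (real^2) topology) (subtopology X U) \<xi>"
    and \<xi>1: "\<And>z. \<phi> (\<xi> z) = z" and \<xi>2: "\<And>u. u \<in> U \<Longrightarrow> \<xi> (\<phi> u) = u"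
    using \<xi> Usub by (auto simp: homeomorphic_maps_def)
  define Q where "Q = \<phi> ` (U \<inter> N)"
  have "openin (subtopology X U) (U \<inter> N)" using N by (simp add: openin_subtopology_Int2)
  then have "openin euclidean Q"
    unfolding Q_def using homeomorphic_imp_open_map[OF \<phi>] open_map_def by blast
  then have Q: "open Q" by simp
  have "continuous_map (top_of_set Q) (subtopology X N) \<xi>"
    using continuous_map_from_subtopology[OF \<xi>c, of Q] \<xi>2
    by (auto simp: continuous_map_in_subtopology Q_def)
  from continuous_map_compose[OF this f] have cont: "continuous_on Q (f \<circ> \<xi>)" by simp
  have injQ: "inj_on (f \<circ> \<xi>) Q"
    using inj \<xi>2 by (auto simp: Q_def inj_on_def)
  have "open ((f \<circ> \<xi>) ` Q)"
    by (rule invariance_of_domain_gen[OF Q cont injQ]) (simp add: dim)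
  moreover have "(f \<circ> \<xi>) ` Q = f ` (U \<inter> N)" using \<xi>2 by (force simp: Q_def image_comp)
  ultimately have "open (f ` (U \<inter> N))" by simp
  then show "\<exists>T. open T \<and> y \<in> T \<and> T \<subseteq> f ` N" using x U(2) by blast
qed

section \<open>Boundary walks of faces\<close>

lemma mem_quarter_circle:
  "z \<in> quarter_circle i \<longleftrightarrow> (\<exists>t\<in>{0..1}. z = cis ((real i + t) * pi / 2))"
proof
  assume "z \<in> quarter_circle i"
  then obtain s where s: "real i * pi / 2 \<le> s" "s \<le> (real i + 1) * pi / 2" "z = cis s"
    by (auto simp: quarter_circle_def)
  have "s = (real i + (s * 2 / pi - real i)) * pi / 2" by (simp add: field_simps)
  moreover have "s * 2 / pi - real i \<in> {0..1}" using s by (simp add: field_simps)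
  ultimately show "\<exists>t\<in>{0..1}. z = cis ((real i + t) * pi / 2)" using s(3) by metis
next
  assume "\<exists>t\<in>{0..1}. z = cis ((real i + t) * pi / 2)"
  then obtain t where t: "0 \<le> t" "t \<le> 1" "z = cis ((real i + t) * pi / 2)" by auto
  have "real i * pi / 2 \<le> (real i + t) * pi / 2" "(real i + t) * pi / 2 \<le> (real i + 1) * pi / 2"
    using t by (auto simp: field_simps)
  then show "z \<in> quarter_circle i" unfolding quarter_circle_def t(3) by auto
qed

lemma quarter_circle_subset_sphere: "quarter_circle i \<subseteq> sphere 0 1"
  by (auto simp: quarter_circle_def)

lemma compact_quarter_circle: "compact (quarter_circle i)"
  unfolding quarter_circle_def by (intro compact_continuous_image continuous_intros compact_Icc)

text \<open>Angles are measured in quarter turns: the sides of a face are unit intervals of a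
  parameter that is faithful on [0, 4).\<close>

lemma cis_quarter_eq_iff:
  fixes s t :: real
  assumes "0 \<le> s" "s < 4" "0 \<le> t" "t < 4"
  shows "cis (s * pi / 2) = cis (t * pi / 2) \<longleftrightarrow> s = t"
proof
  assume "cis (s * pi / 2) = cis (t * pi / 2)"
  then obtain n :: int where n: "s * pi / 2 = t * pi / 2 + 2 * pi * of_int n"
    unfolding cis_conv_exp exp_eq by (auto simp: complex_eq_iff algebra_simps)
  then have "pi * (s - t - 4 * of_int n) = 0" by (simp add: algebra_simps)
  then have "s - t = 4 * of_int n" by simp
  then have "\<bar>4 * of_int n :: real\<bar> < 4" using assms by linarith
  then have "n = 0" by simp
  with \<open>s - t = 4 * of_int n\<close> show "s = t" by simp
qed simp

lemma sphere_quarter_circle: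
  assumes "z \<in> sphere (0::complex) 1"
  obtains i where "i < 4" "z \<in> quarter_circle i"
proof -
  have z: "z = cis (Arg2pi z)" using assms Arg2pi_eq[of z] by (simp add: cis_conv_exp)
  define s where "s = Arg2pi z * 2 / pi"
  have s: "0 \<le> s" "s < 4" using Arg2pi_ge_0[of z] Arg2pi_lt_2pi[of z] by (auto simp: s_def field_simps)
  have zs: "z = cis (s * pi / 2)" using z by (simp add: s_def)
  define i where "i = nat \<lfloor>s\<rfloor>"
  have "i < 4" using s by (simp add: i_def nat_less_iff floor_less_iff)
  moreover have i: "real i \<le> s" "s \<le> real i + 1" using s unfolding i_def by linarith+
  have "z \<in> quarter_circle i"
    unfolding mem_quarter_circle by (rule bexI[of _ "s - real i"]) (use zs i in auto)
  ultimately show ?thesis using that by blast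
qed

locale oriented_quadrangulation =
  fixes X :: "'a topology" and V :: "'a set" and E :: "'a set set"
    and W :: "'a set \<Rightarrow> ('a \<times> 'a set) list"
  assumes surf: "closed_surface X" and emb: "embedded_graph X V E"
    and ori: "face_orientation X V E W"
begin

abbreviation Fs where "Fs \<equiv> faces X V E"
text \<open>Reducing the index makes \<open>Suc i\<close> of the last corner the first corner
  again.\<close>

definition corner :: "'a set \<Rightarrow> nat \<Rightarrow> 'a" where "corner F i = fst (W F ! (i mod 4))"
definition side :: "'a set \<Rightarrow> nat \<Rightarrow> 'a set" where "side F i = snd (W F ! (i mod 4))"

text \<open>Isolates the parametrization inside \<open>quad_walk\<close>, so that it can be
  exchanged for a recentred one while the boundary walk stays fixed.\<close>

definition face_param :: "'a set \<Rightarrow> (complex \<Rightarrow> 'a) \<Rightarrow> bool" where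
  "face_param F h \<longleftrightarrow> continuous_map (top_of_set (cball (0::complex) 1)) X h \<and>
        homeomorphic_map (top_of_set (ball (0::complex) 1)) (subtopology X F) h \<and>
        (\<forall>i<4. h (cis (real i * pi / 2)) = corner F i \<and>
               inj_on h (quarter_circle i) \<and> h ` quarter_circle i = side F i)"

definition face_map :: "'a set \<Rightarrow> complex \<Rightarrow> 'a" where "face_map F = (SOME h. face_param F h)"

lemma Hausdorff: "Hausdorff_space X" using surf by (simp add: closed_surface_def)

lemma graph_subset: "V \<subseteq> topspace X" "e \<in> E \<Longrightarrow> e \<subseteq> topspace X"
proof -
  show "V \<subseteq> topspace X" using emb by (simp add: embedded_graph_def)
  assume "e \<in> E"
  then obtain p where "pathin X p" "e = p ` {0..1}" using emb by (auto simp: embedded_graph_def)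
  then show "e \<subseteq> topspace X" unfolding pathin_def
    using continuous_map_image_subset_topspace by fastforce
qed

lemma face_walk:
  assumes "F \<in> Fs"
  shows "length (W F) = 4" "\<And>i. corner F i \<in> V" "\<And>i. side F i \<in> E"
    "face_param F (face_map F)"
proof -
  have q: "quad_walk X V E F (W F)" using ori assms by (simp add: face_orientation_def)
  then show l: "length (W F) = 4" by (simp add: quad_walk_def)
  have "W F ! (i mod 4) \<in> V \<times> E" for i
    using q l nth_mem[of "i mod 4" "W F"] by (auto simp: quad_walk_def)
  then show "corner F i \<in> V" "side F i \<in> E" for i
    by (auto simp: corner_def side_def mem_Times_iff)
  have "\<exists>h. face_param F h" using q by (simp add: quad_walk_def face_param_def corner_def side_def)
  then show "face_param F (face_map F)" unfolding face_map_def by (rule someI_ex)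
qed

lemma edge_sides_eq: "edge_sides X V E W e = {(F, i). F \<in> Fs \<and> i < 4 \<and> side F i = e}"
  by (auto simp: edge_sides_def side_def)

lemma edge_arc:
  assumes "e \<in> E"
  obtains p where "pathin X p" "inj_on p {0..1}" "e = p ` {0..1}" "e \<inter> V = {p 0, p 1}"
  using assms emb by (auto simp: embedded_graph_def)

lemma edges_disjoint: "e \<in> E \<Longrightarrow> e' \<in> E \<Longrightarrow> e \<noteq> e' \<Longrightarrow> e \<inter> e' \<subseteq> V"
  using emb by (auto simp: embedded_graph_def)

lemma finite_graph: "finite V" "finite E"
  using emb by (auto simp: embedded_graph_def)

lemma closedin_finite: "finite S \<Longrightarrow> S \<subseteq> topspace X \<Longrightarrow> closedin X S"
  using Hausdorff by (simp add: closedin_Hausdorff_finite)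

lemma edge_closed: assumes "e \<in> E" shows "closedin X e"
proof -
  obtain p where p: "pathin X p" "e = p ` {0..1}" using edge_arc[OF assms] by metis
  then have "compactin X e"
    unfolding pathin_def using image_compactin[of "top_of_set {0..1}" "{0..1}" X p]
    by (simp add: compactin_subtopology)
  then show ?thesis using Hausdorff compactin_imp_closedin by blast
qed

lemma face_Union: "\<Union>Fs = topspace X - (V \<union> \<Union>E)"
  unfolding faces_def by (simp add: Union_connected_components_of Int_absorb1)

lemma face_disjoint: "F \<in> Fs \<Longrightarrow> F' \<in> Fs \<Longrightarrow> F \<noteq> F' \<Longrightarrow> F \<inter> F' = {}"
  unfolding faces_def using pairwise_disjoint_connected_components_of
  by (metis disjnt_def pairwiseD)

lemma face_graph_disjoint: "F \<in> Fs \<Longrightarrow> F \<inter> V = {}" "F \<in> Fs \<Longrightarrow> e \<in> E \<Longrightarrow> F \<inter> e = {}"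
  using face_Union by blast+

lemma face_subset: "F \<in> Fs \<Longrightarrow> F \<subseteq> topspace X"
  using face_Union by blast

context
  fixes F h assumes F: "F \<in> Fs" and h: "face_param F h"
begin

lemma param_cont: "continuous_map (top_of_set (cball 0 1)) X h"
  using h by (simp add: face_param_def)

lemma param_ball: "h ` ball 0 1 = F" "inj_on h (ball 0 1)"
proof -
  have hm: "homeomorphic_map (top_of_set (ball 0 1)) (subtopology X F) h"
    using h by (simp add: face_param_def)
  show "h ` ball 0 1 = F"
    using homeomorphic_imp_surjective_map[OF hm] face_subset[OF F] by (simp add: inf_absorb2)
  show "inj_on h (ball 0 1)" using homeomorphic_imp_injective_map[OF hm] by simp
qed

lemma param_quarter:
  assumes "i < 4"
  shows "h (cis (real i * pi / 2)) = corner F i" "h (cis ((real i + 1) * pi / 2)) = corner F (Suc i)"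
    "inj_on h (quarter_circle i)" "h ` quarter_circle i = side F i"
proof -
  show "h (cis (real i * pi / 2)) = corner F i" "inj_on h (quarter_circle i)"
    "h ` quarter_circle i = side F i"
    using h assms by (auto simp: face_param_def)
  show "h (cis ((real i + 1) * pi / 2)) = corner F (Suc i)"
  proof (cases "i = 3")
    case True
    have "h (cis (real 0 * pi / 2)) = corner F 0"
      using h unfolding face_param_def by (metis zero_less_numeral)
    then show ?thesis using True by (simp add: corner_def)
  next
    case False
    then have "Suc i < 4" using assms by simp
    then have "h (cis (real (Suc i) * pi / 2)) = corner F (Suc i)"
      using h unfolding face_param_def by blast
    then show ?thesis by (simp add: add.commute)
  qed
qed

lemma param_sphere: "h ` sphere 0 1 = \<Union> (side F ` {..<4})"
proof -
  have "sphere 0 1 = \<Union> (quarter_circle ` {..<4})"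
  proof
    show "sphere 0 1 \<subseteq> \<Union> (quarter_circle ` {..<4})"
      by (meson UN_I lessThan_iff sphere_quarter_circle subsetI)
    show "\<Union> (quarter_circle ` {..<4}) \<subseteq> sphere 0 1" using quarter_circle_subset_sphere by blast
  qed
  then have "h ` sphere 0 1 = \<Union> ((\<lambda>i. h ` quarter_circle i) ` {..<4})" by (simp add: image_UN)
  also have "\<dots> = \<Union> (side F ` {..<4})" using param_quarter(4) by simp
  finally show ?thesis .
qed

lemma param_closed: "closed C \<Longrightarrow> C \<subseteq> cball 0 1 \<Longrightarrow> closedin X (h ` C)"
proof -
  assume C: "closed C" "C \<subseteq> cball 0 1"
  then have "compact C" using compact_cball compact_eq_bounded_closed bounded_subset by blast
  then have "compactin X (h ` C)"
    using image_compactin[OF _ param_cont] C by (simp add: compactin_subtopology)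
  then show ?thesis using Hausdorff compactin_imp_closedin by blast
qed

text \<open>A quarter circle is mapped injectively, so its ends go to different vertices, and an
  edge contains only two vertices.\<close>

lemma corner_neq:
  assumes "i < 4" shows "corner F i \<noteq> corner F (Suc i)" "side F i \<inter> V = {corner F i, corner F (Suc i)}"
proof -
  have m: "cis (real i * pi / 2) \<in> quarter_circle i" "cis ((real i + 1) * pi / 2) \<in> quarter_circle i"
    unfolding mem_quarter_circle by (rule bexI[of _ 0], simp, simp) (rule bexI[of _ 1], simp, simp)
  have "cis (real i * pi / 2) \<noteq> cis ((real i + 1) * pi / 2)"
  proof
    assume "cis (real i * pi / 2) = cis ((real i + 1) * pi / 2)"
    moreover have "cis ((real i + 1) * pi / 2) = cis (real i * pi / 2) * cis (pi / 2)"
      unfolding cis_mult by (simp add: field_simps)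
    ultimately have "cis (real i * pi / 2) = cis (real i * pi / 2) * \<i>" by simp
    then show False by (metis cis_neq_zero complex_i_not_one mult_cancel_left1)
  qed
  then show ne: "corner F i \<noteq> corner F (Suc i)"
    using param_quarter[OF assms] m by (metis inj_on_contraD)
  have "corner F i \<in> side F i" "corner F (Suc i) \<in> side F i"
    using param_quarter[OF assms] m by (metis imageI)+
  moreover have "\<exists>a b. side F i \<inter> V = {a, b}"
    using edge_arc[OF face_walk(3)[OF F]] by metis
  ultimately show "side F i \<inter> V = {corner F i, corner F (Suc i)}"
    using face_walk(2)[OF F] ne by (metis IntI doubleton_eq_iff insertE singletonD)
qed

text \<open>The open disc goes into the face, which avoids the graph, and different edges meet in
  vertices only. Hence an inner point of an edge is reached only from the quarter circles that run
  along this edge.\<close>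

lemma param_eq_inner:
  assumes "z \<in> cball 0 1" "h z = y" "y \<in> e" "e \<in> E" "y \<notin> V"
  obtains i t where "i < 4" "side F i = e" "0 < t" "t < 1" "z = cis ((real i + t) * pi / 2)"
proof -
  have "z \<notin> ball 0 1" using param_ball(1) assms face_graph_disjoint(2)[OF F] by blast
  then have "z \<in> sphere 0 1" using assms(1) by (auto simp: dist_norm)
  then obtain i where i: "i < 4" "z \<in> quarter_circle i" by (rule sphere_quarter_circle)
  have "y \<in> side F i" using i assms(2) param_quarter(4) by blast
  then have s: "side F i = e"
    using edges_disjoint[OF assms(4) face_walk(3)[OF F]] assms by blast
  obtain t where t: "t \<in> {0..1}" "z = cis ((real i + t) * pi / 2)"
    using i(2) mem_quarter_circle by blast
  have "t \<noteq> 0" "t \<noteq> 1"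
    using t(2) assms(2,5) param_quarter(1,2)[OF i(1)] face_walk(2)[OF F] by auto
  then show ?thesis using that[of i t] i s t by auto
qed

end

end

section \<open>Every edge has two sides\<close>

lemma cball_eq_ball_Un_sphere: "cball (a::'b::metric_space) r = ball a r \<union> sphere a r"
  by auto

lemma compact_image_quotient_map:
  assumes "compact_space Y" "Hausdorff_space X" "continuous_map Y X f"
  shows "quotient_map Y (subtopology X (f ` topspace Y)) f"
proof (rule continuous_closed_imp_quotient_map)
  have sub: "f ` topspace Y \<subseteq> topspace X" using assms(3) continuous_map_image_subset_topspace by blast
  show c: "continuous_map Y (subtopology X (f ` topspace Y)) f"
    using assms(3) by (simp add: continuous_map_in_subtopology)
  have "Hausdorff_space (subtopology X (f ` topspace Y))"
    using assms(2) by (rule Hausdorff_space_subtopology)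
  then show "closed_map Y (subtopology X (f ` topspace Y)) f"
    using c assms(1) continuous_imp_closed_map_gen Hausdorff_imp_kc_space by blast
  show "f ` topspace Y = topspace (subtopology X (f ` topspace Y))" using sub by auto
qed

text \<open>The way in which functions on parts of \<open>X\<close> are proved continuous: a map
  from a compact set to a Hausdorff space is closed, hence a quotient map onto its image, and it
  suffices to check the composition with it.\<close>

lemma compact_continuous_descend:
  assumes "compact S" "Hausdorff_space X" "continuous_map (top_of_set S) X f"
    and "continuous_on S u" and "\<And>x. x \<in> S \<Longrightarrow> g (f x) = u x"
  shows "continuous_map (subtopology X (f ` S)) euclidean g"
proof -
  have q: "quotient_map (top_of_set S) (subtopology X (f ` S)) f"
    using compact_image_quotient_map[of "top_of_set S" X f] assms by (simp add: compact_space_subtopology)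
  have "continuous_map (top_of_set S) euclidean (g \<circ> f)"
    by (rule continuous_map_eq[of _ _ u]) (use assms in auto)
  with q show ?thesis by (rule continuous_compose_quotient_map)
qed

lemma continuous_map_compose_on:
  assumes "continuous_map (top_of_set T) X h" "continuous_on S u" "u ` S \<subseteq> T"
  shows "continuous_map (top_of_set S) X (\<lambda>x. h (u x))"
proof -
  have "continuous_map (top_of_set S) (top_of_set T) u" using assms(2,3) by auto
  from continuous_map_compose[OF this assms(1)] show ?thesis by (simp add: comp_def)
qed

lemma polar_unique:
  fixes r r' s s' :: real
  assumes "r * cis (s * pi / 2) = r' * cis (s' * pi / 2)" "r > 0" "r' > 0"
    "0 \<le> s" "s < 4" "0 \<le> s'" "s' < 4"
  shows "r = r'" "s = s'"
proof -
  have "norm (r * cis (s * pi / 2)) = norm (r' * cis (s' * pi / 2))" using assms(1) by simp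
  then show "r = r'" using assms(2,3) by (simp add: norm_mult)
  then have "cis (s * pi / 2) = cis (s' * pi / 2)" using assms(1,2) by simp
  then show "s = s'" using cis_quarter_eq_iff assms by blast
qed

context oriented_quadrangulation
begin

definition arc_at :: "'a set \<Rightarrow> nat \<Rightarrow> real \<Rightarrow> 'a" where
  "arc_at F i t = face_map F (cis ((real i + t) * pi / 2))"

lemma arc_at:
  assumes "F \<in> Fs" "i < 4"
  shows "continuous_map (top_of_set {0..1}) X (arc_at F i)" "inj_on (arc_at F i) {0..1}"
    "arc_at F i ` {0..1} = side F i"
    "arc_at F i ` {0<..<1} = side F i - V"
proof -
  note h = face_walk(4)[OF assms(1)]
  show "continuous_map (top_of_set {0..1}) X (arc_at F i)" unfolding arc_at_def
    by (rule continuous_map_compose_on[OF param_cont[OF assms(1) h]]) (auto intro!: continuous_intros)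
  have q: "quarter_circle i = (\<lambda>t. cis ((real i + t) * pi / 2)) ` {0..1}"
    using mem_quarter_circle by auto
  have inj: "t = t'" if "t \<in> {0..1}" "t' \<in> {0..1}"
    "cis ((real i + t) * pi / 2) = cis ((real i + t') * pi / 2)" for t t'
  proof -
    have "cis (t * pi / 2) = cis (t' * pi / 2)"
    proof -
      have "cis (u * pi / 2) = cis ((real i + u) * pi / 2) * cis (- (real i * pi / 2))" for u
        unfolding cis_mult by (simp add: field_simps)
      then show ?thesis using that(3) by metis
    qed
    then show ?thesis using cis_quarter_eq_iff[of t t'] that by auto
  qed
  show I: "inj_on (arc_at F i) {0..1}"
    using param_quarter(3)[OF assms(1) h assms(2)] inj unfolding q arc_at_def inj_on_def by blast
  show im: "arc_at F i ` {0..1} = side F i"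
    using param_quarter(4)[OF assms(1) h assms(2)] unfolding q arc_at_def by (simp add: image_image)
  have ends: "arc_at F i 0 = corner F i" "arc_at F i 1 = corner F (Suc i)"
    using param_quarter(1,2)[OF assms(1) h assms(2)] by (simp_all add: arc_at_def)
  have "{0<..<1} = {0..1::real} - {0,1}" by auto
  then have "arc_at F i ` {0<..<1} = arc_at F i ` ({0..1} - {0,1})" by simp
  also have "\<dots> = arc_at F i ` {0..1} - arc_at F i ` {0,1}"
    by (rule inj_on_image_set_diff[OF I]) auto
  also have "\<dots> = side F i - (side F i \<inter> V)"
    by (simp only: im corner_neq(2)[OF assms(1) h assms(2)] ends image_insert image_empty)
  also have "\<dots> = side F i - V" by auto
  finally show "arc_at F i ` {0<..<1} = side F i - V" .
qed

text \<open>Two sides may run along a common edge at different speeds and in either direction. This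
  change of parameter allows two half discs to be glued along the edge.\<close>

lemma arc_transition:
  assumes "F \<in> Fs" "i < 4" "F' \<in> Fs" "i' < 4" "side F i = side F' i'"
  obtains \<tau> where "continuous_on {0<..<1} \<tau>" "inj_on \<tau> {0<..<1}" "\<tau> ` {0<..<1} \<subseteq> {0<..<1}"
    "\<And>t. t \<in> {0<..<1} \<Longrightarrow> arc_at F' i' (\<tau> t) = arc_at F i t"
proof -
  define \<tau> where "\<tau> t = inv_into {0..1} (arc_at F' i') (arc_at F i t)" for t
  note A = arc_at[OF assms(1,2)] and B = arc_at[OF assms(3,4)]
  have inv: "continuous_map (subtopology X (arc_at F' i' ` {0..1})) euclidean (inv_into {0..1} (arc_at F' i'))"
    by (rule compact_continuous_descend[OF compact_Icc Hausdorff B(1), of "\<lambda>x. x"])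
      (auto simp: inv_into_f_f[OF B(2)])
  have "continuous_map (top_of_set {0..1}) (subtopology X (arc_at F' i' ` {0..1})) (arc_at F i)"
    using A(1,3) B(3) assms(5) by (auto simp: continuous_map_in_subtopology)
  from continuous_map_compose[OF this inv] have "continuous_on {0..1} \<tau>"
    by (simp add: comp_def \<tau>_def[abs_def])
  then have c: "continuous_on {0<..<1} \<tau>" by (rule continuous_on_subset) auto
  have ar: "\<tau> t \<in> {0<..<1} \<and> arc_at F' i' (\<tau> t) = arc_at F i t" if "t \<in> {0<..<1}" for t
  proof -
    have "arc_at F i t \<in> arc_at F' i' ` {0<..<1}" using A(4) B(4) assms(5) that by blast
    then obtain s where s: "s \<in> {0<..<1}" "arc_at F i t = arc_at F' i' s" by blast
    then have "\<tau> t = s" unfolding \<tau>_def using inv_into_f_f[OF B(2), of s] by auto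
    then show ?thesis using s by simp
  qed
  have "inj_on \<tau> {0<..<1}"
  proof (rule inj_onI)
    fix s t assume st: "s \<in> {0<..<1::real}" "t \<in> {0<..<1}" "\<tau> s = \<tau> t"
    then have "arc_at F i s = arc_at F i t" using ar by metis
    then show "s = t" using A(2) st(1,2) by (auto dest: inj_onD)
  qed
  then show ?thesis using that c ar by blast
qed

lemma face_map_sector_eq:
  fixes r r' t t' :: real
  assumes "F \<in> Fs" "F' \<in> Fs" "i < 4" "i' < 4" "0 < r" "r < 1" "0 < r'" "r' < 1"
    "0 < t" "t < 1" "0 < t'" "t' < 1"
    and eq: "face_map F (r * cis ((real i + t) * pi / 2)) = face_map F' (r' * cis ((real i' + t') * pi / 2))"
  shows "F = F' \<and> i = i' \<and> r = r' \<and> t = t'"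
proof -
  have b: "r * cis ((real i + t) * pi / 2) \<in> ball 0 1" "r' * cis ((real i' + t') * pi / 2) \<in> ball 0 1"
    using assms by (auto simp: norm_mult)
  have "F = F'"
    using face_disjoint[OF assms(1,2)] b eq param_ball(1)[OF assms(1) face_walk(4)[OF assms(1)]]
      param_ball(1)[OF assms(2) face_walk(4)[OF assms(2)]] by blast
  then have e: "r * cis ((real i + t) * pi / 2) = r' * cis ((real i' + t') * pi / 2)"
    using param_ball(2)[OF assms(1) face_walk(4)[OF assms(1)]] b eq by (auto dest: inj_onD)
  have "real i \<le> 3" "real i' \<le> 3" using assms(3,4) by auto
  then have "r = r'" "real i + t = real i' + t'"
    using polar_unique[OF e] assms by auto
  moreover from this have "i = i'" using assms by linarith
  ultimately show ?thesis using \<open>F = F'\<close> by simp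
qed

text \<open>The union of two pages of a book along an open arc is an open subset of the surface, so
  there is no room for a third page.\<close>

lemma no_three_sides:
  assumes F: "F1 \<in> Fs" "F2 \<in> Fs" "F3 \<in> Fs" and i: "i1 < 4" "i2 < 4" "i3 < 4"
    and e: "side F1 i1 = e" "side F2 i2 = e" "side F3 i3 = e"
    and ne: "(F1, i1) \<noteq> (F2, i2)" "(F1, i1) \<noteq> (F3, i3)" "(F2, i2) \<noteq> (F3, i3)"
  shows False
proof -
  obtain \<tau> where \<tau>: "continuous_on {0<..<1} \<tau>" "inj_on \<tau> {0<..<1}" "\<tau> ` {0<..<1} \<subseteq> {0<..<1}"
    "\<And>t. t \<in> {0<..<1} \<Longrightarrow> arc_at F2 i2 (\<tau> t) = arc_at F1 i1 t"
    using arc_transition[OF F(1) i(1) F(2) i(2)] e by metis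
  \<comment> \<open>The first coordinate is a signed distance from the edge, the second one the
    position along it. The left half parametrizes a sector of the first face, the right half a
    sector of the second, and the line between them is the open edge.\<close>
  define S where "S = {-1<..<1::real} \<times> {0<..<1::real}"
  define \<Psi>1 where "\<Psi>1 = (\<lambda>x::real\<times>real. face_map F1 (of_real (1 + fst x) * cis ((real i1 + snd x) * pi / 2)))"
  define \<Psi>2 where "\<Psi>2 = (\<lambda>x::real\<times>real. face_map F2 (of_real (1 - fst x) * cis ((real i2 + \<tau> (snd x)) * pi / 2)))"
  define \<Psi> where "\<Psi> = (\<lambda>x. if fst x \<le> 0 then \<Psi>1 x else \<Psi>2 x)"
  note h1 = face_walk(4)[OF F(1)] and h2 = face_walk(4)[OF F(2)] and h3 = face_walk(4)[OF F(3)]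
  have "continuous_map (top_of_set S) X \<Psi>"
    unfolding \<Psi>_def
  proof (rule continuous_map_cases_le)
    show "continuous_map (subtopology (top_of_set S) {x \<in> topspace (top_of_set S). fst x \<le> 0}) X \<Psi>1"
      unfolding \<Psi>1_def subtopology_subtopology
      by (rule continuous_map_compose_on[OF param_cont[OF F(1) h1]])
        (auto intro!: continuous_intros simp: S_def norm_mult simp del: of_real_add of_real_diff)
    have ct: "continuous_on (S \<inter> T) (\<lambda>x. \<tau> (snd x))" for T
      by (rule continuous_on_compose2[OF \<tau>(1)]) (auto intro!: continuous_intros simp: S_def)
    show "continuous_map (subtopology (top_of_set S) {x \<in> topspace (top_of_set S). 0 \<le> fst x}) X \<Psi>2"
      unfolding \<Psi>2_def subtopology_subtopology
      by (rule continuous_map_compose_on[OF param_cont[OF F(2) h2]])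
        (auto intro!: continuous_intros ct[unfolded S_def] simp: S_def norm_mult simp del: of_real_add of_real_diff)
    show "continuous_map (top_of_set S) euclideanreal fst" "continuous_map (top_of_set S) euclideanreal (\<lambda>x. 0)"
      by (auto intro!: continuous_intros)
    fix x assume "x \<in> topspace (top_of_set S)" "fst x = 0"
    then show "\<Psi>1 x = \<Psi>2 x"
      using \<tau>(4)[of "snd x"] by (auto simp: \<Psi>1_def \<Psi>2_def S_def arc_at_def)
  qed
  moreover
  have dist: "F1 \<noteq> F2 \<or> i1 \<noteq> i2" using ne(1) by simp
  have t\<tau>: "0 < \<tau> t \<and> \<tau> t < 1" if "0 < t" "t < 1" for t using \<tau>(3) that by (auto simp: image_subset_iff)
  have axis: "\<Psi> (0, t) \<in> e - V" if "0 < t" "t < 1" for t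
    using arc_at(4)[OF F(1) i(1)] e(1) that by (auto simp: \<Psi>_def \<Psi>1_def arc_at_def)
  have neg: "\<Psi> (s, t) = face_map F1 (of_real (1 + s) * cis ((real i1 + t) * pi / 2)) \<and> \<Psi> (s, t) \<in> F1"
    if "(s, t) \<in> S" "s < 0" for s t
    using that param_ball(1)[OF F(1) h1] by (auto simp: \<Psi>_def \<Psi>1_def S_def norm_mult simp del: of_real_add of_real_diff)
  have pos: "\<Psi> (s, t) = face_map F2 (of_real (1 - s) * cis ((real i2 + \<tau> t) * pi / 2)) \<and> \<Psi> (s, t) \<in> F2"
    if "(s, t) \<in> S" "s > 0" for s t
    using that param_ball(1)[OF F(2) h2] by (auto simp: \<Psi>_def \<Psi>2_def S_def norm_mult simp del: of_real_add of_real_diff)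
  have eE: "e \<in> E" using e(1) face_walk(3)[OF F(1)] by blast
  have inj: "inj_on \<Psi> S"
  proof (rule inj_onI, clarify)
    fix s t s' t' assume st: "(s, t) \<in> S" "(s', t') \<in> S" and eq: "\<Psi> (s, t) = \<Psi> (s', t')"
    have b: "0 < t" "t < 1" "0 < t'" "t' < 1" "-1 < s" "s < 1" "-1 < s'" "s' < 1"
      using st by (auto simp: S_def)
    note sees_at = t\<tau>[OF b(1,2)] t\<tau>[OF b(3,4)]
    note fd = face_graph_disjoint(2)[OF F(1) eE] face_graph_disjoint(2)[OF F(2) eE]
    consider "s = 0" "s' = 0" | "s = 0" "s' \<noteq> 0" | "s \<noteq> 0" "s' = 0" | "s < 0" "s' < 0" | "s < 0" "s' > 0"
      | "s > 0" "s' < 0" | "s > 0" "s' > 0" by linarith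
    then show "s = s' \<and> t = t'"
    proof cases
      case 1
      then have "arc_at F1 i1 t = arc_at F1 i1 t'" using eq by (simp add: \<Psi>_def \<Psi>1_def arc_at_def)
      then have "t = t'" using b by (intro inj_onD[OF arc_at(2)[OF F(1) i(1)]]) auto
      then show ?thesis using 1 by simp
    next
      case 2 then show ?thesis using axis[OF b(1,2)] neg[OF st(2)] pos[OF st(2)] fd eq
        by (metis DiffD1 disjoint_iff linorder_neqE_linordered_idom)
    next
      case 3 then show ?thesis using axis[OF b(3,4)] neg[OF st(1)] pos[OF st(1)] fd eq
        by (metis DiffD1 disjoint_iff linorder_neqE_linordered_idom)
    next
      case 4
      have "face_map F1 (of_real (1 + s) * cis ((real i1 + t) * pi / 2)) = face_map F1 (of_real (1 + s') * cis ((real i1 + t') * pi / 2))"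
        using eq neg[OF st(1)] neg[OF st(2)] 4 by simp
      from face_map_sector_eq[OF F(1) F(1) i(1) i(1) _ _ _ _ _ _ _ _ this] show ?thesis using b 4 by simp
    next
      case 5
      have "face_map F1 (of_real (1 + s) * cis ((real i1 + t) * pi / 2)) = face_map F2 (of_real (1 - s') * cis ((real i2 + \<tau> t') * pi / 2))"
        using eq neg[OF st(1)] pos[OF st(2)] 5 by simp
      from face_map_sector_eq[OF F(1) F(2) i(1) i(2) _ _ _ _ _ _ _ _ this] show ?thesis using b 5 sees_at dist by simp
    next
      case 6
      have "face_map F2 (of_real (1 - s) * cis ((real i2 + \<tau> t) * pi / 2)) = face_map F1 (of_real (1 + s') * cis ((real i1 + t') * pi / 2))"
        using eq neg[OF st(2)] pos[OF st(1)] 6 by simp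
      from face_map_sector_eq[OF F(2) F(1) i(2) i(1) _ _ _ _ _ _ _ _ this] show ?thesis using b 6 sees_at dist by simp
    next
      case 7
      have "face_map F2 (of_real (1 - s) * cis ((real i2 + \<tau> t) * pi / 2)) = face_map F2 (of_real (1 - s') * cis ((real i2 + \<tau> t') * pi / 2))"
        using eq pos[OF st(1)] pos[OF st(2)] 7 by simp
      from face_map_sector_eq[OF F(2) F(2) i(2) i(2) _ _ _ _ _ _ _ _ this] have "s = s'" "\<tau> t = \<tau> t'" using b 7 sees_at by auto
      then show ?thesis using \<tau>(2) b by (auto dest: inj_onD)
    qed
  qed
  moreover have "open S" unfolding S_def by (intro open_Times open_greaterThanLessThan)
  ultimately have op: "openin X (\<Psi> ` S)"
    by (intro openin_surface_injective_image[OF surf]) auto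
  \<comment> \<open>The middle of the third occurrence of the edge. A point slightly inside the disc
    is still mapped into the open set covered by the first two sides, although it lies in a third
    sector.\<close>
  define z where "z = cis ((real i3 + 1/2) * pi / 2)"
  have "face_map F3 z \<in> e - V"
  proof -
    have "arc_at F3 i3 (1/2) \<in> side F3 i3 - V"
      unfolding arc_at(4)[OF F(3) i(3), symmetric] by (rule imageI) simp
    then show ?thesis using e(3) by (simp add: z_def arc_at_def)
  qed
  then have "face_map F3 z \<in> arc_at F1 i1 ` {0<..<1}" using arc_at(4)[OF F(1) i(1)] e(1) by simp
  then obtain t0 where t0: "t0 \<in> {0<..<1}" "face_map F3 z = arc_at F1 i1 t0" by blast
  then have "face_map F3 z = \<Psi> (0, t0)" by (simp add: \<Psi>_def \<Psi>1_def arc_at_def)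
  then have "face_map F3 z \<in> \<Psi> ` S" using t0 by (auto simp: S_def)
  define P where "P = {w \<in> cball 0 1. face_map F3 w \<in> \<Psi> ` S}"
  have "openin (top_of_set (cball 0 1)) P"
    using openin_continuous_map_preimage[OF param_cont[OF F(3) h3] op] by (simp add: P_def)
  moreover have "z \<in> P" using \<open>face_map F3 z \<in> \<Psi> ` S\<close> by (simp add: P_def z_def)
  ultimately obtain d where d: "d > 0" "\<And>w. w \<in> cball 0 1 \<Longrightarrow> dist w z < d \<Longrightarrow> w \<in> P"
    unfolding openin_euclidean_subtopology_iff by blast
  define r where "r = 1 - min (d/2) (1/2)"
  have r: "0 < r" "r < 1" using d(1) by (auto simp: r_def)
  have "dist (r * z) z < d"
  proof -
    have "dist (r * z) z = norm (complex_of_real (r - 1) * z)" by (simp add: dist_norm algebra_simps)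
    also have "\<dots> = 1 - r" using r by (simp add: norm_mult z_def del: of_real_diff)
    finally show ?thesis using d(1) by (auto simp: r_def)
  qed
  then have "r * z \<in> P" using d(2)[of "r * z"] r by (simp add: norm_mult z_def)
  then obtain s t where st: "(s, t) \<in> S" "face_map F3 (r * z) = \<Psi> (s, t)" by (auto simp: P_def)
  have b: "0 < t" "t < 1" "-1 < s" "s < 1" using st by (auto simp: S_def)
  have "r * z \<in> ball 0 1" using r by (simp add: norm_mult z_def)
  then have F3: "\<Psi> (s, t) \<in> F3" using param_ball(1)[OF F(3) h3] st(2) by (metis imageI)
  consider "s = 0" | "s < 0" | "s > 0" by linarith
  then show False
  proof cases
    case 1
    then show False using axis[OF b(1,2)] face_graph_disjoint(2)[OF F(3) eE] F3 by blast
  next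
    case 2
    have "face_map F3 (of_real r * cis ((real i3 + 1/2) * pi / 2)) = face_map F1 (of_real (1 + s) * cis ((real i1 + t) * pi / 2))"
      using st(2) neg[OF st(1)] 2 by (simp add: z_def)
    from face_map_sector_eq[OF F(3) F(1) i(3) i(1) _ _ _ _ _ _ _ _ this] show False using b 2 r ne by auto
  next
    case 3
    have "face_map F3 (of_real r * cis ((real i3 + 1/2) * pi / 2)) = face_map F2 (of_real (1 - s) * cis ((real i2 + \<tau> t) * pi / 2))"
      using st(2) pos[OF st(1)] 3 by (simp add: z_def)
    from face_map_sector_eq[OF F(3) F(2) i(3) i(2) _ _ _ _ _ _ _ _ this] show False using b 3 r ne t\<tau>[OF b(1,2)] by auto
  qed
qed

lemma finite_sides_card_le:
  assumes "e \<in> E"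
  shows "finite (edge_sides X V E W e)" "card (edge_sides X V E W e) \<le> 2"
proof -
  have *: "\<not> card T = 3" if "T \<subseteq> edge_sides X V E W e" for T
  proof
    assume "card T = 3"
    then obtain a b c where "T = {a, b, c}" and ne: "a \<noteq> b" "a \<noteq> c" "b \<noteq> c"
      unfolding card_3_iff by metis
    then have "a \<in> edge_sides X V E W e" "b \<in> edge_sides X V E W e" "c \<in> edge_sides X V E W e"
      using that by auto
    then show False using ne no_three_sides[of "fst a" "fst b" "fst c" "snd a" "snd b" "snd c" e]
      by (cases a; cases b; cases c) (simp add: edge_sides_eq)
  qed
  show f: "finite (edge_sides X V E W e)"
    using * infinite_arbitrarily_large by metis
  show "card (edge_sides X V E W e) \<le> 2"
  proof (rule ccontr)
    assume "\<not> ?thesis"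
    then have "3 \<le> card (edge_sides X V E W e)" by simp
    then show False using * obtain_subset_with_card_n by metis
  qed
qed

text \<open>Components of an open set could be infinite in number. Here every face owns a side, each
  of the finitely many edges has at most two sides, and so only finitely many faces occur.\<close>

lemma finite_faces: "finite Fs"
proof -
  have "Fs \<subseteq> fst ` (\<Union>e\<in>E. edge_sides X V E W e)"
  proof
    fix F assume "F \<in> Fs"
    then have "(F, 0) \<in> edge_sides X V E W (side F 0)" "side F 0 \<in> E"
      using face_walk(3) by (auto simp: edge_sides_eq)
    then have "(F, 0) \<in> (\<Union>e\<in>E. edge_sides X V E W e)" by blast
    from imageI[OF this, of fst] show "F \<in> fst ` (\<Union>e\<in>E. edge_sides X V E W e)"
      by (simp only: fst_conv)
  qed
  moreover have "finite (fst ` (\<Union>e\<in>E. edge_sides X V E W e))"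
    using finite_sides_card_le(1) finite_graph(2) by (intro finite_imageI finite_UN_I)
  ultimately show ?thesis by (rule finite_subset)
qed

lemma closedin_graph: "closedin X (V \<union> \<Union>E')" if "E' \<subseteq> E"
proof (rule closedin_Un)
  show "closedin X V" using closedin_finite finite_graph graph_subset by blast
  show "closedin X (\<Union>E')" using that finite_graph edge_closed finite_subset by (intro closedin_Union) auto
qed

lemma closedin_closed_faces: "closedin X (\<Union>F\<in>G. face_map F ` cball 0 1)" if "G \<subseteq> Fs"
proof (rule closedin_Union)
  show "finite ((\<lambda>F. face_map F ` cball 0 1) ` G)" using that finite_faces finite_subset by blast
  show "closedin X T" if "T \<in> (\<lambda>F. face_map F ` cball 0 1) ` G" for T
    using param_closed[OF _ face_walk(4), where C="cball 0 1"] that \<open>G \<subseteq> Fs\<close> by auto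
qed

text \<open>By finiteness of the set of faces, the graph together with all other closed faces is a
  finite union of closed sets; the face is its complement.\<close>

lemma openin_face: assumes F: "F \<in> Fs" shows "openin X F"
proof -
  define C where "C = V \<union> \<Union>E \<union> (\<Union>F'\<in>Fs - {F}. face_map F' ` cball 0 1)"
  have hc: "face_map F' ` cball 0 1 = F' \<union> \<Union> (side F' ` {..<4})" if "F' \<in> Fs" for F'
    using param_ball(1)[OF that face_walk(4)[OF that]] param_sphere[OF that face_walk(4)[OF that]]
    by (simp add: cball_eq_ball_Un_sphere image_Un)
  have "closedin X C"
    unfolding C_def by (rule closedin_Un[OF closedin_graph closedin_closed_faces]) auto
  moreover have "F = topspace X - C"
  proof
    show "F \<subseteq> topspace X - C"
      using face_subset[OF F] face_graph_disjoint[OF F] face_disjoint[OF F] face_walk(3) hc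
      by (fastforce simp: C_def)
    show "topspace X - C \<subseteq> F"
    proof
      fix x assume x: "x \<in> topspace X - C"
      then have "x \<in> \<Union>Fs" unfolding face_Union by (auto simp: C_def)
      then obtain F' where F': "F' \<in> Fs" "x \<in> F'" by blast
      then show "x \<in> F" using x hc[OF F'(1)] by (cases "F' = F") (auto simp: C_def)
    qed
  qed
  ultimately show ?thesis using openin_diff openin_topspace by blast
qed

text \<open>The vertices, the other edges and the closed faces without a side on \<open>e\<close>
  form a closed set which misses the middle of \<open>e\<close>. Near this point the surface thus
  consists of \<open>e\<close> and its incident faces alone.\<close>

lemma edge_neighbourhood:
  assumes "e \<in> E"
  obtains y N where "y \<in> e - V" "openin X N" "y \<in> N" "N \<inter> V = {}"
    "\<And>e'. e' \<in> E \<Longrightarrow> e' \<noteq> e \<Longrightarrow> N \<inter> e' = {}"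
    "\<And>F. F \<in> Fs \<Longrightarrow> (\<And>i. i < 4 \<Longrightarrow> side F i \<noteq> e) \<Longrightarrow> N \<inter> F = {}"
proof -
  obtain p where p: "pathin X p" "inj_on p {0..1}" "e = p ` {0..1}" "e \<inter> V = {p 0, p 1}"
    using edge_arc[OF assms] .
  define y where "y = p (1/2)"
  have "y \<noteq> p 0" "y \<noteq> p 1" unfolding y_def using p(2) by (auto dest: inj_onD)
  moreover have "y \<in> e" unfolding y_def p(3) by auto
  ultimately have y: "y \<in> e - V" using p(4) by blast
  define G where "G = {F \<in> Fs. \<forall>i<4. side F i \<noteq> e}"
  define C where "C = V \<union> \<Union>(E - {e}) \<union> (\<Union>F\<in>G. face_map F ` cball 0 1)"
  have "closedin X C"
    unfolding C_def by (rule closedin_Un[OF closedin_graph closedin_closed_faces]) (auto simp: G_def)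
  then have op: "openin X (topspace X - C)" by blast
  have "y \<notin> face_map F ` cball 0 1" if "F \<in> G" for F
  proof
    have F: "F \<in> Fs" using that by (simp add: G_def)
    assume "y \<in> face_map F ` cball 0 1"
    then obtain z where "z \<in> cball 0 1" "face_map F z = y" by blast
    then obtain i t where "i < 4" "side F i = e"
      using param_eq_inner[OF F face_walk(4)[OF F] _ _ _ assms] y by blast
    then show False using that by (auto simp: G_def)
  qed
  then have "y \<in> topspace X - C"
  proof -
    have "y \<notin> e'" if "e' \<in> E - {e}" for e'
      using edges_disjoint[OF assms, of e'] that y by blast
    moreover have "y \<in> topspace X" using y graph_subset(2)[OF assms] by blast
    ultimately show ?thesis using y \<open>\<And>F. F \<in> G \<Longrightarrow> y \<notin> face_map F ` cball 0 1\<close> unfolding C_def by blast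
  qed
  moreover have "F \<subseteq> face_map F ` cball 0 1" if "F \<in> Fs" for F
    using param_ball(1)[OF that face_walk(4)[OF that]] ball_subset_cball by blast
  then have dG: "(topspace X - C) \<inter> F = {}" if "F \<in> Fs" "\<And>i. i < 4 \<Longrightarrow> side F i \<noteq> e" for F
  proof -
    have "F \<in> G" using that unfolding G_def by blast
    moreover have "F \<subseteq> face_map F ` cball 0 1"
      by (rule \<open>\<And>F. F \<in> Fs \<Longrightarrow> F \<subseteq> face_map F ` cball 0 1\<close>[OF that(1)])
    moreover have "(\<Union>F\<in>G. face_map F ` cball 0 1) \<subseteq> C" unfolding C_def by (rule Un_upper2)
    ultimately have "F \<subseteq> C" by (metis UN_upper order_trans)
    then show ?thesis by auto
  qed
  show ?thesis
  proof (rule that[OF y op \<open>y \<in> topspace X - C\<close>])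
    show "(topspace X - C) \<inter> V = {}" unfolding C_def by blast
    show "(topspace X - C) \<inter> e' = {}" if "e' \<in> E" "e' \<noteq> e" for e' using that unfolding C_def by blast
    show "(topspace X - C) \<inter> F = {}" if "F \<in> Fs" "\<And>i. i < 4 \<Longrightarrow> side F i \<noteq> e" for F
      using dG that by blast
  qed
qed

text \<open>A nonempty open part of the surface would be contained in an arc, and so it would embed
  as an open subset of the plane that lies on the real axis.\<close>

lemma not_no_side:
  assumes "e \<in> E" "edge_sides X V E W e = {}"
  shows False
proof -
  obtain y N where N: "y \<in> e - V" "openin X N" "y \<in> N" "N \<inter> V = {}"
    "\<And>e'. e' \<in> E \<Longrightarrow> e' \<noteq> e \<Longrightarrow> N \<inter> e' = {}"
    "\<And>F. F \<in> Fs \<Longrightarrow> (\<And>i. i < 4 \<Longrightarrow> side F i \<noteq> e) \<Longrightarrow> N \<inter> F = {}"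
    using edge_neighbourhood[OF assms(1)] by metis
  have "N \<inter> F = {}" if "F \<in> Fs" for F using N(6)[OF that] assms(2) that by (auto simp: edge_sides_eq)
  then have "N \<inter> \<Union>Fs = {}" by blast
  then have "N \<subseteq> V \<union> \<Union>E" using openin_subset[OF N(2)] unfolding face_Union by blast
  then have Ne: "N \<subseteq> e" using N(4,5) by blast
  obtain p where p: "pathin X p" "inj_on p {0..1}" "e = p ` {0..1}"
    using edge_arc[OF assms(1)] by metis
  have "continuous_map (subtopology X (p ` {0..1})) euclidean (\<lambda>x. complex_of_real (inv_into {0..1} p x))"
    by (rule compact_continuous_descend[OF compact_Icc Hausdorff p(1)[unfolded pathin_def], of complex_of_real])
      (auto simp: inv_into_f_f[OF p(2)] intro!: continuous_intros)
  then have c: "continuous_map (subtopology X N) euclidean (\<lambda>x. complex_of_real (inv_into {0..1} p x))"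
    using continuous_map_from_subtopology_mono Ne p(3) by blast
  have "inj_on (\<lambda>x. complex_of_real (inv_into {0..1} p x)) N"
    using inj_on_inv_into[of N p "{0..1}"] Ne p(3) by (auto simp: inj_on_def)
  then have "open ((\<lambda>x. complex_of_real (inv_into {0..1} p x)) ` N)" (is "open ?I")
    using open_surface_injective_image[OF surf _ N(2) c] by simp
  moreover have "complex_of_real (inv_into {0..1} p y) \<in> ?I" using N(3) by blast
  ultimately obtain d where "d > 0" "ball (complex_of_real (inv_into {0..1} p y)) d \<subseteq> ?I"
    using open_contains_ball by metis
  moreover from this have "complex_of_real (inv_into {0..1} p y) + \<i> * (d/2) \<in> ?I"
    by (intro subsetD[OF \<open>ball _ d \<subseteq> ?I\<close>]) (auto simp: dist_norm norm_mult)
  ultimately show False by (auto simp: complex_eq_iff)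
qed

text \<open>With a single incidence, a neighbourhood of an inner point of the edge is parametrized
  injectively by a part of the closed disc that touches the unit circle. Invariance of domain would
  make this part open in the plane.\<close>

lemma not_one_side:
  assumes "e \<in> E" "edge_sides X V E W e = {(F, i)}"
  shows False
proof -
  have sides: "(F', i') \<in> edge_sides X V E W e \<longleftrightarrow> F' = F \<and> i' = i" for F' i'
    unfolding assms(2) by simp
  have F: "F \<in> Fs" and i: "i < 4" "side F i = e"
    using sides[of F i] by (simp_all add: edge_sides_eq)
  have only: "F' = F \<and> i' = i" if "F' \<in> Fs" "i' < 4" "side F' i' = e" for F' i'
    using sides[of F' i'] that by (simp add: edge_sides_eq)
  note h = face_walk(4)[OF F]
  obtain y N where N: "y \<in> e - V" "openin X N" "y \<in> N" "N \<inter> V = {}"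
    "\<And>e'. e' \<in> E \<Longrightarrow> e' \<noteq> e \<Longrightarrow> N \<inter> e' = {}"
    "\<And>F. F \<in> Fs \<Longrightarrow> (\<And>i. i < 4 \<Longrightarrow> side F i \<noteq> e) \<Longrightarrow> N \<inter> F = {}"
    using edge_neighbourhood[OF assms(1)] by metis
  define P where "P = {z \<in> cball 0 1. face_map F z \<in> N}"
  have sph: "\<exists>t. 0 < t \<and> t < 1 \<and> z = cis ((real i + t) * pi / 2)" if "z \<in> P" "z \<notin> ball 0 1" for z
  proof -
    have z: "z \<in> cball 0 1" "face_map F z \<in> N" "z \<in> sphere 0 1" using that by (auto simp: P_def)
    then have "face_map F z \<in> \<Union>(side F ` {..<4})" using param_sphere[OF F h] by blast
    then have "face_map F z \<in> e" using N(5) face_walk(3)[OF F] z(2) by blast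
    moreover have "face_map F z \<notin> V" using N(4) z(2) by blast
    ultimately obtain i' t where "i' < 4" "side F i' = e" "0 < t" "t < 1" "z = cis ((real i' + t) * pi / 2)"
      using param_eq_inner[OF F h z(1) refl _ assms(1)] by metis
    then show ?thesis using only[OF F] by blast
  qed
  have injP: "inj_on (face_map F) P"
  proof (rule inj_onI)
    fix z w assume zw: "z \<in> P" "w \<in> P" "face_map F z = face_map F w"
    have b: "u \<in> ball 0 1 \<longleftrightarrow> face_map F u \<in> F" if "u \<in> P" for u
    proof
      assume "face_map F u \<in> F"
      show "u \<in> ball 0 1"
      proof (rule ccontr)
        assume "u \<notin> ball 0 1"
        then have "u \<in> sphere 0 1" using that by (auto simp: P_def)
        then have "face_map F u \<in> \<Union>(side F ` {..<4})" using param_sphere[OF F h] by blast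
        then show False using \<open>face_map F u \<in> F\<close> face_graph_disjoint(2)[OF F] face_walk(3)[OF F] by blast
      qed
    qed (use param_ball(1)[OF F h] in blast)
    show "z = w"
    proof (cases "z \<in> ball 0 1")
      case True
      then show ?thesis using b zw param_ball(2)[OF F h] by (metis inj_onD)
    next
      case False
      then have "w \<notin> ball 0 1" using b zw by metis
      obtain t s where "0 < t" "t < 1" "z = cis ((real i + t) * pi / 2)"
        "0 < s" "s < 1" "w = cis ((real i + s) * pi / 2)"
        using sph[OF zw(1) False] sph[OF zw(2) \<open>w \<notin> ball 0 1\<close>] by blast
      moreover from this have "t = s"
        using zw(3) by (intro inj_onD[OF arc_at(2)[OF F i(1)]]) (auto simp: arc_at_def)
      ultimately show ?thesis by simp
    qed
  qed
  have Nsub: "N \<subseteq> face_map F ` P"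
  proof
    fix x assume x: "x \<in> N"
    then have "x \<in> topspace X" using N(2) openin_subset by blast
    then have "x \<in> V \<or> (\<exists>e'\<in>E. x \<in> e') \<or> x \<in> \<Union>Fs" unfolding face_Union by auto
    moreover have "x \<notin> V" "\<And>e'. e' \<in> E \<Longrightarrow> e' \<noteq> e \<Longrightarrow> x \<notin> e'" using N(4,5) x by auto
    ultimately consider "x \<in> e" | F' where "F' \<in> Fs" "x \<in> F'" by (metis UnionE)
    then show "x \<in> face_map F ` P"
    proof cases
      case 1
      then have "x \<in> face_map F ` quarter_circle i" using param_quarter(4)[OF F h i(1)] i(2) by simp
      then obtain z where z: "z \<in> quarter_circle i" "x = face_map F z" by blast
      then have "z \<in> cball 0 1" using quarter_circle_subset_sphere[of i] sphere_cball by blast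
      then show ?thesis using x z(2) by (simp add: P_def)
    next
      case 2
      have "F' = F"
      proof (rule ccontr)
        assume "F' \<noteq> F"
        then have "side F' i \<noteq> e" if "i < 4" for i using only[OF 2(1) that] by metis
        then have "N \<inter> F' = {}" by (rule N(6)[OF 2(1)])
        then show False using 2(2) x by blast
      qed
      then have "x \<in> face_map F ` ball 0 1" using 2 param_ball(1)[OF F h] by simp
      then obtain z where z: "z \<in> ball 0 1" "x = face_map F z" by blast
      then have "z \<in> cball 0 1" by simp
      then show ?thesis using x z(2) by (simp add: P_def)
    qed
  qed
  then have NP: "N = face_map F ` P" by (auto simp: P_def)
  \<comment> \<open>On \<open>P\<close> the parametrization is injective and a quotient map onto
    \<open>N\<close>; its inverse is therefore a continuous injection of \<open>N\<close> into the
    plane.\<close>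
  define g where "g = inv_into P (face_map F)"
  have "quotient_map (top_of_set (cball 0 1)) (subtopology X (face_map F ` cball 0 1)) (face_map F)"
    using compact_image_quotient_map[OF _ Hausdorff param_cont[OF F h]]
    by (simp add: compact_space_subtopology)
  then have "quotient_map (subtopology (top_of_set (cball 0 1)) P) (subtopology (subtopology X (face_map F ` cball 0 1)) N) (face_map F)"
  proof (rule quotient_map_restriction)
    show "{x \<in> topspace (top_of_set (cball 0 1)). face_map F x \<in> N} = P" by (simp add: P_def)
    show "openin (subtopology X (face_map F ` cball 0 1)) N \<or> closedin (subtopology X (face_map F ` cball 0 1)) N"
    proof -
      have "N = N \<inter> face_map F ` cball 0 1" unfolding NP by (auto simp: P_def)
      then show ?thesis using N(2) unfolding openin_subtopology by blast
    qed
  qed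
  moreover have "subtopology (subtopology X (face_map F ` cball 0 1)) N = subtopology X N"
  proof -
    have "face_map F ` cball 0 1 \<inter> N = N" unfolding NP by (auto simp: P_def)
    then show ?thesis by (simp only: subtopology_subtopology)
  qed
  moreover have "subtopology (top_of_set (cball 0 1)) P = top_of_set P"
  proof -
    have "cball 0 1 \<inter> P = P" by (auto simp: P_def)
    then show ?thesis by (simp only: subtopology_subtopology)
  qed
  ultimately have qP: "quotient_map (top_of_set P) (subtopology X N) (face_map F)" by argo
  have "continuous_map (top_of_set P) euclidean id" by simp
  then have "continuous_map (top_of_set P) euclidean (g \<circ> face_map F)"
    by (rule continuous_map_eq) (simp add: g_def inv_into_f_f[OF injP])
  with qP have gc: "continuous_map (subtopology X N) euclidean g"
    by (rule continuous_compose_quotient_map)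
  have "inj_on g N" unfolding g_def NP by (rule inj_on_inv_into) simp
  then have "open (g ` N)" using open_surface_injective_image[OF surf _ N(2) gc] by simp
  moreover have gN: "g ` N = P" unfolding g_def NP using injP by (simp add: image_image inv_into_f_f cong: image_cong)
  ultimately have oP: "open P" by simp
  obtain z where z: "z \<in> P" "face_map F z = y" using N(3) Nsub by blast
  have "z \<notin> ball 0 1"
    using N(1) z(2) param_ball(1)[OF F h] face_graph_disjoint(2)[OF F assms(1)] by blast
  then have "norm z = 1" using z(1) by (auto simp: P_def)
  obtain d where d: "d > 0" "ball z d \<subseteq> P" using oP z(1) open_contains_ball by metis
  have "(1 + d/2) *\<^sub>R z \<in> ball z d"
  proof -
    have "z - (1 + d/2) *\<^sub>R z = (- (d/2)) *\<^sub>R z" by (simp add: scaleR_left_distrib)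
    then have "dist z ((1 + d/2) *\<^sub>R z) = \<bar>- (d/2)\<bar> * norm z" by (simp only: dist_norm norm_scaleR)
    then have "dist z ((1 + d/2) *\<^sub>R z) = d/2" using d(1) \<open>norm z = 1\<close> by simp
    then show ?thesis using d(1) by (simp only: mem_ball)
  qed
  then have "(1 + d/2) *\<^sub>R z \<in> cball 0 1" using d(2) unfolding P_def by blast
  then have "norm ((1 + d/2) *\<^sub>R z) \<le> 1" by (simp only: mem_cball_0)
  then have "\<bar>1 + d/2\<bar> * 1 \<le> 1" using \<open>norm z = 1\<close> by (simp only: norm_scaleR)
  then show False using d(1) by simp
qed

theorem card_edge_sides: assumes "e \<in> E" shows "card (edge_sides X V E W e) = 2"
proof -
  have "card (edge_sides X V E W e) \<noteq> 0"
    using not_no_side[OF assms] finite_sides_card_le(1)[OF assms] by auto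
  moreover have "card (edge_sides X V E W e) \<noteq> 1"
    using not_one_side[OF assms] by (metis card_1_singletonE surj_pair)
  ultimately show ?thesis using finite_sides_card_le(2)[OF assms] by linarith
qed

end

section \<open>Counting four-coloured faces\<close>

lemma card_less_four:
  "card {j. j < (4::nat) \<and> Q j} = of_bool (Q 0) + of_bool (Q 1) + of_bool (Q 2) + of_bool (Q 3)"
proof -
  have "{j. j < (4::nat) \<and> Q j} = {j \<in> {..<4}. Q j}" by auto
  then have "card {j. j < (4::nat) \<and> Q j} = (\<Sum>j<4. of_bool (Q j))" by (simp add: of_bool_def sum.If_cases Int_def)
  also have "\<dots> = of_bool (Q 0) + of_bool (Q 1) + of_bool (Q 2) + of_bool (Q 3)"
    by (simp add: eval_nat_numeral)
  finally show ?thesis .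
qed

text \<open>Two chords of a circle that interleave, with \<open>e\<close> starting first: of the two
  orders of an interleaving pair exactly one is counted.\<close>

definition crossing :: "nat \<times> nat \<Rightarrow> nat \<times> nat \<Rightarrow> bool" where
  "crossing e f \<longleftrightarrow> fst e < fst f \<and> fst f < snd e \<and> snd e < snd f"

definition sorted_pair :: "nat \<Rightarrow> nat \<Rightarrow> nat \<times> nat" where "sorted_pair a b = (min a b, max a b)"

lemma sorted_pair_eq_iff: "sorted_pair a b = sorted_pair a' b' \<longleftrightarrow> {a, b} = {a', b'}"
  by (auto simp: sorted_pair_def doubleton_eq_iff min_def max_def)

lemma card_split_filter: "finite B \<Longrightarrow> card B = card {a \<in> B. P a} + card {a \<in> B. \<not> P a}"
proof -
  assume "finite B"
  moreover have "{a \<in> B. P a} \<union> {a \<in> B. \<not> P a} = B" by auto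
  ultimately show ?thesis using card_Un_disjoint[of "{a \<in> B. P a}" "{a \<in> B. \<not> P a}"] by auto
qed

text \<open>A closed walk of four proper steps has one, two or three ascents. One or three means
  that the colours are cyclically monotone, and then the diagonals interleave.\<close>

lemma odd_ascents_iff_crossing:
  assumes "c0 \<noteq> c1" "c1 \<noteq> c2" "c2 \<noteq> c3" "c3 \<noteq> c0"
  shows "odd (of_bool (c0 < c1) + of_bool (c1 < c2) + of_bool (c2 < c3) + of_bool (c3 < c0) :: nat) \<longleftrightarrow>
    crossing (sorted_pair c0 c2) (sorted_pair c1 c3) \<or> crossing (sorted_pair c1 c3) (sorted_pair c0 c2)"
  using assms unfolding crossing_def sorted_pair_def
  by (cases "c0 < c1"; cases "c1 < c2"; cases "c2 < c3"; cases "c3 < c0") (auto simp: min_def max_def)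

text \<open>\<open>P\<close> marks corners in a chosen vertex set, \<open>x\<close> corners of a
  chosen colour. The hypotheses make the two clauses for an edge exclusive, so each disjunction is a
  sum modulo 2 and the terms can be regrouped by corners.\<close>

lemma odd_ends_parity:
  assumes "P0 \<longrightarrow> \<not> x0" "P1 \<longrightarrow> \<not> x1" "P2 \<longrightarrow> \<not> x2" "P3 \<longrightarrow> \<not> x3"
  shows "odd (of_bool (P0 \<and> x1 \<or> P1 \<and> x0) + of_bool (P1 \<and> x2 \<or> P2 \<and> x1) +
      of_bool (P2 \<and> x3 \<or> P3 \<and> x2) + of_bool (P3 \<and> x0 \<or> P0 \<and> x3) :: nat) \<longleftrightarrow>
    (((P0 \<and> x1 \<noteq> x3) \<noteq> (P1 \<and> x0 \<noteq> x2)) \<noteq> (P2 \<and> x1 \<noteq> x3)) \<noteq> (P3 \<and> x0 \<noteq> x2)"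
  using assms by (cases P0; cases P1; cases P2; cases P3; cases x0; cases x1; cases x2; cases x3) simp_all

section \<open>Double counting over the sides of edges\<close>

context oriented_quadrangulation
begin

text \<open>Sides can be listed by faces or by edges. Together with the two sides per edge this
  yields all parity statements on faces below.\<close>

lemma card_sides_filter:
  "(\<Sum>F\<in>Fs. card {j. j < 4 \<and> Q F j}) = (\<Sum>e\<in>E. card {s \<in> edge_sides X V E W e. Q (fst s) (snd s)})"
proof -
  have "(\<Sum>F\<in>Fs. card {j. j < 4 \<and> Q F j}) = card (SIGMA F:Fs. {j. j < 4 \<and> Q F j})"
    using finite_faces by (intro card_SigmaI[symmetric]) auto
  also have "(SIGMA F:Fs. {j. j < 4 \<and> Q F j}) = (\<Union>e\<in>E. {s \<in> edge_sides X V E W e. Q (fst s) (snd s)})"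
    using face_walk(3) by (auto simp: edge_sides_eq)
  also have "card \<dots> = (\<Sum>e\<in>E. card {s \<in> edge_sides X V E W e. Q (fst s) (snd s)})"
    using finite_graph(2) finite_sides_card_le(1)
    by (intro card_UN_disjoint) (auto simp: edge_sides_eq)
  finally show ?thesis .
qed

lemma even_card_edges: "even (card E)"
proof -
  have "(\<Sum>F\<in>Fs. card {j. j < (4::nat) \<and> True}) = (\<Sum>e\<in>E. 2)"
    unfolding card_sides_filter using card_edge_sides by (intro sum.cong) auto
  then have "4 * card Fs = 2 * card E" by simp
  then show ?thesis by presburger
qed

end

section \<open>Parities forced by a local 3-colouring\<close>

locale coloured_quadrangulation = oriented_quadrangulation +
  fixes c :: "'a \<Rightarrow> nat"
  assumes col: "local_coloring V (adjacent V E) 3 c"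
begin

definition corner_colour :: "'a set \<Rightarrow> nat \<Rightarrow> nat" where "corner_colour F i = c (corner F i)"
definition A :: "'a \<Rightarrow> nat set" where "A v = c ` neighborhood V (adjacent V E) v"

lemma A: assumes "v \<in> V" shows "finite (A v)" "card (A v) \<le> 2" "c v \<notin> A v"
  using col assms unfolding local_coloring_def A_def proper_coloring_def neighborhood_def
  by (auto simp: imageE)

lemma A_eq:
  assumes "v \<in> V" "x \<in> A v" "y \<in> A v" "x \<noteq> y" shows "A v = {x, y}"
  using card_seteq[of "A v" "{x, y}"] A[OF assms(1)] assms by auto

lemma adjacent_corners:
  assumes "F \<in> Fs"
  shows "adjacent V E (corner F i) (corner F (Suc i))" "adjacent V E (corner F (Suc i)) (corner F i)"
proof -
  have "corner F i = corner F (i mod 4)" "corner F (Suc i) = corner F (Suc (i mod 4))"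
    by (simp_all add: corner_def mod_Suc_eq)
  then show "adjacent V E (corner F i) (corner F (Suc i))" "adjacent V E (corner F (Suc i)) (corner F i)"
    using corner_neq[OF assms face_walk(4)[OF assms], of "i mod 4"] face_walk(3)[OF assms, of "i mod 4"]
    by (auto simp: adjacent_def insert_commute)
qed

lemma corner_colour_in_A:
  assumes "F \<in> Fs" shows "corner_colour F (Suc i) \<in> A (corner F i)" "corner_colour F i \<in> A (corner F (Suc i))"
  using adjacent_corners[OF assms] face_walk(2)[OF assms]
  by (auto simp: A_def neighborhood_def corner_colour_def)

lemma corner_colour_neq: assumes "F \<in> Fs" shows "corner_colour F i \<noteq> corner_colour F (Suc i)"
  using corner_colour_in_A(1)[OF assms, of i] A(3)[OF face_walk(2)[OF assms], of i] unfolding corner_colour_def by metis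

lemma corner_colour_4: "corner_colour F 4 = corner_colour F 0" "corner F 4 = corner F 0" by (simp_all add: corner_colour_def corner_def)

text \<open>The colours at the ends of a diagonal. The pair is degenerate when both ends have the
  same colour.\<close>

definition D0 :: "'a set \<Rightarrow> nat \<times> nat" where "D0 F = sorted_pair (corner_colour F 0) (corner_colour F 2)"
definition D1 :: "'a set \<Rightarrow> nat \<times> nat" where "D1 F = sorted_pair (corner_colour F 1) (corner_colour F 3)"

lemma corner_colour_neqs:
  assumes "F \<in> Fs"
  shows "corner_colour F 0 \<noteq> corner_colour F 1" "corner_colour F 1 \<noteq> corner_colour F 2" "corner_colour F 2 \<noteq> corner_colour F 3" "corner_colour F 3 \<noteq> corner_colour F 0"
proof -
  have n: "Suc 0 = 1" "Suc 1 = 2" "Suc 2 = 3" "Suc 3 = 4" by simp_all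
  show "corner_colour F 0 \<noteq> corner_colour F 1" using corner_colour_neq[OF assms, of 0] unfolding n .
  show "corner_colour F 1 \<noteq> corner_colour F 2" using corner_colour_neq[OF assms, of 1] unfolding n .
  show "corner_colour F 2 \<noteq> corner_colour F 3" using corner_colour_neq[OF assms, of 2] unfolding n .
  show "corner_colour F 3 \<noteq> corner_colour F 0" using corner_colour_neq[OF assms, of 3] unfolding n corner_colour_4 .
qed

text \<open>The alternating form on colour pairs: its values will be identified with intersection
  numbers modulo 2, and its rank decides the theorem.\<close>

definition odd_crossings :: "nat \<times> nat \<Rightarrow> nat \<times> nat \<Rightarrow> bool" where
  "odd_crossings e f \<longleftrightarrow> odd (card {F \<in> Fs. {D0 F, D1 F} = {e, f}})"

lemma odd_crossings_disjoint:
  assumes "odd_crossings e f" shows "{fst e, snd e} \<inter> {fst f, snd f} = {}"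
proof -
  have "{F \<in> Fs. {D0 F, D1 F} = {e, f}} \<noteq> {}" using assms unfolding odd_crossings_def by (metis card.empty even_zero)
  then obtain F where F: "F \<in> Fs" "{D0 F, D1 F} = {e, f}" by blast
  have "{fst (D0 F), snd (D0 F)} \<inter> {fst (D1 F), snd (D1 F)} = {}"
    using corner_colour_neqs[OF F(1)] by (auto simp: D0_def D1_def sorted_pair_def min_def max_def split: if_splits)
  then show ?thesis using F(2) by (auto simp: doubleton_eq_iff)
qed

text \<open>Orienting every edge towards its larger colour, a face has an odd number of edges oriented
  along its boundary walk iff its colours are four and cyclically monotone.\<close>

lemma odd_breaks_crossing:
  assumes "odd (card {e \<in> E. breaks_consistency X V E W e})"
  shows "odd (card {F \<in> Fs. crossing (D0 F) (D1 F) \<or> crossing (D1 F) (D0 F)})"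
proof -
  let ?Q = "\<lambda>F j. corner_colour F j < corner_colour F (Suc j)"
  let ?br = "breaks_consistency X V E W"
  \<comment> \<open>If the two sides traverse the edge in opposite directions, exactly one of them
    is an ascent; otherwise both or none are.\<close>
  have "odd (card {s \<in> edge_sides X V E W e. ?Q (fst s) (snd s)}) \<longleftrightarrow> \<not> ?br e" if e: "e \<in> E" for e
  proof -
    obtain s1 s2 where s: "edge_sides X V E W e = {s1, s2}" "s1 \<noteq> s2"
      using card_edge_sides[OF e] by (auto simp: card_2_iff)
    have "s1 \<in> edge_sides X V E W e" "s2 \<in> edge_sides X V E W e" using s(1) by auto
    then have m: "fst s1 \<in> Fs" "snd s1 < 4" "side (fst s1) (snd s1) = e"
      "fst s2 \<in> Fs" "snd s2 < 4" "side (fst s2) (snd s2) = e"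
      by (simp_all add: edge_sides_eq case_prod_beta)
    let ?st = "\<lambda>s. corner (fst s) (snd s)" let ?en = "\<lambda>s. corner (fst s) (Suc (snd s))"
    have ev: "e \<inter> V = {?st s1, ?en s1}" "e \<inter> V = {?st s2, ?en s2}" "?st s1 \<noteq> ?en s1" "?st s2 \<noteq> ?en s2"
      using corner_neq[OF m(1) face_walk(4)[OF m(1)] m(2)] corner_neq[OF m(4) face_walk(4)[OF m(4)] m(5)] m(3,6)
      by auto
    have "fst (W (fst s1) ! snd s1) = ?st s1" "fst (W (fst s2) ! snd s2) = ?st s2"
      using m by (simp_all add: corner_def)
    then have br: "?br e \<longleftrightarrow> ?st s1 = ?st s2"
      using s(2) unfolding breaks_consistency_def s(1) by (cases s1; cases s2) auto
    have ne: "corner_colour (fst s1) (snd s1) \<noteq> corner_colour (fst s1) (Suc (snd s1))" using corner_colour_neq[OF m(1)] .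
    have "?st s1 = ?st s2 \<and> ?en s1 = ?en s2 \<or> ?st s1 = ?en s2 \<and> ?en s1 = ?st s2"
      using ev by (metis doubleton_eq_iff)
    then have "\<not> ?br e \<longleftrightarrow> (?Q (fst s1) (snd s1) \<longleftrightarrow> \<not> ?Q (fst s2) (snd s2))"
    proof
      assume "?st s1 = ?st s2 \<and> ?en s1 = ?en s2"
      then show ?thesis unfolding br corner_colour_def by simp
    next
      assume o: "?st s1 = ?en s2 \<and> ?en s1 = ?st s2"
      then have "?st s1 \<noteq> ?st s2" using ev(3) by simp
      moreover have "corner_colour (fst s2) (snd s2) = corner_colour (fst s1) (Suc (snd s1))" "corner_colour (fst s2) (Suc (snd s2)) = corner_colour (fst s1) (snd s1)"
        using o by (simp_all add: corner_colour_def)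
      ultimately show ?thesis unfolding br using ne by auto
    qed
    moreover have "{s \<in> edge_sides X V E W e. ?Q (fst s) (snd s)} =
      (if ?Q (fst s1) (snd s1) then {s1} else {}) \<union> (if ?Q (fst s2) (snd s2) then {s2} else {})"
      unfolding s(1) by auto
    ultimately show ?thesis using s(2) by auto
  qed
  then have "{e \<in> E. odd (card {s \<in> edge_sides X V E W e. ?Q (fst s) (snd s)})} = {e \<in> E. \<not> ?br e}" by blast
  then have ev: "even (\<Sum>F\<in>Fs. card {j. j < 4 \<and> ?Q F j}) = even (card {e \<in> E. \<not> ?br e})"
    unfolding card_sides_filter even_sum_iff[OF finite_graph(2)] by (rule arg_cong)
  \<comment> \<open>The number of edges is even because \<open>4 * card Fs = 2 * card E\<close>.
    Hence an odd number of breaking edges leaves an odd number of other edges.\<close>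
  have "odd n" if "even n = even y" "m = x + y" "odd x" "even m" for n m x y :: nat
    using that by auto
  from this[OF ev card_split_filter[OF finite_graph(2)] assms even_card_edges]
  have "odd (\<Sum>F\<in>Fs. card {j. j < 4 \<and> ?Q F j})" .
  moreover have "odd (card {j. j < 4 \<and> ?Q F j}) \<longleftrightarrow> crossing (D0 F) (D1 F) \<or> crossing (D1 F) (D0 F)"
    if F: "F \<in> Fs" for F
  proof -
    have n: "Suc 0 = 1" "Suc 1 = 2" "Suc 2 = 3" "Suc 3 = 4" by simp_all
    show ?thesis unfolding card_less_four n corner_colour_4 D0_def D1_def
      by (rule odd_ascents_iff_crossing[OF corner_colour_neqs[OF F]])
  qed
  then have "{F \<in> Fs. odd (card {j. j < 4 \<and> ?Q F j})} = {F \<in> Fs. crossing (D0 F) (D1 F) \<or> crossing (D1 F) (D0 F)}"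
    by blast
  ultimately show ?thesis
    using even_sum_iff[OF finite_faces, of "\<lambda>F. card {j. j < 4 \<and> ?Q F j}"] by (simp only: simp_thms)
qed

text \<open>Count the edges from a vertex of colour \<open>b\<close> that sees exactly
  \<open>a\<close> and \<open>a'\<close> to a neighbour of colour \<open>a\<close>. Having two sides
  each, they contribute an even number over all faces. Within one face the contribution is odd iff
  one diagonal has the colours \<open>a\<close>, \<open>a'\<close> and exactly one end of the other
  has colour \<open>b\<close>.\<close>

lemma even_row:
  assumes "a \<noteq> a'" "b \<noteq> a" "b \<noteq> a'"
  shows "even (card {F \<in> Fs. (D0 F = sorted_pair a a' \<and> (corner_colour F 1 = b) \<noteq> (corner_colour F 3 = b)) \<or>
     (D1 F = sorted_pair a a' \<and> (corner_colour F 0 = b) \<noteq> (corner_colour F 2 = b))})" (is "even (card ?R)")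
proof -
  define S where "S = {v \<in> V. c v = b \<and> A v = {a, a'}}"
  let ?out = "\<lambda>F j. corner F j \<in> S \<and> corner_colour F (Suc j) = a"
  let ?in = "\<lambda>F j. corner F (Suc j) \<in> S \<and> corner_colour F j = a"
  let ?Q = "\<lambda>F j. ?out F j \<or> ?in F j"
  have "even (card {s \<in> edge_sides X V E W e. ?Q (fst s) (snd s)})" if e: "e \<in> E" for e
  proof -
    let ?T = "\<exists>u w. e \<inter> V = {u, w} \<and> u \<in> S \<and> c w = a"
    have "?Q (fst s) (snd s) \<longleftrightarrow> ?T" if "s \<in> edge_sides X V E W e" for s
    proof -
      have m: "fst s \<in> Fs" "snd s < 4" "side (fst s) (snd s) = e" using that by (auto simp: edge_sides_eq)
      have ev: "e \<inter> V = {corner (fst s) (snd s), corner (fst s) (Suc (snd s))}"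
        using corner_neq[OF m(1) face_walk(4)[OF m(1)] m(2)] m(3) by auto
      show ?thesis unfolding ev corner_colour_def by (auto simp: doubleton_eq_iff)
    qed
    then have *: "{s \<in> edge_sides X V E W e. ?Q (fst s) (snd s)} = {s \<in> edge_sides X V E W e. ?T}" by blast
    show ?thesis
    proof (cases ?T)
      case True
      then have "{s \<in> edge_sides X V E W e. ?T} = edge_sides X V E W e" by blast
      then show ?thesis unfolding * using card_edge_sides[OF e] by simp
    next
      case False
      then have e0: "{s \<in> edge_sides X V E W e. ?T} = {}" by blast
      show ?thesis unfolding * e0 by simp
    qed
  qed
  then have "even (\<Sum>F\<in>Fs. card {j. j < 4 \<and> ?Q F j})"
    unfolding card_sides_filter by (intro dvd_sum) auto
  moreover have "odd (card {j. j < 4 \<and> ?Q F j}) \<longleftrightarrow> F \<in> ?R" if F: "F \<in> Fs" for F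
  proof -
    have n: "Suc 0 = 1" "Suc 1 = 2" "Suc 2 = 3" "Suc 3 = 4" by simp_all
    have ex: "corner F j \<in> S \<longrightarrow> corner_colour F j \<noteq> a" for j using assms(2) by (auto simp: S_def corner_colour_def)
    note c1 = corner_colour_in_A(1)[OF F] and c2 = corner_colour_in_A(2)[OF F]
    have nb: "corner_colour F 1 \<in> A (corner F 0)" "corner_colour F 3 \<in> A (corner F 0)" "corner_colour F 0 \<in> A (corner F 1)" "corner_colour F 2 \<in> A (corner F 1)"
      "corner_colour F 1 \<in> A (corner F 2)" "corner_colour F 3 \<in> A (corner F 2)" "corner_colour F 0 \<in> A (corner F 3)" "corner_colour F 2 \<in> A (corner F 3)"
      using c1[of 0, unfolded n] c2[of 3, unfolded n corner_colour_4] c2[of 0, unfolded n] c1[of 1, unfolded n]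
        c2[of 1, unfolded n] c1[of 2, unfolded n] c1[of 3, unfolded n corner_colour_4] c2[of 2, unfolded n]
      by - (assumption+)
    \<comment> \<open>A corner with differently coloured neighbours in the face sees exactly these
      two colours, so membership in \<open>S\<close> can be read off from the face.\<close>
    have corner: "corner F j \<in> S \<and> (x = a) \<noteq> (y = a) \<longleftrightarrow> corner_colour F j = b \<and> {x, y} = {a, a'}"
      if "x \<in> A (corner F j)" "y \<in> A (corner F j)" for j x y
    proof
      assume l: "corner F j \<in> S \<and> (x = a) \<noteq> (y = a)"
      then have "A (corner F j) = {a, a'}" "corner_colour F j = b" by (simp_all add: S_def corner_colour_def)
      then show "corner_colour F j = b \<and> {x, y} = {a, a'}" using l that by auto
    next
      assume r: "corner_colour F j = b \<and> {x, y} = {a, a'}"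
      then have "x \<noteq> y" using assms(1) by (auto simp: doubleton_eq_iff)
      then have "A (corner F j) = {a, a'}" using A_eq[OF face_walk(2)[OF F] that] r by simp
      moreover have "(x = a) \<noteq> (y = a)" using r assms(1) by (auto simp: doubleton_eq_iff)
      ultimately show "corner F j \<in> S \<and> (x = a) \<noteq> (y = a)"
        using r face_walk(2)[OF F] by (simp add: S_def corner_colour_def)
    qed
    have edge_path: "odd (card {j. j < 4 \<and> ?Q F j}) \<longleftrightarrow>
      (((corner_colour F 0 = b \<and> {corner_colour F 1, corner_colour F 3} = {a, a'}) \<noteq> (corner_colour F 1 = b \<and> {corner_colour F 0, corner_colour F 2} = {a, a'}))
        \<noteq> (corner_colour F 2 = b \<and> {corner_colour F 1, corner_colour F 3} = {a, a'})) \<noteq> (corner_colour F 3 = b \<and> {corner_colour F 0, corner_colour F 2} = {a, a'})"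
      unfolding card_less_four n corner_colour_4
      using odd_ends_parity[OF ex[of 0] ex[of 1] ex[of 2] ex[of 3]]
      unfolding corner[OF nb(1,2)] corner[OF nb(3,4)] corner[OF nb(5,6)] corner[OF nb(7,8)] .
    have "\<not> ({corner_colour F 0, corner_colour F 2} = {a, a'} \<and> {corner_colour F 1, corner_colour F 3} = {a, a'})"
      using corner_colour_neqs[OF F] by (metis insertE insertI1 singletonD)
    then show ?thesis unfolding edge_path D0_def D1_def sorted_pair_eq_iff using F
      by (cases "{corner_colour F 0, corner_colour F 2} = {a, a'}"; cases "{corner_colour F 1, corner_colour F 3} = {a, a'}") simp_all
  qed
  then have "{F \<in> Fs. odd (card {j. j < 4 \<and> ?Q F j})} = ?R" by blast
  ultimately show ?thesis
    using even_sum_iff[OF finite_faces, of "\<lambda>F. card {j. j < 4 \<and> ?Q F j}"] by (simp only: simp_thms)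
qed

end

section \<open>Zeros of continuous functions on the disc\<close>

definition odd_zero :: "(complex \<Rightarrow> complex) \<Rightarrow> complex \<Rightarrow> bool" where
  "odd_zero \<Theta> p \<longleftrightarrow> (\<exists>e0>0. \<forall>e. 0 < e \<and> e < e0 \<longrightarrow>
     (\<exists>l\<in>{id, cnj}. \<exists>v. continuous_on (sphere p e) v \<and>
        (\<forall>z\<in>sphere p e. \<Theta> z = l (z - p) * exp (v z))))"

lemma odd_zero_mult:
  assumes "odd_zero \<Theta> p" "r > 0" "continuous_on (cball p r) u"
    and "\<And>z. z \<in> cball p r \<Longrightarrow> u z \<noteq> 0" "\<And>z. z \<in> cball p r \<Longrightarrow> \<Theta>' z = \<Theta> z * u z"
  shows "odd_zero \<Theta>' p"
proof -
  obtain e0 where e0: "e0 > 0" "\<And>e. 0 < e \<Longrightarrow> e < e0 \<Longrightarrow>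
     \<exists>l\<in>{id, cnj}. \<exists>v. continuous_on (sphere p e) v \<and> (\<forall>z\<in>sphere p e. \<Theta> z = l (z - p) * exp (v z))"
    using assms(1) unfolding odd_zero_def by blast
  obtain w where w: "continuous_on (cball p r) w" "\<And>z. z \<in> cball p r \<Longrightarrow> u z = exp (w z)"
    using continuous_logarithm_on_cball[OF assms(3,4)] by metis
  show ?thesis unfolding odd_zero_def
  proof (intro exI conjI allI impI)
    show "min e0 r > 0" using e0(1) assms(2) by simp
    fix e assume e: "0 < e \<and> e < min e0 r"
    then obtain l v where l: "l \<in> {id, cnj}" and v: "continuous_on (sphere p e) v"
      "\<forall>z\<in>sphere p e. \<Theta> z = l (z - p) * exp (v z)"
      using e0(2)[of e] unfolding min_less_iff_conj by blast
    have sub: "sphere p e \<subseteq> cball p r" using e by auto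
    have "continuous_on (sphere p e) (\<lambda>z. v z + w z)"
      using v(1) continuous_on_subset[OF w(1) sub] by (intro continuous_on_add)
    moreover have "\<Theta>' z = l (z - p) * exp (v z + w z)" if "z \<in> sphere p e" for z
    proof -
      have "z \<in> cball p r" using sub that by blast
      then show ?thesis using bspec[OF v(2) that] w(2) assms(5) by (simp add: exp_add)
    qed
    ultimately show "\<exists>l\<in>{id, cnj}. \<exists>v. continuous_on (sphere p e) v \<and>
        (\<forall>z\<in>sphere p e. \<Theta>' z = l (z - p) * exp (v z))" using l by blast
  qed
qed

text \<open>Outside a small disc around \<open>p\<close> divide by \<open>l (z - p)\<close>; inside,
  put the exponential of a Tietze extension of the logarithm \<open>v\<close> given on the circle.
  Both agree on the circle, and the filling creates no new zero.\<close>

lemma remove_odd_zero: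
  assumes c: "continuous_on (cball 0 1) \<Theta>" and p: "p \<in> ball 0 1" "odd_zero \<Theta> p"
    and P: "finite P" "p \<notin> P" "P \<subseteq> ball 0 1"
    and z: "\<And>z. z \<in> cball 0 1 \<Longrightarrow> \<Theta> z = 0 \<longleftrightarrow> z \<in> insert p P"
    and oz: "\<And>p'. p' \<in> P \<Longrightarrow> odd_zero \<Theta> p'"
  obtains \<Theta>' l where "continuous_on (cball 0 1) \<Theta>'" "l \<in> {id, cnj}"
    "\<And>z. z \<in> cball 0 1 \<Longrightarrow> \<Theta>' z = 0 \<longleftrightarrow> z \<in> P" "\<And>p'. p' \<in> P \<Longrightarrow> odd_zero \<Theta>' p'"
    "\<And>z. z \<in> sphere 0 1 \<Longrightarrow> \<Theta> z = l (z - p) * \<Theta>' z"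
proof -
  obtain e0 where e0: "e0 > 0" "\<And>e. 0 < e \<Longrightarrow> e < e0 \<Longrightarrow>
     \<exists>l\<in>{id, cnj}. \<exists>v. continuous_on (sphere p e) v \<and> (\<forall>z\<in>sphere p e. \<Theta> z = l (z - p) * exp (v z))"
    using p(2) unfolding odd_zero_def by blast
  have "open (ball 0 1 - P)" using P(1) by (intro open_Diff finite_imp_closed) auto
  moreover have "p \<in> ball 0 1 - P" using p(1) P(2) by simp
  ultimately obtain e1 where e1: "e1 > 0" "cball p e1 \<subseteq> ball 0 1 - P"
    using open_contains_cball by metis
  define e where "e = min e0 e1 / 2"
  have e: "0 < e" "e < e0" "e < e1" using e0(1) e1(1) by (auto simp: e_def)
  then obtain l v where l: "l \<in> {id, cnj}" and v: "continuous_on (sphere p e) v"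
    "\<And>z. z \<in> sphere p e \<Longrightarrow> \<Theta> z = l (z - p) * exp (v z)"
    using e0(2)[of e] by blast
  have sub: "cball p e \<subseteq> ball 0 1 - P" using e1(2) e(3) by (auto simp: subset_iff)
  have "compact (v ` sphere p e)" using v(1) by (intro compact_continuous_image compact_sphere)
  then obtain B where B: "B \<ge> 0" "\<And>z. z \<in> sphere p e \<Longrightarrow> norm (v z) \<le> B"
    using compact_imp_bounded bounded_pos by (metis imageI less_imp_le)
  obtain w where w: "continuous_on (cball p e) w" "\<And>z. z \<in> sphere p e \<Longrightarrow> w z = v z"
    using Tietze[OF v(1) _ B, of "cball p e"]
    by (metis closed_sphere closed_subset sphere_cball)
  have l0: "l z = 0 \<longleftrightarrow> z = 0" for z using l by auto
  have lc: "continuous_on S (\<lambda>z. l (z - p))" for S using l by (auto intro!: continuous_intros)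
  define \<Theta>' where "\<Theta>' = (\<lambda>z. if z \<in> cball p e then exp (w z) else \<Theta> z / l (z - p))"
  have outer: "\<Theta>' z = \<Theta> z / l (z - p)" if "z \<notin> ball p e" for z
  proof (cases "z \<in> cball p e")
    case True
    then have s: "z \<in> sphere p e" using that by auto
    then have "z - p \<noteq> 0" using e(1) by auto
    then show ?thesis using True w(2)[OF s] v(2)[OF s] l0 by (simp add: \<Theta>'_def)
  qed (simp add: \<Theta>'_def)
  have "continuous_on (cball p e \<union> (cball 0 1 - ball p e)) \<Theta>'"
    unfolding \<Theta>'_def
  proof (rule continuous_on_cases)
    show "closed (cball p e)" "closed (cball 0 1 - ball p e)" by (auto intro: closed_Diff)
    show "continuous_on (cball p e) (\<lambda>z. exp (w z))" using w(1) by (intro continuous_intros)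
    show "continuous_on (cball 0 1 - ball p e) (\<lambda>z. \<Theta> z / l (z - p))"
      using c lc l0 e(1) by (intro continuous_on_divide) (auto intro: continuous_on_subset)
    show "\<forall>x. x \<in> cball p e \<and> x \<notin> cball p e \<or> x \<in> cball 0 1 - ball p e \<and> x \<in> cball p e \<longrightarrow> exp (w x) = \<Theta> x / l (x - p)"
    proof (intro allI impI)
      fix x assume "x \<in> cball p e \<and> x \<notin> cball p e \<or> x \<in> cball 0 1 - ball p e \<and> x \<in> cball p e"
      then have "x \<in> cball p e" "x \<notin> ball p e" by auto
      then show "exp (w x) = \<Theta> x / l (x - p)" using outer[of x] by (simp add: \<Theta>'_def)
    qed
  qed
  moreover have "cball p e \<union> (cball 0 1 - ball p e) = cball 0 1"
    using sub ball_subset_cball by blast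
  ultimately have "continuous_on (cball 0 1) \<Theta>'" by simp
  moreover have "\<Theta>' z = 0 \<longleftrightarrow> z \<in> P" if "z \<in> cball 0 1" for z
  proof (cases "z \<in> cball p e")
    case True
    then show ?thesis using sub by (auto simp: \<Theta>'_def)
  next
    case False
    then have "z \<noteq> p" using e(1) by auto
    then show ?thesis using False z[OF that] l0 by (simp add: \<Theta>'_def)
  qed
  moreover have "odd_zero \<Theta>' p'" if p': "p' \<in> P" for p'
  proof -
    have "open (- cball p e)" "p' \<in> - cball p e" using sub p' by auto
    then obtain r where r: "r > 0" "cball p' r \<subseteq> - cball p e" using open_contains_cball by metis
    show ?thesis
    proof (rule odd_zero_mult[OF oz[OF p'] r(1)])
      have ne: "z \<noteq> p" if "z \<in> cball p' r" for z using r(2) that e(1) by auto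
      show "continuous_on (cball p' r) (\<lambda>z. inverse (l (z - p)))"
        using lc l0 ne by (intro continuous_on_inverse) auto
      show "inverse (l (z - p)) \<noteq> 0" if "z \<in> cball p' r" for z using l0 ne[OF that] by simp
      show "\<Theta>' z = \<Theta> z * inverse (l (z - p))" if "z \<in> cball p' r" for z
        using r(2) that by (auto simp: \<Theta>'_def divide_inverse)
    qed
  qed
  moreover have "\<Theta> z = l (z - p) * \<Theta>' z" if "z \<in> sphere 0 1" for z
  proof -
    have "z \<notin> cball p e" using sub that by auto
    moreover from this have "z \<noteq> p" using e(1) by auto
    ultimately show ?thesis using l0 by (simp add: \<Theta>'_def)
  qed
  ultimately show ?thesis using that l by blast
qed

lemma odd_zeros_factorization:
  assumes "finite P" "P \<subseteq> ball 0 1" "continuous_on (cball 0 1) \<Theta>"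
    and "\<And>z. z \<in> cball 0 1 \<Longrightarrow> \<Theta> z = 0 \<longleftrightarrow> z \<in> P" "\<And>p. p \<in> P \<Longrightarrow> odd_zero \<Theta> p"
  shows "\<exists>L l. continuous_on (cball 0 1) L \<and> (\<forall>p\<in>P. l p \<in> {id, cnj}) \<and>
    (\<forall>z\<in>sphere 0 1. \<Theta> z = (\<Prod>p\<in>P. l p (z - p)) * exp (L z))"
  using assms
proof (induction P arbitrary: \<Theta> rule: finite_induct)
  case empty
  then obtain h where "continuous_on (cball 0 1) h" "\<And>z. z \<in> cball 0 1 \<Longrightarrow> \<Theta> z = exp (h z)"
    using continuous_logarithm_on_cball[of 0 1 \<Theta>] by auto
  then show ?case by (intro exI[of _ h]) auto
next
  case (insert p P)
  obtain \<Theta>' l where T: "continuous_on (cball 0 1) \<Theta>'" "l \<in> {id, cnj}"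
    "\<And>z. z \<in> cball 0 1 \<Longrightarrow> \<Theta>' z = 0 \<longleftrightarrow> z \<in> P" "\<And>p'. p' \<in> P \<Longrightarrow> odd_zero \<Theta>' p'"
    "\<And>z. z \<in> sphere 0 1 \<Longrightarrow> \<Theta> z = l (z - p) * \<Theta>' z"
    by (rule remove_odd_zero[of \<Theta> p P]) (use insert in auto)
  obtain L m where L: "continuous_on (cball 0 1) L" "\<forall>p\<in>P. m p \<in> {id, cnj}"
    "\<forall>z\<in>sphere 0 1. \<Theta>' z = (\<Prod>p\<in>P. m p (z - p)) * exp (L z)"
    using insert.IH[of \<Theta>'] T insert.prems(1) by blast
  have "(\<Prod>q\<in>P. (m(p := l)) q (z - q)) = (\<Prod>q\<in>P. m q (z - q))" for z
    by (rule prod.cong) (use insert.hyps in auto)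
  then have "\<Theta> z = (\<Prod>q\<in>insert p P. (m(p := l)) q (z - q)) * exp (L z)" if "z \<in> sphere 0 1" for z
    using insert.hyps T(5)[OF that] L(3) that by (simp add: mult.assoc)
  moreover have "\<forall>q\<in>insert p P. (m(p := l)) q \<in> {id, cnj}" using L(2) T(2) by auto
  ultimately show ?case using L(1) by blast
qed

text \<open>The logarithms of 1 form a discrete set with gaps \<open>2 * pi\<close>.\<close>

lemma exp_eq_one_const:
  fixes f :: "'b::topological_space \<Rightarrow> complex"
  assumes "connected S" "continuous_on S f" "\<And>x. x \<in> S \<Longrightarrow> exp (f x) = 1" "x \<in> S" "y \<in> S"
  shows "f x = f y"
proof -
  have "f constant_on S"
  proof (rule continuous_discrete_range_constant[OF assms(1,2)])
    fix x assume x: "x \<in> S"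
    show "\<exists>e>0. \<forall>y. y \<in> S \<and> f y \<noteq> f x \<longrightarrow> e \<le> norm (f y - f x)"
    proof (intro exI[of _ "2 * pi"] conjI allI impI)
      fix y assume y: "y \<in> S \<and> f y \<noteq> f x"
      have "exp (f y - f x) = 1" using assms(3) x y by (simp add: exp_diff)
      then obtain n :: int where n: "f y - f x = of_int (2 * n) * pi * \<i>"
        by (metis exp_eq_1 complex_eqI complex_eq exp_eq add_0 exp_zero)
      then have "n \<noteq> 0" using y by auto
      then have "1 \<le> \<bar>real_of_int n\<bar>" by linarith
      then show "2 * pi \<le> norm (f y - f x)" unfolding n by (simp add: norm_mult)
    qed simp
  qed
  then show ?thesis using assms(4,5) unfolding constant_on_def by metis
qed

lemma exp_eq_one_int:
  assumes "exp z = (1::complex)"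
  obtains n :: int where "z = 2 * pi * \<i> * of_int n"
proof -
  obtain n :: int where "z = 0 + of_int (2 * n) * pi * \<i>"
    using exp_eq[of z 0] assms by auto
  then show ?thesis using that[of n] by (simp add: algebra_simps)
qed

text \<open>After all zeros are divided out, each of them contributes 1 or -1 to the winding number
  along the unit circle, which therefore counts them modulo 2.\<close>

lemma winding_parity_zeros:
  assumes P: "finite P" "P \<subseteq> ball 0 1" and c: "continuous_on (cball 0 1) \<Theta>"
    and z: "\<And>z. z \<in> cball 0 1 \<Longrightarrow> \<Theta> z = 0 \<longleftrightarrow> z \<in> P" and oz: "\<And>p. p \<in> P \<Longrightarrow> odd_zero \<Theta> p"
    and \<Lambda>: "continuous_on {0..2*pi} \<Lambda>" "\<And>t. t \<in> {0..2*pi} \<Longrightarrow> exp (\<Lambda> t) = \<Theta> (cis t)"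
  obtains k :: int where "\<Lambda> (2*pi) - \<Lambda> 0 = 2 * pi * \<i> * of_int k" "even k \<longleftrightarrow> even (card P)"
proof -
  obtain L l where L: "continuous_on (cball 0 1) L" and l: "\<And>p. p \<in> P \<Longrightarrow> l p \<in> {id, cnj}"
    and eq: "\<And>z. z \<in> sphere 0 1 \<Longrightarrow> \<Theta> z = (\<Prod>p\<in>P. l p (z - p)) * exp (L z)"
    using odd_zeros_factorization[OF P c z oz] by blast
  define \<sigma> where "\<sigma> p = (if l p = id then 1 else - 1 :: int)" for p
  \<comment> \<open>An explicit logarithm along the circle:
    \<open>cis t - p = cis t * (1 - p * cis (- t))\<close>, where the second factor has positive
    real part, so \<open>Ln\<close> is continuous there and returns to its value.\<close>
  define M where "M t = (\<Sum>p\<in>P. \<i> * of_int (\<sigma> p) * of_real t + Ln (l p (1 - p * cis (- t)))) + L (cis t)" for t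
  have re: "Re (l p (1 - p * cis (- t))) > 0" if "p \<in> P" for p t
  proof -
    have "norm (p * cis (- t)) < 1" using P(2) that by (auto simp: norm_mult)
    then have "Re (p * cis (- t)) < 1" using complex_Re_le_cmod le_less_trans by blast
    then show ?thesis using l[OF that] by auto
  qed
  then have nr: "l p (1 - p * cis (- t)) \<notin> \<real>\<^sub>\<le>\<^sub>0" if "p \<in> P" for p t
    using re[OF that, of t] by (auto simp: complex_nonpos_Reals_iff)
  have cl: "continuous_on S (\<lambda>t. l p (1 - p * cis (- t)))" if "p \<in> P" for p S
    using l[OF that] by (auto intro!: continuous_intros)
  have Mc: "continuous_on {0..2*pi} M"
    unfolding M_def using nr cl
    by (intro continuous_intros continuous_on_compose2[OF L]) auto
  have "exp (M t) = \<Theta> (cis t)" for t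
  proof -
    have "exp (\<i> * of_int (\<sigma> p) * of_real t + Ln (l p (1 - p * cis (- t)))) = l p (cis t - p)" if "p \<in> P" for p
    proof -
      have ne: "l p (1 - p * cis (- t)) \<noteq> 0" using nr[OF that, of t] by auto
      have d: "cis t - p = cis t * (1 - p * cis (- t))" by (simp add: algebra_simps cis_mult)
      have "exp (\<i> * of_int (\<sigma> p) * of_real t) = l p (cis t)"
      proof (cases "l p = id")
        case True
        then show ?thesis by (simp add: \<sigma>_def cis_conv_exp)
      next
        case False
        then have "l p = cnj" "\<sigma> p = - 1" using l[OF that] by (auto simp: \<sigma>_def)
        moreover have "exp (\<i> * of_int (- 1) * of_real t) = cis (- t)" by (simp add: cis_conv_exp)
        ultimately show ?thesis by (simp only: cis_cnj)
      qed
      then have "exp (\<i> * of_int (\<sigma> p) * of_real t + Ln (l p (1 - p * cis (- t)))) = l p (cis t) * l p (1 - p * cis (- t))"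
        using ne by (simp add: exp_add)
      also have "\<dots> = l p (cis t - p)" unfolding d using l[OF that] by auto
      finally show ?thesis .
    qed
    then show ?thesis using eq[of "cis t"] P(1) by (simp add: M_def exp_add exp_sum)
  qed
  then have "exp (\<Lambda> t - M t) = 1" if "t \<in> {0..2*pi}" for t
    using \<Lambda>(2)[OF that] by (metis exp_diff exp_not_eq_zero divide_self)
  then have "\<Lambda> (2*pi) - M (2*pi) = \<Lambda> 0 - M 0"
    by (intro exp_eq_one_const[of "{0..2*pi}" "\<lambda>t. \<Lambda> t - M t"] continuous_on_diff \<Lambda>(1) Mc) auto
  then have "\<Lambda> (2*pi) - \<Lambda> 0 = M (2*pi) - M 0" by (simp add: algebra_simps)
  also have "\<dots> = (\<Sum>p\<in>P. \<i> * of_int (\<sigma> p) * (2 * pi))"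
    by (simp add: M_def sum.distrib[symmetric] sum_subtractf[symmetric] cis_2pi[simplified] cis.code)
  also have "\<dots> = 2 * pi * \<i> * of_int (\<Sum>p\<in>P. \<sigma> p)"
    by (simp add: sum_distrib_left mult_ac)
  finally have "\<Lambda> (2*pi) - \<Lambda> 0 = 2 * pi * \<i> * of_int (\<Sum>p\<in>P. \<sigma> p)" .
  moreover have "even (\<Sum>p\<in>P. \<sigma> p) \<longleftrightarrow> even (card P)"
  proof -
    have "{p \<in> P. odd (\<sigma> p)} = P" by (auto simp: \<sigma>_def)
    then show ?thesis using even_sum_iff[OF P(1), of \<sigma>] by simp
  qed
  ultimately show ?thesis using that by blast
qed

text \<open>The parameter of a point on the circle is unique except at the base point, where the
  equal end values make the choice harmless.\<close>

lemma circle_log_descend: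
  assumes "e > 0" and Q: "continuous_on {0..1::real} Q" "Q 0 = Q 1"
  obtains v :: "complex \<Rightarrow> complex" where "continuous_on (sphere p e) v"
    "\<And>t. t \<in> {0..1} \<Longrightarrow> v (p + e * cis (2 * pi * t)) = Q t"
proof -
  define f where "f t = p + of_real e * cis (2 * pi * t)" for t :: real
  define v where "v z = Q (SOME t. t \<in> {0..1} \<and> f t = z)" for z
  have fe: "f t = f t' \<Longrightarrow> t = t' \<or> {t, t'} = {0, 1}" if "t \<in> {0..1}" "t' \<in> {0..1}" for t t'
  proof -
    assume "f t = f t'"
    then have "cis (4 * t * pi / 2) = cis (4 * t' * pi / 2)" using assms(1) by (simp add: f_def mult_ac)
    then have *: "4 * t < 4 \<Longrightarrow> 4 * t' < 4 \<Longrightarrow> t = t'"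
      using cis_quarter_eq_iff[of "4 * t" "4 * t'"] that by auto
    have one: "f 1 = f 0" by (simp add: f_def)
    have z: "s = 0" if "s \<in> {0..1}" "s < 1" "f s = f 1" for s
    proof -
      have "cis (4 * s * pi / 2) = cis (2 * pi * s)" by (rule arg_cong[of _ _ cis]) simp
      also have "\<dots> = cis (0 * pi / 2)" using that(3) one assms(1) by (simp add: f_def)
      finally show ?thesis using cis_quarter_eq_iff[of "4 * s" 0] that by auto
    qed
    show ?thesis
    proof (cases "t < 1 \<and> t' < 1")
      case True then show ?thesis using * by simp
    next
      case False
      then show ?thesis using z[of t] z[of t'] that \<open>f t = f t'\<close> by force
    qed
  qed
  have vf: "v (f t) = Q t" if "t \<in> {0..1}" for t
  proof -
    have "(SOME s. s \<in> {0..1} \<and> f s = f t) \<in> {0..1} \<and> f (SOME s. s \<in> {0..1} \<and> f s = f t) = f t"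
      by (rule someI[of _ t]) (use that in simp)
    then show ?thesis unfolding v_def using fe[OF _ that, of "SOME s. s \<in> {0..1} \<and> f s = f t"] Q(2)
      by (auto simp: doubleton_eq_iff)
  qed
  have cf: "continuous_map (top_of_set {0..1}) euclidean f"
    by (auto simp: f_def intro!: continuous_intros)
  have im: "f ` {0..1} = sphere p e"
  proof
    show "f ` {0..1} \<subseteq> sphere p e" using assms(1) by (auto simp: f_def dist_norm norm_mult)
    show "sphere p e \<subseteq> f ` {0..1}"
    proof
      fix z assume "z \<in> sphere p e"
      then have n: "norm (z - p) = e" by (simp add: dist_norm norm_minus_commute)
      have "z - p = of_real e * cis (Arg2pi (z - p))" using Arg2pi_eq[of "z - p"] n by (simp add: cis_conv_exp)
      then have "z = f (Arg2pi (z - p) / (2*pi))" by (simp add: f_def algebra_simps)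
      moreover have "Arg2pi (z - p) / (2*pi) \<in> {0..1}"
        using Arg2pi_ge_0[of "z - p"] Arg2pi_lt_2pi[of "z - p"] by (simp add: field_simps)
      ultimately show "z \<in> f ` {0..1}" by blast
    qed
  qed
  have "continuous_map (subtopology euclidean (f ` {0..1})) euclidean v"
    by (rule compact_continuous_descend[OF compact_Icc Hausdorff_space_euclidean cf Q(1) vf])
  then have "continuous_on (sphere p e) v" by (simp add: im)
  then show ?thesis using that vf by (simp add: f_def)
qed

text \<open>A small circle is mapped to a Jordan curve with the image of the centre inside, around
  which the winding number is 1 or -1. Subtracting this rotation from a logarithm along the curve
  leaves a function that closes up on the circle.\<close>

lemma odd_zero_injective:
  assumes r: "r > 0" and c: "continuous_on (cball p r) \<Psi>" and inj: "inj_on \<Psi> (cball p r)" and "\<Psi> p = 0"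
  shows "odd_zero \<Psi> p"
  unfolding odd_zero_def
proof (intro exI conjI allI impI)
  show "r > 0" by fact
  fix e assume e: "0 < e \<and> e < r"
  define \<gamma> where "\<gamma> = \<Psi> \<circ> circlepath p e"
  have pic: "path_image (circlepath p e) = sphere p e" using e by (simp add: path_image_circlepath)
  have sub: "cball p e \<subseteq> cball p r" "sphere p e \<subseteq> cball p r" using e by auto
  have sp: "simple_path \<gamma>" unfolding \<gamma>_def
    using simple_path_circlepath[of p e] e inj_on_subset[OF inj sub(2)] continuous_on_subset[OF c sub(2)]
    by (intro simple_path_continuous_image) (auto simp: pic)
  have pi: "path_image \<gamma> = \<Psi> ` sphere p e" unfolding \<gamma>_def path_image_compose pic ..
  have "open (\<Psi> ` ball p e)"
    using continuous_on_subset[OF c subset_trans[OF ball_subset_cball sub(1)]]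
      inj_on_subset[OF inj subset_trans[OF ball_subset_cball sub(1)]] by (metis invariance_of_domain open_ball)
  then have int: "\<Psi> ` ball p e \<subseteq> interior (\<Psi> ` cball p e)"
    by (intro interior_maximal image_mono ball_subset_cball)
  have cpt: "compact (\<Psi> ` cball p e)" using c sub by (intro compact_continuous_image) (auto intro: continuous_on_subset)
  \<comment> \<open>By invariance of domain the open disc is mapped into the interior, so the
    frontier of the image comes from the circle alone.\<close>
  then have fr: "frontier (\<Psi> ` cball p e) \<subseteq> path_image \<gamma>"
    using int cball_eq_ball_Un_sphere[of p e] unfolding frontier_def pi
    by (metis Diff_subset_conv Un_mono closure_closed compact_imp_closed image_Un order_refl)
  have n0: "0 \<notin> path_image \<gamma>"
  proof
    assume "0 \<in> path_image \<gamma>"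
    then obtain z where "z \<in> sphere p e" "\<Psi> z = \<Psi> p" unfolding pi using assms(4) by auto
    then show False using inj_onD[OF inj, of z p] sub(2) e by auto
  qed
  have "0 \<in> \<Psi> ` ball p e" using assms(4) e by (metis centre_in_ball imageI)
  then have "0 \<in> inside (frontier (\<Psi> ` cball p e))"
    using interior_inside_frontier[OF compact_imp_bounded[OF cpt]] int by blast
  then have "0 \<notin> outside (path_image \<gamma>)"
    using outside_mono[OF fr] inside_Int_outside by blast
  then have ins: "0 \<in> inside (path_image \<gamma>)" using n0 inside_Un_outside by blast
  have path: "path \<gamma>" and clo: "pathfinish \<gamma> = pathstart \<gamma>"
    using sp simple_path_imp_path by (auto simp: \<gamma>_def pathfinish_compose pathstart_compose)
  obtain q where q: "path q" "pathfinish q - pathstart q = 2 * of_real pi * \<i> * winding_number \<gamma> 0"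
    "\<And>t. t \<in> {0..1} \<Longrightarrow> \<gamma> t = 0 + exp (q t)"
    using winding_number_as_continuous_log[OF path n0] by metis
  have "winding_number \<gamma> 0 = 1 \<or> winding_number \<gamma> 0 = -1"
    by (rule simple_closed_path_winding_number_inside[OF sp]) (use ins in auto)
  then obtain s :: int where s: "s = 1 \<or> s = -1" "winding_number \<gamma> 0 = of_int s" by force
  define l where "l = (if s = 1 then id else cnj)"
  define Q where "Q t = q t - \<i> * of_int s * of_real (2 * pi * t) - of_real (ln e)" for t
  have Qc: "continuous_on {0..1} Q" unfolding Q_def using q(1) by (auto simp: path_def intro!: continuous_intros)
  have "Q 0 = Q 1" using q(2) s(2) by (simp add: Q_def pathfinish_def pathstart_def algebra_simps)
  then obtain v where v: "continuous_on (sphere p e) v"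
    "\<And>t. t \<in> {0..1} \<Longrightarrow> v (p + e * cis (2 * pi * t)) = Q t"
    using circle_log_descend[OF _ Qc] e by metis
  have "\<Psi> z = l (z - p) * exp (v z)" if "z \<in> sphere p e" for z
  proof -
    have "z \<in> circlepath p e ` {0..1}" using that unfolding pic[symmetric] path_image_def .
    then obtain t where t: "t \<in> {0..1}" "z = circlepath p e t" by blast
    have zz: "z = p + e * cis (2 * pi * t)" unfolding t(2) by (simp add: circlepath cis_conv_exp mult_ac)
    have "exp (q t) = \<Psi> z" using q(3)[OF t(1)] t(2) by (simp add: \<gamma>_def)
    moreover have "exp (v z) = exp (q t) / exp (\<i> * of_int s * of_real (2 * pi * t)) / e"
      using v(2)[OF t(1)] zz e by (simp add: Q_def exp_diff exp_of_real)
    moreover have "l (z - p) = e * exp (\<i> * of_int s * of_real (2 * pi * t))"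
    proof -
      have zp: "z - p = of_real e * cis (2 * pi * t)" unfolding zz by simp
      have "exp (\<i> * of_int (- 1) * of_real (2 * pi * t)) = cnj (cis (2 * pi * t))"
        unfolding cis_cnj by (simp add: cis_conv_exp)
      moreover have "exp (\<i> * of_int 1 * of_real (2 * pi * t)) = cis (2 * pi * t)" by (simp add: cis_conv_exp)
      ultimately show ?thesis using s(1) unfolding zp l_def by (elim disjE) (simp_all del: of_real_mult)
    qed
    ultimately show ?thesis using e by simp
  qed
  then show "\<exists>l\<in>{id, cnj}. \<exists>v. continuous_on (sphere p e) v \<and> (\<forall>z\<in>sphere p e. \<Psi> z = l (z - p) * exp (v z))"
    using v(1) by (intro bexI[of _ l]) (auto simp: l_def)
qed

section \<open>Alternating forms of rank two\<close>

definition pairs_of :: "nat set \<Rightarrow> (nat \<times> nat) set" where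
  "pairs_of K = {(a, b). a \<in> K \<and> b \<in> K \<and> a < b}"

lemma finite_pairs_of: "finite K \<Longrightarrow> finite (pairs_of K)"
  by (rule finite_subset[of _ "K \<times> K"]) (auto simp: pairs_of_def)

definition has_end :: "nat \<times> nat \<Rightarrow> nat \<Rightarrow> bool" where
  "has_end e b \<longleftrightarrow> fst e = b \<or> snd e = b"

text \<open>\<open>nl\<close> is the null class. Fix \<open>e\<close> in class \<open>i\<close>. The
  pairs of class \<open>j\<close> have even degree at every colour strictly between the ends of
  \<open>e\<close>, and such a pair crosses \<open>e\<close> iff exactly one of its ends lies
  there.\<close>

lemma even_crossing_classes:
  fixes cl :: "nat \<times> nat \<Rightarrow> 'c"
  assumes K: "finite K"
    and z0: "\<And>e f. e \<in> pairs_of K \<Longrightarrow> f \<in> pairs_of K \<Longrightarrow> z e f \<Longrightarrow> \<not> has_end f (fst e) \<and> \<not> has_end f (snd e)"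
    and row: "\<And>e b. e \<in> pairs_of K \<Longrightarrow> b \<in> K \<Longrightarrow> \<not> has_end e b \<Longrightarrow> even (card {f \<in> pairs_of K. has_end f b \<and> z e f})"
    and z: "\<And>e f. e \<in> pairs_of K \<Longrightarrow> f \<in> pairs_of K \<Longrightarrow> e \<noteq> f \<Longrightarrow> z e f \<longleftrightarrow> cl e \<noteq> nl \<and> cl f \<noteq> nl \<and> cl e \<noteq> cl f"
    and ij: "i \<noteq> nl" "j \<noteq> nl" "i \<noteq> j"
    and e: "e \<in> pairs_of K" "cl e = i"
  shows "even (card {f \<in> pairs_of K. cl f = j \<and> (crossing e f \<or> crossing f e)})"
proof -
  let ?P = "pairs_of K"
  define J where "J = {f \<in> ?P. cl f = j}"
  define B where "B = {b \<in> K. fst e < b \<and> b < snd e}"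
  have fin: "finite J" "finite B" "finite ?P" using finite_pairs_of[OF K] K by (auto simp: J_def B_def)
  have zJ: "z e f" if "f \<in> J" for f using z[OF e(1), of f] that e ij by (auto simp: J_def)
  have deg: "even (card {f \<in> J. has_end f b})" if b: "b \<in> B" for b
  proof (cases "\<exists>f0\<in>J. has_end f0 b")
    case True
    then obtain f0 where f0: "f0 \<in> J" "has_end f0 b" by blast
    have "z e f \<longleftrightarrow> f \<in> J" if f: "f \<in> ?P" "has_end f b" for f
    proof
      assume zf: "z e f"
      have "e \<noteq> f" using z0[OF e(1) f(1) zf] by (auto simp: has_end_def)
      then have "cl f \<noteq> nl" using z[OF e(1) f(1)] zf by blast
      \<comment> \<open>Pairs in different classes other than \<open>nl\<close> are related by
        \<open>z\<close> and hence disjoint, but \<open>f\<close> and \<open>f0\<close> share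
        \<open>b\<close>.\<close>
      moreover have "cl f = cl f0"
      proof (rule ccontr)
        assume ne: "cl f \<noteq> cl f0"
        then have "z f f0" using z[OF f(1), of f0] f0 ij \<open>cl f \<noteq> nl\<close> by (auto simp: J_def)
        then show False using z0[OF f(1), of f0] f0 f(2) by (auto simp: J_def has_end_def)
      qed
      ultimately show "f \<in> J" using f f0 by (simp add: J_def)
    qed (rule zJ)
    then have "{f \<in> J. has_end f b} = {f \<in> ?P. has_end f b \<and> z e f}" by (auto simp: J_def)
    then show ?thesis using row[OF e(1), of b] b by (auto simp: B_def has_end_def)
  next
    case False
    then have "{f \<in> J. has_end f b} = {}" by blast
    then show ?thesis by (metis card.empty even_zero)
  qed
  have "(\<Sum>b\<in>B. card {f \<in> J. has_end f b}) = (\<Sum>f\<in>J. card {b \<in> B. has_end f b})"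
    unfolding card_eq_sum sum.inter_filter[OF fin(1)] sum.inter_filter[OF fin(2)] by (rule sum.swap)
  moreover have "even (\<Sum>b\<in>B. card {f \<in> J. has_end f b})" using deg by (intro dvd_sum) auto
  moreover have "odd (card {b \<in> B. has_end f b}) \<longleftrightarrow> crossing e f \<or> crossing f e" if f: "f \<in> J" for f
  proof -
    have ne: "fst f \<noteq> fst e" "fst f \<noteq> snd e" "snd f \<noteq> fst e" "snd f \<noteq> snd e"
      using z0[OF e(1) _ zJ[OF f]] f by (auto simp: J_def has_end_def)
    have lt: "fst f < snd f" "fst f \<in> K" "snd f \<in> K" "fst e < snd e" using f e(1) by (auto simp: J_def pairs_of_def)
    have "{b \<in> B. has_end f b} = (if fst f \<in> B then {fst f} else {}) \<union> (if snd f \<in> B then {snd f} else {})"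
      by (auto simp: has_end_def)
    then have "odd (card {b \<in> B. has_end f b}) \<longleftrightarrow> (fst f \<in> B) \<noteq> (snd f \<in> B)" using lt(1) by auto
    also have "\<dots> \<longleftrightarrow> crossing e f \<or> crossing f e" using ne lt by (auto simp: B_def crossing_def)
    finally show ?thesis .
  qed
  then have "{f \<in> J. odd (card {b \<in> B. has_end f b})} = {f \<in> ?P. cl f = j \<and> (crossing e f \<or> crossing f e)}"
    by (auto simp: J_def)
  ultimately show ?thesis using even_sum_iff[OF fin(1), of "\<lambda>f. card {b \<in> B. has_end f b}"] by simp
qed

text \<open>The parities of \<open>A\<close> and \<open>B\<close> are coordinates in a plane over
  the field with two elements. The form is the determinant, which is 1 exactly on distinct nonzero
  vectors.\<close>

lemma even_crossings_rank_two:
  fixes A B :: "nat \<times> nat \<Rightarrow> int"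
  assumes K: "finite K"
    and z0: "\<And>e f. e \<in> pairs_of K \<Longrightarrow> f \<in> pairs_of K \<Longrightarrow> z e f \<Longrightarrow> \<not> has_end f (fst e) \<and> \<not> has_end f (snd e)"
    and row: "\<And>e b. e \<in> pairs_of K \<Longrightarrow> b \<in> K \<Longrightarrow> \<not> has_end e b \<Longrightarrow> even (card {f \<in> pairs_of K. has_end f b \<and> z e f})"
    and zAB: "\<And>e f. e \<in> pairs_of K \<Longrightarrow> f \<in> pairs_of K \<Longrightarrow> e \<noteq> f \<Longrightarrow> z e f \<longleftrightarrow> odd (A e * B f + A f * B e)"
  shows "even (card {(e, f) \<in> pairs_of K \<times> pairs_of K. crossing e f \<and> z e f})"
proof -
  let ?P = "pairs_of K"
  define cl where "cl e = (odd (A e), odd (B e))" for e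
  define nl where "nl = (False, False)"
  have z: "z e f \<longleftrightarrow> cl e \<noteq> nl \<and> cl f \<noteq> nl \<and> cl e \<noteq> cl f" if "e \<in> ?P" "f \<in> ?P" "e \<noteq> f" for e f
    unfolding zAB[OF that] cl_def nl_def by auto
  define N where "N i j = card {(e, f) \<in> ?P \<times> ?P. crossing e f \<and> cl e = i \<and> cl f = j}" for i j
  have fin: "finite ?P" by (rule finite_pairs_of[OF K])
  have asym: "\<not> (crossing e f \<and> crossing f e)" for e f by (auto simp: crossing_def)
  \<comment> \<open>Since \<open>crossing\<close> depends on the order, the interleavings between
    two classes are split into \<open>N i j\<close> and \<open>N j i\<close>; only the sum is known
    to be even.\<close>
  have even_N: "even (N i j + N j i)" if ij: "i \<noteq> nl" "j \<noteq> nl" "i \<noteq> j" for i j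
  proof -
    let ?S = "{(e, f) \<in> ?P \<times> ?P. cl e = i \<and> cl f = j \<and> (crossing e f \<or> crossing f e)}"
    let ?S1 = "{(e, f) \<in> ?P \<times> ?P. crossing e f \<and> cl e = i \<and> cl f = j}"
    let ?S2 = "{(e, f) \<in> ?P \<times> ?P. crossing e f \<and> cl e = j \<and> cl f = i}"
    have f12: "finite ?S1" "finite (prod.swap ` ?S2)"
      using fin by (auto intro: finite_subset[of _ "?P \<times> ?P"])
    have sw: "p \<in> prod.swap ` M \<longleftrightarrow> prod.swap p \<in> M" for p :: "(nat \<times> nat) \<times> nat \<times> nat" and M
      by (metis image_iff swap_swap)
    have "?S = ?S1 \<union> prod.swap ` ?S2" unfolding set_eq_iff Un_iff sw by auto
    moreover have "?S1 \<inter> prod.swap ` ?S2 = {}" unfolding disjoint_iff sw using asym by auto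
    ultimately have "card ?S = card ?S1 + card (prod.swap ` ?S2)" using card_Un_disjoint[OF f12] by simp
    also have "card (prod.swap ` ?S2) = card ?S2" by (rule card_image[OF inj_on_subset[OF inj_swap subset_UNIV]])
    finally have "card ?S = N i j + N j i" by (simp add: N_def)
    moreover have "?S = (SIGMA e:{e \<in> ?P. cl e = i}. {f \<in> ?P. cl f = j \<and> (crossing e f \<or> crossing f e)})" by auto
    then have "card ?S = (\<Sum>e\<in>{e \<in> ?P. cl e = i}. card {f \<in> ?P. cl f = j \<and> (crossing e f \<or> crossing f e)})"
      using fin by (simp add: card_SigmaI)
    moreover have "even \<dots>"
      using even_crossing_classes[OF K z0 row z ij] by (intro dvd_sum) auto
    ultimately show ?thesis by simp
  qed
  define T where "T = {(x, y). x \<noteq> nl \<and> y \<noteq> nl \<and> x \<noteq> y}"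
  have T: "T = {((True, True), (True, False)), ((True, False), (True, True)), ((True, True), (False, True)),
    ((False, True), (True, True)), ((True, False), (False, True)), ((False, True), (True, False))}"
    unfolding T_def nl_def set_eq_iff split_paired_All all_bool_eq by simp
  have "{(e, f) \<in> ?P \<times> ?P. crossing e f \<and> z e f} =
      (\<Union>t\<in>T. {(e, f) \<in> ?P \<times> ?P. crossing e f \<and> cl e = fst t \<and> cl f = snd t})" (is "?X = ?Y")
  proof -
    have "z e f \<longleftrightarrow> (cl e, cl f) \<in> T" if "e \<in> ?P" "f \<in> ?P" "crossing e f" for e f
    proof -
      have "e \<noteq> f" using that(3) by (auto simp: crossing_def)
      then show ?thesis using z[OF that(1,2)] unfolding T_def by simp
    qed
    then show ?thesis by (auto simp del: split_paired_Ex)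
  qed
  then have "card ?X = card ?Y" by (rule arg_cong)
  also have "card ?Y = (\<Sum>t\<in>T. N (fst t) (snd t))"
    unfolding N_def
  proof (rule card_UN_disjoint)
    show "finite T" unfolding T by simp
    show "\<forall>t\<in>T. finite {(e, f) \<in> ?P \<times> ?P. crossing e f \<and> cl e = fst t \<and> cl f = snd t}"
      using fin by (auto intro: finite_subset[of _ "?P \<times> ?P"])
  qed (auto simp: prod_eq_iff)
  also have "\<dots> = (N (True, True) (True, False) + N (True, False) (True, True)) +
      (N (True, True) (False, True) + N (False, True) (True, True)) +
      (N (True, False) (False, True) + N (False, True) (True, False))"
    by (simp add: T)
  finally show ?thesis
    using even_N[of "(True, True)" "(True, False)"] even_N[of "(True, True)" "(False, True)"]
      even_N[of "(True, False)" "(False, True)"] by (simp add: nl_def)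
qed

section \<open>The rank two criterion applied to the faces\<close>

context coloured_quadrangulation
begin

lemma sorted_pair_in_pairs: "x \<in> K \<Longrightarrow> y \<in> K \<Longrightarrow> sorted_pair x y \<in> pairs_of K \<longleftrightarrow> x \<noteq> y"
  by (auto simp: sorted_pair_def pairs_of_def min_def max_def)

lemma has_end_upair: "has_end (sorted_pair x y) b \<longleftrightarrow> x = b \<or> y = b"
  by (auto simp: has_end_def sorted_pair_def min_def max_def)

text \<open>The sets of faces for different indices are disjoint, so the size of their union is a
  sum whose parity is the number of odd terms.\<close>

lemma card_union_faces:
  assumes "finite T" and u: "\<And>F s s'. F \<in> Fs \<Longrightarrow> s \<in> T \<Longrightarrow> s' \<in> T \<Longrightarrow> R s F \<Longrightarrow> R s' F \<Longrightarrow> s = s'"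
  shows "even (card {s \<in> T. odd (card {F \<in> Fs. R s F})}) \<longleftrightarrow> even (card {F \<in> Fs. \<exists>s\<in>T. R s F})"
proof -
  have "{F \<in> Fs. \<exists>s\<in>T. R s F} = (\<Union>s\<in>T. {F \<in> Fs. R s F})" by blast
  also have "card \<dots> = (\<Sum>s\<in>T. card {F \<in> Fs. R s F})"
    using finite_faces u by (intro card_UN_disjoint assms(1)) auto
  finally show ?thesis using even_sum_iff[OF assms(1), of "\<lambda>s. card {F \<in> Fs. R s F}"] by simp
qed

lemma corner_colour_range: "F \<in> Fs \<Longrightarrow> corner_colour F i \<in> c ` V"
  using face_walk(2) by (simp add: corner_colour_def)

lemma D0_neq_D1: assumes "F \<in> Fs" shows "D0 F \<noteq> D1 F"
  using corner_colour_neqs[OF assms] by (auto simp: D0_def D1_def sorted_pair_eq_iff doubleton_eq_iff)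

text \<open>\<open>odd_breaks_crossing\<close> turns the parity of the quadrangulation into a number
  of faces with interleaving diagonals. Sorting these faces by their two pairs expresses it through
  \<open>odd_crossings\<close>, and \<open>even_row\<close> supplies the degree condition.\<close>

theorem not_rank_two:
  fixes A B :: "nat \<times> nat \<Rightarrow> int"
  assumes AB: "\<And>e f. e \<in> pairs_of (c ` V) \<Longrightarrow> f \<in> pairs_of (c ` V) \<Longrightarrow> e \<noteq> f \<Longrightarrow>
      odd_crossings e f \<longleftrightarrow> odd (A e * B f + A f * B e)"
  shows "even (card {e \<in> E. breaks_consistency X V E W e})"
proof (rule ccontr)
  assume odd: "odd (card {e \<in> E. breaks_consistency X V E W e})"
  let ?K = "c ` V" let ?P = "pairs_of ?K"
  have K: "finite ?K" using finite_graph by simp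
  note fin = finite_pairs_of[OF K]
  have row: "even (card {f \<in> ?P. has_end f b \<and> odd_crossings e f})" if e: "e \<in> ?P" and b: "b \<in> ?K" "\<not> has_end e b" for e b
  proof -
    obtain a a' where aa: "e = sorted_pair a a'" "a \<noteq> a'" "b \<noteq> a" "b \<noteq> a'"
    proof (rule that[of "fst e" "snd e"])
      show "e = sorted_pair (fst e) (snd e)" "fst e \<noteq> snd e" using e by (auto simp: pairs_of_def sorted_pair_def)
      show "b \<noteq> fst e" "b \<noteq> snd e" using b(2) by (auto simp: has_end_def)
    qed
    have "even (card {f \<in> {f \<in> ?P. has_end f b}. odd (card {F \<in> Fs. {D0 F, D1 F} = {e, f}})}) \<longleftrightarrow>
      even (card {F \<in> Fs. \<exists>f\<in>{f \<in> ?P. has_end f b}. {D0 F, D1 F} = {e, f}})"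
      using fin by (intro card_union_faces) (auto simp: doubleton_eq_iff)
    moreover have "{F \<in> Fs. \<exists>f\<in>{f \<in> ?P. has_end f b}. {D0 F, D1 F} = {e, f}} =
      {F \<in> Fs. (D0 F = sorted_pair a a' \<and> (corner_colour F 1 = b) \<noteq> (corner_colour F 3 = b)) \<or> (D1 F = sorted_pair a a' \<and> (corner_colour F 0 = b) \<noteq> (corner_colour F 2 = b))}"
    proof -
      have "(\<exists>f\<in>{f \<in> ?P. has_end f b}. {D0 F, D1 F} = {e, f}) \<longleftrightarrow>
        (D0 F = e \<and> (corner_colour F 1 = b) \<noteq> (corner_colour F 3 = b)) \<or> (D1 F = e \<and> (corner_colour F 0 = b) \<noteq> (corner_colour F 2 = b))" if F: "F \<in> Fs" for F
      proof -
        have "(\<exists>f\<in>{f \<in> ?P. has_end f b}. {D0 F, D1 F} = {e, f}) \<longleftrightarrow>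
          (D0 F = e \<and> D1 F \<in> ?P \<and> has_end (D1 F) b) \<or> (D1 F = e \<and> D0 F \<in> ?P \<and> has_end (D0 F) b)"
          using D0_neq_D1[OF F] by (simp only: doubleton_eq_iff Bex_def mem_Collect_eq) blast
        also have "D1 F \<in> ?P \<and> has_end (D1 F) b \<longleftrightarrow> (corner_colour F 1 = b) \<noteq> (corner_colour F 3 = b)"
          unfolding D1_def sorted_pair_in_pairs[OF corner_colour_range[OF F] corner_colour_range[OF F]] has_end_upair by auto
        also have "D0 F \<in> ?P \<and> has_end (D0 F) b \<longleftrightarrow> (corner_colour F 0 = b) \<noteq> (corner_colour F 2 = b)"
          unfolding D0_def sorted_pair_in_pairs[OF corner_colour_range[OF F] corner_colour_range[OF F]] has_end_upair by auto
        finally show ?thesis .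
      qed
      then show ?thesis unfolding aa(1) by blast
    qed
    moreover have "{f \<in> {f \<in> ?P. has_end f b}. odd (card {F \<in> Fs. {D0 F, D1 F} = {e, f}})} = {f \<in> ?P. has_end f b \<and> odd_crossings e f}"
      by (auto simp: odd_crossings_def)
    ultimately show ?thesis using even_row[OF aa(2-4)] by simp
  qed
  have z0: "\<not> has_end f (fst e) \<and> \<not> has_end f (snd e)" if "odd_crossings e f" for e f
    using odd_crossings_disjoint[OF that] by (auto simp: has_end_def)
  let ?Cr = "{(e, f) \<in> ?P \<times> ?P. crossing e f}"
  have "even (card {(e, f) \<in> ?P \<times> ?P. crossing e f \<and> odd_crossings e f})"
    using even_crossings_rank_two[OF K, of odd_crossings A B] z0 row AB by blast
  moreover have "{(e, f) \<in> ?P \<times> ?P. crossing e f \<and> odd_crossings e f} = {s \<in> ?Cr. odd (card {F \<in> Fs. {D0 F, D1 F} = {fst s, snd s}})}"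
    by (auto simp: odd_crossings_def)
  moreover have "even (card {s \<in> ?Cr. odd (card {F \<in> Fs. {D0 F, D1 F} = {fst s, snd s}})}) \<longleftrightarrow>
      even (card {F \<in> Fs. \<exists>s\<in>?Cr. {D0 F, D1 F} = {fst s, snd s}})"
    using fin by (intro card_union_faces)
      (auto simp: doubleton_eq_iff crossing_def intro: finite_subset[of _ "?P \<times> ?P"])
  moreover have "{F \<in> Fs. \<exists>s\<in>?Cr. {D0 F, D1 F} = {fst s, snd s}} =
      {F \<in> Fs. crossing (D0 F) (D1 F) \<or> crossing (D1 F) (D0 F)}"
  proof -
    have "(\<exists>s\<in>?Cr. {D0 F, D1 F} = {fst s, snd s}) \<longleftrightarrow> crossing (D0 F) (D1 F) \<or> crossing (D1 F) (D0 F)" if F: "F \<in> Fs" for F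
    proof
      assume "\<exists>s\<in>?Cr. {D0 F, D1 F} = {fst s, snd s}"
      then show "crossing (D0 F) (D1 F) \<or> crossing (D1 F) (D0 F)" by (auto simp: doubleton_eq_iff)
    next
      assume cr: "crossing (D0 F) (D1 F) \<or> crossing (D1 F) (D0 F)"
      then have "fst (D0 F) < snd (D0 F)" "fst (D1 F) < snd (D1 F)" by (auto simp: crossing_def)
      then have "corner_colour F 0 \<noteq> corner_colour F 2" "corner_colour F 1 \<noteq> corner_colour F 3" by (auto simp: D0_def D1_def sorted_pair_def)
      then have "D0 F \<in> ?P" "D1 F \<in> ?P"
        unfolding D0_def D1_def sorted_pair_in_pairs[OF corner_colour_range[OF F] corner_colour_range[OF F]] by auto
      note P = this
      consider "crossing (D0 F) (D1 F)" | "crossing (D1 F) (D0 F)" using cr by blast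
      then show "\<exists>s\<in>?Cr. {D0 F, D1 F} = {fst s, snd s}"
      proof cases
        case 1
        with P show ?thesis by (intro bexI[of _ "(D0 F, D1 F)"]) simp_all
      next
        case 2
        with P show ?thesis by (intro bexI[of _ "(D1 F, D0 F)"]) (simp_all add: insert_commute)
      qed
    qed
    then show ?thesis by blast
  qed
  ultimately have "even (card {F \<in> Fs. crossing (D0 F) (D1 F) \<or> crossing (D1 F) (D0 F)})" by simp
  then show False using odd_breaks_crossing[OF odd] by blast
qed

end

section \<open>A section of the degree one line bundle on the torus\<close>

text \<open>A function on the plane which is multiplied by a phase when translated by the lattice of
  even points and vanishes precisely at the points with odd coordinates.\<close>

definition sec :: "real \<Rightarrow> real \<Rightarrow> complex" where
  "sec x y = cis (pi * \<lfloor>y / 2\<rfloor> * x) * (1 - of_real (frac (y / 2)) + of_real (frac (y / 2)) * cis (pi * x))"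

lemma cis_2pi_int: "cis (2 * pi * of_int n) = 1"
  by (metis cis_multiple_2pi Ints_of_int)

lemma sec_shift_x: "sec (x + 2 * of_int m) y = sec x y"
proof -
  have "cis (pi * of_int k * (x + 2 * of_int m)) = cis (pi * of_int k * x)" for k :: int
  proof -
    have "pi * of_int k * (x + 2 * of_int m) = pi * of_int k * x + 2 * pi * of_int (k * m)"
      by (simp add: algebra_simps)
    then show ?thesis by (simp only: cis_mult[symmetric] cis_2pi_int mult_1_right)
  qed
  from this[of "\<lfloor>y / 2\<rfloor>"] this[of 1] show ?thesis by (simp add: sec_def)
qed

lemma sec_shift_y: "sec x (y + 2 * of_int n) = cis (pi * of_int n * x) * sec x y"
proof -
  have h: "(y + 2 * of_int n) / 2 = y / 2 + of_int n" by simp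
  have "\<lfloor>(y + 2 * of_int n) / 2\<rfloor> = \<lfloor>y / 2\<rfloor> + n" "frac ((y + 2 * of_int n) / 2) = frac (y / 2)"
    unfolding h frac_def by simp_all
  moreover have "cis (pi * of_int (\<lfloor>y / 2\<rfloor> + n) * x) = cis (pi * of_int n * x) * cis (pi * of_int \<lfloor>y / 2\<rfloor> * x)"
    by (simp add: cis_mult algebra_simps)
  ultimately show ?thesis unfolding sec_def by (simp only: mult.assoc)
qed

text \<open>The second factor is a point on the chord from 1 to \<open>cis (pi * x)\<close>. It
  vanishes only in the middle of a diameter.\<close>

lemma sec_eq_0_iff: "sec x y = 0 \<longleftrightarrow> (\<exists>m n :: int. x = 2 * of_int m + 1 \<and> y = 2 * of_int n + 1)"
proof
  assume "sec x y = 0"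
  define u where "u = frac (y / 2)"
  have "1 - of_real u + of_real u * cis (pi * x) = 0" using \<open>sec x y = 0\<close> by (simp add: sec_def u_def)
  then have e: "of_real u * cis (pi * x) = of_real (u - 1)" by (simp add: algebra_simps add_eq_0_iff)
  have u: "0 \<le> u" "u < 1" by (simp_all add: u_def frac_lt_1)
  have "norm (of_real u * cis (pi * x)) = norm (complex_of_real (u - 1))" using e by simp
  then have "u = 1 - u" using u by (simp add: norm_mult del: of_real_diff)
  then have uh: "u = 1/2" by simp
  then have "cis (pi * x) = -1" using e unfolding uh by (simp add: field_simps complex_eq_iff)
  then have "cis (pi * x - pi) = 1" by (simp add: cis_divide[symmetric])
  then have "exp (\<i> * of_real (pi * x - pi)) = 1" by (simp add: cis_conv_exp)
  then obtain m :: int where "\<i> * of_real (pi * x - pi) = 2 * pi * \<i> * of_int m" by (rule exp_eq_one_int)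
  then have "\<i> * of_real (pi * x - pi) = \<i> * of_real (2 * pi * of_int m)" by simp
  then have "pi * x - pi = 2 * pi * of_int m" by (metis complex_i_not_zero mult_left_cancel of_real_eq_iff)
  then have "pi * (x - 1 - 2 * of_int m) = 0" by (simp add: algebra_simps)
  then have "x = 2 * of_int m + 1" by simp
  moreover have "y = 2 * of_int \<lfloor>y / 2\<rfloor> + 1" using uh by (simp add: u_def frac_def)
  ultimately show "\<exists>m n :: int. x = 2 * of_int m + 1 \<and> y = 2 * of_int n + 1" by blast
next
  assume "\<exists>m n :: int. x = 2 * of_int m + 1 \<and> y = 2 * of_int n + 1"
  then obtain m n :: int where "x = 1 + 2 * of_int m" "y = 1 + 2 * of_int n" by (auto simp: add.commute)
  then have "sec x y = cis (pi * of_int n * (1 + 2 * of_int m)) * sec 1 1" by (simp only: sec_shift_y sec_shift_x)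
  moreover have "sec 1 1 = 0" by (simp add: sec_def frac_def)
  ultimately show "sec x y = 0" by simp
qed

text \<open>\<open>G n\<close> is the formula of the \<open>n\<close>-th strip on the closed strip.
  At an even height the strip below has reached weight 1, where its factor
  \<open>cis (pi * x)\<close> accounts for the jump of the floor.\<close>

lemma continuous_sec: "continuous_on UNIV (\<lambda>p. sec (fst p) (snd p))"
proof -
  define G where "G n p = cis (pi * of_int n * fst p) * (1 - of_real (snd p / 2 - of_int n) + of_real (snd p / 2 - of_int n) * cis (pi * fst p))"
    for n :: int and p :: "real \<times> real"
  have Gc: "continuous_on S (G n)" for S n unfolding G_def by (auto intro!: continuous_intros)
  have G: "sec x y = G n (x, y)" if "2 * of_int n \<le> y" "y \<le> 2 * of_int n + 2" for n x y
  proof (cases "y = 2 * of_int n + 2")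
    case True
    then have "y / 2 = of_int (n + 1)" by simp
    then have "\<lfloor>y / 2\<rfloor> = n + 1" "frac (y / 2) = 0" by (simp_all only: floor_of_int frac_of_int)
    then have "sec x y = cis (pi * of_int (n + 1) * x)" by (simp add: sec_def)
    also have "\<dots> = cis (pi * of_int n * x) * cis (pi * x)" by (simp add: cis_mult algebra_simps)
    also have "\<dots> = G n (x, y)"
    proof -
      have h: "y / 2 - of_int n = 1" using True by (simp add: field_simps)
      show ?thesis unfolding G_def fst_conv snd_conv h by simp
    qed
    finally show ?thesis .
  next
    case False
    then have "\<lfloor>y / 2\<rfloor> = n" using that by (intro floor_unique) auto
    then show ?thesis by (simp add: sec_def G_def frac_def)
  qed
  have "continuous_on (\<Union>n::int. {p::real\<times>real. 2 * of_int n - 2 < snd p \<and> snd p < 2 * of_int n + 2}) (\<lambda>p. sec (fst p) (snd p))"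
  proof (rule continuous_on_open_UN)
    fix n :: int
    show "open {p::real\<times>real. 2 * of_int n - 2 < snd p \<and> snd p < 2 * of_int n + 2}"
      by (auto intro!: open_Collect_conj open_Collect_less continuous_intros)
    define S where "S = {p::real\<times>real. 2 * of_int n - 2 < snd p \<and> snd p < 2 * of_int n + 2}"
    have "continuous_on ({p::real\<times>real. 2 * of_int n - 2 \<le> snd p \<and> snd p \<le> 2 * of_int n} \<union> {p. 2 * of_int n \<le> snd p \<and> snd p \<le> 2 * of_int n + 2})
      (\<lambda>p. if snd p \<le> 2 * of_int n then G (n - 1) p else G n p)"
    proof (rule continuous_on_cases[OF _ _ Gc Gc])
      show "closed {p::real\<times>real. 2 * of_int n - 2 \<le> snd p \<and> snd p \<le> 2 * of_int n}"
        "closed {p::real\<times>real. 2 * of_int n \<le> snd p \<and> snd p \<le> 2 * of_int n + 2}"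
        by (auto intro!: closed_Collect_conj closed_Collect_le continuous_intros)
      show "\<forall>x::real\<times>real. x \<in> {p. 2 * of_int n - 2 \<le> snd p \<and> snd p \<le> 2 * of_int n} \<and> \<not> snd x \<le> 2 * of_int n \<or>
          x \<in> {p. 2 * of_int n \<le> snd p \<and> snd p \<le> 2 * of_int n + 2} \<and> snd x \<le> 2 * of_int n \<longrightarrow> G (n - 1) x = G n x"
      proof (intro allI impI)
        fix x :: "real \<times> real" assume "x \<in> {p. 2 * of_int n - 2 \<le> snd p \<and> snd p \<le> 2 * of_int n} \<and> \<not> snd x \<le> 2 * of_int n \<or>
          x \<in> {p. 2 * of_int n \<le> snd p \<and> snd p \<le> 2 * of_int n + 2} \<and> snd x \<le> 2 * of_int n"
        then have "snd x = 2 * of_int n" by auto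
        then show "G (n - 1) x = G n x" using G[of "n - 1" "snd x" "fst x"] G[of n "snd x" "fst x"] by (cases x) simp
      qed
    qed
    then have "continuous_on S (\<lambda>p. if snd p \<le> 2 * of_int n then G (n - 1) p else G n p)"
      by (rule continuous_on_subset) (auto simp: S_def)
    then have "continuous_on S (\<lambda>p. sec (fst p) (snd p))"
      by (rule continuous_on_eq) (auto simp: S_def G[of n] G[of "n - 1"])
    then show "continuous_on {p::real\<times>real. 2 * of_int n - 2 < snd p \<and> snd p < 2 * of_int n + 2} (\<lambda>p. sec (fst p) (snd p))"
      by (simp only: S_def)
  qed
  moreover have "(\<Union>n::int. {p::real\<times>real. 2 * of_int n - 2 < snd p \<and> snd p < 2 * of_int n + 2}) = UNIV"
  proof (intro UNIV_eq_I[symmetric])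
    fix p :: "real \<times> real"
    have "p \<in> {q::real\<times>real. 2 * of_int \<lfloor>snd p / 2\<rfloor> - 2 < snd q \<and> snd q < 2 * of_int \<lfloor>snd p / 2\<rfloor> + 2}"
      by simp linarith
    then show "p \<in> (\<Union>n::int. {p::real\<times>real. 2 * of_int n - 2 < snd p \<and> snd p < 2 * of_int n + 2})" by blast
  qed
  ultimately show ?thesis by simp
qed

lemma continuous_on_sec:
  assumes "continuous_on S a" "continuous_on S b" shows "continuous_on S (\<lambda>z. sec (a z) (b z))"
  using continuous_on_compose2[OF continuous_sec continuous_on_Pair[OF assms]] by simp

text \<open>On the open square the value is 1 plus a vector whose direction depends on
  \<open>x\<close> alone and whose length is \<open>y * sin (x * pi / 2)\<close>. Polar coordinates
  recover first \<open>x\<close> and then \<open>y\<close>.\<close>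

lemma inj_sec:
  assumes "0 < x" "x < 2" "0 < y" "y < 2" "0 < x'" "x' < 2" "0 < y'" "y' < 2" "sec x y = sec x' y'"
  shows "x = x' \<and> y = y'"
proof -
  have s: "sec u v = 1 + of_real (v * sin (u * pi / 2)) * cis (u * pi / 2) * \<i>" if "0 < v" "v < 2" for u v
  proof -
    have "\<lfloor>v / 2\<rfloor> = 0" using that by (intro floor_unique) auto
    then have "sec u v = 1 - of_real (v / 2) + of_real (v / 2) * cis (pi * u)" by (simp add: sec_def frac_def)
    then have "sec u v = 1 + of_real (v / 2) * (cis (pi * u) - 1)" by (simp only: right_diff_distrib) simp
    moreover have "cis (pi * u) - 1 = 2 * \<i> * sin (u * pi / 2) * cis (u * pi / 2)"
      using sin_double[of "u * pi / 2"] cos_double_sin[of "u * pi / 2"]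
      by (simp add: complex_eq_iff power2_eq_square mult_ac)
    ultimately show ?thesis by simp
  qed
  have p: "sin (u * pi / 2) > 0" if "0 < u" "u < 2" for u using that by (intro sin_gt_zero) auto
  have e: "of_real (y * sin (x * pi / 2)) * cis (x * pi / 2) = of_real (y' * sin (x' * pi / 2)) * cis (x' * pi / 2)"
    using assms(9) s[of y x] s[of y' x'] assms by simp
  note pu = polar_unique[OF e]
  have "x = x'" "y * sin (x * pi / 2) = y' * sin (x' * pi / 2)" using pu p[of x] p[of x'] assms by auto
  then show ?thesis using p[of x] assms by auto
qed

section \<open>The winding number along the boundary of the polygon\<close>

text \<open>The function \<open>b\<close> gains \<open>4 * n k\<close> on the two copies of arc
  \<open>k\<close> and must return to its value, whence the sum is 0. The transformation law of
  \<open>sec\<close> compares the logarithms on the two copies; per crosscap this leaves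
  \<open>n k * m k\<close> modulo 2 and a multiple of \<open>a 1\<close>, and the latter terms
  cancel because the \<open>n k\<close> sum to 0.\<close>

lemma boundary_winding_parity:
  fixes a b :: "complex \<Rightarrow> real" and m n :: "nat \<Rightarrow> int"
  assumes g: "1 \<le> g" and ca: "continuous_on (sphere 0 1) a" and cb: "continuous_on (sphere 0 1) b"
    and ma: "\<And>k t. k < g \<Longrightarrow> 2 * real k * pi / real g \<le> t \<Longrightarrow> t \<le> (2 * real k + 1) * pi / real g \<Longrightarrow>
       a (cis (t + pi / real g)) = a (cis t) + 2 * of_int (m k)"
    and nb: "\<And>k t. k < g \<Longrightarrow> 2 * real k * pi / real g \<le> t \<Longrightarrow> t \<le> (2 * real k + 1) * pi / real g \<Longrightarrow>
       b (cis (t + pi / real g)) = b (cis t) + 2 * of_int (n k)"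
  shows "(\<Sum>k<g. n k) = 0"
    and "\<And>\<Lambda>. continuous_on {0..2*pi} \<Lambda> \<Longrightarrow> (\<And>t. t \<in> {0..2*pi} \<Longrightarrow> exp (\<Lambda> t) = sec (a (cis t)) (b (cis t))) \<Longrightarrow>
      \<exists>j::int. \<Lambda> (2*pi) - \<Lambda> 0 = 2 * pi * \<i> * of_int j \<and> (even j \<longleftrightarrow> even (\<Sum>k<g. m k * n k))"
proof -
  define \<tau> where "\<tau> j = j * pi / real g" for j :: real
  have \<tau>1: "\<tau> (j + 1) = \<tau> j + pi / real g" for j by (simp add: \<tau>_def add_divide_distrib distrib_right)
  have \<tau>2: "\<tau> (2 * real k + 2) = \<tau> (2 * real k + 1) + pi / real g" for k
    using \<tau>1[of "2 * real k + 1"] by (simp add: add.assoc)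
  have \<tau>S: "\<tau> (2 * real (Suc k)) = \<tau> (2 * real k + 2)" for k by (rule arg_cong[of _ _ \<tau>]) simp
  have step: "f (cis (\<tau> (2 * real k + 1))) = f (cis (\<tau> (2 * real k))) + 2 * of_int (r k) \<and>
      f (cis (\<tau> (2 * real k + 2))) = f (cis (\<tau> (2 * real k))) + 4 * of_int (r k)"
    if k: "k < g" and f: "\<And>k t. k < g \<Longrightarrow> 2 * real k * pi / real g \<le> t \<Longrightarrow> t \<le> (2 * real k + 1) * pi / real g \<Longrightarrow>
       f (cis (t + pi / real g)) = f (cis t) + 2 * of_int (r k)" for k and f :: "complex \<Rightarrow> real" and r :: "nat \<Rightarrow> int"
  proof -
    have le: "2 * real k * pi / real g \<le> (2 * real k + 1) * pi / real g" using g by (simp add: divide_right_mono)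
    have e1: "\<tau> (2 * real k + 1) = \<tau> (2 * real k) + pi / real g" by (rule \<tau>1)
    have e2: "\<tau> (2 * real k + 2) = \<tau> (2 * real k + 1) + pi / real g" by (rule \<tau>2)
    have "f (cis (\<tau> (2 * real k) + pi / real g)) = f (cis (\<tau> (2 * real k))) + 2 * of_int (r k)"
      by (rule f[OF k]) (use le in \<open>auto simp: \<tau>_def\<close>)
    moreover have "f (cis (\<tau> (2 * real k + 1) + pi / real g)) = f (cis (\<tau> (2 * real k + 1))) + 2 * of_int (r k)"
      by (rule f[OF k]) (use le in \<open>auto simp: \<tau>_def\<close>)
    ultimately show ?thesis unfolding e2 unfolding e1 by simp
  qed
  have acc: "f (cis (\<tau> (2 * real k))) = f 1 + 4 * of_int (\<Sum>i<k. r i)"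
    if k: "k \<le> g" and f: "\<And>k t. k < g \<Longrightarrow> 2 * real k * pi / real g \<le> t \<Longrightarrow> t \<le> (2 * real k + 1) * pi / real g \<Longrightarrow>
       f (cis (t + pi / real g)) = f (cis t) + 2 * of_int (r k)" for k and f :: "complex \<Rightarrow> real" and r :: "nat \<Rightarrow> int"
    using k
  proof (induction k)
    case 0 then show ?case by (simp add: \<tau>_def)
  next
    case (Suc k)
    show ?case unfolding \<tau>S using Suc step[of k f r, OF _ f] by simp
  qed
  have \<tau>g: "\<tau> (2 * real g) = 2 * pi" using g by (simp add: \<tau>_def)
  have "b 1 = b 1 + 4 * of_int (\<Sum>k<g. n k)" using acc[of g b n, OF _ nb] unfolding \<tau>g by simp
  then show sn: "(\<Sum>k<g. n k) = 0" by (simp del: of_int_sum)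
  fix \<Lambda> assume cL: "continuous_on {0..2*pi} \<Lambda>" and L: "\<And>t. t \<in> {0..2*pi} \<Longrightarrow> exp (\<Lambda> t) = sec (a (cis t)) (b (cis t))"
  define M where "M k = (\<Sum>i<k. m i)" for k
  have piece: "\<exists>j::int. \<Lambda> (\<tau> (2 * real k + 2)) - \<Lambda> (\<tau> (2 * real k)) =
      2 * pi * \<i> * of_int (2 * j + 4 * n k * M k + n k * m k) + 2 * pi * \<i> * of_int (n k) * of_real (a 1)" if k: "k < g" for k
  proof -
    define I where "I = {\<tau> (2 * real k)..\<tau> (2 * real k + 1)}"
    have e1: "\<tau> (2 * real k + 1) = \<tau> (2 * real k) + pi / real g" by (rule \<tau>1)
    have e2: "\<tau> (2 * real k + 2) = \<tau> (2 * real k + 1) + pi / real g" by (rule \<tau>2)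
    have pg: "pi / real g > 0" using g by simp
    have "real k + 1 \<le> real g" using k by simp
    then have "(2 * real k + 2) * pi \<le> 2 * real g * pi" by (intro mult_right_mono) auto
    then have top: "\<tau> (2 * real k + 2) \<le> 2 * pi" using g by (simp add: \<tau>_def field_simps)
    have bot: "0 \<le> \<tau> (2 * real k)" using g by (simp add: \<tau>_def)
    \<comment> \<open>The defect of the transformation law on the level of logarithms. Its
      exponential is 1, so it is constant on the arc and the same integer \<open>j\<close> appears
      at both ends.\<close>
    define f where "f t = \<Lambda> (t + pi / real g) - \<Lambda> t - \<i> * of_real (pi * of_int (n k) * a (cis t))" for t
    have r: "t \<in> {0..2*pi}" "t + pi / real g \<in> {0..2*pi}" if "t \<in> I" for t
      using that top bot pg unfolding I_def e2 e1 by auto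
    have cf: "continuous_on I f"
      unfolding f_def using r
      by (intro continuous_intros continuous_on_compose2[OF cL] continuous_on_compose2[OF ca]) auto
    have ef: "exp (f t) = 1" if t: "t \<in> I" for t
    proof -
      have sees_at: "2 * real k * pi / real g \<le> t" "t \<le> (2 * real k + 1) * pi / real g" using t by (auto simp: I_def \<tau>_def)
      have "exp (\<Lambda> (t + pi / real g)) = sec (a (cis t) + 2 * of_int (m k)) (b (cis t) + 2 * of_int (n k))"
        using L[OF r(2)[OF t]] ma[OF k sees_at] nb[OF k sees_at] by simp
      also have "\<dots> = cis (pi * of_int (n k) * a (cis t)) * exp (\<Lambda> t)"
        unfolding sec_shift_x unfolding sec_shift_y L[OF r(1)[OF t]] ..
      finally have "exp (\<Lambda> (t + pi / real g)) = exp (\<i> * of_real (pi * of_int (n k) * a (cis t))) * exp (\<Lambda> t)"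
        by (simp only: cis_conv_exp)
      then show ?thesis by (simp add: f_def exp_diff del: of_real_mult)
    qed
    have I: "\<tau> (2 * real k) \<in> I" "\<tau> (2 * real k + 1) \<in> I" using pg by (auto simp: I_def e1)
    have f0: "f (\<tau> (2 * real k + 1)) = f (\<tau> (2 * real k))"
      using exp_eq_one_const[OF _ cf ef I(2,1)] by (simp add: I_def)
    obtain j :: int where j: "f (\<tau> (2 * real k)) = 2 * pi * \<i> * of_int j"
      using ef[OF I(1)] by (rule exp_eq_one_int)
    have av: "a (cis (\<tau> (2 * real k))) = a 1 + 4 * of_int (M k)"
      "a (cis (\<tau> (2 * real k + 1))) = a (cis (\<tau> (2 * real k))) + 2 * of_int (m k)"
      using acc[of k a m, OF _ ma] k step[of k a m, OF k ma] by (simp_all add: M_def)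
    have f1: "\<Lambda> (\<tau> (2 * real k + 1)) - \<Lambda> (\<tau> (2 * real k)) = 2 * pi * \<i> * of_int j + \<i> * of_real (pi * of_int (n k) * a (cis (\<tau> (2 * real k))))"
      using j unfolding f_def e1[symmetric] by (simp add: algebra_simps)
    have f2: "\<Lambda> (\<tau> (2 * real k + 2)) - \<Lambda> (\<tau> (2 * real k + 1)) = 2 * pi * \<i> * of_int j + \<i> * of_real (pi * of_int (n k) * a (cis (\<tau> (2 * real k + 1))))"
      using j f0
      unfolding f_def[of "\<tau> (2 * real k + 1)"] e2[symmetric] by (simp add: algebra_simps)
    have "\<Lambda> (\<tau> (2 * real k + 2)) - \<Lambda> (\<tau> (2 * real k)) = (\<Lambda> (\<tau> (2 * real k + 2)) - \<Lambda> (\<tau> (2 * real k + 1))) + (\<Lambda> (\<tau> (2 * real k + 1)) - \<Lambda> (\<tau> (2 * real k)))"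
      by simp
    \<comment> \<open>The integer \<open>j\<close> enters twice, hence evenly, and the two values of
      \<open>a\<close> add up to \<open>2 * a 1 + 8 * M k + 2 * m k\<close>.\<close>
    also have "\<dots> = 2 * pi * \<i> * of_int (2 * j + 4 * n k * M k + n k * m k) + 2 * pi * \<i> * of_int (n k) * of_real (a 1)"
      unfolding f1 f2 av by (simp add: algebra_simps)
    finally show ?thesis by blast
  qed
  then obtain j where j: "\<And>k. k < g \<Longrightarrow> \<Lambda> (\<tau> (2 * real k + 2)) - \<Lambda> (\<tau> (2 * real k)) =
      2 * pi * \<i> * of_int (2 * j k + 4 * n k * M k + n k * m k) + 2 * pi * \<i> * of_int (n k) * of_real (a 1)" by metis
  have "\<Lambda> (\<tau> (2 * real k)) - \<Lambda> 0 = 2 * pi * \<i> * of_int (\<Sum>i<k. 2 * j i + 4 * n i * M i + n i * m i) + 2 * pi * \<i> * of_int (\<Sum>i<k. n i) * of_real (a 1)"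
    if "k \<le> g" for k
    using that
  proof (induction k)
    case 0 then show ?case by (simp add: \<tau>_def)
  next
    case (Suc k)
    have "\<Lambda> (\<tau> (2 * real (Suc k))) - \<Lambda> 0 = (\<Lambda> (\<tau> (2 * real k + 2)) - \<Lambda> (\<tau> (2 * real k))) + (\<Lambda> (\<tau> (2 * real k)) - \<Lambda> 0)" unfolding \<tau>S by simp
    then show ?case using Suc j[of k] by (simp add: algebra_simps)
  qed
  from this[of g] have "\<Lambda> (2 * pi) - \<Lambda> 0 = 2 * pi * \<i> * of_int (\<Sum>i<g. 2 * j i + 4 * n i * M i + n i * m i)"
    unfolding \<tau>g sn by simp
  moreover have "even (\<Sum>i<g. 2 * j i + 4 * n i * M i + n i * m i) \<longleftrightarrow> even (\<Sum>k<g. m k * n k)"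
    by (simp add: sum.distrib sum_distrib_left[symmetric] mult.assoc mult.commute[of "n _"])
  ultimately show "\<exists>j::int. \<Lambda> (2*pi) - \<Lambda> 0 = 2 * pi * \<i> * of_int j \<and> (even j \<longleftrightarrow> even (\<Sum>k<g. m k * n k))" by blast
qed

section \<open>The polygonal model\<close>

locale crosscap_model =
  fixes X :: "'a topology" and g :: nat and q :: "complex \<Rightarrow> 'a"
  assumes g: "1 \<le> g" and surface: "closed_surface X"
    and quot: "quotient_map (top_of_set (cball 0 1)) X q"
    and fibres: "\<And>x y. x \<in> cball 0 1 \<Longrightarrow> y \<in> cball 0 1 \<Longrightarrow>
      q x = q y \<longleftrightarrow> (x, y) \<in> (crosscap_gluing g \<union> (crosscap_gluing g)\<inverse>)\<^sup>*"
begin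

lemma gluing_sphere: "(x, y) \<in> crosscap_gluing g \<union> (crosscap_gluing g)\<inverse> \<Longrightarrow> norm x = 1 \<and> norm y = 1"
  by (auto simp: crosscap_gluing_def)

text \<open>The gluing relates points of the unit circle only, so no proper chain of identifications
  starts in the open disc.\<close>

lemma q_eq_ball:
  assumes "x \<in> ball 0 1" "y \<in> cball 0 1" "q x = q y" shows "x = y"
proof -
  have "(x, y) \<in> (crosscap_gluing g \<union> (crosscap_gluing g)\<inverse>)\<^sup>*" using fibres[of x y] assms by simp
  then show ?thesis
  proof (cases rule: converse_rtranclE)
    case (step z)
    then show ?thesis using gluing_sphere[of x z] assms(1) by simp
  qed simp
qed

lemma inj_q_ball: "inj_on q (ball 0 1)"
  using q_eq_ball by (auto intro!: inj_onI)

lemma q_cont: "continuous_map (top_of_set (cball 0 1)) X q"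
  using quot quotient_imp_continuous_map by blast

lemma q_surj: "q ` cball 0 1 = topspace X"
  using quotient_imp_surjective_map[OF quot] by simp

text \<open>A subset of the open disc is saturated, so a quotient map preserves its
  openness.\<close>

lemma openin_q_image:
  assumes "open U" "U \<subseteq> ball 0 1" shows "openin X (q ` U)"
proof -
  have "{x \<in> cball 0 1. q x \<in> q ` U} = U"
  proof
    show "{x \<in> cball 0 1. q x \<in> q ` U} \<subseteq> U"
    proof
      fix x assume "x \<in> {x \<in> cball 0 1. q x \<in> q ` U}"
      then obtain u where "x \<in> cball 0 1" "u \<in> U" "q u = q x" by auto
      then show "x \<in> U" using q_eq_ball[of u x] subsetD[OF assms(2)] by metis
    qed
    show "U \<subseteq> {x \<in> cball 0 1. q x \<in> q ` U}" using assms(2) by force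
  qed
  moreover have "openin (top_of_set (cball 0 1)) U"
    by (rule open_subset[OF subset_trans[OF assms(2) ball_subset_cball] assms(1)])
  moreover have "q ` U \<subseteq> topspace X" using assms(2) q_surj ball_subset_cball by blast
  moreover from this have "openin (top_of_set (cball 0 1)) {x \<in> topspace (top_of_set (cball 0 1)). q x \<in> q ` U} = openin X (q ` U)"
    using quot unfolding quotient_map_def by blast
  ultimately show ?thesis by (simp only: topspace_euclidean_subtopology)
qed

lemma q_glue:
  assumes "k < g" "2 * real k * pi / real g \<le> t" "t \<le> (2 * real k + 1) * pi / real g"
  shows "q (cis (t + pi / real g)) = q (cis t)"
proof -
  have "(cis t, cis (t + pi / real g)) \<in> crosscap_gluing g" using assms by (auto simp: crosscap_gluing_def)
  then have "(cis t, cis (t + pi / real g)) \<in> (crosscap_gluing g \<union> (crosscap_gluing g)\<inverse>)\<^sup>*" by blast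
  then have "q (cis t) = q (cis (t + pi / real g))" using fibres[of "cis t" "cis (t + pi / real g)"] by simp
  then show ?thesis by simp
qed

lemma open_meets_ball:
  assumes "openin X N" "x \<in> N"
  obtains z U where "open U" "z \<in> U" "U \<subseteq> ball 0 1" "q ` U \<subseteq> N"
proof -
  have "x \<in> topspace X" using assms openin_subset by blast
  then obtain w where w: "w \<in> cball 0 1" "q w = x" unfolding q_surj[symmetric] by blast
  define P where "P = {z \<in> cball 0 1. q z \<in> N}"
  have "openin (top_of_set (cball 0 1)) P"
    using openin_continuous_map_preimage[OF q_cont assms(1)] by (simp add: P_def)
  then obtain T where T: "open T" "P = cball 0 1 \<inter> T" by (auto simp: openin_open)
  have "w \<in> T" using w assms(2) T(2) by (auto simp: P_def)
  moreover have "w \<in> closure (ball 0 1)" using w(1) by (simp add: closure_ball)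
  ultimately have "T \<inter> ball 0 1 \<noteq> {}" using open_Int_closure_eq_empty[OF T(1), of "ball 0 1"] by blast
  then obtain z where "z \<in> T \<inter> ball 0 1" by blast
  moreover have "open (T \<inter> ball 0 1)" using T(1) by blast
  moreover have "q ` (T \<inter> ball 0 1) \<subseteq> N" using T(2) ball_subset_cball unfolding P_def by blast
  ultimately show ?thesis using that[of "T \<inter> ball 0 1" z] by blast
qed

lemma finite_not_open:
  assumes "openin X N" "finite N" shows "N = {}"
proof (rule ccontr)
  assume "N \<noteq> {}"
  then obtain x where "x \<in> N" by blast
  obtain z U where U: "open U" "z \<in> U" "U \<subseteq> ball 0 1" "q ` U \<subseteq> N"
    using open_meets_ball[OF assms(1) \<open>x \<in> N\<close>] .
  have "finite (q ` U)" using U(4) assms(2) finite_subset by blast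
  then have "finite U" using inj_on_subset[OF inj_q_ball U(3)] finite_imageD by blast
  then show False using U(1,2) by (metis empty_iff finite_imp_not_open)
qed

text \<open>On the disc the map has a logarithm. At glued points its two values differ by an even
  integer, and by connectedness this integer is constant along an arc.\<close>

lemma circle_lift:
  assumes "continuous_map X euclidean \<alpha>" "\<And>x. x \<in> topspace X \<Longrightarrow> norm (\<alpha> x) = 1"
  obtains a :: "complex \<Rightarrow> real" and m :: "nat \<Rightarrow> int" where "continuous_on (cball 0 1) a"
    "\<And>z. z \<in> cball 0 1 \<Longrightarrow> \<alpha> (q z) = cis (pi * a z)"
    "\<And>k t. k < g \<Longrightarrow> 2 * real k * pi / real g \<le> t \<Longrightarrow> t \<le> (2 * real k + 1) * pi / real g \<Longrightarrow>
       a (cis (t + pi / real g)) = a (cis t) + 2 * of_int (m k)"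
proof -
  have "continuous_on (cball 0 1) (\<alpha> \<circ> q)" using continuous_map_compose[OF q_cont assms(1)] by simp
  moreover have n1: "norm (\<alpha> (q z)) = 1" if "z \<in> cball 0 1" for z using assms(2) q_surj that by blast
  then have "(\<alpha> \<circ> q) z \<noteq> 0" if "z \<in> cball 0 1" for z using that by fastforce
  ultimately obtain h where h: "continuous_on (cball 0 1) h" "\<And>z. z \<in> cball 0 1 \<Longrightarrow> (\<alpha> \<circ> q) z = exp (h z)"
    using continuous_logarithm_on_cball by metis
  define a where "a z = Im (h z) / pi" for z
  have ca: "continuous_on (cball 0 1) a" unfolding a_def using h(1) by (auto intro!: continuous_intros)
  have eq: "\<alpha> (q z) = cis (pi * a z)" if "z \<in> cball 0 1" for z
  proof -
    have "norm (exp (h z)) = 1" using n1[OF that] h(2)[OF that] by simp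
    then have "Re (h z) = 0" by simp
    then show ?thesis using h(2)[OF that] by (simp add: a_def exp_eq_polar)
  qed
  have "\<exists>m::int. \<forall>t. 2 * real k * pi / real g \<le> t \<longrightarrow> t \<le> (2 * real k + 1) * pi / real g \<longrightarrow>
       a (cis (t + pi / real g)) = a (cis t) + 2 * of_int m" if k: "k < g" for k
  proof -
    define I where "I = {2 * real k * pi / real g..(2 * real k + 1) * pi / real g}"
    define f where "f t = \<i> * of_real (pi * (a (cis (t + pi / real g)) - a (cis t)))" for t
    have cf: "continuous_on I f" unfolding f_def
      by (intro continuous_intros continuous_on_compose2[OF ca]) auto
    have ef: "exp (f t) = 1" if "t \<in> I" for t
    proof -
      have "cis (pi * a (cis (t + pi / real g))) = cis (pi * a (cis t))"
        using eq[of "cis (t + pi / real g)"] eq[of "cis t"] q_glue[OF k, of t] that by (simp add: I_def)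
      moreover have "exp (f t) = cis (pi * a (cis (t + pi / real g))) / cis (pi * a (cis t))"
        unfolding f_def cis_conv_exp exp_diff[symmetric] by (simp add: algebra_simps)
      ultimately show ?thesis by simp
    qed
    have s: "2 * real k * pi / real g \<in> I" using g by (simp add: I_def divide_right_mono)
    obtain m :: int where m: "f (2 * real k * pi / real g) = 2 * pi * \<i> * of_int m"
      using ef[OF s] by (rule exp_eq_one_int)
    have "a (cis (t + pi / real g)) = a (cis t) + 2 * of_int m" if "t \<in> I" for t
    proof -
      have "f t = 2 * pi * \<i> * of_int m"
        using exp_eq_one_const[OF _ cf ef that s] m by (simp add: I_def)
      then have "Im (f t) = Im (2 * pi * \<i> * of_int m)" by simp
      then have "pi * (a (cis (t + pi / real g)) - a (cis t)) = pi * (2 * of_int m)" by (simp add: f_def)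
      then show ?thesis by simp
    qed
    then show ?thesis by (intro exI[of _ m]) (simp add: I_def)
  qed
  then obtain m where "\<And>k t. k < g \<Longrightarrow> 2 * real k * pi / real g \<le> t \<Longrightarrow> t \<le> (2 * real k + 1) * pi / real g \<Longrightarrow>
       a (cis (t + pi / real g)) = a (cis t) + 2 * of_int (m k :: int)" by metis
  then show ?thesis using that ca eq by blast
qed

end

section \<open>Recentring faces\<close>

text \<open>Moves 0 to \<open>w\<close> and fixes the unit circle. Injectivity holds because the
  displacement is a contraction, as \<open>norm w < 1\<close>. The image of the open disc is open by
  invariance of domain and relatively closed, hence everything.\<close>

lemma disc_recentre:
  assumes w: "w \<in> ball (0::complex) 1"
  defines "f \<equiv> \<lambda>z. z + of_real (1 - norm z) * w"
  shows "continuous_on S f" "inj_on f S" "f ` ball 0 1 = ball 0 1" "f ` cball 0 1 \<subseteq> cball 0 1"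
proof -
  show c: "continuous_on S f" for S unfolding f_def by (intro continuous_intros)
  show inj: "inj_on f S" for S
  proof (rule inj_onI)
    fix x y assume "f x = f y"
    then have "x - y = of_real (norm x - norm y) * w" by (simp add: f_def algebra_simps)
    then have "norm (x - y) = \<bar>norm x - norm y\<bar> * norm w" by (simp add: norm_mult del: of_real_diff)
    also have "\<dots> \<le> norm (x - y) * norm w" by (intro mult_right_mono norm_triangle_ineq3) simp
    finally have "norm (x - y) * (1 - norm w) \<le> 0" by (simp add: algebra_simps)
    moreover have "1 - norm w > 0" using w by simp
    ultimately have "norm (x - y) \<le> 0" by (simp add: mult_le_0_iff)
    then show "x = y" by simp
  qed
  have b: "f z \<in> ball 0 1" if "z \<in> ball 0 1" for z
  proof -
    have "norm (f z) \<le> norm z + (1 - norm z) * norm w"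
      unfolding f_def using that by (intro order_trans[OF norm_triangle_ineq]) (simp add: norm_mult del: of_real_diff)
    also have "\<dots> < norm z + (1 - norm z) * 1"
      using that w by (intro add_strict_left_mono mult_strict_left_mono) auto
    finally show ?thesis by simp
  qed
  have s: "f z = z" if "norm z = 1" for z using that by (simp add: f_def)
  show cb: "f ` cball 0 1 \<subseteq> cball 0 1"
  proof (rule image_subsetI)
    fix z :: complex assume "z \<in> cball 0 1"
    then show "f z \<in> cball 0 1" using b[of z] s[of z] by (cases "norm z = 1") auto
  qed
  have op: "open (f ` ball 0 1)" by (rule invariance_of_domain[OF c _ inj]) simp
  have "f ` ball 0 1 = ball 0 1 \<inter> f ` cball 0 1"
  proof
    show "f ` ball 0 1 \<subseteq> ball 0 1 \<inter> f ` cball 0 1" using b by auto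
    show "ball 0 1 \<inter> f ` cball 0 1 \<subseteq> f ` ball 0 1"
    proof
      fix y assume "y \<in> ball 0 1 \<inter> f ` cball 0 1"
      then obtain z where z: "z \<in> cball 0 1" "y = f z" "norm y < 1" by auto
      then have "norm z \<noteq> 1" using s by auto
      then show "y \<in> f ` ball 0 1" using z by auto
    qed
  qed
  moreover have "closed (f ` cball 0 1)" by (intro compact_imp_closed compact_continuous_image c compact_cball)
  ultimately have "closedin (top_of_set (ball 0 1)) (f ` ball 0 1)" by (metis closedin_closed_Int)
  moreover have "openin (top_of_set (ball 0 1)) (f ` ball 0 1)" using op b by (auto intro: open_subset)
  moreover have "connected (ball (0::complex) 1)" by simp
  ultimately have "f ` ball 0 1 = {} \<or> f ` ball 0 1 = ball 0 1" using connected_clopen by blast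
  then show "f ` ball 0 1 = ball 0 1" by auto
qed

context oriented_quadrangulation
begin

text \<open>The zeros will sit at the centres of faces. Recentring moves such a centre away from the
  image of the polygon boundary without disturbing the boundary walk.\<close>

lemma face_param_recentre:
  assumes F: "F \<in> Fs" and h: "face_param F h" and y: "y \<in> F"
  obtains h' where "face_param F h'" "h' 0 = y"
proof -
  obtain w where w: "w \<in> ball 0 1" "y = h w" using param_ball(1)[OF F h] y by blast
  define f where "f = (\<lambda>z. z + of_real (1 - norm z) * w)"
  note f = disc_recentre[OF w(1), folded f_def]
  have s: "f z = z" if "norm z = 1" for z using that by (simp add: f_def)
  have fb: "norm (f z) < 1" if "norm z < 1" for z using f(3) that by (metis image_eqI mem_ball_0)
  obtain k where "homeomorphism (ball 0 1) (f ` ball 0 1) f k"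
    using invariance_of_domain_homeomorphism[OF open_ball f(1) _ f(2)] by auto
  then have "homeomorphic_map (top_of_set (ball 0 1)) (top_of_set (ball 0 1)) f"
    unfolding f(3) homeomorphic_map_maps homeomorphic_maps_def homeomorphism_def
    by (intro exI[of _ k]) (auto simp: image_subset_iff_funcset[symmetric] fb)
  then have hm: "homeomorphic_map (top_of_set (ball 0 1)) (subtopology X F) (h \<circ> f)"
    using h homeomorphic_map_compose unfolding face_param_def by blast
  have "continuous_map (top_of_set (cball 0 1)) X (\<lambda>z. h (f z))"
    by (rule continuous_map_compose_on[OF param_cont[OF F h] f(1) f(4)])
  then have c: "continuous_map (top_of_set (cball 0 1)) X (h \<circ> f)" by (simp add: comp_def)
  have qf: "f z = z" if "z \<in> quarter_circle i" for z i using s quarter_circle_subset_sphere that by fastforce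
  have "inj_on (h \<circ> f) (quarter_circle i)" "(h \<circ> f) ` quarter_circle i = h ` quarter_circle i"
    if "inj_on h (quarter_circle i)" for i using that qf by (auto simp: inj_on_def image_def)
  then have "face_param F (h \<circ> f)"
    using h hm c s unfolding face_param_def by auto
  moreover have "(h \<circ> f) 0 = y" using w(2) by (simp add: f_def)
  ultimately show ?thesis using that by blast
qed

end

section \<open>Circle-valued maps from colour pairs\<close>

lemma sgn_mem_sphere: "z \<noteq> 0 \<Longrightarrow> sgn z \<in> sphere (0::complex) 1"
  by (simp add: norm_sgn)

text \<open>Away from the centre this is a composition; at the centre it follows from the
  boundedness of \<open>G\<close>.\<close>

lemma cone_continuous:
  fixes G :: "complex \<Rightarrow> real"
  assumes "continuous_on (sphere 0 1) G"
  shows "continuous_on (cball 0 1) (\<lambda>w. norm w * G (sgn w))"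
proof -
  obtain B where B: "B > 0" "\<And>z. z \<in> sphere 0 1 \<Longrightarrow> norm (G z) \<le> B"
    using compact_imp_bounded[OF compact_continuous_image[OF assms compact_sphere]] bounded_pos
    by (metis imageI)
  have "continuous (at w within cball 0 1) (\<lambda>w. norm w * G (sgn w))" for w
  proof (cases "w = 0")
    case True
    have "((\<lambda>w. norm w * G (sgn w)) \<longlongrightarrow> 0) (at 0 within cball 0 1)"
    proof (rule Lim_null_comparison[of _ "\<lambda>w. norm w * B"])
      have "norm (norm x * G (sgn x)) \<le> norm x * B" for x :: complex
      proof (cases "x = 0")
        case False
        then show ?thesis using B(2)[OF sgn_mem_sphere[OF False]] by (simp add: abs_mult mult_left_mono)
      qed simp
      then show "\<forall>\<^sub>F x in at 0 within cball 0 1. norm (norm x * G (sgn x)) \<le> norm x * B" by simp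
      have "((\<lambda>x::complex. norm x * B) \<longlongrightarrow> norm (0::complex) * B) (at 0 within cball 0 1)"
        by (rule tendsto_mult[OF tendsto_norm[OF tendsto_ident_at] tendsto_const])
      then show "((\<lambda>x::complex. norm x * B) \<longlongrightarrow> 0) (at 0 within cball 0 1)" by simp
    qed
    then show ?thesis using True by (simp add: continuous_within)
  next
    case False
    have "continuous_on (- {0}) (\<lambda>w. G (sgn w))"
      by (rule continuous_on_compose2[OF assms]) (auto intro!: continuous_intros simp: norm_sgn split: if_splits)
    then have "continuous_on (- {0}) (\<lambda>w. norm w * G (sgn w))" by (intro continuous_intros)
    then have "continuous (at w) (\<lambda>w. norm w * G (sgn w))"
      by (rule continuous_on_interior) (use False in \<open>simp add: interior_open open_Compl\<close>)
    then show ?thesis by (rule continuous_at_imp_continuous_at_within)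
  qed
  then show ?thesis by (simp add: continuous_on_eq_continuous_within)
qed

lemma cis_pi_eq_iff: "cis (pi * x) = cis (pi * y) \<longleftrightarrow> (\<exists>n::int. x = y + 2 * of_int n)"
proof
  assume "cis (pi * x) = cis (pi * y)"
  then have "exp (\<i> * of_real (pi * x) - \<i> * of_real (pi * y)) = 1" by (simp add: cis_conv_exp exp_diff del: of_real_mult)
  then obtain n :: int where "\<i> * of_real (pi * x) - \<i> * of_real (pi * y) = 2 * pi * \<i> * of_int n"
    by (rule exp_eq_one_int)
  then have "Im (\<i> * of_real (pi * x) - \<i> * of_real (pi * y)) = Im (2 * pi * \<i> * of_int n)" by simp
  then have "pi * x = pi * (y + 2 * of_int n)" by (simp add: algebra_simps)
  then show "\<exists>n::int. x = y + 2 * of_int n" by auto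
next
  assume "\<exists>n::int. x = y + 2 * of_int n"
  then obtain n :: int where n: "x = y + 2 * of_int n" by blast
  have "cis (pi * x) = cis (pi * y) * cis (2 * pi * of_int n)" unfolding n cis_mult by (simp add: algebra_simps)
  then show "cis (pi * x) = cis (pi * y)" by (simp only: cis_2pi_int mult_1_right)
qed

definition odd_real :: "real \<Rightarrow> bool" where "odd_real x \<longleftrightarrow> (\<exists>n::int. x = 2 * of_int n + 1)"

lemma odd_real_iff_cis: "odd_real x \<longleftrightarrow> cis (pi * x) = - 1"
proof -
  have "cis (pi * x) = - 1 \<longleftrightarrow> cis (pi * x) = cis (pi * 1)" by simp
  also have "\<dots> \<longleftrightarrow> odd_real x" unfolding cis_pi_eq_iff odd_real_def by (simp add: add.commute)
  finally show ?thesis ..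
qed

section \<open>Coordinates along the edges\<close>

context oriented_quadrangulation
begin

definition edge_path :: "'a set \<Rightarrow> real \<Rightarrow> 'a" where
  "edge_path e = (SOME p. pathin X p \<and> inj_on p {0..1} \<and> e = p ` {0..1} \<and> e \<inter> V = {p 0, p 1})"

lemma edge_path:
  assumes "e \<in> E"
  shows "pathin X (edge_path e)" "inj_on (edge_path e) {0..1}" "e = edge_path e ` {0..1}" "e \<inter> V = {edge_path e 0, edge_path e 1}"
proof -
  have "\<exists>p. pathin X p \<and> inj_on p {0..1} \<and> e = p ` {0..1} \<and> e \<inter> V = {p 0, p 1}"
    using edge_arc[OF assms] by metis
  from someI_ex[OF this, folded edge_path_def]
  show "pathin X (edge_path e)" "inj_on (edge_path e) {0..1}" "e = edge_path e ` {0..1}" "e \<inter> V = {edge_path e 0, edge_path e 1}" by auto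
qed

definition pos :: "'a set \<Rightarrow> 'a \<Rightarrow> real" where "pos e x = inv_into {0..1} (edge_path e) x"

lemma pos:
  assumes "e \<in> E"
  shows "x \<in> e \<Longrightarrow> pos e x \<in> {0..1}" "x \<in> e \<Longrightarrow> edge_path e (pos e x) = x"
    "pos e (edge_path e 0) = 0" "pos e (edge_path e 1) = 1" "inj_on (pos e) e"
    "continuous_map (subtopology X e) euclidean (pos e)"
proof -
  note p = edge_path[OF assms]
  show a: "x \<in> e \<Longrightarrow> pos e x \<in> {0..1}" "x \<in> e \<Longrightarrow> edge_path e (pos e x) = x" for x
    unfolding pos_def using p(3) inv_into_into[of x "edge_path e" "{0..1}"] f_inv_into_f[of x "edge_path e" "{0..1}"] by metis+
  show "pos e (edge_path e 0) = 0" "pos e (edge_path e 1) = 1" unfolding pos_def by (auto intro!: inv_into_f_f[OF p(2)])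
  show "inj_on (pos e) e" using a(2) by (metis inj_onI)
  have "continuous_map (subtopology X (edge_path e ` {0..1})) euclidean (pos e)"
    by (rule compact_continuous_descend[OF compact_Icc Hausdorff p(1)[unfolded pathin_def], of "\<lambda>x. x"])
      (auto simp: pos_def inv_into_f_f[OF p(2)])
  then show "continuous_map (subtopology X e) euclidean (pos e)" using p(3) by simp
qed

text \<open>The position on \<open>e\<close> as seen from its end \<open>u\<close>. The direction
  chosen by \<open>edge_path\<close> is auxiliary.\<close>

definition edge_coord :: "'a \<Rightarrow> 'a set \<Rightarrow> 'a \<Rightarrow> real" where
  "edge_coord u e x = (if u = edge_path e 0 then pos e x else 1 - pos e x)"

lemma edge_coord:
  assumes "e \<in> E" "e \<inter> V = {u, w}" "u \<noteq> w"
  shows "x \<in> e \<Longrightarrow> edge_coord u e x \<in> {0..1}" "edge_coord u e u = 0" "edge_coord u e w = 1" "edge_coord w e x = 1 - edge_coord u e x"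
    "inj_on (edge_coord u e) e" "continuous_map (subtopology X e) euclidean (edge_coord u e)"
proof -
  have ends: "{u, w} = {edge_path e 0, edge_path e 1}" "edge_path e 0 \<noteq> edge_path e 1"
    using assms edge_path(4)[OF assms(1)] by (auto simp: doubleton_eq_iff)
  show "x \<in> e \<Longrightarrow> edge_coord u e x \<in> {0..1}" using pos(1)[OF assms(1), of x] by (auto simp: edge_coord_def)
  show "edge_coord u e u = 0" "edge_coord u e w = 1" "edge_coord w e x = 1 - edge_coord u e x"
    using ends assms(3) pos(3,4)[OF assms(1)] by (auto simp: edge_coord_def doubleton_eq_iff)
  show "inj_on (edge_coord u e) e" using pos(5)[OF assms(1)] by (auto simp: edge_coord_def inj_on_def)
  show "continuous_map (subtopology X e) euclidean (edge_coord u e)"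
    using pos(6)[OF assms(1)] by (cases "u = edge_path e 0") (auto simp: edge_coord_def[abs_def] intro!: continuous_intros)
qed

end

text \<open>The centres of the faces are required to come from the open disc, so that each of them
  has exactly one preimage under \<open>q\<close>.\<close>

locale disc_coloured = coloured_quadrangulation X V E W c + crosscap_model X g q
  for X :: "'a topology" and V E W c g q +
  fixes hc :: "'a set \<Rightarrow> complex \<Rightarrow> 'a"
  assumes hc: "\<And>F. F \<in> Fs \<Longrightarrow> face_param F (hc F)" and hc0: "\<And>F. F \<in> Fs \<Longrightarrow> hc F 0 \<in> q ` ball 0 1"
begin

text \<open>Going along an edge from a vertex which sees the pair \<open>e\<close> to one which does not, the phase moves
  by \<open>1\<close> in the direction given by which of the two colours the other end has. Modulo \<open>2\<close> the phase
  at a vertex is thus well-defined, and it returns to its initial value along every face.\<close>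

definition sees_pair :: "nat \<times> nat \<Rightarrow> 'a \<Rightarrow> bool" where "sees_pair e v \<longleftrightarrow> A v = {fst e, snd e}"
definition pair_sign :: "nat \<times> nat \<Rightarrow> 'a \<Rightarrow> int" where "pair_sign e v = (if c v = snd e then 1 else - 1)"
definition edge_jump :: "nat \<times> nat \<Rightarrow> 'a \<Rightarrow> 'a \<Rightarrow> int" where
  "edge_jump e u w = of_bool (sees_pair e u) * pair_sign e w - of_bool (sees_pair e w) * pair_sign e u"
definition vertex_phase :: "nat \<times> nat \<Rightarrow> 'a \<Rightarrow> int" where "vertex_phase e v = of_bool (sees_pair e v)"

lemma adj_A: "adjacent V E u w \<Longrightarrow> u \<in> V \<Longrightarrow> w \<in> V \<Longrightarrow> c w \<in> A u"
  by (auto simp: A_def neighborhood_def)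

text \<open>Otherwise the two ends would see the same set of colours, and one of them would see its
  own colour.\<close>

lemma sees_pair_excl:
  assumes "adjacent V E u w" "u \<in> V" "w \<in> V" shows "\<not> (sees_pair e u \<and> sees_pair e w)"
proof
  assume "sees_pair e u \<and> sees_pair e w"
  then have "A u = A w" by (simp add: sees_pair_def)
  then show False using adj_A[OF assms] A(3)[OF assms(3)] by simp
qed

lemma edge_jump_parity:
  assumes "adjacent V E u w" "u \<in> V" "w \<in> V"
  shows "even (vertex_phase e w - vertex_phase e u - edge_jump e u w)" "edge_jump e w u = - edge_jump e u w" "\<bar>edge_jump e u w\<bar> \<le> 1"
  using sees_pair_excl[OF assms, of e] by (auto simp: vertex_phase_def edge_jump_def pair_sign_def)

lemma side_adj:
  assumes "e \<in> E" "e \<inter> V = {u, w}" "u \<noteq> w"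
  shows "adjacent V E u w" "adjacent V E w u" "u \<in> V" "w \<in> V"
  using assms by (auto simp: adjacent_def)

definition sees_at :: "nat \<times> nat \<Rightarrow> 'a set \<Rightarrow> nat \<Rightarrow> int" where "sees_at e F i = of_bool (sees_pair e (corner F i))"
definition sign_at :: "nat \<times> nat \<Rightarrow> 'a set \<Rightarrow> nat \<Rightarrow> int" where "sign_at e F i = pair_sign e (corner F i)"
text \<open>An integral lift of the phases along the boundary walk, accumulated from corner 0 by the
  jumps of the edges.\<close>

definition corner_phase :: "nat \<times> nat \<Rightarrow> 'a set \<Rightarrow> nat \<Rightarrow> int" where
  "corner_phase e F i = sees_at e F 0 + (\<Sum>j<i. sees_at e F j * sign_at e F (Suc j) - sees_at e F (Suc j) * sign_at e F j)"

lemma corner_phase_Suc: "corner_phase e F (Suc i) = corner_phase e F i + edge_jump e (corner F i) (corner F (Suc i))"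
  by (simp add: corner_phase_def edge_jump_def sees_at_def sign_at_def)

text \<open>If the corners 1 and 3 have different colours, then the corners 0 and 2 both see exactly
  these colours; likewise for the other diagonal. At the ends of a diagonal coloured by
  \<open>e\<close> the signs are opposite, at those of a monochromatic diagonal they agree.\<close>

lemma types:
  assumes F: "F \<in> Fs" and e: "e = sorted_pair (fst e) (snd e)" "fst e \<noteq> snd e"
  shows "sees_at e F 0 * sees_at e F 1 = 0" "sees_at e F 1 * sees_at e F 2 = 0" "sees_at e F 2 * sees_at e F 3 = 0" "sees_at e F 3 * sees_at e F 0 = 0"
    "corner_colour F 1 \<noteq> corner_colour F 3 \<Longrightarrow> sees_at e F 0 = of_bool (D1 F = e) \<and> sees_at e F 2 = of_bool (D1 F = e)"
    "corner_colour F 0 \<noteq> corner_colour F 2 \<Longrightarrow> sees_at e F 1 = of_bool (D0 F = e) \<and> sees_at e F 3 = of_bool (D0 F = e)"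
    "corner_colour F 1 = corner_colour F 3 \<Longrightarrow> sign_at e F 1 = sign_at e F 3" "corner_colour F 0 = corner_colour F 2 \<Longrightarrow> sign_at e F 0 = sign_at e F 2"
    "D1 F = e \<Longrightarrow> corner_colour F 1 \<noteq> corner_colour F 3 \<Longrightarrow> sign_at e F 1 = - sign_at e F 3"
    "D0 F = e \<Longrightarrow> corner_colour F 0 \<noteq> corner_colour F 2 \<Longrightarrow> sign_at e F 0 = - sign_at e F 2"
proof -
  have n: "Suc 0 = 1" "Suc 1 = 2" "Suc 2 = 3" "Suc 3 = 4" by simp_all
  have V: "corner F i \<in> V" for i by (rule face_walk(2)[OF F])
  have x: "sees_at e F i * sees_at e F (Suc i) = 0" for i
    using sees_pair_excl[OF adjacent_corners(1)[OF F, of i] V V, of e] by (auto simp: sees_at_def)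
  show "sees_at e F 0 * sees_at e F 1 = 0" using x[of 0] unfolding n .
  show "sees_at e F 1 * sees_at e F 2 = 0" using x[of 1] unfolding n .
  show "sees_at e F 2 * sees_at e F 3 = 0" using x[of 2] unfolding n .
  show "sees_at e F 3 * sees_at e F 0 = 0" using x[of 3] unfolding n by (simp add: sees_at_def corner_colour_4)
  note c1 = corner_colour_in_A(1)[OF F] and c2 = corner_colour_in_A(2)[OF F]
  have nb: "corner_colour F 1 \<in> A (corner F 0)" "corner_colour F 3 \<in> A (corner F 0)" "corner_colour F 0 \<in> A (corner F 1)" "corner_colour F 2 \<in> A (corner F 1)"
      "corner_colour F 1 \<in> A (corner F 2)" "corner_colour F 3 \<in> A (corner F 2)" "corner_colour F 0 \<in> A (corner F 3)" "corner_colour F 2 \<in> A (corner F 3)"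
      using c1[of 0, unfolded n] c2[of 3, unfolded n corner_colour_4] c2[of 0, unfolded n] c1[of 1, unfolded n]
        c2[of 1, unfolded n] c1[of 2, unfolded n] c1[of 3, unfolded n corner_colour_4] c2[of 2, unfolded n]
      by - (assumption+)
  have D: "sorted_pair x y = e \<longleftrightarrow> {x, y} = {fst e, snd e}" for x y using e(1) sorted_pair_eq_iff by metis
  have eq: "sees_at e F i = of_bool (sorted_pair x y = e)" if "x \<in> A (corner F i)" "y \<in> A (corner F i)" "x \<noteq> y" for i x y
    using A_eq[OF V that] unfolding D sees_at_def sees_pair_def by simp
  show "corner_colour F 1 \<noteq> corner_colour F 3 \<Longrightarrow> sees_at e F 0 = of_bool (D1 F = e) \<and> sees_at e F 2 = of_bool (D1 F = e)"
    unfolding D1_def using eq[OF nb(1,2)] eq[OF nb(5,6)] by blast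
  show "corner_colour F 0 \<noteq> corner_colour F 2 \<Longrightarrow> sees_at e F 1 = of_bool (D0 F = e) \<and> sees_at e F 3 = of_bool (D0 F = e)"
    unfolding D0_def using eq[OF nb(3,4)] eq[OF nb(7,8)] by blast
  show "corner_colour F 1 = corner_colour F 3 \<Longrightarrow> sign_at e F 1 = sign_at e F 3" "corner_colour F 0 = corner_colour F 2 \<Longrightarrow> sign_at e F 0 = sign_at e F 2"
    by (simp_all only: sign_at_def pair_sign_def corner_colour_def)
  show "D1 F = e \<Longrightarrow> corner_colour F 1 \<noteq> corner_colour F 3 \<Longrightarrow> sign_at e F 1 = - sign_at e F 3"
    unfolding D1_def D sign_at_def pair_sign_def corner_colour_def using e(2) by (auto simp: doubleton_eq_iff)
  show "D0 F = e \<Longrightarrow> corner_colour F 0 \<noteq> corner_colour F 2 \<Longrightarrow> sign_at e F 0 = - sign_at e F 2"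
    unfolding D0_def D sign_at_def pair_sign_def corner_colour_def using e(2) by (auto simp: doubleton_eq_iff)
qed

lemma sees_at_01: "sees_at e F i = 0 \<or> sees_at e F i = 1" by (simp add: sees_at_def)
lemma sign_at_pm: "sign_at e F i = 1 \<or> sign_at e F i = - 1" by (simp add: sign_at_def pair_sign_def)

lemma corner_phase_values:
  "corner_phase e F 0 = sees_at e F 0"
  "corner_phase e F 1 = corner_phase e F 0 + sees_at e F 0 * sign_at e F 1 - sees_at e F 1 * sign_at e F 0"
  "corner_phase e F 2 = corner_phase e F 1 + sees_at e F 1 * sign_at e F 2 - sees_at e F 2 * sign_at e F 1"
  "corner_phase e F 3 = corner_phase e F 2 + sees_at e F 2 * sign_at e F 3 - sees_at e F 3 * sign_at e F 2"
  "corner_phase e F 4 = corner_phase e F 3 + sees_at e F 3 * sign_at e F 0 - sees_at e F 0 * sign_at e F 3"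
proof -
  have n: "Suc 0 = 1" "Suc 1 = 2" "Suc 2 = 3" "Suc 3 = 4" by simp_all
  have s: "corner_phase e F (Suc i) = corner_phase e F i + sees_at e F i * sign_at e F (Suc i) - sees_at e F (Suc i) * sign_at e F i" for i
    by (simp add: corner_phase_def)
  show "corner_phase e F 0 = sees_at e F 0" by (simp add: corner_phase_def)
  show "corner_phase e F 1 = corner_phase e F 0 + sees_at e F 0 * sign_at e F 1 - sees_at e F 1 * sign_at e F 0" using s[of 0] unfolding n .
  show "corner_phase e F 2 = corner_phase e F 1 + sees_at e F 1 * sign_at e F 2 - sees_at e F 2 * sign_at e F 1" using s[of 1] unfolding n .
  show "corner_phase e F 3 = corner_phase e F 2 + sees_at e F 2 * sign_at e F 3 - sees_at e F 3 * sign_at e F 2" using s[of 2] unfolding n .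
  show "corner_phase e F 4 = corner_phase e F 3 + sees_at e F 3 * sign_at e F 0 - sees_at e F 0 * sign_at e F 3"
    using s[of 3] unfolding n by (simp add: sees_at_def sign_at_def corner_colour_4)
qed

text \<open>The jumps group by diagonals. If the ends of a diagonal have one colour, their signs
  agree and the contributions of each opposite corner cancel; otherwise both opposite corners see
  the same pair and cancel each other.\<close>

lemma corner_phase_closed:
  assumes F: "F \<in> Fs" and e: "e = sorted_pair (fst e) (snd e)" "fst e \<noteq> snd e"
  shows "corner_phase e F 4 = corner_phase e F 0"
proof -
  note t = types[OF F e]
  have a: "sees_at e F 0 * (sign_at e F 1 - sign_at e F 3) + sees_at e F 2 * (sign_at e F 3 - sign_at e F 1) = 0"
    by (cases "corner_colour F 1 = corner_colour F 3") (use t(5,7) in simp_all)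
  have b: "sees_at e F 1 * (sign_at e F 2 - sign_at e F 0) + sees_at e F 3 * (sign_at e F 0 - sign_at e F 2) = 0"
    by (cases "corner_colour F 0 = corner_colour F 2") (use t(6,8) in simp_all)
  show ?thesis using a b unfolding corner_phase_values by (simp add: algebra_simps)
qed

text \<open>At a corner two quarter circles are eligible. The least index is an arbitrary choice,
  justified by \<open>boundary_phase_eq\<close>, where the closing of the phases serves the corner
  0.\<close>

definition boundary_phase :: "nat \<times> nat \<Rightarrow> 'a set \<Rightarrow> complex \<Rightarrow> real" where
  "boundary_phase e F z = (let i = (LEAST i. z \<in> quarter_circle i) in
     corner_phase e F i + edge_jump e (corner F i) (corner F (Suc i)) * edge_coord (corner F i) (side F i) (hc F z))"

definition side_coord :: "'a set \<Rightarrow> nat \<Rightarrow> complex \<Rightarrow> real" where "side_coord F i z = edge_coord (corner F i) (side F i) (hc F z)"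

context
  fixes F assumes F: "F \<in> Fs"
begin

lemma side_facts:
  assumes "i < 4"
  shows "side F i \<in> E" "side F i \<inter> V = {corner F i, corner F (Suc i)}" "corner F i \<noteq> corner F (Suc i)"
  using face_walk(3)[OF F] corner_neq[OF F hc[OF F] assms] by auto

lemma hc_side: "i < 4 \<Longrightarrow> z \<in> quarter_circle i \<Longrightarrow> hc F z \<in> side F i"
  using param_quarter(4)[OF F hc[OF F]] by blast

lemma side_coord:
  assumes "i < 4"
  shows "z \<in> quarter_circle i \<Longrightarrow> side_coord F i z \<in> {0..1}" "side_coord F i (cis (real i * pi / 2)) = 0"
    "side_coord F i (cis ((real i + 1) * pi / 2)) = 1" "inj_on (side_coord F i) (quarter_circle i)"
    "continuous_on (quarter_circle i) (side_coord F i)"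
proof -
  note L = edge_coord[OF side_facts[OF assms]]
  show "z \<in> quarter_circle i \<Longrightarrow> side_coord F i z \<in> {0..1}" unfolding side_coord_def using L(1) hc_side[OF assms] by blast
  show "side_coord F i (cis (real i * pi / 2)) = 0" "side_coord F i (cis ((real i + 1) * pi / 2)) = 1"
    unfolding side_coord_def param_quarter(1,2)[OF F hc[OF F] assms] using L(2,3) by auto
  show "inj_on (side_coord F i) (quarter_circle i)"
    unfolding side_coord_def using param_quarter(3)[OF F hc[OF F] assms] L(5) hc_side[OF assms]
    by (auto simp: inj_on_def)
  have "continuous_map (top_of_set (quarter_circle i)) X (hc F)"
    using continuous_map_from_subtopology_mono[OF param_cont[OF F hc[OF F]]] quarter_circle_subset_sphere sphere_cball
    by (metis order_trans)
  then have "continuous_map (top_of_set (quarter_circle i)) (subtopology X (side F i)) (hc F)"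
    using hc_side[OF assms] by (auto simp: continuous_map_in_subtopology)
  from continuous_map_compose[OF this L(6)] show "continuous_on (quarter_circle i) (side_coord F i)"
    by (simp add: comp_def side_coord_def[abs_def])
qed

lemma quarter_inter:
  assumes "i < 4" "j < 4" "i < j" "z \<in> quarter_circle i" "z \<in> quarter_circle j"
  shows "(j = Suc i \<and> z = cis ((real i + 1) * pi / 2) \<and> z = cis (real j * pi / 2)) \<or>
    (i = 0 \<and> j = 3 \<and> z = cis (real i * pi / 2) \<and> z = cis ((real j + 1) * pi / 2))"
proof -
  obtain s where s: "s \<in> {0..1}" "z = cis ((real i + s) * pi / 2)" using assms(4) mem_quarter_circle by blast
  obtain t where t: "t \<in> {0..1}" "z = cis ((real j + t) * pi / 2)" using assms(5) mem_quarter_circle by blast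
  have ij: "real i + 1 \<le> real j" "real j \<le> 3" using assms by auto
  show ?thesis
  proof (cases "real j + t = 4")
    case True
    then have j3: "real j = 3" "t = 1" using t(1) ij by auto
    have "z = cis (0 * pi / 2)"
    proof -
      have "z = cis (2 * pi)" unfolding t(2) True by simp
      then show ?thesis by simp
    qed
    moreover have "real i + s < 4" using s(1) ij j3 by auto
    ultimately have "real i + s = 0" using s cis_quarter_eq_iff[of "real i + s" 0] by auto
    then have "i = 0" "s = 0" using s(1) by auto
    then show ?thesis using s(2) t(2) j3 by auto
  next
    case False
    then have "real i + s = real j + t" using s t ij cis_quarter_eq_iff[of "real i + s" "real j + t"] by auto
    then have "s = 1" "t = 0" "real j = real i + 1" using s(1) t(1) ij by auto
    then show ?thesis using s(2) t(2) by auto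
  qed
qed

lemma boundary_phase_eq:
  assumes e: "e = sorted_pair (fst e) (snd e)" "fst e \<noteq> snd e" and i: "i < 4" "z \<in> quarter_circle i"
  shows "boundary_phase e F z = (1 - side_coord F i z) * corner_phase e F i + side_coord F i z * corner_phase e F (Suc i)"
proof -
  let ?G = "\<lambda>i. (1 - side_coord F i z) * corner_phase e F i + side_coord F i z * corner_phase e F (Suc i)"
  define j where "j = (LEAST i. z \<in> quarter_circle i)"
  have j: "z \<in> quarter_circle j" unfolding j_def by (rule LeastI[of _ i]) (rule i(2))
  have ji: "j \<le> i" unfolding j_def by (rule Least_le) (rule i(2))
  have "boundary_phase e F z = ?G j"
    unfolding boundary_phase_def Let_def j_def[symmetric] corner_phase_Suc side_coord_def by (simp add: algebra_simps)
  also have "\<dots> = ?G i"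
  proof (cases "j = i")
    case False
    then have "j < i" "j < 4" using ji i(1) by auto
    from quarter_inter[OF this(2) i(1) this(1) j i(2)] show ?thesis
    proof (elim disjE conjE)
      assume a: "i = Suc j" "z = cis ((real j + 1) * pi / 2)" "z = cis (real i * pi / 2)"
      have "side_coord F j z = 1" using side_coord(3)[OF \<open>j < 4\<close>] a(2) by simp
      moreover have "side_coord F i z = 0" using side_coord(2)[OF i(1)] a(3) by simp
      ultimately show ?thesis using a(1) by simp
    next
      assume a: "j = 0" "i = 3" "z = cis (real j * pi / 2)" "z = cis ((real i + 1) * pi / 2)"
      have "side_coord F j z = 0" using side_coord(2)[OF \<open>j < 4\<close>] a(3) by simp
      moreover have "side_coord F i z = 1" using side_coord(3)[OF i(1)] a(4) by simp
      moreover have "corner_phase e F (Suc 3) = corner_phase e F 0" using corner_phase_closed[OF F e] by simp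
      ultimately show ?thesis using a(1,2) by simp
    qed
  qed simp
  finally show ?thesis .
qed

lemma boundary_phase_cont:
  assumes e: "e = sorted_pair (fst e) (snd e)" "fst e \<noteq> snd e"
  shows "continuous_on (sphere 0 1) (boundary_phase e F)"
proof -
  have c: "continuous_on (quarter_circle i) (boundary_phase e F)" if "i < 4" for i
  proof (rule continuous_on_eq)
    show "continuous_on (quarter_circle i) (\<lambda>z. (1 - side_coord F i z) * corner_phase e F i + side_coord F i z * corner_phase e F (Suc i))"
      using side_coord(5)[OF that] by (intro continuous_intros)
  qed (simp add: boundary_phase_eq[OF e that])
  have "continuous_on (((quarter_circle 0 \<union> quarter_circle 1) \<union> quarter_circle 2) \<union> quarter_circle 3) (boundary_phase e F)"
    by (intro continuous_on_closed_Un closed_Un c compact_imp_closed compact_quarter_circle) auto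
  moreover have "sphere 0 1 \<subseteq> ((quarter_circle 0 \<union> quarter_circle 1) \<union> quarter_circle 2) \<union> quarter_circle 3"
  proof
    fix z :: complex assume "z \<in> sphere 0 1"
    then obtain i where i: "i < 4" "z \<in> quarter_circle i" by (rule sphere_quarter_circle)
    then have "i = 0 \<or> i = 1 \<or> i = 2 \<or> i = 3" by auto
    then show "z \<in> ((quarter_circle 0 \<union> quarter_circle 1) \<union> quarter_circle 2) \<union> quarter_circle 3" using i(2) by auto
  qed
  ultimately show ?thesis by (rule continuous_on_subset)
qed

end

end

section \<open>Odd real numbers, and half-open quadrants of the plane\<close>

lemma odd_real_of_int: "odd_real (of_int k) \<longleftrightarrow> odd k"
proof
  assume "odd_real (of_int k)"
  then obtain n :: int where "of_int k = (2 * of_int n + 1 :: real)" by (auto simp: odd_real_def)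
  then have "k = 2 * n + 1" by linarith
  then show "odd k" by simp
next
  assume "odd k"
  then obtain n where "k = 2 * n + 1" by (rule oddE)
  then show "odd_real (of_int k)" by (auto simp: odd_real_def)
qed

lemma odd_real_shift: "odd_real (2 * of_int B + x) \<longleftrightarrow> odd_real x"
proof -
  have "cis (pi * (2 * of_int B + x)) = cis (pi * x)" unfolding cis_pi_eq_iff by (auto simp: add.commute)
  then show ?thesis by (simp add: odd_real_iff_cis)
qed

lemma odd_real_unit:
  assumes "odd_real x" "-1 \<le> x" "x \<le> 1" shows "x = 1 \<or> x = -1"
proof -
  obtain n :: int where n: "x = 2 * of_int n + 1" using assms(1) by (auto simp: odd_real_def)
  then have "-1 \<le> n" "n \<le> 0" using assms(2,3) by linarith+
  then have "n = -1 \<or> n = 0" by linarith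
  then show ?thesis using n by auto
qed

text \<open>The four half-open quadrants, each a quarter turn of the one before, are
  disjoint.\<close>

lemma rotated_pairs_unique:
  fixes p u p' u' :: real
  assumes "0 \<le> p" "0 < u" "0 \<le> p'" "0 < u'" "i < (4::nat)" "j < (4::nat)"
    and "(if i = 0 then (p, u) else if i = 1 then (u, - p) else if i = 2 then (- p, - u) else (- u, p)) =
     (if j = 0 then (p', u') else if j = 1 then (u', - p') else if j = 2 then (- p', - u') else (- u', p'))"
  shows "i = j \<and> p = p' \<and> u = u'"
proof -
  have "i = 0 \<or> i = 1 \<or> i = 2 \<or> i = 3" "j = 0 \<or> j = 1 \<or> j = 2 \<or> j = 3" using assms(5,6) by auto
  then show ?thesis using assms by (elim disjE) auto
qed

section \<open>Cones over the faces and the resulting circle-valued maps\<close>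

context disc_coloured
begin

abbreviation proper_pair :: "nat \<times> nat \<Rightarrow> bool" where
  "proper_pair e \<equiv> e = sorted_pair (fst e) (snd e) \<and> fst e \<noteq> snd e"

lemma proper_pairs_of: "e \<in> pairs_of K \<Longrightarrow> proper_pair e"
  by (auto simp: pairs_of_def sorted_pair_def)

text \<open>Chosen so that two cones are odd at the same point only at the centre of a face with
  these diagonals. If exactly one diagonal is monochromatic, the phases at its ends agree and are
  taken at the centre. If none is, the average gives the midpoint of the phases at the ends of a
  diagonal.\<close>

definition apex :: "nat \<times> nat \<Rightarrow> 'a set \<Rightarrow> real" where
  "apex e F = (if corner_colour F 1 = corner_colour F 3 then corner_phase e F 1 else (corner_phase e F 0 + corner_phase e F 2) / 2)"
definition cone :: "nat \<times> nat \<Rightarrow> 'a set \<Rightarrow> complex \<Rightarrow> real" where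
  "cone e F w = apex e F + norm w * (boundary_phase e F (sgn w) - apex e F)"
definition hinv :: "'a set \<Rightarrow> 'a \<Rightarrow> complex" where "hinv F x = inv_into (ball 0 1) (hc F) x"

lemma hinv: assumes "F \<in> Fs" "x \<in> F" shows "hinv F x \<in> ball 0 1" "hc F (hinv F x) = x"
  using param_ball(1)[OF assms(1) hc[OF assms(1)]] assms(2) inv_into_into[of x "hc F" "ball 0 1"]
    f_inv_into_f[of x "hc F" "ball 0 1"] unfolding hinv_def by blast+

lemma hinv_hc: "F \<in> Fs \<Longrightarrow> w \<in> ball 0 1 \<Longrightarrow> hinv F (hc F w) = w"
  unfolding hinv_def by (rule inv_into_f_f[OF param_ball(2)[OF _ hc]])

lemma cone_cont:
  assumes "F \<in> Fs" "proper_pair e" shows "continuous_on (cball 0 1) (cone e F)"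
proof -
  have "continuous_on (sphere 0 1) (\<lambda>z. boundary_phase e F z - apex e F)"
    using boundary_phase_cont[OF assms(1), of e] assms(2) by (intro continuous_intros) auto
  from continuous_on_add[OF continuous_on_const cone_continuous[OF this]]
  show ?thesis unfolding cone_def[abs_def] .
qed

lemma cone_sphere: "norm z = 1 \<Longrightarrow> cone e F z = boundary_phase e F z"
  by (simp add: cone_def sgn_eq)

text \<open>Defined from the edges alone, without reference to a face, so that the cones of all
  faces agree along the graph. At a point outside \<open>V\<close> the chosen edge is the only
  one.\<close>

definition graph_phase :: "nat \<times> nat \<Rightarrow> 'a \<Rightarrow> complex" where
  "graph_phase e x = (if x \<in> V then cis (pi * vertex_phase e x) else let e' = (SOME e'. e' \<in> E \<and> x \<in> e') in
     cis (pi * (vertex_phase e (edge_path e' 0) + edge_jump e (edge_path e' 0) (edge_path e' 1) * pos e' x)))"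

text \<open>Different faces lift the phase of a vertex to different integers, but its parity is
  global.\<close>

lemma corner_phase_parity: "even (corner_phase e F i - vertex_phase e (corner F i))" if F: "F \<in> Fs"
proof (induction i)
  case 0 then show ?case by (simp add: corner_phase_def sees_at_def vertex_phase_def)
next
  case (Suc i)
  have "even (vertex_phase e (corner F (Suc i)) - vertex_phase e (corner F i) - edge_jump e (corner F i) (corner F (Suc i)))"
    by (rule edge_jump_parity(1)[OF adjacent_corners(1)[OF F] face_walk(2)[OF F] face_walk(2)[OF F]])
  then show ?case using Suc unfolding corner_phase_Suc by presburger
qed

lemma cis_pi_even: "even (k - l) \<Longrightarrow> cis (pi * (of_int k + y)) = cis (pi * (of_int l + y))"
proof -
  assume "even (k - l)"
  then obtain n where "k = l + 2 * n" by (metis add_diff_cancel_left' diff_add_cancel evenE add.commute)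
  then show ?thesis unfolding cis_pi_eq_iff by (intro exI[of _ n]) simp
qed

lemma graph_phase_sphere:
  assumes F: "F \<in> Fs" and e: "proper_pair e" and z: "z \<in> sphere 0 1"
  shows "cis (pi * boundary_phase e F z) = graph_phase e (hc F z)"
proof -
  obtain i where i: "i < 4" "z \<in> quarter_circle i" using z by (rule sphere_quarter_circle)
  let ?u = "corner F i" let ?w = "corner F (Suc i)" let ?d = "side F i" let ?x = "hc F z"
  note sf = side_facts[OF F i(1)] and L = edge_coord[OF side_facts[OF F i(1)]]
  have x: "?x \<in> ?d" by (rule hc_side[OF F i])
  have adj: "adjacent V E ?u ?w" "?u \<in> V" "?w \<in> V" using side_adj[OF sf] by auto
  have "boundary_phase e F z = corner_phase e F i + edge_jump e ?u ?w * edge_coord ?u ?d ?x"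
    using boundary_phase_eq[OF F _ _ i, of e] e unfolding corner_phase_Suc side_coord_def by (simp add: algebra_simps)
  then have g1: "cis (pi * boundary_phase e F z) = cis (pi * (vertex_phase e ?u + edge_jump e ?u ?w * edge_coord ?u ?d ?x))"
    using cis_pi_even[OF corner_phase_parity[OF F]] by simp
  show ?thesis
  proof (cases "?x \<in> V")
    case True
    then have "?x = ?u \<or> ?x = ?w" using x sf(2) by blast
    then show ?thesis
    proof
      assume "?x = ?u"
      then show ?thesis using True g1 L(2) by (simp add: graph_phase_def)
    next
      assume w: "?x = ?w"
      have "cis (pi * (of_int (vertex_phase e ?u + edge_jump e ?u ?w) + 0)) = cis (pi * (of_int (vertex_phase e ?w) + 0))"
        by (rule cis_pi_even) (use edge_jump_parity(1)[OF adj, of e] in presburger)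
      then show ?thesis using True g1 L(3) w by (simp add: graph_phase_def)
    qed
  next
    case False
    have "(SOME e'. e' \<in> E \<and> ?x \<in> e') = ?d"
    proof (rule some_equality)
      show "?d \<in> E \<and> ?x \<in> ?d" using x sf(1) by blast
      show "e' = ?d" if "e' \<in> E \<and> ?x \<in> e'" for e'
        using edges_disjoint[OF _ sf(1), of e'] that x False by blast
    qed
    then have graph_phase: "graph_phase e ?x = cis (pi * (vertex_phase e (edge_path ?d 0) + edge_jump e (edge_path ?d 0) (edge_path ?d 1) * pos ?d ?x))"
      using False by (simp add: graph_phase_def Let_def)
    have ends: "{?u, ?w} = {edge_path ?d 0, edge_path ?d 1}" using sf(2) edge_path(4)[OF sf(1)] by simp
    show ?thesis
    proof (cases "?u = edge_path ?d 0")
      case True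
      then have "?w = edge_path ?d 1" using ends sf(3) by (auto simp: doubleton_eq_iff)
      then show ?thesis using g1 graph_phase True by (simp add: edge_coord_def)
    next
      case False
      then have u: "?u = edge_path ?d 1" "?w = edge_path ?d 0" using ends by (auto simp: doubleton_eq_iff)
      have "edge_jump e ?w ?u = - edge_jump e ?u ?w" by (rule edge_jump_parity(2)[OF adj])
      then have E: "vertex_phase e ?u + edge_jump e ?u ?w * edge_coord ?u ?d ?x = of_int (vertex_phase e ?u + edge_jump e ?u ?w) + edge_jump e ?w ?u * pos ?d ?x"
        using False by (simp add: edge_coord_def algebra_simps)
      have C: "cis (pi * (of_int (vertex_phase e ?u + edge_jump e ?u ?w) + edge_jump e ?w ?u * pos ?d ?x)) = cis (pi * (of_int (vertex_phase e ?w) + edge_jump e ?w ?u * pos ?d ?x))"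
        by (rule cis_pi_even) (use edge_jump_parity(1)[OF adj, of e] in presburger)
      show ?thesis unfolding g1 E C graph_phase u[symmetric] ..
    qed
  qed
qed

lemma hc_closed: "F \<in> Fs \<Longrightarrow> closedin X (hc F ` cball 0 1)"
  by (rule param_closed[OF _ hc]) auto

text \<open>Every edge is a side of some face, so what the closed faces miss is contained in the
  finite set \<open>V\<close>. It is open as well, and a surface has no nonempty finite open
  set.\<close>

lemma faces_cover: "topspace X = (\<Union>F\<in>Fs. hc F ` cball 0 1)"
proof
  have cl: "closedin X (\<Union>F\<in>Fs. hc F ` cball 0 1)"
    using hc_closed finite_faces by (intro closedin_Union) auto
  then show "(\<Union>F\<in>Fs. hc F ` cball 0 1) \<subseteq> topspace X" using closedin_subset by blast
  define N where "N = topspace X - (\<Union>F\<in>Fs. hc F ` cball 0 1)"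
  have "N \<subseteq> V"
  proof
    fix x assume x: "x \<in> N"
    show "x \<in> V"
    proof (rule ccontr)
      assume xV: "x \<notin> V"
      have "x \<notin> \<Union>Fs"
      proof
        assume "x \<in> \<Union>Fs"
        then obtain F where F: "F \<in> Fs" "x \<in> F" by blast
        then have "x \<in> hc F ` ball 0 1" using param_ball(1)[OF F(1) hc[OF F(1)]] by simp
        then have "x \<in> hc F ` cball 0 1" using ball_subset_cball by blast
        then show False using x F(1) by (auto simp: N_def)
      qed
      then have "x \<in> \<Union>E" using x xV unfolding face_Union N_def by auto
      then obtain e where e: "e \<in> E" "x \<in> e" by blast
      have "edge_sides X V E W e \<noteq> {}" using card_edge_sides[OF e(1)] by auto
      then obtain F i where Fi: "F \<in> Fs" "i < 4" "side F i = e" by (auto simp: edge_sides_eq)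
      then have "x \<in> hc F ` quarter_circle i" using param_quarter(4)[OF Fi(1) hc[OF Fi(1)] Fi(2)] e(2) by simp
      moreover have "quarter_circle i \<subseteq> cball 0 1" using quarter_circle_subset_sphere[of i] by force
      ultimately have "x \<in> hc F ` cball 0 1" by blast
      then show False using x Fi(1) by (auto simp: N_def)
    qed
  qed
  then have "finite N" using finite_graph(1) finite_subset by blast
  moreover have "openin X N" unfolding N_def using cl by blast
  ultimately have "N = {}" using finite_not_open by blast
  then show "topspace X \<subseteq> (\<Union>F\<in>Fs. hc F ` cball 0 1)" by (auto simp: N_def)
qed

text \<open>Paste the cones of the finitely many closed faces. Different faces overlap in the graph
  only, where all of them are given by \<open>graph_phase\<close>.\<close>

lemma alpha_exists:
  assumes e: "proper_pair e"
  obtains \<alpha> where "continuous_map X euclidean \<alpha>" "\<And>x. x \<in> topspace X \<Longrightarrow> norm (\<alpha> x) = 1"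
    "\<And>F w. F \<in> Fs \<Longrightarrow> w \<in> cball 0 1 \<Longrightarrow> \<alpha> (hc F w) = cis (pi * cone e F w)"
proof -
  define f where "f F x = (if x \<in> F then cis (pi * cone e F (hinv F x)) else graph_phase e x)" for F x
  have fw: "f F (hc F w) = cis (pi * cone e F w)" if F: "F \<in> Fs" and w: "w \<in> cball 0 1" for F w
  proof (cases "w \<in> ball 0 1")
    case True
    then have "hc F w \<in> F" using param_ball(1)[OF F hc[OF F]] by blast
    then show ?thesis using hinv_hc[OF F True] by (simp add: f_def)
  next
    case False
    then have s: "w \<in> sphere 0 1" using w by auto
    have "hc F w \<in> \<Union>(side F ` {..<4})" using param_sphere[OF F hc[OF F]] s by blast
    then have "hc F w \<notin> F" using face_graph_disjoint(2)[OF F] face_walk(3)[OF F] by blast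
    then show ?thesis using graph_phase_sphere[OF F e s] s by (simp add: f_def cone_sphere)
  qed
  have TF: "hc F ` cball 0 1 \<subseteq> F \<union> \<Union>E" if F: "F \<in> Fs" for F
    unfolding cball_eq_ball_Un_sphere image_Un param_ball(1)[OF F hc[OF F]] param_sphere[OF F hc[OF F]]
    using face_walk(3)[OF F] by blast
  obtain \<alpha> where \<alpha>: "continuous_map X euclidean \<alpha>" "\<And>x F. F \<in> Fs \<Longrightarrow> x \<in> topspace X \<inter> hc F ` cball 0 1 \<Longrightarrow> \<alpha> x = f F x"
  proof (rule pasting_lemma_exists_closed[of Fs X "\<lambda>F. hc F ` cball 0 1" euclidean f])
    show "finite Fs" by (rule finite_faces)
    show "topspace X \<subseteq> (\<Union>F\<in>Fs. hc F ` cball 0 1)" using faces_cover by simp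
    show "closedin X (hc F ` cball 0 1)" if "F \<in> Fs" for F by (rule hc_closed[OF that])
    show "continuous_map (subtopology X (hc F ` cball 0 1)) euclidean (f F)" if "F \<in> Fs" for F
    proof (rule compact_continuous_descend[of "cball 0 1" X "hc F" "\<lambda>w. cis (pi * cone e F w)" "f F"])
      show "continuous_on (cball 0 1) (\<lambda>w. cis (pi * cone e F w))"
        using cone_cont[OF that e] by (auto intro!: continuous_intros)
    qed (use Hausdorff param_cont[OF that hc[OF that]] fw[OF that] in auto)
    show "f F x = f F' x" if "F \<in> Fs" "F' \<in> Fs" "x \<in> topspace X \<inter> hc F ` cball 0 1 \<inter> hc F' ` cball 0 1" for F F' x
    proof (cases "F = F'")
      case False
      have x: "x \<in> F \<union> \<Union>E" "x \<in> F' \<union> \<Union>E" using that TF by blast+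
      have "x \<notin> F" "x \<notin> F'"
        using x face_disjoint[OF that(1,2) False] face_graph_disjoint(2)[OF that(1)] face_graph_disjoint(2)[OF that(2)] by blast+
      then show ?thesis by (simp add: f_def)
    qed simp
  qed blast
  have a: "\<alpha> (hc F w) = cis (pi * cone e F w)" if "F \<in> Fs" "w \<in> cball 0 1" for F w
  proof -
    have "hc F w \<in> topspace X \<inter> hc F ` cball 0 1" using that faces_cover by blast
    then show ?thesis using \<alpha>(2)[OF that(1)] fw[OF that] by simp
  qed
  have "norm (\<alpha> x) = 1" if "x \<in> topspace X" for x
    using that a unfolding faces_cover by auto
  then show ?thesis using that \<alpha>(1) a by blast
qed

lemma cone_point:
  assumes F: "F \<in> Fs" and w: "w \<in> cball 0 1"
  obtains i and \<mu> :: real where "i < 4" "0 \<le> \<mu>" "\<mu> < 1" "w \<noteq> 0 \<Longrightarrow> sgn w \<in> quarter_circle i \<and> side_coord F i (sgn w) = \<mu>"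
    "\<And>e. proper_pair e \<Longrightarrow> cone e F w = apex e F + norm w * ((1 - \<mu>) * corner_phase e F i + \<mu> * corner_phase e F (Suc i) - apex e F)"
proof (cases "w = 0")
  case True
  show ?thesis by (rule that[of 0 0]) (auto simp: True cone_def)
next
  case False
  then have s: "sgn w \<in> sphere 0 1" by (rule sgn_mem_sphere)
  obtain i where i: "i < 4" "sgn w \<in> quarter_circle i" using s by (rule sphere_quarter_circle)
  \<comment> \<open>A point at the far end of a side is assigned to the next side. This half-open
    convention makes sector and position unique, as injectivity of the cones will need.\<close>
  have "\<exists>j<4. sgn w \<in> quarter_circle j \<and> 0 \<le> side_coord F j (sgn w) \<and> side_coord F j (sgn w) < 1"
  proof (cases "side_coord F i (sgn w) = 1")
    case True
    have m: "cis ((real i + 1) * pi / 2) \<in> quarter_circle i"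
      unfolding mem_quarter_circle by (rule bexI[of _ 1]) auto
    then have sw: "sgn w = cis ((real i + 1) * pi / 2)"
      using True side_coord(3,4)[OF F i(1)] i(2) by (metis inj_onD)
    define j where "j = (if i = 3 then 0 else Suc i)"
    have j: "j < 4" using i(1) by (auto simp: j_def)
    have "cis ((real i + 1) * pi / 2) = cis (real j * pi / 2)"
    proof (cases "i = 3")
      case True
      have "cis ((real i + 1) * pi / 2) = cis (2 * pi)" by (rule arg_cong[of _ _ cis]) (simp add: True)
      then show ?thesis using True by (simp add: j_def)
    next
      case False
      then show ?thesis by (simp add: j_def add.commute)
    qed
    then have sj: "sgn w = cis (real j * pi / 2)" using sw by simp
    have "sgn w \<in> quarter_circle j" unfolding mem_quarter_circle sj by (rule bexI[of _ 0]) auto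
    moreover have "side_coord F j (sgn w) = 0" unfolding sj by (rule side_coord(2)[OF F j])
    ultimately show ?thesis using j by (intro exI[of _ j]) simp
  next
    case False
    then show ?thesis using side_coord(1)[OF F i] i by (intro exI[of _ i]) auto
  qed
  then obtain j where j: "j < 4" "sgn w \<in> quarter_circle j" "0 \<le> side_coord F j (sgn w)" "side_coord F j (sgn w) < 1" by blast
  show ?thesis
  proof (rule that[OF j(1,3,4)])
    show "sgn w \<in> quarter_circle j \<and> side_coord F j (sgn w) = side_coord F j (sgn w)" using j by simp
    show "cone e F w = apex e F + norm w * ((1 - side_coord F j (sgn w)) * corner_phase e F j + side_coord F j (sgn w) * corner_phase e F (Suc j) - apex e F)"
      if "proper_pair e" for e
      unfolding cone_def using boundary_phase_eq[OF F _ _ j(1,2), of e] that by simp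
  qed
qed

lemma sees_at_4: "sees_at e F 4 = sees_at e F 0" by (simp add: sees_at_def corner_colour_4)

lemma sees_at_excl: "proper_pair e \<Longrightarrow> proper_pair f \<Longrightarrow> e \<noteq> f \<Longrightarrow> sees_at e F i + sees_at f F i \<le> 1"
proof -
  assume e: "proper_pair e" and f: "proper_pair f" and ne: "e \<noteq> f"
  have "\<not> (sees_pair e v \<and> sees_pair f v)" for v
  proof
    assume "sees_pair e v \<and> sees_pair f v"
    then have "{fst e, snd e} = {fst f, snd f}" by (auto simp: sees_pair_def)
    then have "sorted_pair (fst e) (snd e) = sorted_pair (fst f) (snd f)" by (simp only: sorted_pair_eq_iff)
    then show False using e f ne by metis
  qed
  then show ?thesis by (auto simp: sees_at_def)
qed

lemma corner_phase_tt_parity: "F \<in> Fs \<Longrightarrow> odd (corner_phase e F i) \<longleftrightarrow> sees_at e F i = 1"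
proof -
  assume "F \<in> Fs"
  from corner_phase_parity[OF this, of e i] have "odd (corner_phase e F i) \<longleftrightarrow> odd (vertex_phase e (corner F i))"
    using even_add[of "corner_phase e F i - vertex_phase e (corner F i)" "vertex_phase e (corner F i)"] by simp
  then show ?thesis by (simp add: vertex_phase_def sees_at_def)
qed

text \<open>At a vertex an odd phase means that the pair is seen, and no vertex sees two pairs
  exactly. Inside an edge a phase that changes lies strictly between consecutive integers, so two
  odd phases would both be constant and odd at an end as well.\<close>

lemma edge_point_not_odd:
  fixes s :: real
  assumes F: "F \<in> Fs" and ef: "proper_pair e" "proper_pair f" "e \<noteq> f" and s: "0 \<le> s" "s \<le> 1"
    and o: "odd_real (corner_phase e F i + s * (corner_phase e F (Suc i) - corner_phase e F i))" "odd_real (corner_phase f F i + s * (corner_phase f F (Suc i) - corner_phase f F i))"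
  shows False
proof -
  have no: "\<not> (odd (corner_phase e F j) \<and> odd (corner_phase f F j))" for j
    using corner_phase_tt_parity[OF F] sees_at_excl[OF ef, of F j] by auto
  have edge_jump: "\<bar>corner_phase e' F (Suc i) - corner_phase e' F i\<bar> \<le> 1" for e'
    unfolding corner_phase_Suc using edge_jump_parity(3)[OF adjacent_corners(1)[OF F] face_walk(2)[OF F] face_walk(2)[OF F]] by simp
  have z: "corner_phase e' F (Suc i) = corner_phase e' F i" if s01: "0 < s" "s < 1" and od: "odd_real (corner_phase e' F i + s * (corner_phase e' F (Suc i) - corner_phase e' F i))" for e'
  proof (rule ccontr)
    assume ne: "corner_phase e' F (Suc i) \<noteq> corner_phase e' F i"
    then have "corner_phase e' F (Suc i) - corner_phase e' F i = 1 \<or> corner_phase e' F (Suc i) - corner_phase e' F i = -1" using edge_jump[of e'] by linarith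
    then have "of_int (corner_phase e' F (Suc i)) - of_int (corner_phase e' F i) = (1::real) \<or> of_int (corner_phase e' F (Suc i)) - of_int (corner_phase e' F i) = (-1::real)"
      by linarith
    moreover obtain n :: int where "corner_phase e' F i + s * (corner_phase e' F (Suc i) - corner_phase e' F i) = 2 * of_int n + 1"
      using od by (auto simp: odd_real_def)
    ultimately have "s = of_int (2 * n + 1 - corner_phase e' F i) \<or> s = of_int (corner_phase e' F i - 2 * n - 1)" by auto
    then show False
    proof
      assume "s = of_int (2 * n + 1 - corner_phase e' F i)"
      then have "0 < 2 * n + 1 - corner_phase e' F i" "2 * n + 1 - corner_phase e' F i < 1" using s01 by linarith+
      then show False by simp
    next
      assume "s = of_int (corner_phase e' F i - 2 * n - 1)"
      then have "0 < corner_phase e' F i - 2 * n - 1" "corner_phase e' F i - 2 * n - 1 < 1" using s01 by linarith+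
      then show False by simp
    qed
  qed
  consider "s = 0" | "s = 1" | "0 < s" "s < 1" using s by linarith
  then show False
  proof cases
    case 1 then show ?thesis using o no[of i] odd_real_of_int[of "corner_phase e F i"] odd_real_of_int[of "corner_phase f F i"] by simp
  next
    case 2 then show ?thesis using o no[of "Suc i"] odd_real_of_int[of "corner_phase e F (Suc i)"] odd_real_of_int[of "corner_phase f F (Suc i)"] by simp
  next
    case 3
    then have "corner_phase e F (Suc i) = corner_phase e F i" "corner_phase f F (Suc i) = corner_phase f F i" using z o by auto
    then show ?thesis using o no[of i] odd_real_of_int[of "corner_phase e F i"] odd_real_of_int[of "corner_phase f F i"] by simp
  qed
qed

text \<open>With two monochromatic diagonals the signs along each diagonal agree. The phase
  therefore always leaves its even base in the same direction.\<close>

lemma two_coloured_values: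
  assumes F: "F \<in> Fs" and e: "proper_pair e" and c: "corner_colour F 0 = corner_colour F 2" "corner_colour F 1 = corner_colour F 3"
  obtains B \<sigma> :: int where "\<sigma> = 1 \<or> \<sigma> = -1" "\<And>i. i \<le> 4 \<Longrightarrow> corner_phase e F i = 2 * B + \<sigma> * sees_at e F i"
proof -
  note t = types[OF F conjunct1[OF e] conjunct2[OF e]]
  have s: "sign_at e F 1 = sign_at e F 3" "sign_at e F 0 = sign_at e F 2" using t(7,8) c by auto
  have i4: "i = 0 \<or> i = 1 \<or> i = 2 \<or> i = 3 \<or> i = 4" if "i \<le> 4" for i :: nat using that by auto
  note pm = sees_at_01[of e F 0] sees_at_01[of e F 1] sees_at_01[of e F 2] sees_at_01[of e F 3] sign_at_pm[of e F 0] sign_at_pm[of e F 1]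
  have "\<exists>B \<sigma>. (\<sigma> = 1 \<or> \<sigma> = -1) \<and> (\<forall>i\<in>{0,1,2,3,4}. corner_phase e F i = 2 * B + \<sigma> * sees_at e F i)"
  proof (cases "sees_at e F 1 = 0 \<and> sees_at e F 3 = 0")
    case True
    have "\<exists>B. sees_at e F 0 * (1 + sign_at e F 1) = 2 * B" using pm(1,6) by (elim disjE) auto
    then obtain B where B: "sees_at e F 0 * (1 + sign_at e F 1) = 2 * B" by blast
    have "\<forall>i\<in>{0,1,2,3,4}. corner_phase e F i = 2 * B + (- sign_at e F 1) * sees_at e F i"
      using True s B unfolding ball_simps corner_phase_values by (simp add: sees_at_4 algebra_simps)
    then show ?thesis using pm(6) by (intro exI[of _ B] exI[of _ "- sign_at e F 1"]) auto
  next
    case False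
    then have "sees_at e F 0 = 0" "sees_at e F 2 = 0" using t(1-4) by auto
    then have "\<forall>i\<in>{0,1,2,3,4}. corner_phase e F i = 2 * 0 + (- sign_at e F 0) * sees_at e F i"
      using s unfolding ball_simps corner_phase_values by (simp add: sees_at_4 algebra_simps)
    then show ?thesis using pm(5) by (intro exI[of _ 0] exI[of _ "- sign_at e F 0"]) auto
  qed
  then obtain B \<sigma> where "\<sigma> = 1 \<or> \<sigma> = -1" and *: "\<forall>i\<in>{0,1,2,3,4}. corner_phase e F i = 2 * B + \<sigma> * sees_at e F i" by blast
  moreover have "corner_phase e F i = 2 * B + \<sigma> * sees_at e F i" if "i \<le> 4" for i using i4[OF that] * by auto
  ultimately show ?thesis using that by blast
qed

text \<open>The cases are distinguished by the monochromatic diagonals. If there is exactly one, the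
  apex has the phase of two opposite corners, so the cone folds every sector onto its side and
  \<open>edge_point_not_odd\<close> applies. If there is none, only the pairs of the two diagonals
  have a nonzero phase.\<close>

lemma not_both_odd:
  assumes F: "F \<in> Fs" and ef: "proper_pair e" "proper_pair f" "e \<noteq> f" and D: "{D0 F, D1 F} \<noteq> {e, f}"
    and w: "w \<in> cball 0 1" and o: "odd_real (cone e F w)" "odd_real (cone f F w)"
  shows False
proof -
  obtain i and \<mu> :: real where i: "i < 4" and \<mu>: "0 \<le> \<mu>" "\<mu> < 1"
    and "w \<noteq> 0 \<Longrightarrow> sgn w \<in> quarter_circle i \<and> side_coord F i (sgn w) = \<mu>"
    and cp: "\<And>e. proper_pair e \<Longrightarrow> cone e F w = apex e F + norm w * ((1 - \<mu>) * corner_phase e F i + \<mu> * corner_phase e F (Suc i) - apex e F)"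
    by (rule cone_point[OF F w]) blast
  define r where "r = norm w"
  have r: "0 \<le> r" "r \<le> 1" using w by (auto simp: r_def)
  have i4: "i = 0 \<or> i = 1 \<or> i = 2 \<or> i = 3" using i by auto
  have n: "Suc 0 = 1" "Suc 1 = 2" "Suc 2 = 3" "Suc 3 = 4" by simp_all
  have rm: "0 \<le> r * \<mu>" "r * \<mu> \<le> 1" "0 \<le> r * (1 - \<mu>)" "r * (1 - \<mu>) \<le> 1"
    using r \<mu> mult_mono[of r 1 \<mu> 1] mult_mono[of r 1 "1 - \<mu>" 1] by auto
  have low: False if "\<And>e'. proper_pair e' \<Longrightarrow> apex e' F = corner_phase e' F i"
    using edge_point_not_odd[OF F ef rm(1,2), of i] o cp[OF ef(1)] cp[OF ef(2)] that[OF ef(1)] that[OF ef(2)]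
    by (simp add: algebra_simps r_def)
  have high: False if "\<And>e'. proper_pair e' \<Longrightarrow> apex e' F = corner_phase e' F (Suc i)"
  proof -
    have "0 \<le> 1 - r * (1 - \<mu>)" "1 - r * (1 - \<mu>) \<le> 1" using rm by auto
    from edge_point_not_odd[OF F ef this, of i] show False
      using o cp[OF ef(1)] cp[OF ef(2)] that[OF ef(1)] that[OF ef(2)] by (simp add: algebra_simps r_def)
  qed
  consider "corner_colour F 0 = corner_colour F 2" "corner_colour F 1 = corner_colour F 3" | "corner_colour F 0 \<noteq> corner_colour F 2" "corner_colour F 1 = corner_colour F 3"
    | "corner_colour F 0 = corner_colour F 2" "corner_colour F 1 \<noteq> corner_colour F 3" | "corner_colour F 0 \<noteq> corner_colour F 2" "corner_colour F 1 \<noteq> corner_colour F 3" by blast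
  then show False
  proof cases
    case 1
    \<comment> \<open>The distance of the cone from its even base. An odd value needs weight 1, but
      the weights of two pairs add up to at most 1 since no corner sees both.\<close>
    define wt where "wt e' = (1 - r) * sees_at e' F 1 + r * ((1 - \<mu>) * sees_at e' F i + \<mu> * sees_at e' F (Suc i))" for e'
    have one: "wt e' = 1" if e': "proper_pair e'" and oe: "odd_real (cone e' F w)" for e'
    proof -
      obtain B \<sigma> :: int where \<sigma>: "\<sigma> = 1 \<or> \<sigma> = -1" and corner_phase: "\<And>i. i \<le> 4 \<Longrightarrow> corner_phase e' F i = 2 * B + \<sigma> * sees_at e' F i"
        using two_coloured_values[OF F e' 1] by metis
      have tr: "0 \<le> real_of_int (sees_at e' F j)" "real_of_int (sees_at e' F j) \<le> 1" for j using sees_at_01[of e' F j] by auto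
      have in01: "0 \<le> (1 - \<mu>) * sees_at e' F i + \<mu> * sees_at e' F (Suc i)" "(1 - \<mu>) * sees_at e' F i + \<mu> * sees_at e' F (Suc i) \<le> 1"
        using tr \<mu> convex_bound_le[of "real_of_int (sees_at e' F i)" 1 "real_of_int (sees_at e' F (Suc i))" "1 - \<mu>" \<mu>] by auto
      have w01: "0 \<le> wt e'" "wt e' \<le> 1"
        unfolding wt_def using tr in01 r convex_bound_le[of "real_of_int (sees_at e' F 1)" 1 "(1 - \<mu>) * sees_at e' F i + \<mu> * sees_at e' F (Suc i)" "1 - r" r] by auto
      have "cone e' F w = 2 * of_int B + of_int \<sigma> * wt e'"
        using cp[OF e'] corner_phase[of 1] corner_phase[of i] corner_phase[of "Suc i"] i 1 by (simp add: apex_def wt_def r_def algebra_simps)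
      then have "odd_real (of_int \<sigma> * wt e')" using oe odd_real_shift by simp
      then have "of_int \<sigma> * wt e' = 1 \<or> of_int \<sigma> * wt e' = -1" by (rule odd_real_unit) (use \<sigma> w01 in auto)
      then show ?thesis using \<sigma> w01 by auto
    qed
    have "wt e + wt f = (1 - r) * of_int (sees_at e F 1 + sees_at f F 1) + r * ((1 - \<mu>) * of_int (sees_at e F i + sees_at f F i) + \<mu> * of_int (sees_at e F (Suc i) + sees_at f F (Suc i)))"
      by (simp add: wt_def algebra_simps)
    also have "\<dots> \<le> (1 - r) * 1 + r * ((1 - \<mu>) * 1 + \<mu> * 1)"
    proof -
      have "real_of_int (sees_at e F j + sees_at f F j) \<le> 1" for j using sees_at_excl[OF ef, of F j] by linarith
      then show ?thesis using r \<mu> by (intro add_mono mult_left_mono) auto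
    qed
    finally show False using one[OF ef(1) o(1)] one[OF ef(2) o(2)] by simp
  next
    case 2
    have "apex e' F = corner_phase e' F 1 \<and> apex e' F = corner_phase e' F 3" if e': "proper_pair e'" for e'
    proof -
      note t = types[OF F conjunct1[OF e'] conjunct2[OF e']]
      have "corner_phase e' F 3 = corner_phase e' F 1" unfolding corner_phase_values(3,4) using t(6,7) 2 by simp
      then show ?thesis using 2 by (simp add: apex_def)
    qed
    note ap = conjunct1[OF this] conjunct2[OF this]
    show False using i4
    proof (elim disjE)
      assume "i = 0" then have si: "Suc i = 1" by simp
      show False by (rule high, unfold si, erule ap(1))
    next
      assume "i = 1" then show False using low ap(1) by simp
    next
      assume "i = 2" then have si: "Suc i = 3" by simp
      show False by (rule high, unfold si, erule ap(2))
    next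
      assume "i = 3" then show False using low ap(2) by simp
    qed
  next
    case 3
    have "apex e' F = corner_phase e' F 0 \<and> apex e' F = corner_phase e' F 2 \<and> apex e' F = corner_phase e' F 4" if e': "proper_pair e'" for e'
    proof -
      note t = types[OF F conjunct1[OF e'] conjunct2[OF e']]
      have "corner_phase e' F 2 = corner_phase e' F 0" unfolding corner_phase_values(2,3) using t(5,8) 3 by simp
      then show ?thesis using 3 corner_phase_closed[OF F conjunct1[OF e'] conjunct2[OF e']] by (simp add: apex_def)
    qed
    note ap = conjunct1[OF this] conjunct1[OF conjunct2[OF this]] conjunct2[OF conjunct2[OF this]]
    show False using i4
    proof (elim disjE)
      assume "i = 0" then show False using low ap(1) by simp
    next
      assume "i = 1" then have si: "Suc i = 2" by simp
      show False by (rule high, unfold si, erule ap(2))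
    next
      assume "i = 2" then show False using low ap(2) by simp
    next
      assume "i = 3" then have si: "Suc i = 4" by simp
      show False by (rule high, unfold si, erule ap(3))
    qed
  next
    case 4
    have zero: False if e': "proper_pair e'" "e' \<noteq> D0 F" "e' \<noteq> D1 F" "odd_real (cone e' F w)" for e'
    proof -
      note t = types[OF F conjunct1[OF e'(1)] conjunct2[OF e'(1)]]
      have t0: "sees_at e' F 0 = 0" "sees_at e' F 1 = 0" "sees_at e' F 2 = 0" "sees_at e' F 3 = 0" using t(5,6) 4 e'(2,3) by auto
      then have "corner_phase e' F 0 = 0" "corner_phase e' F 1 = 0" "corner_phase e' F 2 = 0" "corner_phase e' F 3 = 0" "corner_phase e' F 4 = 0" unfolding corner_phase_values by auto
      note P0 = this
      have "corner_phase e' F i = 0" using i4 P0 by (elim disjE) simp_all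
      moreover have "corner_phase e' F (Suc i) = 0" using i4
      proof (elim disjE)
        assume "i = 0" then have si: "Suc i = 1" by simp
        show ?thesis unfolding si by (rule P0(2))
      next
        assume "i = 1" then have si: "Suc i = 2" by simp
        show ?thesis unfolding si by (rule P0(3))
      next
        assume "i = 2" then have si: "Suc i = 3" by simp
        show ?thesis unfolding si by (rule P0(4))
      next
        assume "i = 3" then have si: "Suc i = 4" by simp
        show ?thesis unfolding si by (rule P0(5))
      qed
      moreover have "apex e' F = 0" using P0 by (simp add: apex_def)
      ultimately have "corner_phase e' F i = 0" "corner_phase e' F (Suc i) = 0" "apex e' F = 0" by auto
      then have "cone e' F w = of_int 0" using cp[OF e'(1)] by simp
      then show False using e'(4) odd_real_of_int[of 0] by simp
    qed
    show False
    proof (cases "e = D0 F \<or> e = D1 F")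
      case True
      then have "f \<noteq> D0 F" "f \<noteq> D1 F" using D ef(3) by auto
      then show False using zero[OF ef(2) _ _ o(2)] by blast
    next
      case False
      then show False using zero[OF ef(1) _ _ o(1)] by blast
    qed
  qed
qed

text \<open>Relative to the apex and up to signs, the phases of \<open>e\<close> and
  \<open>f\<close> at the corners are (0, 1), (1, 0), (0, -1), (-1, 0). The two cones together form
  a radial map of the disc to the diamond spanned by these points.\<close>

lemma crossing_face:
  assumes F: "F \<in> Fs" and ef: "proper_pair e" "proper_pair f" "e \<noteq> f" and D: "D1 F = e" "D0 F = f"
    and w: "w \<in> cball 0 1"
  obtains i and \<mu> :: real where "i < 4" "0 \<le> \<mu>" "\<mu> < 1"
    "w \<noteq> 0 \<Longrightarrow> sgn w \<in> quarter_circle i \<and> side_coord F i (sgn w) = \<mu>"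
    "(sign_at e F 1 * (cone e F w - apex e F), sign_at f F 0 * (cone f F w - apex f F)) =
     (if i = 0 then (norm w * \<mu>, norm w * (1 - \<mu>)) else if i = 1 then (norm w * (1 - \<mu>), - (norm w * \<mu>))
      else if i = 2 then (- (norm w * \<mu>), - (norm w * (1 - \<mu>))) else (- (norm w * (1 - \<mu>)), norm w * \<mu>))"
    "apex e F = 1" "apex f F = - sign_at f F 0"
proof -
  obtain i and \<mu> :: real where i: "i < 4" and \<mu>: "0 \<le> \<mu>" "\<mu> < 1"
    and s: "w \<noteq> 0 \<Longrightarrow> sgn w \<in> quarter_circle i \<and> side_coord F i (sgn w) = \<mu>"
    and cp: "\<And>e. proper_pair e \<Longrightarrow> cone e F w = apex e F + norm w * ((1 - \<mu>) * corner_phase e F i + \<mu> * corner_phase e F (Suc i) - apex e F)"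
    by (rule cone_point[OF F w]) blast
  note te = types[OF F conjunct1[OF ef(1)] conjunct2[OF ef(1)]] and tf = types[OF F conjunct1[OF ef(2)] conjunct2[OF ef(2)]]
  have c: "corner_colour F 1 \<noteq> corner_colour F 3" "corner_colour F 0 \<noteq> corner_colour F 2"
    using D ef(1,2) by (auto simp: D0_def D1_def sorted_pair_def)
  have e0: "sees_at e F 0 = 1" "sees_at e F 2 = 1" "sees_at e F 1 = 0" "sees_at e F 3 = 0" using te(5,6) c D ef(3) by auto
  have f0: "sees_at f F 0 = 0" "sees_at f F 2 = 0" "sees_at f F 1 = 1" "sees_at f F 3 = 1" using tf(5,6) c D ef(3) by auto
  have se: "sign_at e F 3 = - sign_at e F 1" using te(9) D c by simp
  have sf: "sign_at f F 2 = - sign_at f F 0" using tf(10) D c by simp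
  have Pe: "corner_phase e F 0 = 1" "corner_phase e F 1 = 1 + sign_at e F 1" "corner_phase e F 2 = 1" "corner_phase e F 3 = 1 - sign_at e F 1" "corner_phase e F 4 = 1"
    unfolding corner_phase_values e0 se by simp_all
  have Pf: "corner_phase f F 0 = 0" "corner_phase f F 1 = - sign_at f F 0" "corner_phase f F 2 = - 2 * sign_at f F 0" "corner_phase f F 3 = - sign_at f F 0" "corner_phase f F 4 = 0"
    unfolding corner_phase_values f0 sf by simp_all
  have ap: "apex e F = 1" "apex f F = - sign_at f F 0" using c Pe Pf by (simp_all add: apex_def)
  have sq: "real_of_int (sign_at e F 1) * real_of_int (sign_at e F 1) = 1" "real_of_int (sign_at f F 0) * real_of_int (sign_at f F 0) = 1"
    using sign_at_pm[of e F 1] sign_at_pm[of f F 0] by auto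
  define x where "x = real_of_int (sign_at e F 1)"
  define y where "y = real_of_int (sign_at f F 0)"
  have xy: "x * x = 1" "y * y = 1" using sq by (simp_all add: x_def y_def)
  have xx: "x * (t * (x * v)) = t * v" "y * (t * (y * v)) = t * v" for t v
    using xy by (metis mult.assoc mult.commute mult_1)+
  have xm: "x * (t * (v * x)) = t * v" "y * (t * (v * y)) = t * v" for t v
    using xx[of t v] by (simp_all add: mult_ac)
  have ce: "x * (cone e F w - apex e F) = x * (norm w * ((1 - \<mu>) * (real_of_int (corner_phase e F i) - 1) + \<mu> * (real_of_int (corner_phase e F (Suc i)) - 1)))"
    unfolding cp[OF ef(1)] ap by (simp add: algebra_simps)
  have cf: "y * (cone f F w - apex f F) = y * (norm w * ((1 - \<mu>) * (real_of_int (corner_phase f F i) + y) + \<mu> * (real_of_int (corner_phase f F (Suc i)) + y)))"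
    unfolding cp[OF ef(2)] ap y_def by (simp add: algebra_simps)
  have four: "i = 0 \<or> i = 1 \<or> i = 2 \<or> i = 3" using i by auto
  have si: "Suc 0 = 1" "Suc 1 = 2" "Suc 2 = 3" "Suc 3 = 4" by simp_all
  have main: "(x * (cone e F w - apex e F), y * (cone f F w - apex f F)) =
     (if i = 0 then (norm w * \<mu>, norm w * (1 - \<mu>)) else if i = 1 then (norm w * (1 - \<mu>), - (norm w * \<mu>))
      else if i = 2 then (- (norm w * \<mu>), - (norm w * (1 - \<mu>))) else (- (norm w * (1 - \<mu>)), norm w * \<mu>))"
    using four
  proof (elim disjE)
    assume i: "i = 0"
    have "real_of_int (corner_phase e F i) - 1 = 0" "real_of_int (corner_phase e F (Suc i)) - 1 = x" "real_of_int (corner_phase f F i) + y = y" "real_of_int (corner_phase f F (Suc i)) + y = 0"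
      unfolding i si Pe Pf by (simp_all add: x_def y_def)
    note H = this
    show ?thesis unfolding ce cf H unfolding i by (simp add: xm)
  next
    assume i: "i = 1"
    have "real_of_int (corner_phase e F i) - 1 = x" "real_of_int (corner_phase e F (Suc i)) - 1 = 0" "real_of_int (corner_phase f F i) + y = 0" "real_of_int (corner_phase f F (Suc i)) + y = - y"
      unfolding i si Pe Pf by (simp_all add: x_def y_def)
    note H = this
    show ?thesis unfolding ce cf H unfolding i by (simp add: xm)
  next
    assume i: "i = 2"
    have "real_of_int (corner_phase e F i) - 1 = 0" "real_of_int (corner_phase e F (Suc i)) - 1 = - x" "real_of_int (corner_phase f F i) + y = - y" "real_of_int (corner_phase f F (Suc i)) + y = 0"
      unfolding i si Pe Pf by (simp_all add: x_def y_def)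
    note H = this
    show ?thesis unfolding ce cf H unfolding i by (simp add: xm)
  next
    assume i: "i = 3"
    have "real_of_int (corner_phase e F i) - 1 = - x" "real_of_int (corner_phase e F (Suc i)) - 1 = 0" "real_of_int (corner_phase f F i) + y = 0" "real_of_int (corner_phase f F (Suc i)) + y = y"
      unfolding i si Pe Pf by (simp_all add: x_def y_def)
    note H = this
    show ?thesis unfolding ce cf H unfolding i by (simp add: xm)
  qed
  show ?thesis by (rule that[OF i \<mu> s]) (use main ap in \<open>simp_all add: x_def y_def\<close>)
qed

text \<open>Consequences of the diamond for an unordered pair of diagonals. The two deviations from
  the apex add up to \<open>norm w\<close>; two odd values would both have deviation 0, forcing the
  centre. Injectivity comes from the disjoint half-open quadrants.\<close>

lemma crossing_face_local:
  assumes F: "F \<in> Fs" and ef: "proper_pair e" "proper_pair f" "e \<noteq> f" and D: "{D0 F, D1 F} = {e, f}"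
  shows "odd_real (apex e F)" "odd_real (apex f F)"
    "w \<in> cball 0 1 \<Longrightarrow> \<bar>cone e F w - apex e F\<bar> \<le> norm w" "w \<in> cball 0 1 \<Longrightarrow> \<bar>cone f F w - apex f F\<bar> \<le> norm w"
    "w \<in> cball 0 1 \<Longrightarrow> odd_real (cone e F w) \<Longrightarrow> odd_real (cone f F w) \<Longrightarrow> w = 0"
    "w \<in> cball 0 1 \<Longrightarrow> w' \<in> cball 0 1 \<Longrightarrow> cone e F w = cone e F w' \<Longrightarrow> cone f F w = cone f F w' \<Longrightarrow> w = w'"
proof -
  have main: "odd_real (apex e F) \<and> odd_real (apex f F) \<and>
      (\<forall>w\<in>cball 0 1. \<bar>cone e F w - apex e F\<bar> \<le> norm w \<and> \<bar>cone f F w - apex f F\<bar> \<le> norm w \<and>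
        (odd_real (cone e F w) \<and> odd_real (cone f F w) \<longrightarrow> w = 0)) \<and>
      (\<forall>w\<in>cball 0 1. \<forall>w'\<in>cball 0 1. cone e F w = cone e F w' \<and> cone f F w = cone f F w' \<longrightarrow> w = w')"
    if ef: "proper_pair e" "proper_pair f" "e \<noteq> f" and D: "D1 F = e" "D0 F = f" for e f
  proof -
    define x where "x = real_of_int (sign_at e F 1)"
    define y where "y = real_of_int (sign_at f F 0)"
    have xy: "x = 1 \<or> x = -1" "y = 1 \<or> y = -1" using sign_at_pm[of e F 1] sign_at_pm[of f F 0] by (auto simp: x_def y_def)
    note cf = crossing_face[OF F ef D, folded x_def y_def]
    have ap: "apex e F = of_int 1" "apex f F = of_int (- sign_at f F 0)" by (rule cf[of 0], simp, simp)+
    have oa: "odd_real (apex e F)" "odd_real (apex f F)"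
      unfolding ap odd_real_of_int using sign_at_pm[of f F 0] by auto
    have 1: "\<bar>cone e F w - apex e F\<bar> \<le> norm w \<and> \<bar>cone f F w - apex f F\<bar> \<le> norm w \<and>
        \<bar>cone e F w - apex e F\<bar> + \<bar>cone f F w - apex f F\<bar> = norm w" if "w \<in> cball 0 1" for w
    proof (rule cf[OF that])
      fix i and \<mu> :: real assume \<mu>: "0 \<le> \<mu>" "\<mu> < 1" and
        eq: "(x * (cone e F w - apex e F), y * (cone f F w - apex f F)) =
     (if i = 0 then (norm w * \<mu>, norm w * (1 - \<mu>)) else if i = 1 then (norm w * (1 - \<mu>), - (norm w * \<mu>))
      else if i = 2 then (- (norm w * \<mu>), - (norm w * (1 - \<mu>))) else (- (norm w * (1 - \<mu>)), norm w * \<mu>))"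
      have "\<bar>x * (cone e F w - apex e F)\<bar> = \<bar>cone e F w - apex e F\<bar>" "\<bar>y * (cone f F w - apex f F)\<bar> = \<bar>cone f F w - apex f F\<bar>"
        using xy by (auto simp: abs_mult)
      moreover have nn: "0 \<le> norm w * \<mu>" "0 \<le> norm w * (1 - \<mu>)" using \<mu> by simp_all
      moreover have "norm w * \<mu> + norm w * (1 - \<mu>) = norm w" by (simp add: algebra_simps)
      moreover have "(\<bar>x * (cone e F w - apex e F)\<bar> = norm w * \<mu> \<and> \<bar>y * (cone f F w - apex f F)\<bar> = norm w * (1 - \<mu>)) \<or>
         (\<bar>x * (cone e F w - apex e F)\<bar> = norm w * (1 - \<mu>) \<and> \<bar>y * (cone f F w - apex f F)\<bar> = norm w * \<mu>)"
        using eq nn by (auto split: if_splits)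
      ultimately show ?thesis by auto
    qed
    have 2: "w = 0" if w: "w \<in> cball 0 1" and o: "odd_real (cone e F w)" "odd_real (cone f F w)" for w
    proof (rule ccontr)
      assume "w \<noteq> 0"
      have z: "cone e' F w = apex e' F" if od: "odd_real (apex e' F)" "odd_real (cone e' F w)" "\<bar>cone e' F w - apex e' F\<bar> \<le> 1" for e'
      proof -
        obtain n m :: int where "cone e' F w = 2 * real_of_int n + 1" "apex e' F = 2 * real_of_int m + 1"
          using od unfolding odd_real_def by blast
        moreover from this have "\<bar>2 * real_of_int n - 2 * real_of_int m\<bar> \<le> 1" using od(3) by simp
        then have "n = m" by linarith
        ultimately show ?thesis by simp
      qed
      have "norm w \<le> 1" using w by simp
      then have "cone e F w = apex e F" "cone f F w = apex f F" using 1[OF w] z oa o by auto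
      then show False using 1[OF w] \<open>w \<noteq> 0\<close> by simp
    qed
    have 3: "w = w'" if w: "w \<in> cball 0 1" "w' \<in> cball 0 1" and eq: "cone e F w = cone e F w'" "cone f F w = cone f F w'" for w w'
    proof -
      have nw: "norm w = norm w'" using 1[OF w(1)] 1[OF w(2)] eq by simp
      show ?thesis
      proof (cases "w = 0")
        case True then show ?thesis using nw by simp
      next
        case False
        then have w'0: "w' \<noteq> 0" using nw by auto
        show ?thesis
        proof (rule cf[OF w(1)], rule cf[OF w(2)])
          fix i j :: nat and \<mu> \<nu> :: real
          assume i: "i < 4" "0 \<le> \<mu>" "\<mu> < 1" "w \<noteq> 0 \<Longrightarrow> sgn w \<in> quarter_circle i \<and> side_coord F i (sgn w) = \<mu>"
            and j: "j < 4" "0 \<le> \<nu>" "\<nu> < 1" "w' \<noteq> 0 \<Longrightarrow> sgn w' \<in> quarter_circle j \<and> side_coord F j (sgn w') = \<nu>"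
            and ei: "(x * (cone e F w - apex e F), y * (cone f F w - apex f F)) =
     (if i = 0 then (norm w * \<mu>, norm w * (1 - \<mu>)) else if i = 1 then (norm w * (1 - \<mu>), - (norm w * \<mu>))
      else if i = 2 then (- (norm w * \<mu>), - (norm w * (1 - \<mu>))) else (- (norm w * (1 - \<mu>)), norm w * \<mu>))"
            and ej: "(x * (cone e F w' - apex e F), y * (cone f F w' - apex f F)) =
     (if j = 0 then (norm w' * \<nu>, norm w' * (1 - \<nu>)) else if j = 1 then (norm w' * (1 - \<nu>), - (norm w' * \<nu>))
      else if j = 2 then (- (norm w' * \<nu>), - (norm w' * (1 - \<nu>))) else (- (norm w' * (1 - \<nu>)), norm w' * \<nu>))"
          have "i = j \<and> norm w * \<mu> = norm w' * \<nu> \<and> norm w * (1 - \<mu>) = norm w' * (1 - \<nu>)"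
            by (rule rotated_pairs_unique[OF _ _ _ _ i(1) j(1)])
              (use i j False w'0 ei ej eq in \<open>simp_all only: zero_less_norm_iff, auto\<close>)
          then have "i = j" "\<mu> = \<nu>" using nw w'0 by auto
          then have "sgn w = sgn w'" using i(4)[OF False] j(4)[OF w'0] side_coord(4)[OF F j(1)] by (metis inj_onD)
          then have "norm w *\<^sub>R sgn w = norm w' *\<^sub>R sgn w'" using nw by simp
          then show ?thesis by (simp add: sgn_div_norm False w'0)
        qed
      qed
    qed
    show ?thesis using oa 1 2 3 by blast
  qed
  have "(D0 F = f \<and> D1 F = e) \<or> (D0 F = e \<and> D1 F = f)" using D by (auto simp: doubleton_eq_iff)
  then have all: "odd_real (apex e F) \<and> odd_real (apex f F) \<and>
      (\<forall>w\<in>cball 0 1. \<bar>cone e F w - apex e F\<bar> \<le> norm w \<and> \<bar>cone f F w - apex f F\<bar> \<le> norm w \<and>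
        (odd_real (cone e F w) \<and> odd_real (cone f F w) \<longrightarrow> w = 0)) \<and>
      (\<forall>w\<in>cball 0 1. \<forall>w'\<in>cball 0 1. cone e F w = cone e F w' \<and> cone f F w = cone f F w' \<longrightarrow> w = w')"
    using main[OF ef] main[OF ef(2,1) ef(3)[symmetric]] by blast
  show "odd_real (apex e F)" "odd_real (apex f F)"
    "w \<in> cball 0 1 \<Longrightarrow> \<bar>cone e F w - apex e F\<bar> \<le> norm w" "w \<in> cball 0 1 \<Longrightarrow> \<bar>cone f F w - apex f F\<bar> \<le> norm w"
    "w \<in> cball 0 1 \<Longrightarrow> odd_real (cone e F w) \<Longrightarrow> odd_real (cone f F w) \<Longrightarrow> w = 0"
    "w \<in> cball 0 1 \<Longrightarrow> w' \<in> cball 0 1 \<Longrightarrow> cone e F w = cone e F w' \<Longrightarrow> cone f F w = cone f F w' \<Longrightarrow> w = w'"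
    using all by blast+
qed

end

section \<open>The intersection number of two colour pairs\<close>

context disc_coloured
begin

text \<open>The zeros of \<open>\<Theta>\<close> in the disc are the preimages of the centres of the
  faces with diagonals \<open>e\<close> and \<open>f\<close>, each of local degree 1 or -1. The
  winding number of \<open>\<Theta>\<close> on the unit circle is then evaluated modulo 2 in two
  ways, by its zeros and by the boundary jumps.\<close>

lemma intersection_parity:
  fixes a b :: "complex \<Rightarrow> real" and m n :: "nat \<Rightarrow> int"
  assumes ef: "proper_pair e" "proper_pair f" "e \<noteq> f"
    and \<alpha>: "\<And>F w. F \<in> Fs \<Longrightarrow> w \<in> cball 0 1 \<Longrightarrow> \<alpha> (hc F w) = cis (pi * cone e F w)"
    and \<beta>: "\<And>F w. F \<in> Fs \<Longrightarrow> w \<in> cball 0 1 \<Longrightarrow> \<beta> (hc F w) = cis (pi * cone f F w)"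
    and ca: "continuous_on (cball 0 1) a" and cb: "continuous_on (cball 0 1) b"
    and a: "\<And>z. z \<in> cball 0 1 \<Longrightarrow> \<alpha> (q z) = cis (pi * a z)"
    and b: "\<And>z. z \<in> cball 0 1 \<Longrightarrow> \<beta> (q z) = cis (pi * b z)"
    and ma: "\<And>k t. k < g \<Longrightarrow> 2 * real k * pi / real g \<le> t \<Longrightarrow> t \<le> (2 * real k + 1) * pi / real g \<Longrightarrow>
       a (cis (t + pi / real g)) = a (cis t) + 2 * of_int (m k)"
    and nb: "\<And>k t. k < g \<Longrightarrow> 2 * real k * pi / real g \<le> t \<Longrightarrow> t \<le> (2 * real k + 1) * pi / real g \<Longrightarrow>
       b (cis (t + pi / real g)) = b (cis t) + 2 * of_int (n k)"
  shows "odd (\<Sum>k<g. m k * n k) \<longleftrightarrow> odd_crossings e f"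
proof -
  define Q where "Q = {F \<in> Fs. {D0 F, D1 F} = {e, f}}"
  define ctr where "ctr F = (SOME z. z \<in> ball 0 1 \<and> q z = hc F 0)" for F
  have ctr: "ctr F \<in> ball 0 1" "q (ctr F) = hc F 0" if "F \<in> Fs" for F
  proof -
    have "\<exists>z. z \<in> ball 0 1 \<and> q z = hc F 0" using hc0[OF that] by force
    from someI_ex[OF this] show "ctr F \<in> ball 0 1" "q (ctr F) = hc F 0" by (auto simp: ctr_def)
  qed
  have hc0F: "hc F 0 \<in> F" if "F \<in> Fs" for F using param_ball(1)[OF that hc[OF that]] by force
  define P where "P = ctr ` Q"
  have "inj_on ctr Q"
  proof (rule inj_onI)
    fix F F' assume F: "F \<in> Q" "F' \<in> Q" "ctr F = ctr F'"
    then have "hc F 0 = hc F' 0" using ctr(2) by (metis (mono_tags, lifting) Q_def mem_Collect_eq)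
    then show "F = F'" using F hc0F[of F] hc0F[of F'] face_disjoint[of F F'] by (auto simp: Q_def)
  qed
  then have cardP: "card P = card Q" unfolding P_def by (rule card_image)
  have finP: "finite P" unfolding P_def Q_def using finite_faces by simp
  have PB: "P \<subseteq> ball 0 1" unfolding P_def Q_def using ctr(1) by auto
  define \<Theta> where "\<Theta> z = sec (a z) (b z)" for z
  have c\<Theta>: "continuous_on (cball 0 1) \<Theta>" unfolding \<Theta>_def by (rule continuous_on_sec[OF ca cb])
  have od: "odd_real (a z) \<longleftrightarrow> odd_real (cone e F w)" "odd_real (b z) \<longleftrightarrow> odd_real (cone f F w)"
    if "z \<in> cball 0 1" "F \<in> Fs" "w \<in> cball 0 1" "q z = hc F w" for z F w
    using a[OF that(1)] b[OF that(1)] \<alpha>[OF that(2,3)] \<beta>[OF that(2,3)] that(4) by (simp_all add: odd_real_iff_cis)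
  have zeros: "\<Theta> z = 0 \<longleftrightarrow> z \<in> P" if z: "z \<in> cball 0 1" for z
  proof -
    have eq: "\<Theta> z = 0 \<longleftrightarrow> odd_real (a z) \<and> odd_real (b z)" unfolding \<Theta>_def sec_eq_0_iff odd_real_def by blast
    have "q z \<in> topspace X" using q_surj z by blast
    then obtain F w where F: "F \<in> Fs" and w: "w \<in> cball 0 1" "q z = hc F w" unfolding faces_cover by blast
    show ?thesis
    proof
      assume "\<Theta> z = 0"
      then have o: "odd_real (cone e F w)" "odd_real (cone f F w)" using eq od[OF z F w] by auto
      have D: "{D0 F, D1 F} = {e, f}" using not_both_odd[OF F ef _ w(1) o] by blast
      then have "w = 0" using crossing_face_local(5)[OF F ef D w(1) o] by blast
      then have "z = ctr F" using q_eq_ball[OF ctr(1)[OF F] z] ctr(2)[OF F] w(2) by simp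
      then show "z \<in> P" using F D by (auto simp: P_def Q_def)
    next
      assume "z \<in> P"
      then obtain F where F: "F \<in> Fs" and D: "{D0 F, D1 F} = {e, f}" and zF: "z = ctr F" by (auto simp: P_def Q_def)
      have "q z = hc F 0" using ctr(2)[OF F] zF by simp
      moreover have "cone e F 0 = apex e F" "cone f F 0 = apex f F" by (simp_all add: cone_def)
      ultimately show "\<Theta> z = 0" using eq od[OF z F, of 0] crossing_face_local(1,2)[OF F ef D] by simp
    qed
  qed
  have oz: "odd_zero \<Theta> p" if p: "p \<in> P" for p
  proof -
    obtain F where F: "F \<in> Fs" and D: "{D0 F, D1 F} = {e, f}" and pF: "p = ctr F" using p by (auto simp: P_def Q_def)
    note loc = crossing_face_local[OF F ef D]
    have pb: "p \<in> ball 0 1" "p \<in> cball 0 1" using ctr(1)[OF F] pF by auto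
    have "openin (top_of_set (cball 0 1)) {z \<in> cball 0 1. q z \<in> F}"
      using openin_continuous_map_preimage[OF q_cont openin_face[OF F]] by simp
    moreover have "p \<in> {z \<in> cball 0 1. q z \<in> F}" using pb ctr(2)[OF F] hc0F[OF F] pF by simp
    ultimately obtain d1 where d1: "d1 > 0" "\<And>z. z \<in> cball 0 1 \<Longrightarrow> dist z p < d1 \<Longrightarrow> q z \<in> F"
      unfolding openin_euclidean_subtopology_iff by blast
    obtain d2 where d2: "d2 > 0" "\<And>z. z \<in> cball 0 1 \<Longrightarrow> dist z p < d2 \<Longrightarrow> dist (a z) (a p) < 1"
      using ca pb(2) unfolding continuous_on_iff by (metis zero_less_one)
    obtain d3 where d3: "d3 > 0" "\<And>z. z \<in> cball 0 1 \<Longrightarrow> dist z p < d3 \<Longrightarrow> dist (b z) (b p) < 1"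
      using cb pb(2) unfolding continuous_on_iff by (metis zero_less_one)
    obtain d4 where d4: "d4 > 0" "ball p d4 \<subseteq> ball 0 1" using pb(1) open_contains_ball by (metis open_ball)
    define r where "r = Min {d1, d2, d3, d4} / 2"
    have r: "r > 0" "r < d1" "r < d2" "r < d3" "r < d4" using d1(1) d2(1) d3(1) d4(1) by (auto simp: r_def)
    have near: "z \<in> ball 0 1" "z \<in> cball 0 1" "q z \<in> F" "\<bar>a z - a p\<bar> < 1" "\<bar>b z - b p\<bar> < 1" if "z \<in> cball p r" for z
    proof -
      have dz: "dist z p \<le> r" using that by (simp add: dist_commute)
      then have "z \<in> ball p d4" using r by (simp add: dist_commute)
      then show zb: "z \<in> ball 0 1" using d4(2) by blast
      then show zc: "z \<in> cball 0 1" by simp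
      show "q z \<in> F" using d1(2)[OF zc] dz r by simp
      show "\<bar>a z - a p\<bar> < 1" "\<bar>b z - b p\<bar> < 1" using d2(2)[OF zc] d3(2)[OF zc] dz r by (simp_all add: dist_real_def)
    qed
    \<comment> \<open>The lift and the cone agree up to an even integer. Both deviate from their
      values at the centre by less than 1, so this integer does not change.\<close>
    have same: "x z - x p = cone e' F (hinv F (q z)) - apex e' F"
      if z: "z \<in> cball p r" and x: "\<And>z. z \<in> cball 0 1 \<Longrightarrow> \<gamma> (q z) = cis (pi * x z)"
        and \<gamma>: "\<And>F w. F \<in> Fs \<Longrightarrow> w \<in> cball 0 1 \<Longrightarrow> \<gamma> (hc F w) = cis (pi * cone e' F w)"
        and bd: "\<And>w. w \<in> cball 0 1 \<Longrightarrow> \<bar>cone e' F w - apex e' F\<bar> \<le> norm w" and xz: "\<bar>x z - x p\<bar> < 1" for z x \<gamma> e'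
    proof -
      have h: "hinv F (q z) \<in> ball 0 1" "hc F (hinv F (q z)) = q z" using hinv[OF F near(3)[OF z]] by auto
      then have hcb: "hinv F (q z) \<in> cball 0 1" by simp
      have "cis (pi * x z) = cis (pi * cone e' F (hinv F (q z)))"
        using x[OF near(2)[OF z]] \<gamma>[OF F hcb] h(2) by simp
      then obtain k where k: "x z = cone e' F (hinv F (q z)) + 2 * of_int k" unfolding cis_pi_eq_iff by blast
      have "cis (pi * x p) = cis (pi * apex e' F)"
        using x[OF pb(2)] \<gamma>[OF F, of 0] ctr(2)[OF F] pF by (simp add: cone_def)
      then obtain l where l: "x p = apex e' F + 2 * of_int l" unfolding cis_pi_eq_iff by blast
      have "\<bar>cone e' F (hinv F (q z)) - apex e' F\<bar> < 1" using bd[OF hcb] h(1) by simp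
      then have "\<bar>2 * real_of_int k - 2 * real_of_int l\<bar> < 2" using xz k l by linarith
      then have "k = l" by linarith
      then show ?thesis using k l by simp
    qed
    have sa: "a z - a p = cone e F (hinv F (q z)) - apex e F" "b z - b p = cone f F (hinv F (q z)) - apex f F"
      if "z \<in> cball p r" for z
      using same[OF that a \<alpha> loc(3) near(4)[OF that]] same[OF that b \<beta> loc(4) near(5)[OF that]] by blast+
    have cpr: "cball p r \<subseteq> cball 0 1" using near(2) by blast
    have cap: "continuous_on (cball p r) a" "continuous_on (cball p r) b"
      using continuous_on_subset[OF ca cpr] continuous_on_subset[OF cb cpr] by blast+
    \<comment> \<open>An even translation puts the zero at (1, 1), the middle of the square on which
      \<open>sec\<close> is injective. By the transformation law the translation costs only a
      nonvanishing factor.\<close>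
    define \<Psi> where "\<Psi> z = sec (1 + (a z - a p)) (1 + (b z - b p))" for z
    have c\<Psi>: "continuous_on (cball p r) \<Psi>" unfolding \<Psi>_def
      by (intro continuous_on_sec continuous_intros cap)
    have "inj_on \<Psi> (cball p r)"
    proof (rule inj_onI)
      fix z z' assume z: "z \<in> cball p r" "z' \<in> cball p r" "\<Psi> z = \<Psi> z'"
      have "1 + (a z - a p) = 1 + (a z' - a p) \<and> 1 + (b z - b p) = 1 + (b z' - b p)"
        by (rule inj_sec) (use near(4,5)[OF z(1)] near(4,5)[OF z(2)] z(3) in \<open>auto simp: \<Psi>_def\<close>)
      then have "cone e F (hinv F (q z)) = cone e F (hinv F (q z'))" "cone f F (hinv F (q z)) = cone f F (hinv F (q z'))"
        using sa[OF z(1)] sa[OF z(2)] by auto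
      moreover have h: "hinv F (q z) \<in> cball 0 1" "hinv F (q z') \<in> cball 0 1"
        using hinv(1)[OF F near(3)[OF z(1)]] hinv(1)[OF F near(3)[OF z(2)]] by auto
      ultimately have "hinv F (q z) = hinv F (q z')" using loc(6) by blast
      then have "q z = q z'" using hinv(2)[OF F near(3)[OF z(1)]] hinv(2)[OF F near(3)[OF z(2)]] by metis
      then show "z = z'" using q_eq_ball[OF near(1)[OF z(1)] near(2)[OF z(2)]] by blast
    qed
    moreover have "\<Psi> p = 0" using sec_eq_0_iff[of 1 1] by (auto simp: \<Psi>_def intro!: exI[of _ "0::int"])
    ultimately have oz\<Psi>: "odd_zero \<Psi> p" using odd_zero_injective[OF r(1) c\<Psi>] by blast
    have "\<Theta> p = 0" using zeros[OF pb(2)] p by blast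
    then obtain M N :: int where MN: "a p = 2 * of_int M + 1" "b p = 2 * of_int N + 1"
      unfolding \<Theta>_def sec_eq_0_iff by blast
    show ?thesis
    proof (rule odd_zero_mult[OF oz\<Psi> r(1)])
      show "continuous_on (cball p r) (\<lambda>z. cis (pi * of_int N * (1 + (a z - a p))))"
        by (intro continuous_intros cap)
      show "\<Theta> z = \<Psi> z * cis (pi * of_int N * (1 + (a z - a p)))" if "z \<in> cball p r" for z
      proof -
        have "\<Theta> z = sec ((1 + (a z - a p)) + 2 * of_int M) ((1 + (b z - b p)) + 2 * of_int N)"
          unfolding \<Theta>_def MN by (simp add: algebra_simps)
        then show ?thesis unfolding sec_shift_x unfolding sec_shift_y \<Psi>_def by (simp only: mult.commute)
      qed
    qed auto
  qed
  have "continuous_on {0..2*pi} (\<lambda>t. \<Theta> (cis t))"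
    by (rule continuous_on_compose2[OF c\<Theta>]) (auto intro!: continuous_intros)
  moreover have "\<Theta> (cis t) \<noteq> 0" for t using zeros[of "cis t"] PB by auto
  ultimately obtain \<Lambda> where \<Lambda>: "continuous_on {0..2*pi} \<Lambda>" "\<And>t. t \<in> {0..2*pi} \<Longrightarrow> \<Theta> (cis t) = exp (\<Lambda> t)"
    using continuous_logarithm_on_contractible[of "{0..2*pi}" "\<lambda>t. \<Theta> (cis t)"] convex_imp_contractible[of "{0..2*pi}"] by auto
  obtain k :: int where k: "\<Lambda> (2*pi) - \<Lambda> 0 = 2 * pi * \<i> * of_int k" "even k \<longleftrightarrow> even (card P)"
    using winding_parity_zeros[OF finP PB c\<Theta> zeros oz \<Lambda>(1)] \<Lambda>(2) by metis
  have ca': "continuous_on (sphere 0 1) a" and cb': "continuous_on (sphere 0 1) b"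
    using ca cb by (auto intro: continuous_on_subset)
  have "\<exists>j::int. \<Lambda> (2*pi) - \<Lambda> 0 = 2 * pi * \<i> * of_int j \<and> (even j \<longleftrightarrow> even (\<Sum>k<g. m k * n k))"
    by (rule boundary_winding_parity(2)[OF g ca' cb' ma nb \<Lambda>(1)]) (use \<Lambda>(2) in \<open>auto simp: \<Theta>_def\<close>)
  then obtain j :: int where j: "\<Lambda> (2*pi) - \<Lambda> 0 = 2 * pi * \<i> * of_int j" "even j \<longleftrightarrow> even (\<Sum>k<g. m k * n k)"
    by blast
  have "2 * pi * \<i> * of_int k = 2 * pi * \<i> * of_int j" using k(1) j(1) by simp
  then have "k = j" by simp
  then show ?thesis using k(2) j(2) cardP unfolding odd_crossings_def Q_def by simp
qed

text \<open>On the even vectors of length four over the field with two elements the standard bilinear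
  form is alternating of rank two.\<close>

lemma dot_product_rank_two:
  fixes m n :: "nat \<Rightarrow> int"
  assumes "g \<le> 4" "(\<Sum>k<g. m k) = 0" "(\<Sum>k<g. n k) = 0"
  defines "x \<equiv> \<lambda>(r::nat \<Rightarrow> int) k. if k < g then r k else 0"
  shows "odd (\<Sum>k<g. m k * n k) \<longleftrightarrow> odd ((x m 0 + x m 1) * (x n 0 + x n 2) + (x n 0 + x n 1) * (x m 0 + x m 2))"
proof -
  have sum4: "(\<Sum>k<g. h k) = h' 0 + h' 1 + h' 2 + h' 3" if "\<And>k. h' k = (if k < g then h k else 0)" for h h' :: "nat \<Rightarrow> int"
  proof -
    have "{..<g} = {..<4} \<inter> {k. k < g}" using assms(1) by auto
    then have "(\<Sum>k<g. h k) = (\<Sum>k<4. if k < g then h k else 0)" by (simp add: sum.If_cases)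
    also have "\<dots> = (\<Sum>k<4. h' k)" using that by simp
    finally show ?thesis by (simp add: eval_nat_numeral)
  qed
  have s: "x m 0 + x m 1 + x m 2 + x m 3 = 0" "x n 0 + x n 1 + x n 2 + x n 3 = 0"
    using sum4[of "x m" m] sum4[of "x n" n] assms(2,3) by (simp_all add: x_def)
  have m3: "x m 3 = - x m 0 - x m 1 - x m 2" "x n 3 = - x n 0 - x n 1 - x n 2" using s by linarith+
  have "(\<Sum>k<g. m k * n k) = x m 0 * x n 0 + x m 1 * x n 1 + x m 2 * x n 2 + x m 3 * x n 3"
    by (rule sum4) (simp add: x_def)
  \<comment> \<open>Eliminating the last entries leaves the determinant of two coordinates that are
    even on the all-one vector, up to an even term.\<close>
  also have "\<dots> = (x m 0 + x m 1) * (x n 0 + x n 2) + (x n 0 + x n 1) * (x m 0 + x m 2)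
      + 2 * (x m 1 * x n 1 + x m 2 * x n 2)"
    unfolding m3 by (simp add: algebra_simps)
  finally show ?thesis by simp
qed

theorem genus_le_4_even:
  assumes g4: "g \<le> 4"
  shows "even (card {e \<in> E. breaks_consistency X V E W e})"
proof -
  let ?P = "pairs_of (c ` V)"
  \<comment> \<open>Bundles a lift for one pair with its jumps. The jumps must be chosen for each
    \<open>e\<close> once and for all, because the coordinates in \<open>not_rank_two\<close> are
    functions of a single pair.\<close>
  define good where "good e a m \<longleftrightarrow> continuous_on (cball 0 1) a \<and>
      (\<exists>\<alpha>. (\<forall>F\<in>Fs. \<forall>w\<in>cball 0 1. \<alpha> (hc F w) = cis (pi * cone e F w)) \<and> (\<forall>z\<in>cball 0 1. \<alpha> (q z) = cis (pi * a z))) \<and>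
      (\<forall>k t. k < g \<longrightarrow> 2 * real k * pi / real g \<le> t \<longrightarrow> t \<le> (2 * real k + 1) * pi / real g \<longrightarrow>
       a (cis (t + pi / real g)) = a (cis t) + 2 * of_int (m k))" for e and a :: "complex \<Rightarrow> real" and m :: "nat \<Rightarrow> int"
  have ex: "\<exists>a m. good e a m" if pe: "proper_pair e" for e
  proof -
    obtain \<alpha> where \<alpha>: "continuous_map X euclidean \<alpha>" "\<And>x. x \<in> topspace X \<Longrightarrow> norm (\<alpha> x) = 1"
      "\<And>F w. F \<in> Fs \<Longrightarrow> w \<in> cball 0 1 \<Longrightarrow> \<alpha> (hc F w) = cis (pi * cone e F w)"
      by (rule alpha_exists[OF pe]) blast
    obtain a m where "continuous_on (cball 0 1) a" "\<And>z. z \<in> cball 0 1 \<Longrightarrow> \<alpha> (q z) = cis (pi * a z)"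
      "\<And>k t. k < g \<Longrightarrow> 2 * real k * pi / real g \<le> t \<Longrightarrow> t \<le> (2 * real k + 1) * pi / real g \<Longrightarrow>
       a (cis (t + pi / real g)) = a (cis t) + 2 * of_int (m k)"
      by (rule circle_lift[OF \<alpha>(1,2)]) blast+
    then show ?thesis unfolding good_def using \<alpha>(3) by blast
  qed
  then obtain a m where am: "\<And>e. proper_pair e \<Longrightarrow> good e (a e) (m e)" by metis
  have sum0: "(\<Sum>k<g. m e k) = 0" if "proper_pair e" for e
  proof (rule boundary_winding_parity(1)[OF g, of "a e" "a e"])
    show "continuous_on (sphere 0 1) (a e)" "continuous_on (sphere 0 1) (a e)"
      using am[OF that] unfolding good_def by (auto intro: continuous_on_subset)
  qed (use am[OF that] in \<open>auto simp: good_def\<close>)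
  define x where "x r k = (if k < g then r k else 0 :: int)" for r :: "nat \<Rightarrow> int" and k
  show ?thesis
  proof (rule not_rank_two[of "\<lambda>e. x (m e) 0 + x (m e) 1" "\<lambda>e. x (m e) 0 + x (m e) 2"])
    fix e f assume "e \<in> ?P" "f \<in> ?P" and ne: "e \<noteq> f"
    then have e: "proper_pair e" and f: "proper_pair f" using proper_pairs_of by blast+
    obtain \<alpha> where \<alpha>: "\<forall>F\<in>Fs. \<forall>w\<in>cball 0 1. \<alpha> (hc F w) = cis (pi * cone e F w)" "\<forall>z\<in>cball 0 1. \<alpha> (q z) = cis (pi * a e z)"
      using am[OF e] unfolding good_def by blast
    obtain \<beta> where \<beta>: "\<forall>F\<in>Fs. \<forall>w\<in>cball 0 1. \<beta> (hc F w) = cis (pi * cone f F w)" "\<forall>z\<in>cball 0 1. \<beta> (q z) = cis (pi * a f z)"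
      using am[OF f] unfolding good_def by blast
    have "odd (\<Sum>k<g. m e k * m f k) \<longleftrightarrow> odd_crossings e f"
      by (rule intersection_parity[OF e f ne, of \<alpha> \<beta> "a e" "a f"])
        (use \<alpha> \<beta> am[OF e] am[OF f] in \<open>auto simp: good_def\<close>)
    then show "odd_crossings e f \<longleftrightarrow> odd ((x (m e) 0 + x (m e) 1) * (x (m f) 0 + x (m f) 2) + (x (m f) 0 + x (m f) 1) * (x (m e) 0 + x (m e) 2))"
      using dot_product_rank_two[OF g4 sum0[OF e] sum0[OF f]] unfolding x_def by simp
  qed
qed

end

lemma local_coloring_mono:
  "local_coloring V adj k c \<Longrightarrow> k \<le> k' \<Longrightarrow> local_coloring V adj k' c"
  unfolding local_coloring_def by (meson diff_le_mono le_trans)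

theorem local_chromatic_ge_4:
  fixes X :: "'a topology"
  assumes X: "nonorientable_surface g X" and g4: "g \<le> 4" and odd: "odd_quadrangulation X V E"
  shows "4 \<le> local_chromatic_number V (adjacent V E)"
proof (rule ccontr)
  assume less: "\<not> 4 \<le> local_chromatic_number V (adjacent V E)"
  obtain W where W: "face_orientation X V E W" "odd (card {e \<in> E. breaks_consistency X V E W e})"
    and quad: "quadrangulation X V E" using odd unfolding odd_quadrangulation_def by blast
  interpret oriented_quadrangulation X V E W
    using quad W(1) by unfold_locales (auto simp: quadrangulation_def)
  obtain f :: "'a \<Rightarrow> nat" where f: "inj_on f V" using finite_imp_inj_to_nat_seg[OF finite_graph(1)] by metis
  \<comment> \<open>Some number of colours works, so the minimum in the definition is
    attained.\<close>
  have "local_coloring V (adjacent V E) (card V + 1) f"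
  proof -
    have "finite (f ` neighborhood V (adjacent V E) v) \<and> card (f ` neighborhood V (adjacent V E) v) \<le> card V" for v
    proof -
      have s: "neighborhood V (adjacent V E) v \<subseteq> V" by (auto simp: neighborhood_def)
      then have "finite (neighborhood V (adjacent V E) v)" using finite_graph(1) finite_subset by blast
      then show ?thesis using card_image_le[of "neighborhood V (adjacent V E) v" f] card_mono[OF finite_graph(1) s] by auto
    qed
    moreover have "proper_coloring V (adjacent V E) f"
      using f by (auto simp: proper_coloring_def adjacent_def inj_on_def)
    ultimately show ?thesis by (simp add: local_coloring_def)
  qed
  then have "\<exists>k. \<exists>c :: 'a \<Rightarrow> nat. local_coloring V (adjacent V E) k c" by blast
  from LeastI_ex[OF this] obtain c :: "'a \<Rightarrow> nat" where
    "local_coloring V (adjacent V E) (local_chromatic_number V (adjacent V E)) c"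
    unfolding local_chromatic_number_def by blast
  then have col: "local_coloring V (adjacent V E) 3 c" by (rule local_coloring_mono) (use less in simp)
  obtain q where q: "quotient_map (top_of_set (cball (0::complex) 1)) X q"
    "\<And>x y. x \<in> cball 0 1 \<Longrightarrow> y \<in> cball 0 1 \<Longrightarrow> q x = q y \<longleftrightarrow> (x, y) \<in> (crosscap_gluing g \<union> (crosscap_gluing g)\<inverse>)\<^sup>*"
    using X unfolding nonorientable_surface_def by blast
  interpret M: crosscap_model X g q
    using X q by unfold_locales (auto simp: nonorientable_surface_def)
  \<comment> \<open>A face is open, so it contains images of points of the open disc; recentre it at
    one of them.\<close>
  have "\<exists>h. face_param F h \<and> h 0 \<in> q ` ball 0 1" if F: "F \<in> Fs" for F
  proof -
    have "F \<noteq> {}" using param_ball(1)[OF F face_walk(4)[OF F]] by force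
    then obtain x where "x \<in> F" by blast
    obtain z U where "z \<in> U" "U \<subseteq> ball 0 1" "q ` U \<subseteq> F"
      using M.open_meets_ball[OF openin_face[OF F] \<open>x \<in> F\<close>] by metis
    then have z: "z \<in> ball 0 1" "q z \<in> F" by auto
    obtain h where "face_param F h" "h 0 = q z" by (rule face_param_recentre[OF F face_walk(4)[OF F] z(2)])
    then show ?thesis using z(1) by auto
  qed
  then obtain hc where hc: "\<And>F. F \<in> Fs \<Longrightarrow> face_param F (hc F) \<and> hc F 0 \<in> q ` ball 0 1" by metis
  interpret disc_coloured X V E W c g q hc
    using col hc by unfold_locales auto
  show False using genus_le_4_even[OF g4] W(2) by blast
qed

section \<open>The disc as a square\<close>

text \<open>The radial map from Euclidean circles to diamonds of the same radius.
  \<open>square\<close> turns and scales the diamond into the unit square with the point 1 at the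
  corner (0, 0).\<close>

definition diamond :: "complex \<Rightarrow> complex" where
  "diamond z = of_real (cmod z / (\<bar>Re z\<bar> + \<bar>Im z\<bar>)) * z"

definition square :: "complex \<Rightarrow> real \<times> real" where
  "square z = ((1 - Re (diamond z) + Im (diamond z)) / 2, (1 - Re (diamond z) - Im (diamond z)) / 2)"

definition square_side :: "nat \<Rightarrow> real \<Rightarrow> real \<times> real" where
  "square_side n t = (if n = 0 then (t, 0) else if n = 1 then (1, t) else if n = 2 then (1 - t, 1) else (0, 1 - t))"

lemma l1_pos: "z \<noteq> 0 \<Longrightarrow> \<bar>Re z\<bar> + \<bar>Im z\<bar> > 0" for z :: complex
  by (auto simp: complex_eq_iff)

lemma diamond_l1: "\<bar>Re (diamond z)\<bar> + \<bar>Im (diamond z)\<bar> = cmod z"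
proof (cases "z = 0")
  case False
  then have "\<bar>Re z\<bar> + \<bar>Im z\<bar> > 0" by (rule l1_pos)
  then show ?thesis by (simp add: diamond_def abs_mult divide_simps distrib_left [symmetric])
qed (simp add: diamond_def)

lemma diamond_inverse: "diamond z * of_real ((\<bar>Re (diamond z)\<bar> + \<bar>Im (diamond z)\<bar>) / cmod (diamond z)) = z"
proof (cases "z = 0")
  case False
  have p: "\<bar>Re z\<bar> + \<bar>Im z\<bar> > 0" using False by (rule l1_pos)
  have "cmod (diamond z) = cmod z * cmod z / (\<bar>Re z\<bar> + \<bar>Im z\<bar>)"
    unfolding diamond_def norm_mult norm_of_real using p by simp
  then have "(cmod z / (\<bar>Re z\<bar> + \<bar>Im z\<bar>)) * (cmod z / cmod (diamond z)) = 1"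
    using p False by simp
  then have "of_real ((cmod z / (\<bar>Re z\<bar> + \<bar>Im z\<bar>)) * (cmod z / cmod (diamond z))) * z = z" by simp
  then show ?thesis unfolding diamond_l1 unfolding diamond_def[of z] of_real_mult
    by (simp only: mult_ac)
qed (simp add: diamond_def)

lemma diamond_surj: "diamond (w * of_real ((\<bar>Re w\<bar> + \<bar>Im w\<bar>) / cmod w)) = w" (is "diamond ?z = w")
proof (cases "w = 0")
  case False
  define r where "r = (\<bar>Re w\<bar> + \<bar>Im w\<bar>) / cmod w"
  have p: "\<bar>Re w\<bar> + \<bar>Im w\<bar> > 0" using False by (rule l1_pos)
  then have r: "r > 0" using False by (simp add: r_def)
  have "cmod (w * of_real r) / (\<bar>Re (w * of_real r)\<bar> + \<bar>Im (w * of_real r)\<bar>) = cmod w / (\<bar>Re w\<bar> + \<bar>Im w\<bar>)"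
    using r p by (simp add: norm_mult abs_mult distrib_right [symmetric])
  moreover have "cmod w / (\<bar>Re w\<bar> + \<bar>Im w\<bar>) * r = 1" using p False by (simp add: r_def)
  then have "of_real (cmod w / (\<bar>Re w\<bar> + \<bar>Im w\<bar>)) * (w * of_real r) = w"
    by (metis mult.assoc mult.commute mult_1 of_real_1 of_real_mult)
  ultimately show ?thesis unfolding r_def[symmetric] diamond_def[of "w * of_real r"] by simp
qed (simp add: diamond_def)

lemma norm_le_l1: "cmod z \<le> \<bar>Re z\<bar> + \<bar>Im z\<bar>"
  by (rule cmod_le)

lemma continuous_on_diamond: "continuous_on UNIV diamond"
proof -
  have "isCont diamond z" for z
  proof (cases "z = 0")
    case True
    have "((\<lambda>z. cmod z) \<longlongrightarrow> 0) (at 0)" by (intro tendsto_eq_intros) auto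
    moreover have "cmod (diamond z) \<le> cmod z" for z
      using norm_le_l1[of "diamond z"] diamond_l1[of z] by simp
    ultimately have "(diamond \<longlongrightarrow> 0) (at 0)" by (intro Lim_null_comparison[of diamond cmod]) auto
    then show ?thesis using True by (simp add: isCont_def diamond_def)
  next
    case False
    then have "\<bar>Re z\<bar> + \<bar>Im z\<bar> \<noteq> 0" using l1_pos[of z] by simp
    then show ?thesis unfolding diamond_def[abs_def]
      by (intro continuous_intros linear_continuous_at[OF bounded_linear_Re] linear_continuous_at[OF bounded_linear_Im])
  qed
  then show ?thesis by (simp add: continuous_at_imp_continuous_on)
qed

lemma continuous_on_square: "continuous_on S square"
  unfolding square_def using continuous_on_subset[OF continuous_on_diamond subset_UNIV, of S]
  by (intro continuous_intros) auto

lemma inj_square: "inj square"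
proof (rule injI)
  fix z w assume eq: "square z = square w"
  have "1 - Re (diamond z) + Im (diamond z) = 1 - Re (diamond w) + Im (diamond w)"
    "1 - Re (diamond z) - Im (diamond z) = 1 - Re (diamond w) - Im (diamond w)"
    using eq by (simp_all add: square_def)
  then have "Re (diamond z) = Re (diamond w) \<and> Im (diamond z) = Im (diamond w)" by linarith
  then have "diamond z = diamond w" by (simp add: complex_eq_iff)
  then show "z = w" using diamond_inverse[of z] diamond_inverse[of w] by simp
qed

lemma square_cball: "square ` cball 0 1 \<subseteq> {0..1} \<times> {0..1}"
proof
  fix p assume "p \<in> square ` cball 0 1"
  then obtain z where "cmod z \<le> 1" "p = square z" by auto
  then show "p \<in> {0..1} \<times> {0..1}" using diamond_l1[of z] by (auto simp: square_def)
qed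

lemma square_ball: "square ` ball 0 1 = {0<..<1} \<times> {0<..<1}"
proof
  show "square ` ball 0 1 \<subseteq> {0<..<1} \<times> {0<..<1}"
  proof
    fix p assume "p \<in> square ` ball 0 1"
    then obtain z where "cmod z < 1" "p = square z" by auto
    then show "p \<in> {0<..<1} \<times> {0<..<1}" using diamond_l1[of z] by (auto simp: square_def)
  qed
  show "{0<..<1} \<times> {0<..<1} \<subseteq> square ` ball 0 1"
  proof
    fix p :: "real \<times> real" assume p: "p \<in> {0<..<1} \<times> {0<..<1}"
    define w where "w = Complex (1 - fst p - snd p) (fst p - snd p)"
    define z where "z = w * of_real ((\<bar>Re w\<bar> + \<bar>Im w\<bar>) / cmod w)"
    have d: "diamond z = w" unfolding z_def by (rule diamond_surj)
    have "\<bar>Re w\<bar> + \<bar>Im w\<bar> < 1" using p by (auto simp: w_def abs_if)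
    then have "cmod z < 1" using diamond_l1[of z] d by simp
    moreover have "square z = p" by (cases p) (simp add: square_def d w_def)
    ultimately show "p \<in> square ` ball 0 1" by force
  qed
qed

lemma mem_quarter_circle_0: "z \<in> quarter_circle 0 \<longleftrightarrow> cmod z = 1 \<and> 0 \<le> Re z \<and> 0 \<le> Im z"
proof
  assume "z \<in> quarter_circle 0"
  then obtain t where "0 \<le> t" "t \<le> pi / 2" "z = cis t" by (auto simp: quarter_circle_def)
  then show "cmod z = 1 \<and> 0 \<le> Re z \<and> 0 \<le> Im z" by (auto intro!: cos_ge_zero sin_ge_zero)
next
  assume z: "cmod z = 1 \<and> 0 \<le> Re z \<and> 0 \<le> Im z"
  then have s: "(Re z)\<^sup>2 + (Im z)\<^sup>2 = 1" by (metis cmod_power2 one_power2)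
  have R: "Re z \<le> 1" using abs_Re_le_cmod[of z] z by simp
  have "Im z = sqrt (1 - (Re z)\<^sup>2)" using s z by (intro real_sqrt_unique[symmetric]) (auto simp: algebra_simps)
  then have "z = cis (arccos (Re z))" using z R by (simp add: complex_eq_iff sin_arccos)
  moreover have "0 \<le> arccos (Re z)" "arccos (Re z) \<le> pi / 2"
    using z R arccos_le_pi2[of "Re z"] arccos_lbound[of "Re z"] by auto
  ultimately show "z \<in> quarter_circle 0" unfolding quarter_circle_def by auto
qed

lemma i_power_cis: "\<i> ^ n = cis (real n * pi / 2)"
  using Complex.DeMoivre[of "pi / 2" n] unfolding cis_pi_half by (simp only: times_divide_eq_right)

lemma quarter_circle_rotate: "quarter_circle n = (\<lambda>z. \<i> ^ n * z) ` quarter_circle 0"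
proof -
  have m: "\<i> ^ n * cis (t * pi / 2) = cis ((real n + t) * pi / 2)" for t
    unfolding i_power_cis cis_mult by (simp add: algebra_simps add_divide_distrib)
  have q: "quarter_circle n = (\<lambda>t. cis ((real n + t) * pi / 2)) ` {0..1}" for n
    using mem_quarter_circle by blast
  show ?thesis unfolding q[of n] q[of 0] image_image m[symmetric] by simp
qed

lemma diamond_rotate: "diamond (\<i> ^ n * z) = \<i> ^ n * diamond z"
proof (induction n)
  case (Suc n)
  have "diamond (\<i> * w) = \<i> * diamond w" for w by (simp add: diamond_def norm_mult add.commute)
  then show ?case using Suc by (simp add: mult.assoc)
qed simp

lemma square_corner:
  assumes "n < 4" shows "square (cis (real n * pi / 2)) = square_side n 0"
proof -
  have "diamond (\<i> ^ n * 1) = \<i> ^ n" unfolding diamond_rotate by (simp add: diamond_def)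
  then have d: "diamond (cis (real n * pi / 2)) = \<i> ^ n" by (simp add: i_power_cis)
  consider "n = 0" | "n = 1" | "n = 2" | "n = 3" using assms by linarith
  then show ?thesis unfolding square_def d by cases (simp_all add: square_side_def power3_eq_cube)
qed

lemma square_quarter_circle:
  assumes "n < 4" shows "square ` quarter_circle n = square_side n ` {0..1}"
proof -
  have D0: "diamond ` quarter_circle 0 = (\<lambda>t. Complex (1 - t) t) ` {0..1}"
  proof
    show "diamond ` quarter_circle 0 \<subseteq> (\<lambda>t. Complex (1 - t) t) ` {0..1}"
    proof
      fix w assume "w \<in> diamond ` quarter_circle 0"
      then obtain z where z: "w = diamond z" "cmod z = 1" "0 \<le> Re z" "0 \<le> Im z" using mem_quarter_circle_0 by blast
      then have "0 \<le> Re w" "0 \<le> Im w" by (simp_all add: diamond_def)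
      moreover have "\<bar>Re w\<bar> + \<bar>Im w\<bar> = 1" using diamond_l1[of z] z by simp
      ultimately have "Im w \<in> {0..1}" "w = Complex (1 - Im w) (Im w)" by (auto simp: complex_eq_iff)
      then show "w \<in> (\<lambda>t. Complex (1 - t) t) ` {0..1}" by blast
    qed
    show "(\<lambda>t. Complex (1 - t) t) ` {0..1} \<subseteq> diamond ` quarter_circle 0"
    proof
      fix w assume "w \<in> (\<lambda>t. Complex (1 - t) t) ` {0..1}"
      then have w: "0 \<le> Re w" "0 \<le> Im w" "\<bar>Re w\<bar> + \<bar>Im w\<bar> = 1" by auto
      define z where "z = w * of_real ((\<bar>Re w\<bar> + \<bar>Im w\<bar>) / cmod w)"
      have d: "diamond z = w" unfolding z_def by (rule diamond_surj)
      have "cmod z = 1" using diamond_l1[of z] d w(3) by simp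
      moreover have "0 \<le> Re z" "0 \<le> Im z" using w by (simp_all add: z_def)
      ultimately show "w \<in> diamond ` quarter_circle 0" using d mem_quarter_circle_0 by (metis image_eqI)
    qed
  qed
  define sq where "sq w = ((1 - Re w + Im w) / 2, (1 - Re w - Im w) / 2)" for w
  have "square ` quarter_circle n = (\<lambda>w. sq (\<i> ^ n * w)) ` diamond ` quarter_circle 0"
    unfolding quarter_circle_rotate[of n] image_image by (simp add: square_def sq_def diamond_rotate)
  also have "\<dots> = (\<lambda>t. sq (\<i> ^ n * Complex (1 - t) t)) ` {0..1}" unfolding D0 image_image ..
  also have "(\<lambda>t. sq (\<i> ^ n * Complex (1 - t) t)) = square_side n"
  proof
    fix t
    consider "n = 0" | "n = 1" | "n = 2" | "n = 3" using assms by linarith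
    then show "sq (\<i> ^ n * Complex (1 - t) t) = square_side n t"
      by cases (simp_all add: sq_def square_side_def power3_eq_cube field_simps)
  qed
  finally show ?thesis .
qed

text \<open>The complement of a part is a union of open parts, so each part is clopen and no
  connected set leaves it.\<close>

lemma connected_components_of_open_partition:
  assumes U: "\<Union>\<C> = topspace Y" and C: "\<And>C. C \<in> \<C> \<Longrightarrow> openin Y C \<and> connectedin Y C \<and> C \<noteq> {}"
    and dis: "\<And>C D. C \<in> \<C> \<Longrightarrow> D \<in> \<C> \<Longrightarrow> C \<noteq> D \<Longrightarrow> C \<inter> D = {}"
  shows "connected_components_of Y = \<C>"
proof -
  have comp: "connected_component_of_set Y x = C" if "C \<in> \<C>" "x \<in> C" for C x
  proof
    show "C \<subseteq> connected_component_of_set Y x" using connected_component_of_maximal C that by metis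
    have x: "x \<in> connected_component_of_set Y x" using \<open>C \<subseteq> connected_component_of_set Y x\<close> that(2) by blast
    have "openin Y (\<Union>(\<C> - {C}))" using C by (intro openin_Union) blast
    moreover have "topspace Y - C = \<Union>(\<C> - {C})" using U dis that(1) by auto
    ultimately have "closedin Y C" using C[OF that(1)] openin_subset unfolding closedin_def by metis
    then show "connected_component_of_set Y x \<subseteq> C"
      using connectedin_clopen_cases[of Y "connected_component_of_set Y x" C] C[OF that(1)] x that(2)
      by (auto simp: connectedin_connected_component_of disjnt_iff)
  qed
  show ?thesis
  proof
    show "connected_components_of Y \<subseteq> \<C>"
      unfolding connected_components_of_def using comp U by fastforce
    show "\<C> \<subseteq> connected_components_of Y"
    proof
      fix C assume "C \<in> \<C>"
      moreover from this obtain x where "x \<in> C" using C by blast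
      ultimately show "C \<in> connected_components_of Y"
        using comp U unfolding connected_components_of_def by blast
    qed
  qed
qed

section \<open>A polar grid on the polygonal model\<close>

datatype node = Centre | Node nat nat
datatype arc = Arc nat nat | Radius nat nat | Spoke nat
datatype cell = Ring nat nat | Sector nat
datatype stratum = At node | On arc | In cell

fun linked :: "nat \<times> nat \<times> nat \<Rightarrow> nat \<times> nat \<times> nat \<Rightarrow> bool" where
  "linked (a, b, c) (a', b', c') \<longleftrightarrow> a \<noteq> a' \<and> a' \<in> {b, c} \<and> a \<in> {b', c'}"

text \<open>Level \<open>j \<le> M\<close> of the grid is the circle of radius \<open>1 - j / (M + 1)\<close>, and \<open>\<theta> k\<close> is the angle
  of column \<open>k\<close>. Only every second column reaches the centre, so the cells at the centre are
  quadrilaterals too. \<open>T j k = (a, b, c)\<close> prescribes colour \<open>a\<close> for a node and the colours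
  \<open>b\<close>, \<open>c\<close> for its neighbours.\<close>

locale polar_grid = crosscap_model X g q
  for X :: "'a topology" and g :: nat and q :: "complex \<Rightarrow> 'a" +
  fixes M N :: nat and \<theta> :: "real \<Rightarrow> real" and \<sigma> :: "nat \<Rightarrow> nat"
    and To :: "nat \<times> nat \<times> nat" and T :: "nat \<Rightarrow> nat \<Rightarrow> nat \<times> nat \<times> nat"
  assumes M: "1 \<le> M" and N: "4 \<le> N" "even N"
    and \<theta>: "continuous_on {0..real N} \<theta>" "strict_mono_on {0..real N} \<theta>" "\<theta> 0 = 0" "\<theta> (real N) = 2 * pi"
    and \<sigma>: "\<And>k. k < N \<Longrightarrow> \<sigma> k < N \<and> \<sigma> (\<sigma> k) = k \<and> \<sigma> k \<noteq> k"
    and glue1: "\<And>a b. (a, b) \<in> crosscap_gluing g \<Longrightarrow>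
       \<exists>k<N. \<exists>u\<in>{0..1}. a = cis (\<theta> (real k + u)) \<and> b = cis (\<theta> (real (\<sigma> k) + u))"
    and glue2: "\<And>k u. k < N \<Longrightarrow> u \<in> {0..1} \<Longrightarrow> q (cis (\<theta> (real k + u))) = q (cis (\<theta> (real (\<sigma> k) + u)))"
    and T_wrap: "\<And>j. T j N = T j 0"
    and T_arc: "\<And>j k. j \<le> M \<Longrightarrow> k < N \<Longrightarrow> linked (T j k) (T j (Suc k))"
    and T_radius: "\<And>j k. j < M \<Longrightarrow> k < N \<Longrightarrow> linked (T j k) (T (Suc j) k)"
    and T_spoke: "\<And>k. 2 * k < N \<Longrightarrow> linked To (T M (2 * k))"
    and T_glue: "\<And>k. k < N \<Longrightarrow> T 0 (\<sigma> k) = T 0 k \<and> T 0 (Suc (\<sigma> k)) = T 0 (Suc k)"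
begin

text \<open>Real polar coordinates: \<open>s\<close> measures levels inwards from the boundary, with
  the centre at \<open>real M + 1\<close>, and \<open>x\<close> measures columns.\<close>

definition \<Phi> :: "real \<Rightarrow> real \<Rightarrow> complex" where
  "\<Phi> s x = of_real (1 - s / (real M + 1)) * cis (\<theta> x)"

definition next_col :: "nat \<Rightarrow> nat" where "next_col k = (if Suc k = N then 0 else Suc k)"

fun valid_node where
  "valid_node Centre \<longleftrightarrow> True" | "valid_node (Node j k) \<longleftrightarrow> j \<le> M \<and> k < N"
fun valid_arc where
  "valid_arc (Arc j k) \<longleftrightarrow> j \<le> M \<and> k < N" | "valid_arc (Radius j k) \<longleftrightarrow> j < M \<and> k < N" |
  "valid_arc (Spoke k) \<longleftrightarrow> 2 * k < N"
fun valid_cell where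
  "valid_cell (Ring j k) \<longleftrightarrow> j < M \<and> k < N" | "valid_cell (Sector k) \<longleftrightarrow> 2 * k < N"

fun pos where
  "pos Centre = 0" | "pos (Node j k) = \<Phi> (real j) (real k)"
fun arc_path where
  "arc_path (Arc j k) t = \<Phi> (real j) (real k + t)" |
  "arc_path (Radius j k) t = \<Phi> (real j + t) (real k)" |
  "arc_path (Spoke k) t = \<Phi> (real M + 1 - t) (real (2 * k))"
fun arc_start where
  "arc_start (Arc j k) = Node j k" | "arc_start (Radius j k) = Node j k" | "arc_start (Spoke k) = Centre"
fun arc_end where
  "arc_end (Arc j k) = Node j (next_col k)" | "arc_end (Radius j k) = Node (Suc j) k" |
  "arc_end (Spoke k) = Node M (2 * k)"
text \<open>For a sector the corner (0, 0) of the square is the centre of the disc. There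
  \<open>max u v\<close> is the distance from the centre and \<open>v / (u + v)\<close> the fraction
  of the angle, so two sides become spokes and the other two become consecutive arcs.\<close>

fun cell_map :: "cell \<Rightarrow> real \<times> real \<Rightarrow> complex" where
  "cell_map (Ring j k) (u, v) = \<Phi> (real j + v) (real k + u)" |
  "cell_map (Sector k) (u, v) = \<Phi> (real M + 1 - max u v) (real (2 * k) + 2 * (v / (u + v)))"

fun type_of where
  "type_of Centre = To" | "type_of (Node j k) = T j k"

lemma T_next: "k < N \<Longrightarrow> T j (next_col k) = T j (Suc k)"
  using T_wrap by (auto simp: next_col_def)

lemma next_col_less: "k < N \<Longrightarrow> next_col k < N" by (auto simp: next_col_def)

lemma next_col_inj: "next_col k = next_col k' \<Longrightarrow> k = k'" by (auto simp: next_col_def split: if_splits)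

lemma linked_ends: "valid_arc a \<Longrightarrow> linked (type_of (arc_start a)) (type_of (arc_end a))"
  by (cases a) (use T_arc T_radius T_spoke T_next in auto)

lemma type_of_ends: "valid_arc a \<Longrightarrow> type_of (arc_start a) \<noteq> type_of (arc_end a)"
  using linked_ends[of a] by (cases "type_of (arc_start a)"; cases "type_of (arc_end a)") auto

lemma valid_ends: "valid_arc a \<Longrightarrow> valid_node (arc_start a) \<and> valid_node (arc_end a)"
  by (cases a) (auto simp: next_col_less)

lemma \<Phi>_wrap: "\<Phi> s (real N) = \<Phi> s 0" by (simp add: \<Phi>_def \<theta> cis_2pi_int[of 1, simplified])

lemma \<Phi>_centre: "\<Phi> (real M + 1) x = 0" "\<Phi> (1 + real M) x = 0"
proof -
  have "real M + 1 \<noteq> 0" by linarith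
  then have "1 - (real M + 1) / (real M + 1) = 0" by simp
  then show "\<Phi> (real M + 1) x = 0" unfolding \<Phi>_def by (simp only: of_real_0 mult_zero_left)
  then show "\<Phi> (1 + real M) x = 0" by (simp only: add.commute)
qed

lemma \<Phi>_next: "k < N \<Longrightarrow> \<Phi> s (real (next_col k)) = \<Phi> s (real k + 1)"
  using \<Phi>_wrap by (auto simp: next_col_def add.commute simp flip: of_nat_Suc)

lemma arc_path_ends: "valid_arc a \<Longrightarrow> arc_path a 0 = pos (arc_start a) \<and> arc_path a 1 = pos (arc_end a)"
  by (cases a) (auto simp: \<Phi>_next \<Phi>_centre add.commute)

lemma \<theta>_less: "0 \<le> x \<Longrightarrow> x < y \<Longrightarrow> y \<le> real N \<Longrightarrow> \<theta> x < \<theta> y"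
  using \<theta>(2) by (auto simp: strict_mono_on_def)

lemma \<theta>_range: "0 \<le> x \<Longrightarrow> x < real N \<Longrightarrow> \<theta> x \<in> {0..<2 * pi}"
  using \<theta>_less[of 0 x] \<theta>_less[of x "real N"] \<theta>(3,4) by (cases "x = 0") auto

lemma norm_\<Phi>: "s \<le> real M + 1 \<Longrightarrow> cmod (\<Phi> s x) = 1 - s / (real M + 1)"
  by (simp add: \<Phi>_def norm_mult del: of_real_diff of_real_divide)

lemma \<Phi>_unique:
  assumes "\<Phi> s x = \<Phi> s' x'" "s < real M + 1" "s' < real M + 1" "0 \<le> x" "x < real N" "0 \<le> x'" "x' < real N"
  shows "s = s' \<and> x = x'"
proof -
  have "1 - s / (real M + 1) = 1 - s' / (real M + 1)" using norm_\<Phi>[of s x] norm_\<Phi>[of s' x'] assms by simp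
  then have s: "s = s'" by simp
  have "1 - s / (real M + 1) > 0" using assms by simp
  then have "cis (\<theta> x) = cis (\<theta> x')" using assms(1) unfolding s \<Phi>_def by (metis less_irrefl mult_left_cancel of_real_eq_0_iff)
  then obtain n :: int where n: "\<theta> x = \<theta> x' + 2 * pi * of_int n"
    unfolding cis_conv_exp exp_eq by (auto simp: complex_eq_iff algebra_simps)
  have "0 \<le> \<theta> x" "\<theta> x < 2 * pi" "0 \<le> \<theta> x'" "\<theta> x' < 2 * pi" using \<theta>_range[of x] \<theta>_range[of x'] assms by auto
  then have "2 * pi * of_int n < 2 * pi * 1" "2 * pi * (- 1) < 2 * pi * of_int n" using n by linarith+
  then have "(of_int n :: real) < 1" "- 1 < (of_int n :: real)"
    using mult_less_cancel_left_pos[of "2 * pi"] pi_gt_zero by (metis mult_pos_pos zero_less_numeral)+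
  then have "n = 0" by linarith
  then have "\<theta> x = \<theta> x'" using n by simp
  then have "x = x'" using \<theta>_less[of x x'] \<theta>_less[of x' x] assms by (metis less_eq_real_def linorder_neqE_linordered_idom less_irrefl)
  then show ?thesis using s by blast
qed

lemma \<Phi>_surj:
  assumes "z \<in> cball 0 1" "z \<noteq> 0"
  obtains s x where "0 \<le> s" "s < real M + 1" "0 \<le> x" "x < real N" "z = \<Phi> s x"
proof -
  define s where "s = (1 - cmod z) * (real M + 1)"
  have s: "0 \<le> s" "s < real M + 1" "1 - s / (real M + 1) = cmod z"
    using assms by (auto simp: s_def)
  have z: "z = of_real (cmod z) * cis (Arg2pi z)" using Arg2pi_eq[of z] by (simp add: cis_conv_exp)
  have "\<exists>x. 0 \<le> x \<and> x \<le> real N \<and> \<theta> x = Arg2pi z"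
    by (rule IVT'[of \<theta> 0 "Arg2pi z" "real N"]) (use \<theta> Arg2pi_ge_0[of z] Arg2pi_lt_2pi[of z] in auto)
  then obtain x where x: "0 \<le> x" "x \<le> real N" "\<theta> x = Arg2pi z" by blast
  have "x < real N" using x \<theta>(4) Arg2pi_lt_2pi[of z] by (cases "x = real N") auto
  moreover have "z = \<Phi> s x" unfolding \<Phi>_def s(3) x(3) by (rule z)
  ultimately show ?thesis using that s x by blast
qed

text \<open>The piece of the grid that contains a point, as a function of its coordinates.
  Disjointness of nodes, open arcs and open cells then needs no pairwise comparison. On the
  innermost level an odd column runs inside a sector.\<close>

definition strat :: "real \<Rightarrow> real \<Rightarrow> stratum" where
  "strat s x = (let j = nat \<lfloor>s\<rfloor>; k = nat \<lfloor>x\<rfloor> in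
     if s = real j \<and> x = real k then At (Node j k)
     else if s = real j then On (Arc j k)
     else if x = real k \<and> j < M then On (Radius j k)
     else if x = real k \<and> even k then On (Spoke (k div 2))
     else if j < M then In (Ring j k) else In (Sector (k div 2)))"

definition stratum :: "complex \<Rightarrow> stratum" where
  "stratum z = (if z = 0 then At Centre
     else (case SOME (s, x). s < real M + 1 \<and> 0 \<le> x \<and> x < real N \<and> z = \<Phi> s x of (s, x) \<Rightarrow> strat s x))"

lemma \<Phi>_nonzero: "s < real M + 1 \<Longrightarrow> \<Phi> s x \<noteq> 0"
  using norm_\<Phi>[of s x] by auto

lemma stratum_\<Phi>:
  assumes "s < real M + 1" "0 \<le> x" "x < real N" shows "stratum (\<Phi> s x) = strat s x"
proof -
  define p where "p = (SOME (s', x'). s' < real M + 1 \<and> 0 \<le> x' \<and> x' < real N \<and> \<Phi> s x = \<Phi> s' x')"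
  have "case p of (s', x') \<Rightarrow> s' < real M + 1 \<and> 0 \<le> x' \<and> x' < real N \<and> \<Phi> s x = \<Phi> s' x'"
    unfolding p_def by (rule someI[of _ "(s, x)"]) (use assms in simp)
  then have "p = (s, x)" using \<Phi>_unique[of s x "fst p" "snd p"] assms by (cases p) auto
  then show ?thesis using \<Phi>_nonzero[of s x] assms(1) unfolding stratum_def p_def[symmetric] by simp
qed

lemma strat_eq:
  assumes "real j \<le> s" "s < real j + 1" "real k \<le> x" "x < real k + 1"
  shows "strat s x = (if s = real j \<and> x = real k then At (Node j k)
     else if s = real j then On (Arc j k)
     else if x = real k \<and> j < M then On (Radius j k)
     else if x = real k \<and> even k then On (Spoke (k div 2))
     else if j < M then In (Ring j k) else In (Sector (k div 2)))"
proof -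
  have "nat \<lfloor>s\<rfloor> = j" "nat \<lfloor>x\<rfloor> = k" using assms by linarith+
  then show ?thesis by (simp add: strat_def)
qed

lemma stratum_pos: "valid_node n \<Longrightarrow> stratum (pos n) = At n"
proof (cases n)
  case (Node j k)
  assume "valid_node n"
  then have "stratum (\<Phi> (real j) (real k)) = strat (real j) (real k)" using Node by (intro stratum_\<Phi>) auto
  then show ?thesis using Node strat_eq[of j "real j" k "real k"] by simp
qed (simp add: stratum_def)

lemma stratum_arc:
  assumes a: "valid_arc a" and t: "0 < t" "t < 1" shows "stratum (arc_path a t) = On a"
proof (cases a)
  case (Arc j k)
  then have "real (Suc k) \<le> real N" using a by (intro of_nat_mono) simp
  then have "stratum (\<Phi> (real j) (real k + t)) = strat (real j) (real k + t)" using Arc a t by (intro stratum_\<Phi>) auto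
  then show ?thesis using Arc t strat_eq[of j "real j" k "real k + t"] by simp
next
  case (Radius j k)
  then have "stratum (\<Phi> (real j + t) (real k)) = strat (real j + t) (real k)" using a t by (intro stratum_\<Phi>) auto
  then show ?thesis using Radius t a strat_eq[of j "real j + t" k "real k"] by simp
next
  case (Spoke k)
  then have "stratum (\<Phi> (real M + 1 - t) (real (2 * k))) = strat (real M + 1 - t) (real (2 * k))" 
    using a t by (intro stratum_\<Phi>) auto
  then show ?thesis using Spoke t strat_eq[of M "real M + 1 - t" "2 * k" "real (2 * k)"] by simp
qed

lemma stratum_cell:
  assumes i: "valid_cell i" and p: "p \<in> {0<..<1} \<times> {0<..<1}" shows "stratum (cell_map i p) = In i"
proof -
  obtain u v where uv: "p = (u, v)" "0 < u" "u < 1" "0 < v" "v < 1" using p by auto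
  show ?thesis
  proof (cases i)
    case (Ring j k)
    then have "real (Suc k) \<le> real N" using i by (intro of_nat_mono) simp
    then have "stratum (\<Phi> (real j + v) (real k + u)) = strat (real j + v) (real k + u)"
      using Ring i uv by (intro stratum_\<Phi>) auto
    then show ?thesis using Ring i uv strat_eq[of j "real j + v" k "real k + u"] by simp
  next
    case (Sector k)
    define r where "r = max u v"
    define a where "a = v / (u + v)"
    have r: "0 < r" "r < 1" using uv by (auto simp: r_def)
    have a: "0 < a" "a < 1" using uv by (auto simp: a_def field_simps)
    have "real (2 * k + 2) \<le> real N" using i Sector N(2) by (intro of_nat_mono) (auto elim!: evenE)
    then have "stratum (\<Phi> (real M + 1 - r) (real (2 * k) + 2 * a)) = strat (real M + 1 - r) (real (2 * k) + 2 * a)"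
      using r a by (intro stratum_\<Phi>) auto
    moreover have "strat (real M + 1 - r) (real (2 * k) + 2 * a) = In (Sector k)"
    proof (cases "2 * a < 1")
      case True
      then show ?thesis using strat_eq[of M "real M + 1 - r" "2 * k" "real (2 * k) + 2 * a"] r a by simp
    next
      case False
      then show ?thesis using strat_eq[of M "real M + 1 - r" "2 * k + 1" "real (2 * k) + 2 * a"] r a by simp
    qed
    ultimately show ?thesis using Sector uv by (simp add: r_def a_def)
  qed
qed

lemma stratum_cases:
  assumes z: "z \<in> cball 0 1"
  obtains n where "valid_node n" "z = pos n"
  | a t where "valid_arc a" "0 < t" "t < 1" "z = arc_path a t"
  | i p where "valid_cell i" "p \<in> {0<..<1} \<times> {0<..<1}" "z = cell_map i p"
proof (cases "z = 0")
  case True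
  then show ?thesis using that(1)[of Centre] by simp
next
  case False
  obtain s x where sx: "0 \<le> s" "s < real M + 1" "0 \<le> x" "x < real N" "z = \<Phi> s x" using \<Phi>_surj[OF z False] .
  define j where "j = nat \<lfloor>s\<rfloor>"
  define k where "k = nat \<lfloor>x\<rfloor>"
  define v where "v = s - real j"
  define u where "u = x - real k"
  have j: "s = real j + v" "0 \<le> v" "v < 1" using sx(1) unfolding v_def j_def by linarith+
  have k: "x = real k + u" "0 \<le> u" "u < 1" using sx(3) unfolding u_def k_def by linarith+
  have jM: "j \<le> M" using sx(2) j by linarith
  have kN: "k < N" using sx(4) k by linarith
  consider "u = 0" "v = 0" | "v = 0" "u > 0" | "v > 0" "u = 0" "j < M" | "v > 0" "u > 0" "j < M"
    | "v > 0" "j = M" "u = 0" "even k" | "v > 0" "j = M" "u > 0 \<or> odd k" using j(2) k(2) jM by linarith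
  then show ?thesis
  proof cases
    case 1 then show ?thesis using that(1)[of "Node j k"] jM kN sx(5) j k by simp
  next
    case 2 then show ?thesis using that(2)[of "Arc j k" u] jM kN sx(5) j k by simp
  next
    case 3 then show ?thesis using that(2)[of "Radius j k" v] jM kN sx(5) j k by simp
  next
    case 4 then show ?thesis using that(3)[of "Ring j k" "(u, v)"] jM kN sx(5) j k by simp
  next
    case 5
    then obtain k' where k': "k = 2 * k'" by blast
    show ?thesis using that(2)[of "Spoke k'" "1 - v"] kN sx(5) j k 5 k' by simp
  next
    case 6
    define k' where "k' = k div 2"
    define a where "a = (x - real (2 * k')) / 2"
    have "real (2 * k') + real (k mod 2) = real k" unfolding k'_def of_nat_add[symmetric] by simp
    then have ax: "2 * a = real (k mod 2) + u" using k by (simp add: a_def)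
    have "real (k mod 2) \<le> 1" by simp
    then have a1: "a < 1" using ax k by linarith
    have a0: "a > 0" using ax 6(3) k(2) by (auto simp: odd_iff_mod_2_eq_one)
    define r where "r = 1 - v"
    have r: "0 < r" "r < 1" using j 6 by (auto simp: r_def)
    \<comment> \<open>Inverts the cell map on a sector: \<open>(c * (1 - a), c * a)\<close> has
      angle fraction \<open>a\<close>, and \<open>c\<close> scales its maximum to
      \<open>r\<close>.\<close>
    define c where "c = r / max a (1 - a)"
    have m: "max a (1 - a) > 0" using a0 by auto
    then have c: "c > 0" using r by (simp add: c_def)
    have cr: "c * max a (1 - a) = r" using m by (simp add: c_def)
    have "max (c * (1 - a)) (c * a) = c * max a (1 - a)" using c
      by (simp only: max_mult_distrib_left if_True max.commute less_imp_le)
    then have "max (c * (1 - a)) (c * a) = r" using cr by simp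
    moreover from this have "c * (1 - a) < 1" "c * a < 1" using r by linarith+
    moreover have "c * a / (c * (1 - a) + c * a) = a" using c by (simp add: algebra_simps)
    moreover have "real (2 * k') + 2 * a = x" by (simp add: a_def field_simps)
    moreover have "2 * k' < N" using kN by (simp add: k'_def)
    moreover have "real M + 1 - r = s" using j 6 by (simp add: r_def)
    ultimately show ?thesis using that(3)[of "Sector k'" "(c * (1 - a), c * a)"] c a0 a1 sx(5) by simp
  qed
qed

end

section \<open>Sides of the cells, and continuity and injectivity of the cell maps\<close>

context polar_grid
begin

fun side :: "cell \<Rightarrow> nat \<Rightarrow> arc" where
  "side (Ring j k) n = (if n = 0 then Arc j k else if n = 1 then Radius j (next_col k)
     else if n = 2 then Arc (Suc j) k else Radius j k)" |
  "side (Sector k) n = (if n = 0 then Spoke k else if n = 1 then Arc M (2 * k)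
     else if n = 2 then Arc M (Suc (2 * k)) else Spoke (next_col (Suc (2 * k)) div 2))"

text \<open>Tells whether the boundary walk of the cell follows the direction of the arc.\<close>

fun forward :: "cell \<Rightarrow> nat \<Rightarrow> bool" where
  "forward (Ring j k) n \<longleftrightarrow> n < 2" | "forward (Sector k) n \<longleftrightarrow> n < 3"

lemma even_next: "2 * k < N \<Longrightarrow> Suc (2 * k) < N \<and> 2 * (next_col (Suc (2 * k)) div 2) = next_col (Suc (2 * k))"
  using N(2) by (auto simp: next_col_def elim!: evenE)

lemma valid_side: "valid_cell i \<Longrightarrow> valid_arc (side i n)"
  using even_next next_col_less by (cases i) auto

definition prev_col :: "nat \<Rightarrow> nat" where "prev_col k = (SOME k'. next_col k' = k)"

lemma prev_next: "prev_col (next_col k) = k"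
  unfolding prev_col_def by (rule some_equality) (auto dest: next_col_inj)

text \<open>Recovers cell and index from a side with its direction, so a directed arc is a side of
  at most one cell. A boundary arc is met in forward direction only; the value for the other
  direction is a default.\<close>

fun owner :: "arc \<Rightarrow> bool \<Rightarrow> cell \<times> nat" where
  "owner (Arc j k) b = (if \<not> b then (Ring (j - 1) k, 2) else if j < M then (Ring j k, 0) else (Sector (k div 2), Suc (k mod 2)))" |
  "owner (Radius j k) b = (if b then (Ring j (prev_col k), 1) else (Ring j k, 3))" |
  "owner (Spoke k) b = (if b then (Sector k, 0) else (Sector (prev_col (2 * k) div 2), 3))"

lemma owner_side:
  assumes "valid_cell i" "n < 4" shows "owner (side i n) (forward i n) = (i, n)"
proof -
  have four: "n = 0 \<or> n = 1 \<or> n = 2 \<or> n = 3" using assms(2) by auto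
  show ?thesis
  proof (cases i)
    case (Ring j k)
    then show ?thesis using four assms(1) prev_next[of k] by auto
  next
    case (Sector k)
    then have p: "prev_col (2 * (next_col (Suc (2 * k)) div 2)) = Suc (2 * k)"
      using even_next[of k] assms(1) prev_next[of "Suc (2 * k)"] by simp
    have o: "owner (Arc M x) True = (Sector (x div 2), Suc (x mod 2))" for x by simp
    have d: "Suc (2 * k) div 2 = k" "Suc (2 * k) mod 2 = 1" "2 * k div 2 = k" "2 * k mod 2 = 0" by simp_all
    from four show ?thesis
    proof (elim disjE)
      assume n: "n = 0"
      show ?thesis unfolding n Sector by simp
    next
      assume n: "n = 1"
      have s: "side i n = Arc M (2 * k)" "forward i n = True" unfolding n Sector by simp_all
      show ?thesis unfolding s o d unfolding n Sector by simp
    next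
      assume n: "n = 2"
      have s: "side i n = Arc M (Suc (2 * k))" "forward i n = True" unfolding n Sector by simp_all
      show ?thesis unfolding s o d unfolding n Sector by simp
    next
      assume n: "n = 3"
      have s: "side i n = Spoke (next_col (Suc (2 * k)) div 2)" "forward i n = False" unfolding n Sector by simp_all
      show ?thesis unfolding s owner.simps p d unfolding n Sector by simp
    qed
  qed
qed

lemma side_forward_inj:
  assumes "valid_cell i" "valid_cell i'" "n < 4" "n' < 4" "side i n = side i' n'" "forward i n = forward i' n'"
  shows "i = i' \<and> n = n'"
  using owner_side[OF assms(1,3)] owner_side[OF assms(2,4)] unfolding assms(5,6) by (metis prod.inject)

lemma side_path:
  assumes i: "valid_cell i" and n: "n < 4"
  obtains \<phi> where "bij_betw \<phi> {0..1} {0..1::real}" "\<phi> 0 = (if forward i n then 0 else 1)"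
    "\<And>t. t \<in> {0..1} \<Longrightarrow> cell_map i (square_side n t) = arc_path (side i n) (\<phi> t)"
proof -
  have four: "n = 0 \<or> n = 1 \<or> n = 2 \<or> n = 3" using n by auto
  have b1: "bij_betw (\<lambda>t. t) {0..1} {0..1::real}" by (simp add: bij_betw_def)
  have b2: "bij_betw (\<lambda>t. 1 - t) {0..1} {0..1::real}"
    by (rule bij_betw_byWitness[where f' = "\<lambda>t. 1 - t"]) auto
  \<comment> \<open>The angle fraction \<open>v / (u + v)\<close> is not affine along the two outer
    sides of a sector, whence these fractional linear changes of parameter.\<close>
  have b3: "bij_betw (\<lambda>t. 2 * t / (1 + t)) {0..1} {0..1::real}"
    by (rule bij_betw_byWitness[where f' = "\<lambda>y. y / (2 - y)"]) (auto simp: field_simps)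
  have b4: "bij_betw (\<lambda>t. t / (2 - t)) {0..1} {0..1::real}"
    by (rule bij_betw_byWitness[where f' = "\<lambda>y. 2 * y / (1 + y)"]) (auto simp: field_simps)
  show ?thesis
  proof (cases i)
    case (Ring j k)
    then have k: "k < N" using i by simp
    show ?thesis
    proof (cases "n < 2")
      case True
      have "cell_map i (square_side n t) = arc_path (side i n) t" for t
        using four True Ring \<Phi>_next[OF k, of "real j + t"] by (auto simp: square_side_def)
      then show ?thesis using that[OF b1] Ring True by simp
    next
      case False
      have "cell_map i (square_side n t) = arc_path (side i n) (1 - t)" for t
        using four False Ring by (auto simp: square_side_def algebra_simps)
      then show ?thesis using that[OF b2] Ring False by simp
    qed
  next
    case (Sector k)
    then have k: "2 * k < N" using i by simp
    consider "n = 0" | "n = 1" | "n = 2" | "n = 3" using four by blast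
    then show ?thesis
    proof cases
      case 1
      have "cell_map i (square_side n t) = arc_path (side i n) t" if "t \<in> {0..1}" for t
        using 1 Sector that max_absorb1[of 0 t] by (simp add: square_side_def)
      then show ?thesis using that[OF b1] Sector 1 by simp
    next
      case 2
      have "cell_map i (square_side n t) = arc_path (side i n) (2 * t / (1 + t))" if "t \<in> {0..1}" for t
        using 2 Sector that max_absorb1[of t 1] by (simp add: square_side_def)
      then show ?thesis using that[OF b3] Sector 2 by simp
    next
      case 3
      have "cell_map i (square_side n t) = arc_path (side i n) (t / (2 - t))" if "t \<in> {0..1}" for t
      proof -
        have "2 * (1 / (1 - t + 1)) = 1 + t / (2 - t)" using that by (simp add: field_simps)
        moreover have "max (1 - t) 1 = 1" using that by auto
        ultimately have "cell_map i (square_side n t) = \<Phi> (real M + 1 - 1) (real (2 * k) + (1 + t / (2 - t)))"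
          using 3 Sector by (simp only: square_side_def cell_map.simps) simp
        then show ?thesis using 3 Sector by (simp add: algebra_simps)
      qed
      then show ?thesis using that[OF b4] Sector 3 by simp
    next
      case 4
      have "cell_map i (square_side n t) = arc_path (side i n) (1 - t)" if "t \<in> {0..1}" for t
      \<comment> \<open>At the centre the convention \<open>0 / 0 = 0\<close> yields the first
        column of the sector instead of the last one; at this level every column gives the same
        point.\<close>
      proof (cases "t = 1")
        case True
        then show ?thesis using 4 Sector by (simp add: square_side_def \<Phi>_centre add.commute)
      next
        case False
        then have "2 * ((1 - t) / (0 + (1 - t))) = 2" by simp
        moreover have "max 0 (1 - t) = 1 - t" using that by auto
        ultimately have "cell_map i (square_side n t) = \<Phi> (real M + 1 - (1 - t)) (real (2 * k) + 2)"
          using 4 Sector by (simp only: square_side_def cell_map.simps) simp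
        also have "real (2 * k) + 2 = real (Suc (2 * k)) + 1" by simp
        also have "\<Phi> (real M + 1 - (1 - t)) (real (Suc (2 * k)) + 1) = \<Phi> (real M + 1 - (1 - t)) (real (next_col (Suc (2 * k))))"
          using \<Phi>_next[of "Suc (2 * k)"] even_next[OF k] by simp
        also have "real (next_col (Suc (2 * k))) = real (2 * (next_col (Suc (2 * k)) div 2))"
          using even_next[OF k] by presburger
        finally show ?thesis using 4 Sector by (simp del: of_nat_mult)
      qed
      then show ?thesis using that[OF b2] Sector 4 by simp
    qed
  qed
qed

lemma continuous_on_\<Phi>:
  assumes "continuous_on S a" "continuous_on S b" "b ` S \<subseteq> {0..real N}"
  shows "continuous_on S (\<lambda>p. \<Phi> (a p) (b p))"
  unfolding \<Phi>_def using continuous_on_compose2[OF \<theta>(1) assms(2,3)] assms(1)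
  by (intro continuous_intros) auto

lemma continuous_on_extend_point:
  fixes f :: "'b::t1_space \<Rightarrow> 'c::topological_space"
  assumes "continuous_on (S - {a}) f" "(f \<longlongrightarrow> f a) (at a within S)"
  shows "continuous_on S f"
  unfolding continuous_on_def
proof
  fix x assume x: "x \<in> S"
  show "(f \<longlongrightarrow> f x) (at x within S)"
  proof (cases "x = a")
    case False
    then have "at x within (S - {a}) = at x within S" by (intro at_within_nhd[of x "- {a}"]) auto
    then show ?thesis using assms(1) x False unfolding continuous_on_def by (metis DiffI singletonD)
  qed (use assms(2) in simp)
qed

lemma continuous_on_cell_map:
  assumes i: "valid_cell i" shows "continuous_on ({0..1} \<times> {0..1}) (cell_map i)"
proof (cases i)
  case (Ring j k)
  then have "real (Suc k) \<le> real N" using i by (intro of_nat_mono) simp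
  then have "continuous_on ({0..1} \<times> {0..1}) (\<lambda>p. \<Phi> (real j + snd p) (real k + fst p))"
    by (intro continuous_on_\<Phi> continuous_intros) auto
  moreover have "cell_map i = (\<lambda>p. \<Phi> (real j + snd p) (real k + fst p))" using Ring by (auto simp: fun_eq_iff)
  ultimately show ?thesis by simp
next
  case (Sector k)
  define f where "f = (\<lambda>p. \<Phi> (real M + 1 - max (fst p) (snd p)) (real (2 * k) + 2 * (snd p / (fst p + snd p))))"
  have f: "cell_map i = f" using Sector by (auto simp: fun_eq_iff f_def)
  have "real (2 * k + 2) \<le> real N" using i Sector N(2) by (intro of_nat_mono) (auto elim!: evenE)
  moreover have "0 \<le> v / (u + v) \<and> v / (u + v) \<le> 1" if "0 \<le> u" "0 \<le> v" for u v :: real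
    using that by (auto simp: divide_le_eq_1)
  moreover have "u + v \<noteq> 0" if "0 \<le> u" "0 \<le> v" "(u, v) \<noteq> 0" for u v :: real
    using that by (auto simp: zero_prod_def)
  ultimately have "continuous_on ({0..1} \<times> {0..1} - {0}) f"
    unfolding f_def by (intro continuous_on_\<Phi> continuous_intros) (auto, fastforce+)?
  \<comment> \<open>The angle has no limit at this corner, but the radius tends to 0.\<close>
  moreover have "(f \<longlongrightarrow> f 0) (at 0 within ({0..1} \<times> {0..1}))"
  proof -
    have "((\<lambda>p. max (fst p) (snd p) / (real M + 1)) \<longlongrightarrow> max (fst (0::real \<times> real)) (snd (0::real \<times> real)) / (real M + 1)) (at 0 within ({0..1} \<times> {0..1}))"
      by (intro tendsto_intros) auto
    then have t: "((\<lambda>p. max (fst p) (snd p) / (real M + 1)) \<longlongrightarrow> 0) (at (0::real \<times> real) within ({0..1} \<times> {0..1}))" by simp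
    have "cmod (f p) = max (fst p) (snd p) / (real M + 1)" if "p \<in> {0..1} \<times> {0..1}" for p
    proof -
      have "max (fst p) (snd p) \<ge> 0" using that by auto
      then have "cmod (f p) = 1 - (real M + 1 - max (fst p) (snd p)) / (real M + 1)" unfolding f_def by (intro norm_\<Phi>) simp
      then show ?thesis by (simp add: diff_divide_distrib)
    qed
    then have "eventually (\<lambda>p. cmod (f p) \<le> max (fst p) (snd p) / (real M + 1)) (at 0 within ({0..1} \<times> {0..1}))"
      unfolding eventually_at_filter by (intro always_eventually) auto
    then have "(f \<longlongrightarrow> 0) (at 0 within ({0..1} \<times> {0..1}))" using t by (rule Lim_null_comparison)
    moreover have "f 0 = 0" by (simp add: f_def \<Phi>_centre del: of_nat_mult)
    ultimately show ?thesis by simp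
  qed
  ultimately show ?thesis unfolding f by (rule continuous_on_extend_point)
qed

lemma cell_map_inner:
  assumes i: "valid_cell i" and p: "p \<in> {0<..<1} \<times> {0<..<1}"
  shows "cell_map i p \<in> ball 0 1"
proof -
  obtain u v where uv: "p = (u, v)" "0 < u" "u < 1" "0 < v" "v < 1" using p by auto
  obtain s x where s: "cell_map i p = \<Phi> s x" "0 < s" "s \<le> real M + 1"
  proof (cases i)
    case (Ring j k)
    then have "real (Suc j) \<le> real M" using i by (intro of_nat_mono) simp
    then show ?thesis using that[of "real j + v" "real k + u"] Ring uv by simp
  next
    case (Sector k)
    then show ?thesis using that[of "real M + 1 - max u v"] uv by simp
  qed
  then show ?thesis using norm_\<Phi>[of s x] by simp
qed

lemma inj_cell_map:
  assumes i: "valid_cell i" shows "inj_on (cell_map i) ({0<..<1} \<times> {0<..<1})"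
proof (rule inj_onI)
  fix p p' assume p: "p \<in> {0<..<1} \<times> {0<..<1}" "p' \<in> {0<..<1} \<times> {0<..<1}" and eq: "cell_map i p = cell_map i p'"
  obtain u v where uv: "p = (u, v)" "0 < u" "u < 1" "0 < v" "v < 1" using p by auto
  obtain u' v' where uv': "p' = (u', v')" "0 < u'" "u' < 1" "0 < v'" "v' < 1" using p by auto
  show "p = p'"
  proof (cases i)
    case (Ring j k)
    then have "real (Suc j) \<le> real M" "real (Suc k) \<le> real N" using i by (auto intro!: of_nat_mono)
    then have "real j + v = real j + v' \<and> real k + u = real k + u'"
      using Ring uv uv' eq by (intro \<Phi>_unique) auto
    then show ?thesis using uv uv' by simp
  next
    case (Sector k)
    have N2: "real (2 * k + 2) \<le> real N" using i Sector N(2) by (intro of_nat_mono) (auto elim!: evenE)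
    have a: "0 < v / (u + v) \<and> v / (u + v) < 1" if "0 < u" "0 < v" for u v :: real using that by simp
    have b: "0 \<le> real (2 * k) + 2 * (v / (u + v)) \<and> real (2 * k) + 2 * (v / (u + v)) < real N" if "0 < u" "0 < v" for u v :: real
      using a[OF that] N2 by (simp del: times_divide_eq_right)
    have "real M + 1 - max u v = real M + 1 - max u' v' \<and> real (2 * k) + 2 * (v / (u + v)) = real (2 * k) + 2 * (v' / (u' + v'))"
    proof (rule \<Phi>_unique)
      show "\<Phi> (real M + 1 - max u v) (real (2 * k) + 2 * (v / (u + v))) = \<Phi> (real M + 1 - max u' v') (real (2 * k) + 2 * (v' / (u' + v')))"
        using eq Sector uv uv' by simp
      show "real M + 1 - max u v < real M + 1" "real M + 1 - max u' v' < real M + 1" using uv uv' by auto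
    qed (use b[OF uv(2,4)] b[OF uv'(2,4)] in blast)+
    then have m: "max u v = max u' v'" and r: "v / (u + v) = v' / (u' + v')" by linarith+
    have "v * u' = v' * u" using r uv uv' by (simp add: field_simps)
    moreover have "u = u' \<and> v = v'" if "v * u' = v' * u" "max u v = max u' v'" "u' \<le> u"
    proof -
      have "v' \<le> v" using that(1,3) uv uv' by (smt (verit) mult_less_cancel_left_pos mult_strict_mono mult_le_less_imp_less mult.commute)
      then show ?thesis using that uv uv' by (auto simp: max_def split: if_splits)
    qed
    moreover have "u = u' \<and> v = v'" if "v * u' = v' * u" "max u v = max u' v'" "u \<le> u'"
    proof -
      have "v \<le> v'" using that(1,3) uv uv' by (smt (verit) mult_less_cancel_left_pos mult_strict_mono mult_le_less_imp_less mult.commute)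
      then show ?thesis using that uv uv' by (auto simp: max_def split: if_splits)
    qed
    ultimately show ?thesis using m uv uv' by (metis linear)
  qed
qed

lemma arc_path_inj:
  assumes a: "valid_arc a" and t: "0 < t" "t < 1" "0 < t'" "t' < 1" and eq: "arc_path a t = arc_path a t'"
  shows "t = t'"
proof (cases a)
  case (Arc j k)
  then have "real (Suc k) \<le> real N" using a by (intro of_nat_mono) simp
  then have "real j = real j \<and> real k + t = real k + t'" using Arc a t eq by (intro \<Phi>_unique) auto
  then show ?thesis by simp
next
  case (Radius j k)
  then have "real (Suc j) \<le> real M" using a by (intro of_nat_mono) simp
  then have "real j + t = real j + t' \<and> real k = real k" using Radius a t eq by (intro \<Phi>_unique) auto
  then show ?thesis by simp
next
  case (Spoke k)
  then have "real (2 * k) < real N" using a by (intro of_nat_less_iff[THEN iffD2]) simp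
  then have "real M + 1 - t = real M + 1 - t' \<and> real (2 * k) = real (2 * k)" using Spoke t eq by (intro \<Phi>_unique) auto
  then show ?thesis by simp
qed

end

section \<open>Which points of the grid are identified\<close>

context polar_grid
begin

lemma \<Phi>_cball: "0 \<le> s \<Longrightarrow> s \<le> real M + 1 \<Longrightarrow> \<Phi> s x \<in> cball 0 1"
  using norm_\<Phi>[of s x] by simp

lemma pos_cball: "valid_node n \<Longrightarrow> pos n \<in> cball 0 1"
  using \<Phi>_cball by (cases n) auto

lemma arc_path_cball:
  assumes "valid_arc a" "t \<in> {0..1}" shows "arc_path a t \<in> cball 0 1"
proof (cases a)
  case (Radius j k)
  then have "real (Suc j) \<le> real M" using assms by (intro of_nat_mono) simp
  then show ?thesis using Radius assms \<Phi>_cball[of "real j + t" "real k"] by simp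
next
  case (Arc j k)
  then show ?thesis using assms \<Phi>_cball[of "real j" "real k + t"] by simp
next
  case (Spoke k)
  then show ?thesis using assms \<Phi>_cball[of "real M + 1 - t" "real (2 * k)"] by simp
qed

lemma cell_map_cball:
  assumes "valid_cell i" "p \<in> {0..1} \<times> {0..1}" shows "cell_map i p \<in> cball 0 1"
proof -
  obtain u v where uv: "p = (u, v)" "0 \<le> u" "u \<le> 1" "0 \<le> v" "v \<le> 1" using assms(2) by auto
  show ?thesis
  proof (cases i)
    case (Ring j k)
    then have "real (Suc j) \<le> real M" using assms by (intro of_nat_mono) simp
    then show ?thesis using Ring uv \<Phi>_cball[of "real j + v" "real k + u"] by simp
  next
    case (Sector k)
    then show ?thesis using uv \<Phi>_cball[of "real M + 1 - max u v"] by simp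
  qed
qed

lemma pos_inj: "valid_node n \<Longrightarrow> valid_node n' \<Longrightarrow> pos n = pos n' \<Longrightarrow> n = n'"
  using stratum_pos by (metis stratum.inject(1))

text \<open>Contains the identifications of the polygon but may be coarser: any two nodes of equal
  type are related, so the classes of boundary nodes need not be computed. It is fine enough to show
  that \<open>q\<close> identifies nodes only if their types agree.\<close>

definition glued :: "complex \<Rightarrow> complex \<Rightarrow> bool" where
  "glued z w \<longleftrightarrow> z = w \<or>
     (\<exists>n n'. valid_node n \<and> valid_node n' \<and> z = pos n \<and> w = pos n' \<and> type_of n = type_of n') \<or>
     (\<exists>k u. k < N \<and> 0 < u \<and> u < 1 \<and> z = arc_path (Arc 0 k) u \<and> w = arc_path (Arc 0 (\<sigma> k)) u)"

lemma glued_boundary: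
  assumes k: "k < N" and u: "u \<in> {0..1}"
  shows "glued (cis (\<theta> (real k + u))) (cis (\<theta> (real (\<sigma> k) + u)))"
proof -
  have sk: "\<sigma> k < N" using \<sigma> k by blast
  have c: "cis (\<theta> x) = \<Phi> (real 0) x" for x by (simp add: \<Phi>_def)
  consider "u = 0" | "u = 1" | "0 < u" "u < 1" using u by force
  then show ?thesis
  proof cases
    case 1
    then show ?thesis unfolding c glued_def using k sk T_glue[OF k]
      by (intro disjI2 disjI1 exI[of _ "Node 0 k"] exI[of _ "Node 0 (\<sigma> k)"]) simp
  next
    case 2
    then show ?thesis unfolding c glued_def using next_col_less[OF k] next_col_less[OF sk] T_glue[OF k] T_next k sk \<Phi>_next
      by (intro disjI2 disjI1 exI[of _ "Node 0 (next_col k)"] exI[of _ "Node 0 (next_col (\<sigma> k))"]) simp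
  next
    case 3
    then show ?thesis unfolding c glued_def using k by (intro disjI2 exI[of _ k] exI[of _ u]) simp
  qed
qed

lemma glued_gluing: "(a, b) \<in> crosscap_gluing g \<union> (crosscap_gluing g)\<inverse> \<Longrightarrow> glued a b"
proof (elim UnE converseE)
  assume "(a, b) \<in> crosscap_gluing g"
  then show "glued a b" using glue1 glued_boundary by blast
next
  fix x y assume xy: "(a, b) = (y, x)" "(x, y) \<in> crosscap_gluing g"
  then obtain k u where k: "k < N" "u \<in> {0..1}" "x = cis (\<theta> (real k + u))" "y = cis (\<theta> (real (\<sigma> k) + u))"
    using glue1 by blast
  then show "glued a b" using glued_boundary[of "\<sigma> k" u] \<sigma>[OF k(1)] xy by simp
qed

text \<open>Nodes and inner points of arcs never coincide, so a chain stays within one kind of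
  points; two steps along arcs return to the start because \<open>\<sigma>\<close> is an
  involution.\<close>

lemma glued_trans:
  assumes zw: "glued z w" and wy: "glued w y" shows "glued z y"
proof (cases "z = w \<or> w = y")
  case False
  have arc: False if "valid_node n" "k < N" "0 < u" "u < 1" "pos n = arc_path (Arc 0 k) u" for n k u
    using stratum_pos[OF that(1)] stratum_arc[of "Arc 0 k" u] that by simp
  from False zw consider (n) n n' where "valid_node n" "valid_node n'" "z = pos n" "w = pos n'" "type_of n = type_of n'"
    | (k) k u where "k < N" "0 < u" "u < 1" "z = arc_path (Arc 0 k) u" "w = arc_path (Arc 0 (\<sigma> k)) u"
    unfolding glued_def by blast
  then show ?thesis
  proof cases
    case n
    from False wy consider (m) m m' where "valid_node m" "valid_node m'" "w = pos m" "y = pos m'" "type_of m = type_of m'"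
      | (l) l u where "l < N" "0 < u" "u < 1" "w = arc_path (Arc 0 l) u" "y = arc_path (Arc 0 (\<sigma> l)) u"
      unfolding glued_def by blast
    then show ?thesis
    proof cases
      case m
      then have "n' = m" using pos_inj n by metis
      then show ?thesis using n m unfolding glued_def by metis
    next
      case l
      then show ?thesis using arc[of n' l u] n by metis
    qed
  next
    case k
    have sk: "\<sigma> k < N" "\<sigma> (\<sigma> k) = k" using \<sigma>[OF k(1)] by auto
    from False wy consider (m) m m' where "valid_node m" "valid_node m'" "w = pos m" "y = pos m'" "type_of m = type_of m'"
      | (l) l v where "l < N" "0 < v" "v < 1" "w = arc_path (Arc 0 l) v" "y = arc_path (Arc 0 (\<sigma> l)) v"
      unfolding glued_def by blast
    then show ?thesis
    proof cases
      case m
      then show ?thesis using arc[of m "\<sigma> k" u] k sk by metis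
    next
      case l
      have "On (Arc 0 (\<sigma> k)) = On (Arc 0 l)"
        using stratum_arc[of "Arc 0 (\<sigma> k)" u] stratum_arc[of "Arc 0 l" v] sk l k by simp
      then have e: "\<sigma> k = l" by simp
      have "u = v" by (rule arc_path_inj[of "Arc 0 (\<sigma> k)"]) (use k l sk e in auto)
      then have "z = y" using k l e sk by simp
      then show ?thesis by (simp add: glued_def)
    qed
  qed
qed (use zw wy in auto)

lemma q_glued: assumes "z \<in> cball 0 1" "w \<in> cball 0 1" "q z = q w" shows "glued z w"
proof -
  have "(z, w) \<in> (crosscap_gluing g \<union> (crosscap_gluing g)\<inverse>)\<^sup>*" using fibres assms by blast
  then show ?thesis
  proof induction
    case base show ?case by (simp add: glued_def)
  next
    case (step y y')
    then show ?case using glued_trans glued_gluing by blast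
  qed
qed

lemma q_node:
  assumes "valid_node n" "valid_node n'" "q (pos n) = q (pos n')" shows "type_of n = type_of n'"
proof -
  have "glued (pos n) (pos n')" using q_glued pos_cball assms by blast
  moreover have False if "k < N" "0 < u" "u < 1" "pos n = arc_path (Arc 0 k) u" for k u
    using stratum_pos[OF assms(1)] stratum_arc[of "Arc 0 k" u] that by simp
  ultimately show ?thesis unfolding glued_def using pos_inj assms(1,2) by metis
qed

lemma q_node_arc:
  assumes n: "valid_node n" and a: "valid_arc a" and t: "0 < t" "t < 1" shows "q (pos n) \<noteq> q (arc_path a t)"
proof
  assume "q (pos n) = q (arc_path a t)"
  then have "glued (pos n) (arc_path a t)" using q_glued pos_cball[OF n] arc_path_cball[OF a, of t] t by auto
  moreover have "stratum (pos n) = At n" "stratum (arc_path a t) = On a" using stratum_pos stratum_arc assms by blast+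
  moreover have "stratum (arc_path (Arc 0 k) u) = On (Arc 0 k)" if "k < N" "0 < u" "u < 1" for k u
    using stratum_arc[of "Arc 0 k" u] that by simp
  ultimately show False unfolding glued_def using stratum_pos by (metis stratum.distinct(1))
qed

lemma q_arc:
  assumes a: "valid_arc a" "valid_arc a'" and t: "0 < t" "t < 1" "0 < t'" "t' < 1" and eq: "q (arc_path a t) = q (arc_path a' t')"
  shows "t = t' \<and> (a = a' \<or> (\<exists>k<N. a = Arc 0 k \<and> a' = Arc 0 (\<sigma> k)))"
proof -
  have "glued (arc_path a t) (arc_path a' t')" using q_glued arc_path_cball[OF a(1), of t] arc_path_cball[OF a(2), of t'] t eq by auto
  moreover have s: "stratum (arc_path a t) = On a" "stratum (arc_path a' t') = On a'" using stratum_arc a t by blast+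
  moreover have "t = t' \<and> a = a'" if "arc_path a t = arc_path a' t'"
  proof -
    have "a = a'" using s that by simp
    then show ?thesis using arc_path_inj[OF a(1) t] that by simp
  qed
  moreover have False if "valid_node n" "arc_path a t = pos n" for n using stratum_pos[OF that(1)] that(2) s by simp
  moreover have "t = t' \<and> (\<exists>k<N. a = Arc 0 k \<and> a' = Arc 0 (\<sigma> k))"
    if k: "k < N" "0 < u" "u < 1" "arc_path a t = arc_path (Arc 0 k) u" "arc_path a' t' = arc_path (Arc 0 (\<sigma> k)) u" for k u
  proof -
    have "\<sigma> k < N" using \<sigma> k by blast
    then have "stratum (arc_path (Arc 0 k) u) = On (Arc 0 k)" "stratum (arc_path (Arc 0 (\<sigma> k)) u) = On (Arc 0 (\<sigma> k))"
      using stratum_arc[of "Arc 0 k" u] stratum_arc[of "Arc 0 (\<sigma> k)" u] k by simp_all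
    then have e: "a = Arc 0 k" "a' = Arc 0 (\<sigma> k)" using s k by auto
    have "t = u" "t' = u" using arc_path_inj[OF a(1) t(1,2) k(2,3)] arc_path_inj[OF a(2) t(3,4) k(2,3)] k e by auto
    then show ?thesis using e k(1) by auto
  qed
  ultimately show ?thesis unfolding glued_def by metis
qed

definition grid_vertices :: "'a set" where "grid_vertices = (\<lambda>n. q (pos n)) ` {n. valid_node n}"
definition arc_edge :: "arc \<Rightarrow> 'a set" where "arc_edge a = (\<lambda>t. q (arc_path a t)) ` {0..1}"
definition grid_edges :: "'a set set" where "grid_edges = arc_edge ` {a. valid_arc a}"
definition cell_face :: "cell \<Rightarrow> 'a set" where "cell_face i = (\<lambda>p. q (cell_map i p)) ` ({0<..<1} \<times> {0<..<1})"

lemma finite_valid: "finite {n. valid_node n}" "finite {a. valid_arc a}"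
proof -
  have "{n. valid_node n} \<subseteq> insert Centre ((\<lambda>(j, k). Node j k) ` ({..M} \<times> {..<N}))"
  proof
    fix n assume "n \<in> {n. valid_node n}"
    then show "n \<in> insert Centre ((\<lambda>(j, k). Node j k) ` ({..M} \<times> {..<N}))" by (cases n) auto
  qed
  then show "finite {n. valid_node n}" by (rule finite_subset) simp
  have "{a. valid_arc a} \<subseteq> (\<lambda>(j, k). Arc j k) ` ({..M} \<times> {..<N}) \<union> (\<lambda>(j, k). Radius j k) ` ({..M} \<times> {..<N}) \<union> Spoke ` {..<N}"
  proof
    fix a assume "a \<in> {a. valid_arc a}"
    then show "a \<in> (\<lambda>(j, k). Arc j k) ` ({..M} \<times> {..<N}) \<union> (\<lambda>(j, k). Radius j k) ` ({..M} \<times> {..<N}) \<union> Spoke ` {..<N}"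
      by (cases a) auto
  qed
  then show "finite {a. valid_arc a}" by (rule finite_subset) simp
qed

lemma arc_edge_ends: "valid_arc a \<Longrightarrow> {q (pos (arc_start a)), q (pos (arc_end a))} \<subseteq> arc_edge a"
  using arc_path_ends[of a] unfolding arc_edge_def by (auto simp: image_iff intro: bexI[of _ 0] bexI[of _ 1])

lemma arc_edge_vertices:
  assumes a: "valid_arc a" shows "arc_edge a \<inter> grid_vertices = {q (pos (arc_start a)), q (pos (arc_end a))}"
proof
  show "arc_edge a \<inter> grid_vertices \<subseteq> {q (pos (arc_start a)), q (pos (arc_end a))}"
  proof
    fix x assume "x \<in> arc_edge a \<inter> grid_vertices"
    then obtain t n where t: "t \<in> {0..1}" "x = q (arc_path a t)" "valid_node n" "x = q (pos n)"
      unfolding arc_edge_def grid_vertices_def by blast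
    then have "\<not> (0 < t \<and> t < 1)" using q_node_arc[OF t(3) a] by metis
    then have "t = 0 \<or> t = 1" using t(1) by auto
    then show "x \<in> {q (pos (arc_start a)), q (pos (arc_end a))}" using t arc_path_ends[OF a] by auto
  qed
  show "{q (pos (arc_start a)), q (pos (arc_end a))} \<subseteq> arc_edge a \<inter> grid_vertices"
    using arc_edge_ends[OF a] valid_ends[OF a] by (auto simp: grid_vertices_def)
qed

lemma ends_neq: "valid_arc a \<Longrightarrow> q (pos (arc_start a)) \<noteq> q (pos (arc_end a))"
  using q_node type_of_ends valid_ends by blast

lemma inj_q_arc: assumes a: "valid_arc a" shows "inj_on (\<lambda>t. q (arc_path a t)) {0..1}"
proof (rule inj_onI)
  fix t t' :: real assume t: "t \<in> {0..1}" "t' \<in> {0..1}" and eq: "q (arc_path a t) = q (arc_path a t')"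
  have c: "t = 0 \<or> t = 1 \<or> (0 < t \<and> t < 1)" "t' = 0 \<or> t' = 1 \<or> (0 < t' \<and> t' < 1)" using t by auto
  note e = arc_path_ends[OF a] valid_ends[OF a] ends_neq[OF a]
  show "t = t'"
  proof (cases "0 < t \<and> t < 1 \<and> 0 < t' \<and> t' < 1")
    case True
    then show ?thesis using q_arc[OF a a _ _ _ _ eq] by blast
  next
    case False
    then show ?thesis using c eq e q_node_arc[OF _ a] by metis
  qed
qed

lemma arc_edge_glue:
  assumes k: "k < N" shows "arc_edge (Arc 0 (\<sigma> k)) = arc_edge (Arc 0 k)"
proof -
  have "q (arc_path (Arc 0 k) t) = q (arc_path (Arc 0 (\<sigma> k)) t)" if "t \<in> {0..1}" for t
    using glue2[OF k that] by (simp add: \<Phi>_def)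
  then show ?thesis unfolding arc_edge_def by (intro image_cong) auto
qed

lemma arc_edge_meet:
  assumes a: "valid_arc a" "valid_arc a'" and x: "x \<in> arc_edge a" "x \<in> arc_edge a'" "x \<notin> grid_vertices"
  shows "a = a' \<or> (\<exists>k<N. a = Arc 0 k \<and> a' = Arc 0 (\<sigma> k))"
proof -
  have pos: "q (pos (arc_start a)) \<in> grid_vertices" "q (pos (arc_end a)) \<in> grid_vertices" if "valid_arc a" for a
    using valid_ends[OF that] by (auto simp: grid_vertices_def)
  obtain t t' where t: "t \<in> {0..1}" "t' \<in> {0..1}" "x = q (arc_path a t)" "x = q (arc_path a' t')"
    using x unfolding arc_edge_def by blast
  have "t \<noteq> 0" "t \<noteq> 1" "t' \<noteq> 0" "t' \<noteq> 1"
    using t x(3) pos[OF a(1)] pos[OF a(2)] arc_path_ends[OF a(1)] arc_path_ends[OF a(2)] by metis+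
  then have "0 < t" "t < 1" "0 < t'" "t' < 1" using t by auto
  then show ?thesis using q_arc[OF a, of t t'] t by metis
qed

lemma arc_edge_eq:
  assumes a: "valid_arc a" "valid_arc a'"
  shows "arc_edge a = arc_edge a' \<longleftrightarrow> a = a' \<or> (\<exists>k<N. a = Arc 0 k \<and> a' = Arc 0 (\<sigma> k))"
proof
  assume eq: "arc_edge a = arc_edge a'"
  have "q (arc_path a (1/2)) \<in> arc_edge a" by (auto simp: arc_edge_def)
  moreover have "q (arc_path a (1/2)) \<notin> grid_vertices"
  proof
    assume "q (arc_path a (1/2)) \<in> grid_vertices"
    then obtain n where "valid_node n" "q (pos n) = q (arc_path a (1/2))" by (force simp: grid_vertices_def)
    then show False using q_node_arc[OF _ a(1), of n "1/2"] by simp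
  qed
  ultimately show "a = a' \<or> (\<exists>k<N. a = Arc 0 k \<and> a' = Arc 0 (\<sigma> k))" using arc_edge_meet[OF a] eq by metis
next
  assume "a = a' \<or> (\<exists>k<N. a = Arc 0 k \<and> a' = Arc 0 (\<sigma> k))"
  then show "arc_edge a = arc_edge a'" using arc_edge_glue by auto
qed

lemma continuous_arc_path: assumes a: "valid_arc a" shows "continuous_on {0..1} (arc_path a)"
proof (cases a)
  case (Arc j k)
  then have "real (Suc k) \<le> real N" using a by (intro of_nat_mono) simp
  then show ?thesis unfolding Arc arc_path.simps by (intro continuous_on_\<Phi> continuous_intros) auto
next
  case (Radius j k)
  then have "real k \<le> real N" using a by simp
  then show ?thesis unfolding Radius arc_path.simps by (intro continuous_on_\<Phi> continuous_intros) auto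
next
  case (Spoke k)
  then have "real (2 * k) \<le> real N" using a by (intro of_nat_mono) simp
  then show ?thesis unfolding Spoke arc_path.simps by (intro continuous_on_\<Phi> continuous_intros) auto
qed

lemma embedded_grid: "embedded_graph X grid_vertices grid_edges"
  unfolding embedded_graph_def
proof (intro conjI ballI impI)
  show "finite grid_vertices" "finite grid_edges" using finite_valid by (auto simp: grid_vertices_def grid_edges_def)
  show "grid_vertices \<subseteq> topspace X" using pos_cball q_surj by (auto simp: grid_vertices_def)
next
  fix e assume "e \<in> grid_edges"
  then obtain a where a: "valid_arc a" "e = arc_edge a" by (auto simp: grid_edges_def)
  have "continuous_map (top_of_set {0..1}) (top_of_set (cball 0 1)) (arc_path a)"
    using continuous_arc_path[OF a(1)] arc_path_cball[OF a(1)] by (auto simp: continuous_map_in_subtopology)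
  then have "pathin X (q \<circ> arc_path a)" unfolding pathin_def using continuous_map_compose q_cont by blast
  moreover have "e \<inter> grid_vertices = {(q \<circ> arc_path a) 0, (q \<circ> arc_path a) 1}"
    using arc_edge_vertices[OF a(1)] arc_path_ends[OF a(1)] a(2) by simp
  ultimately show "\<exists>p. pathin X p \<and> inj_on p {0..1} \<and> e = p ` {0..1} \<and> e \<inter> grid_vertices = {p 0, p 1}"
    using inj_q_arc[OF a(1)] a(2) by (intro exI[of _ "q \<circ> arc_path a"]) (simp add: comp_def arc_edge_def)
next
  fix e e' assume "e \<in> grid_edges" "e' \<in> grid_edges" and ne: "e \<noteq> e'"
  then obtain a a' where a: "valid_arc a" "e = arc_edge a" "valid_arc a'" "e' = arc_edge a'" by (auto simp: grid_edges_def)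
  show "e \<inter> e' \<subseteq> grid_vertices"
  proof (rule subsetI, rule ccontr)
    fix x assume "x \<in> e \<inter> e'" "x \<notin> grid_vertices"
    then show False using arc_edge_meet[OF a(1,3), of x] arc_edge_eq[OF a(1,3)] a ne by blast
  qed
qed

end

section \<open>Cells as faces, the parity of the grid and its colouring\<close>

context polar_grid
begin

lemma q_cell_map:
  assumes i: "valid_cell i" and p: "p \<in> {0<..<1} \<times> {0<..<1}" and z: "z \<in> cball 0 1" "q (cell_map i p) = q z"
  shows "z = cell_map i p"
  using q_eq_ball[OF cell_map_inner[OF i p] z] by simp

lemma cell_face_eq: "cell_face i = q ` (cell_map i \<circ> square) ` ball 0 1"
  unfolding cell_face_def image_comp[symmetric] square_ball by (simp add: image_image)

lemma cell_face_disjoint: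
  assumes "valid_cell i" "valid_cell i'" "x \<in> cell_face i" "x \<in> cell_face i'" shows "i = i'"
proof -
  obtain p p' where p: "p \<in> {0<..<1} \<times> {0<..<1}" "x = q (cell_map i p)" "p' \<in> {0<..<1} \<times> {0<..<1}" "x = q (cell_map i' p')"
    using assms(3,4) unfolding cell_face_def by blast
  have "cell_map i' p' \<in> cball 0 1" using cell_map_inner[OF assms(2) p(3)] ball_subset_cball by blast
  then have "cell_map i' p' = cell_map i p" using q_cell_map[OF assms(1) p(1)] p by metis
  then have "In i = In i'" using stratum_cell[OF assms(1) p(1)] stratum_cell[OF assms(2) p(3)] by simp
  then show ?thesis by simp
qed

lemma cell_face_graph:
  assumes "valid_cell i" "x \<in> cell_face i" shows "x \<notin> grid_vertices \<union> \<Union>grid_edges"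
proof
  obtain p where p: "p \<in> {0<..<1} \<times> {0<..<1}" "x = q (cell_map i p)" using assms(2) unfolding cell_face_def by blast
  have s: "stratum (cell_map i p) = In i" by (rule stratum_cell[OF assms(1) p(1)])
  have node: "x \<noteq> q (pos n)" if "valid_node n" for n
  proof
    assume "x = q (pos n)"
    then have "pos n = cell_map i p" using q_cell_map[OF assms(1) p(1) pos_cball[OF that]] p(2) by metis
    then show False using s stratum_pos[OF that] by simp
  qed
  assume "x \<in> grid_vertices \<union> \<Union>grid_edges"
  then show False
  proof
    assume "x \<in> grid_vertices"
    then show False unfolding grid_vertices_def using node by blast
  next
    assume "x \<in> \<Union>grid_edges"
    then obtain a t where a: "valid_arc a" "t \<in> {0..1}" "x = q (arc_path a t)"
      unfolding grid_edges_def arc_edge_def by blast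
    then consider "t = 0" | "t = 1" | "0 < t" "t < 1" by force
    then show False
    proof cases
      case 1
      then show False using node[of "arc_start a"] valid_ends[OF a(1)] arc_path_ends[OF a(1)] a by simp
    next
      case 2
      then show False using node[of "arc_end a"] valid_ends[OF a(1)] arc_path_ends[OF a(1)] a by simp
    next
      case 3
      have "arc_path a t = cell_map i p" using q_cell_map[OF assms(1) p(1) arc_path_cball[OF a(1,2)]] p(2) a(3) by simp
      then show False using stratum_arc[OF a(1) 3] s by simp
    qed
  qed
qed

lemma cells_cover: "\<Union>(cell_face ` {i. valid_cell i}) = topspace X - (grid_vertices \<union> \<Union>grid_edges)"
proof
  show "\<Union>(cell_face ` {i. valid_cell i}) \<subseteq> topspace X - (grid_vertices \<union> \<Union>grid_edges)"
  proof
    fix x assume "x \<in> \<Union>(cell_face ` {i. valid_cell i})"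
    then obtain i where i: "valid_cell i" "x \<in> cell_face i" by blast
    then obtain p where "p \<in> {0<..<1} \<times> {0<..<1}" "x = q (cell_map i p)" unfolding cell_face_def by blast
    then have "x \<in> topspace X" using cell_map_inner[OF i(1)] ball_subset_cball q_surj by blast
    then show "x \<in> topspace X - (grid_vertices \<union> \<Union>grid_edges)" using cell_face_graph[OF i] by blast
  qed
  show "topspace X - (grid_vertices \<union> \<Union>grid_edges) \<subseteq> \<Union>(cell_face ` {i. valid_cell i})"
  proof
    fix x assume x: "x \<in> topspace X - (grid_vertices \<union> \<Union>grid_edges)"
    then obtain z where z: "z \<in> cball 0 1" "x = q z" using q_surj by blast
    show "x \<in> \<Union>(cell_face ` {i. valid_cell i})"
    proof (rule stratum_cases[OF z(1)])
      fix n assume "valid_node n" "z = pos n"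
      then have "x \<in> grid_vertices" using z by (auto simp: grid_vertices_def)
      then show ?thesis using x by blast
    next
      fix a and t :: real assume "valid_arc a" "0 < t" "t < 1" "z = arc_path a t"
      then have "x \<in> \<Union>grid_edges" using z by (auto simp: grid_edges_def arc_edge_def)
      then show ?thesis using x by blast
    next
      fix i p assume "valid_cell i" "p \<in> {0<..<1} \<times> {0<..<1::real}" "z = cell_map i p"
      then show ?thesis using z(2) unfolding cell_face_def by blast
    qed
  qed
qed

lemma open_cell:
  assumes i: "valid_cell i" and U: "open U" "U \<subseteq> ball 0 1"
  shows "openin X (q ` (cell_map i \<circ> square) ` U)"
proof (rule openin_q_image)
  have sq: "square ` U \<subseteq> {0<..<1} \<times> {0<..<1}" using image_mono[OF U(2), of square] unfolding square_ball .
  have "{0<..<1} \<times> {0<..<1} \<subseteq> {0..1::real} \<times> {0..1::real}" by auto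
  then have "continuous_on (square ` U) (cell_map i)"
    using continuous_on_subset[OF continuous_on_cell_map[OF i]] sq by blast
  then have "continuous_on U (cell_map i \<circ> square)" by (intro continuous_on_compose continuous_on_square)
  moreover have "inj_on (cell_map i \<circ> square) U"
    using inj_on_subset[OF inj_square subset_UNIV] inj_on_subset[OF inj_cell_map[OF i] sq] by (rule comp_inj_on)
  ultimately show "open ((cell_map i \<circ> square) ` U)" using U(1) by (intro invariance_of_domain)
  show "(cell_map i \<circ> square) ` U \<subseteq> ball 0 1"
    unfolding image_comp[symmetric] using cell_map_inner[OF i] sq by blast
qed

lemma continuous_cell:
  assumes i: "valid_cell i" shows "continuous_map (top_of_set (cball 0 1)) X (q \<circ> (cell_map i \<circ> square))"
proof (rule continuous_map_compose[OF _ q_cont])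
  have "continuous_on (cball 0 1) (cell_map i \<circ> square)"
    using continuous_on_subset[OF continuous_on_cell_map[OF i] square_cball]
    by (intro continuous_on_compose continuous_on_square)
  then show "continuous_map (top_of_set (cball 0 1)) (top_of_set (cball 0 1)) (cell_map i \<circ> square)"
    using cell_map_cball[OF i] square_cball by (auto simp: continuous_map_in_subtopology)
qed

lemma faces_grid: "faces X grid_vertices grid_edges = cell_face ` {i. valid_cell i}"
  unfolding faces_def
proof (rule connected_components_of_open_partition)
  let ?S = "topspace X - (grid_vertices \<union> \<Union>grid_edges)"
  show "\<Union>(cell_face ` {i. valid_cell i}) = topspace (subtopology X ?S)" using cells_cover by auto
  fix C assume "C \<in> cell_face ` {i. valid_cell i}"
  then obtain i where i: "valid_cell i" "C = cell_face i" by blast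
  have sub: "C \<subseteq> ?S" using cells_cover i by blast
  have "openin X C" using open_cell[OF i(1), of "ball 0 1"] unfolding i(2) cell_face_eq by simp
  then have "openin (subtopology X ?S) C" using sub by (metis openin_subtopology_Int2 inf.absorb2)
  moreover have "connectedin X ((q \<circ> (cell_map i \<circ> square)) ` ball 0 1)"
    by (rule connectedin_continuous_map_image[OF continuous_cell[OF i(1)]])
      (auto simp: connectedin_subtopology connectedin_iff_connected)
  then have "connectedin X C" unfolding i(2) cell_face_eq by (simp add: image_comp)
  moreover have "C \<noteq> {}" unfolding i(2) cell_face_def by auto
  ultimately show "openin (subtopology X ?S) C \<and> connectedin (subtopology X ?S) C \<and> C \<noteq> {}"
    using sub by (auto simp: connectedin_subtopology)
next
  fix C D assume "C \<in> cell_face ` {i. valid_cell i}" "D \<in> cell_face ` {i. valid_cell i}" "C \<noteq> D"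
  then show "C \<inter> D = {}" using cell_face_disjoint by blast
qed

definition cell_corner :: "cell \<Rightarrow> nat \<Rightarrow> node" where
  "cell_corner i n = (if forward i n then arc_start (side i n) else arc_end (side i n))"

definition cell_walk :: "cell \<Rightarrow> ('a \<times> 'a set) list" where
  "cell_walk i = map (\<lambda>n. (q (pos (cell_corner i n)), arc_edge (side i n))) [0..<4]"

lemma cell_walk_nth: "n < 4 \<Longrightarrow> cell_walk i ! n = (q (pos (cell_corner i n)), arc_edge (side i n))"
  unfolding cell_walk_def by (subst nth_map) simp_all

lemma valid_corner: "valid_cell i \<Longrightarrow> valid_node (cell_corner i n)"
  using valid_side valid_ends by (auto simp: cell_corner_def)

lemma quad_walk_cell:
  assumes i: "valid_cell i" shows "quad_walk X grid_vertices grid_edges (cell_face i) (cell_walk i)"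
proof -
  define h where "h = q \<circ> (cell_map i \<circ> square)"
  have hb: "h ` ball 0 1 = cell_face i" unfolding h_def cell_face_eq by (simp add: image_comp)
  have cont: "continuous_map (top_of_set (cball 0 1)) X h" unfolding h_def by (rule continuous_cell[OF i])
  have homeo: "homeomorphic_map (top_of_set (ball 0 1)) (subtopology X (cell_face i)) h"
  proof (rule bijective_open_imp_homeomorphic_map)
    have "continuous_map (top_of_set (ball 0 1)) X h"
      using continuous_map_from_subtopology_mono[OF cont] ball_subset_cball by blast
    then show "continuous_map (top_of_set (ball 0 1)) (subtopology X (cell_face i)) h"
      using hb by (auto simp: continuous_map_in_subtopology)
    show "open_map (top_of_set (ball 0 1)) (subtopology X (cell_face i)) h"
      unfolding open_map_def
    proof (intro allI impI)
      fix U :: "complex set" assume "openin (top_of_set (ball 0 1)) U"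
      then have U: "open U" "U \<subseteq> ball 0 1" using open_openin_trans[OF open_ball] by (auto dest: openin_imp_subset simp: openin_open_eq)
      then have "openin X (h ` U)" using open_cell[OF i U] by (simp add: h_def image_comp)
      moreover have "h ` U \<subseteq> cell_face i" using U(2) hb by blast
      ultimately show "openin (subtopology X (cell_face i)) (h ` U)" by (metis openin_subtopology_Int2 inf.absorb2)
    qed
    have "cell_face i \<subseteq> topspace X" using cells_cover i by blast
    then show "h ` topspace (top_of_set (ball 0 1)) = topspace (subtopology X (cell_face i))" using hb by auto
    have "inj_on (cell_map i \<circ> square) (ball 0 1)"
      by (rule comp_inj_on[OF inj_on_subset[OF inj_square subset_UNIV]]) (simp add: square_ball inj_cell_map[OF i])
    moreover have "(cell_map i \<circ> square) ` ball 0 1 \<subseteq> ball 0 1"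
      unfolding image_comp[symmetric] square_ball using cell_map_inner[OF i] by blast
    ultimately show "inj_on h (topspace (top_of_set (ball 0 1)))"
      unfolding h_def by (auto intro!: comp_inj_on inj_on_subset[OF inj_q_ball])
  qed
  have sides: "h (cis (real n * pi / 2)) = fst (cell_walk i ! n) \<and> inj_on h (quarter_circle n) \<and>
      h ` quarter_circle n = snd (cell_walk i ! n)" if n: "n < 4" for n
  proof -
    obtain \<phi> where \<phi>: "bij_betw \<phi> {0..1} {0..1::real}" "\<phi> 0 = (if forward i n then 0 else 1)"
      "\<And>t. t \<in> {0..1} \<Longrightarrow> cell_map i (square_side n t) = arc_path (side i n) (\<phi> t)"
      using side_path[OF i n] by blast
    have va: "valid_arc (side i n)" by (rule valid_side[OF i])
    have qs: "q (cell_map i (square_side n t)) = q (arc_path (side i n) (\<phi> t))" if "t \<in> {0..1}" for t using \<phi>(3)[OF that] by simp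
    have "h (cis (real n * pi / 2)) = q (arc_path (side i n) (\<phi> 0))" using square_corner[OF n] qs[of 0] by (simp add: h_def)
    also have "\<dots> = fst (cell_walk i ! n)" using arc_path_ends[OF va] by (simp add: cell_walk_nth[OF n] cell_corner_def \<phi>(2))
    finally have 1: "h (cis (real n * pi / 2)) = fst (cell_walk i ! n)" .
    have "h ` quarter_circle n = (\<lambda>p. q (cell_map i p)) ` square_side n ` {0..1}"
      unfolding square_quarter_circle[OF n, symmetric] h_def by (simp add: image_image)
    also have "\<dots> = (\<lambda>t. q (arc_path (side i n) t)) ` \<phi> ` {0..1}" unfolding image_image using qs by (intro image_cong) auto
    finally have 2: "h ` quarter_circle n = snd (cell_walk i ! n)"
      using \<phi>(1) by (simp add: cell_walk_nth[OF n] arc_edge_def bij_betw_def)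
    have "inj_on h (quarter_circle n)"
    proof (rule inj_onI)
      fix z w assume zw: "z \<in> quarter_circle n" "w \<in> quarter_circle n" "h z = h w"
      obtain t t' where t: "t \<in> {0..1}" "t' \<in> {0..1}" "square z = square_side n t" "square w = square_side n t'"
        using zw square_quarter_circle[OF n] by blast
      then have "q (arc_path (side i n) (\<phi> t)) = q (arc_path (side i n) (\<phi> t'))" using zw(3) qs by (simp add: h_def)
      moreover have "\<phi> t \<in> {0..1}" "\<phi> t' \<in> {0..1}" using \<phi>(1) t by (auto simp: bij_betw_def)
      ultimately have "\<phi> t = \<phi> t'" using inj_onD[OF inj_q_arc[OF va]] by blast
      then have "t = t'" using \<phi>(1) t by (auto simp: bij_betw_def inj_on_def)
      then show "z = w" using t injD[OF inj_square] by metis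
    qed
    then show ?thesis using 1 2 by blast
  qed
  have "set (cell_walk i) \<subseteq> grid_vertices \<times> grid_edges"
    using valid_corner[OF i] valid_side[OF i] by (auto simp: cell_walk_def grid_vertices_def grid_edges_def)
  moreover have "length (cell_walk i) = 4" by (simp add: cell_walk_def)
  ultimately show ?thesis unfolding quad_walk_def using cont homeo sides by blast
qed

definition grid_walk :: "'a set \<Rightarrow> ('a \<times> 'a set) list" where
  "grid_walk F = cell_walk (SOME i. valid_cell i \<and> cell_face i = F)"

lemma grid_walk: assumes i: "valid_cell i" shows "grid_walk (cell_face i) = cell_walk i"
proof -
  have "(SOME i'. valid_cell i' \<and> cell_face i' = cell_face i) = i"
  proof (rule some_equality)
    fix i' assume i': "valid_cell i' \<and> cell_face i' = cell_face i"
    have "cell_face i \<noteq> {}" unfolding cell_face_def by auto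
    then show "i' = i" using cell_face_disjoint[of i' i] i i' by blast
  qed (use i in blast)
  then show ?thesis by (simp add: grid_walk_def)
qed

lemma grid_orientation: "face_orientation X grid_vertices grid_edges grid_walk"
  unfolding face_orientation_def faces_grid using quad_walk_cell grid_walk by auto

lemma mem_grid_sides:
  "(F, n) \<in> edge_sides X grid_vertices grid_edges grid_walk e \<longleftrightarrow>
     (\<exists>i. valid_cell i \<and> F = cell_face i \<and> n < 4 \<and> arc_edge (side i n) = e)"
  unfolding edge_sides_def faces_grid using grid_walk cell_walk_nth by auto

lemma start_grid_walk: "valid_cell i \<Longrightarrow> n < 4 \<Longrightarrow> fst (grid_walk (cell_face i) ! n) = q (pos (cell_corner i n))"
  using grid_walk cell_walk_nth by simp

lemma cell_corner_forward:
  assumes "valid_cell i" "valid_cell i'" "side i n = side i' n'" "q (pos (cell_corner i n)) = q (pos (cell_corner i' n'))"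
  shows "forward i n = forward i' n'"
  using assms(3,4) ends_neq[OF valid_side[OF assms(2), of n']] unfolding cell_corner_def by (auto split: if_splits)

text \<open>The two cells at an inner arc follow it in opposite directions, by
  \<open>side_forward_inj\<close>. A boundary arc is glued to its partner without reversal, and both
  are followed forward by their ring cells.\<close>

lemma breaking_edges:
  "{e \<in> grid_edges. breaks_consistency X grid_vertices grid_edges grid_walk e} = (\<lambda>k. arc_edge (Arc 0 k)) ` {..<N}"
proof (intro subset_antisym subsetI)
  fix e assume "e \<in> {e \<in> grid_edges. breaks_consistency X grid_vertices grid_edges grid_walk e}"
  then obtain a F n F' n' where a: "valid_arc a" "e = arc_edge a"
    and s: "(F, n) \<in> edge_sides X grid_vertices grid_edges grid_walk e" "(F', n') \<in> edge_sides X grid_vertices grid_edges grid_walk e"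
      "(F, n) \<noteq> (F', n')" "fst (grid_walk F ! n) = fst (grid_walk F' ! n')"
    unfolding breaks_consistency_def grid_edges_def by blast
  obtain i i' where i: "valid_cell i" "F = cell_face i" "n < 4" "arc_edge (side i n) = e"
    and i': "valid_cell i'" "F' = cell_face i'" "n' < 4" "arc_edge (side i' n') = e"
    using s unfolding mem_grid_sides by blast
  show "e \<in> (\<lambda>k. arc_edge (Arc 0 k)) ` {..<N}"
  proof (rule ccontr)
    assume no: "e \<notin> (\<lambda>k. arc_edge (Arc 0 k)) ` {..<N}"
    then have nk: "a \<noteq> Arc 0 k" if "k < N" for k using a that by blast
    have "side i n = a" "side i' n' = a"
      using arc_edge_eq[OF a(1) valid_side[OF i(1)], of n] arc_edge_eq[OF a(1) valid_side[OF i'(1)], of n'] nk a(2) i(4) i'(4) by metis+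
    then have sd: "side i n = side i' n'" by simp
    have "q (pos (cell_corner i n)) = q (pos (cell_corner i' n'))"
      using s(4) start_grid_walk i i' by simp
    then have "i = i' \<and> n = n'" using side_forward_inj[OF i(1) i'(1) i(3) i'(3) sd] cell_corner_forward[OF i(1) i'(1) sd] by blast
    then show False using s(3) i i' by simp
  qed
next
  fix e assume "e \<in> (\<lambda>k. arc_edge (Arc 0 k)) ` {..<N}"
  then obtain k where k: "k < N" "e = arc_edge (Arc 0 k)" by blast
  have sk: "\<sigma> k < N" "\<sigma> k \<noteq> k" using \<sigma>[OF k(1)] by auto
  let ?i = "Ring 0 k" and ?i' = "Ring 0 (\<sigma> k)"
  have v: "valid_cell ?i" "valid_cell ?i'" using k sk M by auto
  have "(cell_face ?i, 0) \<in> edge_sides X grid_vertices grid_edges grid_walk e"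
    unfolding mem_grid_sides using v k by (intro exI[of _ ?i]) simp
  moreover have "(cell_face ?i', 0) \<in> edge_sides X grid_vertices grid_edges grid_walk e"
    unfolding mem_grid_sides using v k arc_edge_glue by (intro exI[of _ ?i']) simp
  moreover have "cell_face ?i \<noteq> cell_face ?i'"
  proof
    assume "cell_face ?i = cell_face ?i'"
    moreover have "cell_face ?i \<noteq> {}" unfolding cell_face_def by auto
    ultimately have "?i = ?i'" using cell_face_disjoint[OF v] by blast
    then show False using sk by simp
  qed
  moreover have "q (pos (cell_corner ?i 0)) = q (pos (cell_corner ?i' 0))"
    using glue2[OF k(1), of 0] by (simp add: cell_corner_def \<Phi>_def)
  then have "fst (grid_walk (cell_face ?i) ! 0) = fst (grid_walk (cell_face ?i') ! 0)" using start_grid_walk v by simp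
  ultimately have "breaks_consistency X grid_vertices grid_edges grid_walk e" unfolding breaks_consistency_def by blast
  moreover have "e \<in> grid_edges" using k by (auto simp: grid_edges_def)
  ultimately show "e \<in> {e \<in> grid_edges. breaks_consistency X grid_vertices grid_edges grid_walk e}" by blast
qed

text \<open>The map \<open>\<sigma>\<close> has no fixed points, so the boundary arcs are identified
  exactly in pairs.\<close>

lemma card_breaking_edges:
  "2 * card {e \<in> grid_edges. breaks_consistency X grid_vertices grid_edges grid_walk e} = N"
proof -
  let ?f = "\<lambda>k. arc_edge (Arc 0 k)"
  have "{l \<in> {..<N}. ?f l = ?f k} = {k, \<sigma> k}" if k: "k < N" for k
  proof -
    have "?f l = ?f k \<longleftrightarrow> l = k \<or> l = \<sigma> k" if "l < N" for l
    proof -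
      have "?f l = ?f k \<longleftrightarrow> Arc 0 k = Arc 0 l \<or> (\<exists>k'<N. Arc 0 k = Arc 0 k' \<and> Arc 0 l = Arc 0 (\<sigma> k'))"
        using arc_edge_eq[of "Arc 0 k" "Arc 0 l"] k that by (simp only: valid_arc.simps le0 simp_thms eq_commute[of "?f l"])
      then show ?thesis using k by blast
    qed
    moreover have "\<sigma> k < N" using \<sigma> k by blast
    ultimately show ?thesis using k by blast
  qed
  then have two: "card {l \<in> {..<N}. ?f l = ?f k} = 2" if "k < N" for k using \<sigma>[OF that] that by (simp add: card_insert_if)
  have "N = (\<Sum>l<N. 1)" by simp
  also have "\<dots> = (\<Sum>e\<in>?f ` {..<N}. \<Sum>l\<in>{l \<in> {..<N}. ?f l = e}. 1)" by (rule sum.image_gen) simp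
  also have "\<dots> = (\<Sum>e\<in>?f ` {..<N}. 2)" by (rule sum.cong) (use two in auto)
  finally show ?thesis unfolding breaking_edges by simp
qed

lemma odd_grid: "odd (N div 2) \<Longrightarrow> odd_quadrangulation X grid_vertices grid_edges"
  unfolding odd_quadrangulation_def quadrangulation_def
proof (intro conjI exI[of _ grid_walk] surface embedded_grid grid_orientation)
  assume "odd (N div 2)"
  moreover have "N div 2 = card {e \<in> grid_edges. breaks_consistency X grid_vertices grid_edges grid_walk e}"
    using card_breaking_edges by linarith
  ultimately show "odd (card {e \<in> grid_edges. breaks_consistency X grid_vertices grid_edges grid_walk e})" by simp
  show "\<forall>F\<in>faces X grid_vertices grid_edges. \<exists>w. quad_walk X grid_vertices grid_edges F w"
    using grid_orientation unfolding face_orientation_def by blast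
qed

text \<open>The choice of the node is immaterial, since identified nodes have equal types.\<close>

definition grid_colour :: "'a \<Rightarrow> nat" where
  "grid_colour x = fst (type_of (SOME n. valid_node n \<and> q (pos n) = x))"

lemma grid_colour: assumes "valid_node n" shows "grid_colour (q (pos n)) = fst (type_of n)"
proof -
  have "\<exists>n'. valid_node n' \<and> q (pos n') = q (pos n)" using assms by blast
  from someI_ex[OF this] show ?thesis unfolding grid_colour_def using q_node[OF _ assms] by metis
qed

lemma linked_colour:
  "linked s t \<Longrightarrow> fst s \<noteq> fst t \<and> fst t \<in> {fst (snd s), snd (snd s)} \<and> fst s \<in> {fst (snd t), snd (snd t)}"
  by (cases s; cases t) auto

lemma adjacent_grid:
  assumes "adjacent grid_vertices grid_edges x y"
  obtains n m where "valid_node n" "valid_node m" "x = q (pos n)" "y = q (pos m)" "fst (type_of n) \<noteq> fst (type_of m)"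
    "fst (type_of m) \<in> {fst (snd (type_of n)), snd (snd (type_of n))}"
proof -
  obtain a where a: "valid_arc a" "arc_edge a \<inter> grid_vertices = {x, y}" using assms by (auto simp: adjacent_def grid_edges_def)
  then have eq: "{x, y} = {q (pos (arc_start a)), q (pos (arc_end a))}" using arc_edge_vertices by simp
  note l = linked_colour[OF linked_ends[OF a(1)]]
  show ?thesis
    using eq that[of "arc_start a" "arc_end a"] that[of "arc_end a" "arc_start a"] valid_ends[OF a(1)] l
    unfolding doubleton_eq_iff by metis
qed

text \<open>All nodes over one vertex share the whole type, not just the colour. The neighbours at
  any of these nodes therefore draw their colours from the same two.\<close>

lemma local_coloring_grid: "local_coloring grid_vertices (adjacent grid_vertices grid_edges) 3 grid_colour"
  unfolding local_coloring_def
proof (intro conjI ballI)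
  show "proper_coloring grid_vertices (adjacent grid_vertices grid_edges) grid_colour"
    unfolding proper_coloring_def
  proof (intro ballI impI)
    fix x y assume "adjacent grid_vertices grid_edges x y"
    then show "grid_colour x \<noteq> grid_colour y" by (rule adjacent_grid) (simp add: grid_colour)
  qed
  fix x assume "x \<in> grid_vertices"
  then obtain n where n: "valid_node n" "x = q (pos n)" by (auto simp: grid_vertices_def)
  let ?A = "{fst (snd (type_of n)), snd (snd (type_of n))}"
  have sub: "grid_colour ` neighborhood grid_vertices (adjacent grid_vertices grid_edges) x \<subseteq> ?A"
  proof
    fix b assume "b \<in> grid_colour ` neighborhood grid_vertices (adjacent grid_vertices grid_edges) x"
    then obtain y where y: "adjacent grid_vertices grid_edges x y" "b = grid_colour y" by (auto simp: neighborhood_def)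
    from y(1) obtain n' m where m: "valid_node n'" "valid_node m" "x = q (pos n')" "y = q (pos m)"
      "fst (type_of m) \<in> {fst (snd (type_of n')), snd (snd (type_of n'))}" by (rule adjacent_grid)
    have "type_of n' = type_of n" using q_node[OF m(1) n(1)] m(3) n(2) by simp
    then show "b \<in> ?A" using m(5) y(2) grid_colour[OF m(2)] m(4) by simp
  qed
  then show "finite (grid_colour ` neighborhood grid_vertices (adjacent grid_vertices grid_edges) x)"
    by (rule finite_subset) simp
  have "card ?A \<le> 2" by (simp add: card_insert_if)
  then show "card (grid_colour ` neighborhood grid_vertices (adjacent grid_vertices grid_edges) x) \<le> 3 - 1"
    using card_mono[OF _ sub] by simp
qed simp

lemma grid_colours: "grid_colour ` grid_vertices = (\<lambda>n. fst (type_of n)) ` {n. valid_node n}"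
  unfolding grid_vertices_def image_image by (intro image_cong) (auto simp: grid_colour)

end

section \<open>The colour table\<close>

text \<open>The boundary row of types spells \<open>w\<^sub>1 w\<^sub>1 \<dots> w\<^sub>5 w\<^sub>5\<close> for five closed walks of length \<open>13\<close> in the
  graph of types, and the rows further inside contract this walk step by step. The table was found
  by a computer search.\<close>

definition boundary_walks :: "(nat \<times> nat \<times> nat) list list" where
  "boundary_walks = [
    [(2,0,3), (3,2,5), (5,2,3), (2,0,5), (0,2,4), (2,0,3), (0,2,4), (2,0,3), (0,2,4), (2,0,3),
     (0,2,4), (2,0,3), (0,2,4)],
    [(2,0,3), (0,2,3), (3,0,5), (5,2,3), (3,2,5), (2,0,3), (3,2,4), (4,2,3), (2,1,4), (1,2,5),
     (5,1,3), (3,0,5), (0,2,3)],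
    [(2,0,3), (0,2,3), (3,0,5), (5,1,3), (1,2,5), (2,1,4), (4,2,5), (2,0,4), (0,2,5), (2,0,3),
     (0,2,5), (2,0,3), (0,2,5)],
    [(2,0,3), (0,2,5), (5,0,4), (4,0,5), (0,1,4), (1,0,3), (0,1,5), (5,0,3), (3,2,5), (2,0,3),
     (3,2,5), (2,0,3), (3,2,5)],
    [(2,0,3), (0,2,5), (5,0,3), (0,1,5), (1,0,5), (5,1,4), (4,1,5), (5,2,4), (2,1,5), (5,2,3),
     (3,2,5), (2,0,3), (3,2,5)]]"

definition inner_rows :: "(nat \<times> nat \<times> nat) list list" where
  "inner_rows = [
    [(3,2,5), (5,2,3), (2,0,5), (0,2,5), (2,0,3), (0,2,4), (4,0,3), (0,2,4), (2,0,5), (0,2,5),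
     (2,0,4), (0,2,4), (2,0,3), (0,2,5), (5,0,3), (3,1,5), (5,2,3), (2,0,5), (0,2,3), (2,0,5),
     (0,2,3), (2,0,5), (0,2,3), (2,0,5), (0,2,3), (2,0,5), (0,2,3), (3,0,5), (5,0,3), (3,2,5),
     (2,0,3), (3,2,4), (4,2,3), (2,1,4), (1,2,4), (2,1,5), (1,2,5), (5,1,3), (3,0,5), (0,2,3),
     (3,0,5), (5,0,3), (3,2,5), (2,0,3), (3,2,4), (4,2,3), (2,0,4), (4,2,3), (2,1,4), (1,2,5),
     (5,1,3), (3,0,5), (0,2,3), (3,0,5), (5,1,3), (1,0,5), (5,1,3), (1,2,5), (2,1,4), (4,2,3),
     (2,0,4), (0,2,3), (2,0,4), (0,2,5), (2,0,5), (0,2,3), (3,0,5), (5,1,3), (1,0,5), (5,1,4),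
     (4,2,5), (5,1,4), (4,2,5), (2,0,4), (0,2,5), (5,0,4), (0,2,5), (5,0,4), (0,2,5), (5,0,4),
     (4,0,5), (0,1,4), (1,0,4), (0,1,4), (1,0,3), (0,1,5), (5,0,3), (0,2,5), (5,0,3), (0,2,5),
     (5,0,3), (0,2,5), (5,0,4), (4,0,5), (0,1,4), (4,0,3), (0,1,4), (1,0,3), (3,1,5), (5,1,3),
     (3,2,5), (5,0,3), (0,2,5), (5,0,3), (0,2,5), (5,0,4), (0,1,5), (1,0,4), (0,1,4), (4,0,5),
     (5,2,4), (2,0,5), (5,2,3), (3,0,5), (5,0,3), (0,2,5), (5,0,3), (0,2,5), (5,0,3), (0,1,5),
     (1,0,5), (0,1,4), (4,0,5), (5,0,4), (4,1,5), (5,2,4), (2,1,5), (5,2,3), (3,2,5), (5,2,3)],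
    [(5,2,3), (2,0,5), (0,2,4), (2,0,3), (0,2,4), (4,0,3), (0,1,4), (4,0,5), (0,2,4), (2,0,3),
     (0,2,4), (2,0,3), (3,2,5), (2,0,3), (0,2,5), (5,0,3), (3,2,5), (5,2,3), (3,0,5), (5,2,3),
     (2,0,5), (5,2,4), (2,0,5), (5,2,3), (3,0,5), (0,2,3), (3,0,5), (5,0,3), (0,2,5), (2,0,3),
     (3,2,4), (4,2,3), (2,1,4), (1,2,4), (4,1,5), (1,2,4), (2,1,3), (1,2,5), (5,1,3), (3,0,5),
     (5,0,3), (0,2,5), (2,0,3), (0,2,3), (2,0,3), (3,2,4), (4,2,3), (2,1,4), (4,2,5), (2,1,4),
     (1,2,5), (5,1,3), (3,0,5), (5,1,3), (1,2,5), (5,1,3), (1,0,5), (5,1,3), (1,2,5), (2,1,4),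
     (4,2,3), (3,0,4), (4,2,3), (2,0,4), (0,2,3), (3,0,4), (0,1,3), (1,0,5), (5,1,4), (1,0,5),
     (5,1,4), (4,0,5), (5,1,4), (4,2,5), (5,0,4), (4,1,5), (5,0,4), (4,0,5), (5,0,4), (4,0,5),
     (0,1,4), (1,0,4), (4,1,5), (1,0,4), (0,1,4), (1,0,4), (0,1,5), (5,0,4), (0,1,5), (5,0,4),
     (0,1,5), (5,0,4), (4,0,5), (0,2,4), (4,0,3), (3,0,4), (4,0,3), (3,1,4), (1,0,3), (3,1,5),
     (5,0,3), (0,1,5), (5,0,4), (0,1,5), (5,0,4), (0,1,5), (1,0,5), (0,1,4), (4,0,5), (0,2,4),
     (2,0,5), (5,2,3), (3,0,5), (0,1,3), (3,0,5), (5,0,3), (0,1,5), (5,0,3), (0,1,5), (1,0,3),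
     (0,1,4), (4,0,5), (0,2,4), (4,0,5), (5,2,4), (4,0,5), (5,2,4), (2,0,5), (5,2,3), (2,1,5)],
    [(2,0,5), (0,2,4), (4,0,3), (3,2,4), (4,0,3), (3,0,4), (4,0,3), (0,2,4), (2,0,3), (3,2,5),
     (2,0,3), (3,2,5), (2,1,3), (3,2,4), (2,0,3), (3,2,5), (2,1,3), (3,2,5), (5,0,3), (3,2,5),
     (5,2,3), (2,0,5), (5,2,3), (3,2,5), (5,0,3), (3,0,5), (5,0,3), (3,2,5), (2,0,3), (3,2,4),
     (4,2,3), (2,1,4), (1,2,4), (4,1,5), (1,2,4), (2,1,4), (1,2,4), (2,1,4), (1,2,5), (5,1,3),
     (3,2,5), (2,0,3), (0,2,4), (2,0,5), (0,2,4), (4,0,3), (3,1,4), (4,2,3), (2,0,4), (4,2,5),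
     (5,1,4), (1,2,5), (5,1,3), (1,2,5), (2,1,3), (3,2,5), (5,1,3), (1,2,5), (2,1,4), (4,2,3),
     (3,0,4), (4,1,3), (3,1,4), (4,2,3), (3,0,4), (0,1,3), (1,0,3), (0,1,4), (4,0,5), (0,1,4),
     (1,0,5), (0,1,4), (1,0,5), (5,1,4), (4,0,5), (5,1,4), (4,0,5), (0,1,4), (4,0,5), (0,1,4),
     (1,0,4), (4,1,5), (5,2,4), (4,1,5), (1,0,4), (4,1,5), (5,0,4), (4,1,5), (5,0,4), (4,0,5),
     (5,0,4), (4,0,5), (0,2,4), (4,0,3), (3,0,4), (0,2,3), (3,0,4), (4,2,3), (3,1,4), (1,0,3),
     (0,1,5), (1,0,4), (4,1,5), (1,0,4), (0,1,5), (1,0,5), (0,1,4), (4,0,5), (0,2,4), (2,0,5),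
     (5,2,4), (2,1,5), (5,2,3), (3,0,5), (0,1,3), (3,0,5), (5,0,3), (0,1,5), (1,0,3), (0,1,3),
     (1,0,4), (0,1,4), (4,0,3), (0,1,4), (4,0,5), (5,2,4), (4,2,5), (5,2,4), (2,1,5), (5,2,4)],
    [(0,2,5), (2,0,3), (3,2,4), (4,2,3), (3,2,4), (4,2,3), (3,2,4), (2,0,3), (3,2,5), (5,2,3),
     (3,2,5), (2,0,3), (3,2,4), (2,0,3), (3,2,4), (2,0,3), (3,2,4), (2,0,3), (0,2,5), (2,0,3),
     (3,2,5), (5,2,3), (3,2,5), (2,0,3), (0,2,5), (5,0,3), (0,2,5), (2,0,3), (3,2,4), (4,2,3),
     (2,1,4), (1,2,4), (4,1,5), (5,2,4), (4,1,5), (1,2,4), (4,1,5), (1,2,4), (2,1,3), (3,2,5),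
     (2,0,3), (3,2,4), (4,0,3), (0,2,4), (4,0,3), (3,1,4), (1,2,3), (3,1,4), (4,2,3), (2,0,4),
     (4,2,5), (5,1,4), (1,2,5), (2,1,5), (1,2,3), (2,1,3), (1,2,5), (2,1,4), (4,2,3), (3,0,4),
     (4,1,3), (1,0,4), (4,1,3), (3,1,4), (4,1,3), (1,0,4), (0,1,5), (1,0,3), (0,1,4), (1,0,3),
     (0,1,3), (1,0,4), (0,1,4), (1,0,5), (0,1,4), (1,0,5), (0,1,4), (1,0,4), (0,1,4), (1,0,4),
     (4,1,5), (5,2,4), (2,1,5), (5,2,4), (4,1,5), (5,0,4), (4,0,5), (5,1,4), (4,0,5), (5,0,4),
     (4,0,5), (0,2,4), (2,0,4), (0,2,4), (4,0,3), (3,0,4), (4,0,3), (3,2,4), (4,0,3), (0,1,4),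
     (1,0,4), (0,1,4), (1,0,4), (0,1,3), (1,0,5), (5,1,4), (4,0,5), (5,2,4), (2,0,5), (0,2,3),
     (2,0,5), (5,2,3), (3,2,5), (5,1,3), (3,0,5), (0,1,3), (3,0,5), (5,0,3), (3,1,5), (1,0,3),
     (0,1,5), (1,0,3), (0,1,4), (1,0,3), (0,1,4), (4,0,5), (5,1,4), (4,0,5), (5,2,4), (2,0,5)],
    [(2,0,3), (3,2,5), (2,1,3), (3,2,4), (4,2,3), (2,0,4), (4,2,3), (3,2,4), (2,0,3), (3,2,5),
     (2,1,3), (3,2,4), (4,1,3), (3,2,4), (4,1,3), (3,2,4), (4,1,3), (3,2,4), (2,0,3), (3,2,4),
     (2,1,3), (3,2,5), (2,0,3), (0,2,4), (2,0,4), (0,2,5), (2,0,3), (3,2,4), (4,2,3), (2,1,4),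
     (1,2,4), (4,1,5), (5,2,4), (2,1,5), (5,2,4), (4,1,5), (5,0,4), (4,1,5), (1,2,4), (2,1,3),
     (3,2,4), (4,2,3), (3,1,4), (4,0,3), (3,0,4), (4,1,3), (3,1,4), (1,2,3), (3,1,4), (4,2,3),
     (2,0,4), (4,2,5), (2,1,4), (1,2,3), (2,1,4), (1,2,3), (2,1,4), (4,2,3), (3,0,4), (0,1,3),
     (1,0,4), (0,1,4), (1,0,4), (4,1,3), (1,0,4), (0,1,3), (1,0,4), (0,1,3), (1,0,4), (0,1,3),
     (1,0,4), (0,1,3), (1,0,4), (0,1,3), (1,0,4), (0,1,3), (1,0,4), (0,1,3), (1,0,4), (4,1,3),
     (1,2,4), (2,1,5), (1,2,5), (2,1,5), (5,2,4), (4,0,5), (0,1,4), (1,0,5), (5,1,4), (4,1,5),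
     (5,2,4), (2,0,5), (0,2,3), (2,0,3), (0,2,4), (4,0,3), (0,2,4), (4,0,3), (0,2,4), (4,0,5),
     (0,1,4), (4,0,5), (0,1,4), (1,0,5), (5,1,4), (4,0,5), (0,2,4), (2,0,5), (0,2,3), (3,0,5),
     (5,2,3), (3,1,5), (5,1,3), (1,0,5), (0,1,3), (1,0,3), (0,1,3), (3,0,5), (5,2,3), (3,1,5),
     (5,0,3), (3,1,5), (1,0,3), (3,1,5), (1,0,3), (0,1,4), (1,0,5), (5,1,4), (4,0,5), (0,2,4)],
    [(0,2,4), (2,0,3), (3,2,4), (4,2,3), (2,0,4), (0,2,4), (2,0,4), (4,2,3), (3,2,4), (2,1,3),
     (3,2,4), (4,1,3), (3,1,4), (4,0,3), (3,1,4), (4,0,3), (3,1,4), (4,2,3), (3,2,4), (4,0,3),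
     (3,2,4), (2,0,3), (0,2,4), (4,0,5), (0,2,4), (2,0,3), (0,2,4), (4,0,3), (3,1,4), (1,2,3),
     (2,1,5), (5,2,4), (2,0,5), (5,2,3), (2,0,5), (5,2,4), (4,2,5), (5,0,4), (4,1,5), (1,2,4),
     (2,1,3), (3,2,4), (4,2,3), (3,1,4), (4,1,3), (3,1,4), (4,1,3), (3,1,4), (4,0,3), (3,0,4),
     (4,2,3), (2,0,4), (4,2,3), (3,1,4), (4,2,3), (3,1,4), (4,2,3), (3,0,4), (4,1,3), (1,0,4),
     (4,1,3), (1,0,4), (4,1,5), (1,0,4), (4,1,3), (1,0,4), (4,1,3), (1,0,4), (4,1,3), (1,0,4),
     (4,1,5), (1,0,4), (4,1,5), (1,0,4), (4,1,3), (1,0,4), (4,1,3), (3,0,4), (4,1,3), (3,2,4),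
     (2,1,3), (1,2,4), (2,1,5), (5,2,4), (4,0,5), (0,1,4), (4,0,5), (5,1,4), (4,1,5), (1,0,4),
     (4,1,5), (5,2,4), (2,0,5), (0,2,5), (2,0,5), (0,2,4), (2,0,5), (0,2,4), (2,0,5), (0,2,4),
     (4,0,5), (0,2,4), (4,0,5), (5,1,4), (4,2,5), (5,2,4), (2,0,5), (0,2,3), (3,0,5), (5,1,3),
     (3,1,5), (5,1,3), (1,0,5), (0,1,3), (1,0,5), (0,1,3), (1,0,5), (5,1,3), (3,2,5), (5,2,3),
     (3,1,5), (5,1,3), (3,1,5), (1,0,3), (3,1,4), (4,0,3), (0,1,4), (4,0,5), (0,2,4), (2,0,3)],
    [(4,0,3), (0,2,4), (4,0,3), (3,2,4), (4,2,3), (2,0,4), (4,2,5), (2,1,4), (4,2,3), (3,2,4),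
     (4,0,3), (3,1,4), (1,2,3), (3,1,4), (1,2,3), (3,1,4), (4,2,3), (3,0,4), (4,2,3), (3,1,4),
     (4,2,3), (3,2,4), (4,0,3), (0,1,4), (4,0,3), (0,2,4), (4,0,3), (3,1,4), (1,2,3), (2,1,4),
     (1,2,3), (2,1,5), (5,2,4), (2,0,5), (5,2,3), (2,0,5), (5,2,4), (4,1,5), (1,2,4), (2,1,3),
     (3,2,4), (2,0,3), (3,2,4), (4,1,3), (1,2,4), (4,1,3), (3,2,4), (4,0,3), (3,2,4), (4,1,3),
     (3,2,4), (4,2,3), (3,2,4), (4,1,3), (3,2,4), (4,1,3), (3,2,4), (4,1,3), (1,2,4), (4,1,5),
     (1,2,4), (4,1,5), (5,2,4), (4,1,5), (1,2,4), (4,1,3), (3,2,4), (4,1,3), (3,2,4), (4,1,3),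
     (1,2,4), (4,1,3), (1,2,4), (4,1,5), (1,2,4), (4,1,3), (3,2,4), (4,2,3), (3,2,4), (4,1,3),
     (1,2,4), (2,1,4), (1,2,4), (4,1,5), (5,2,4), (4,0,5), (5,2,4), (4,0,5), (5,2,4), (4,1,5),
     (5,2,4), (2,0,5), (5,2,4), (2,0,5), (5,2,4), (4,0,5), (5,2,4), (4,0,5), (5,2,4), (2,0,5),
     (5,2,4), (4,0,5), (5,2,4), (4,2,5), (5,2,4), (2,1,5), (5,2,3), (3,0,5), (5,1,3), (1,0,5),
     (5,1,3), (1,0,5), (5,1,3), (1,0,5), (5,1,3), (1,0,5), (5,1,3), (3,1,5), (5,2,3), (2,1,5),
     (1,2,3), (3,1,5), (1,0,3), (0,1,3), (1,0,3), (3,1,4), (1,0,3), (0,1,4), (4,0,3), (3,2,4)],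
    [(3,1,4), (4,0,3), (3,1,4), (4,1,3), (3,1,4), (4,2,3), (2,1,4), (1,2,5), (2,1,4), (4,2,3),
     (3,1,4), (1,2,3), (3,1,5), (1,2,3), (2,1,4), (1,2,3), (3,1,4), (4,2,3), (2,1,4), (1,2,3),
     (2,1,4), (4,2,3), (3,1,4), (1,0,3), (3,1,4), (4,0,3), (3,1,4), (1,2,3), (3,1,5), (1,2,3),
     (3,1,5), (5,2,3), (2,1,5), (5,2,4), (2,1,5), (5,2,3), (2,1,5), (5,2,4), (2,1,5), (1,2,3),
     (2,1,3), (3,2,5), (2,1,3), (3,2,4), (2,1,3), (1,2,4), (2,1,3), (3,2,4), (2,1,3), (1,2,4),
     (2,1,3), (3,2,4), (2,1,3), (1,2,4), (2,1,3), (1,2,4), (2,1,3), (1,2,4), (2,1,5), (5,2,4),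
     (2,1,5), (5,2,4), (2,1,5), (1,2,4), (2,1,5), (1,2,4), (2,1,3), (3,2,4), (2,1,3), (1,2,4),
     (2,1,4), (1,2,4), (2,1,5), (5,2,4), (2,1,5), (1,2,4), (2,1,3), (3,2,4), (2,1,3), (1,2,4),
     (2,1,3), (1,2,4), (2,1,4), (1,2,4), (2,1,5), (5,2,4), (2,1,5), (5,2,4), (2,1,5), (5,2,4),
     (2,1,5), (5,2,4), (2,1,5), (5,2,3), (2,1,5), (5,2,4), (2,1,5), (5,2,4), (2,1,5), (5,2,3),
     (2,1,5), (5,2,4), (2,1,5), (5,2,4), (2,1,5), (5,2,3), (3,1,5), (5,1,3), (3,1,5), (5,1,3),
     (3,1,5), (5,1,3), (3,1,5), (5,1,3), (3,1,5), (5,1,3), (3,1,5), (5,1,3), (3,1,5), (1,2,3),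
     (3,1,5), (5,2,3), (3,1,5), (1,0,3), (3,1,5), (1,2,3), (3,1,5), (1,0,3), (3,1,4), (4,0,3)]]"

text \<open>Row \<open>j\<close> holds the types on level \<open>j\<close>. The boundary row doubles
  each walk because both copies of an arc of the polygon carry the same types.\<close>

definition types :: "(nat \<times> nat \<times> nat) list list" where
  "types = concat (map (\<lambda>w. w @ w) boundary_walks) # inner_rows"

text \<open>In the last row all even columns have colour 2 or 3 and allow colour 1 at a
  neighbour.\<close>

definition centre_type :: "nat \<times> nat \<times> nat" where "centre_type = (1, 2, 3)"

lemma boundary_walks_length: "length boundary_walks = 5 \<and> list_all (\<lambda>w. length w = 13) boundary_walks"
  unfolding boundary_walks_def by simp

lemma boundary_walks_hd: "list_all (\<lambda>w. w ! 0 = boundary_walks ! 0 ! 0) boundary_walks"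
  unfolding boundary_walks_def by simp

lemma inner_rows_length: "length inner_rows = 8 \<and> list_all (\<lambda>r. length r = 130) inner_rows"
  unfolding inner_rows_def by simp

text \<open>Comparing with \<open>rotate1\<close> includes the step from the last column back to the
  first.\<close>

lemma table_rows: "list_all (\<lambda>r. list_all2 linked r (rotate1 r)) types"
  unfolding types_def boundary_walks_def inner_rows_def by simp

lemma table_columns: "list_all2 (list_all2 linked) (butlast types) inner_rows"
  unfolding types_def boundary_walks_def inner_rows_def by simp

lemma table_centre: "list_all2 (\<lambda>k t. even k \<longrightarrow> linked centre_type t) [0..<130] (last inner_rows)"
  unfolding inner_rows_def centre_type_def by (simp add: upt_rec)

lemma table_colours: "fst ` set (concat types) = {0, 1, 2, 3, 4, 5}"
  unfolding types_def boundary_walks_def inner_rows_def by (simp add: insert_commute)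

lemma table_length: "length types = 9 \<and> list_all (\<lambda>r. length r = 130) types"
proof -
  have "length (concat (map (\<lambda>w. w @ w) boundary_walks)) = 130" by (simp add: boundary_walks_def)
  then show ?thesis using inner_rows_length by (simp add: types_def)
qed

lemma nth_concat_double:
  assumes "list_all (\<lambda>w. length w = n) ws" "i < length ws" "e < 2 * n"
  shows "concat (map (\<lambda>w. w @ w) ws) ! (2 * n * i + e) = (ws ! i @ ws ! i) ! e"
  using assms
proof (induction ws arbitrary: i)
  case (Cons w ws)
  have w: "length (w @ w) = 2 * n" using Cons.prems by simp
  show ?case
  proof (cases i)
    case 0
    then show ?thesis using w Cons.prems(3) by (simp add: nth_append del: length_append append_assoc)
  next
    case (Suc i')
    have "concat (map (\<lambda>w. w @ w) ws) ! (2 * n * i' + e) = (ws ! i' @ ws ! i') ! e"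
      using Suc Cons by simp
    moreover have "2 * n * i + e = length (w @ w) + (2 * n * i' + e)" unfolding w Suc by simp
    ultimately show ?thesis using Suc by (simp only: list.map concat.simps nth_append_length_plus nth_Cons_Suc)
  qed
qed simp

lemma boundary_row:
  assumes "i < 5" "e < 13"
  shows "types ! 0 ! (26 * i + e) = boundary_walks ! i ! e" "types ! 0 ! (26 * i + 13 + e) = boundary_walks ! i ! e"
proof -
  have l: "length (boundary_walks ! i) = 13" using boundary_walks_length assms(1) by (simp add: list_all_length)
  have t: "types ! 0 = concat (map (\<lambda>w. w @ w) boundary_walks)" by (simp add: types_def)
  have b: "list_all (\<lambda>w. length w = 13) boundary_walks" "i < length boundary_walks" using boundary_walks_length assms(1) by auto
  have "types ! 0 ! (26 * i + f) = (boundary_walks ! i @ boundary_walks ! i) ! f" if "f < 26" for f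
    using nth_concat_double[OF b, of f] that unfolding t by simp
  from this[of e] this[of "13 + e"]
  show "types ! 0 ! (26 * i + e) = boundary_walks ! i ! e" "types ! 0 ! (26 * i + 13 + e) = boundary_walks ! i ! e"
    using assms(2) l nth_append_length_plus[of "boundary_walks ! i" "boundary_walks ! i" e]
    by (simp_all only: nth_append add.assoc if_True)
qed

lemma boundary_walk_base: "i < 5 \<Longrightarrow> boundary_walks ! i ! 0 = boundary_walks ! 0 ! 0"
  using boundary_walks_hd boundary_walks_length unfolding list_all_length by metis

lemma linked_sym: "linked s t \<longleftrightarrow> linked t s"
  by (cases s; cases t) auto

text \<open>Every crosscap beyond the fifth contributes four columns, which go back and forth between the
  types of column \<open>0\<close> and the types of column \<open>0\<close> one level further inside.\<close>

definition node_type :: "nat \<Rightarrow> nat \<Rightarrow> nat \<times> nat \<times> nat" where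
  "node_type j k = (if k < 130 then types ! j ! k else if even k then types ! j ! 0
     else if j < 8 then types ! Suc j ! 0 else types ! 8 ! 1)"

lemma types_length: "j \<le> 8 \<Longrightarrow> length (types ! j) = 130"
  using table_length by (auto simp: list_all_length)

lemma types_row: "j \<le> 8 \<Longrightarrow> k < 130 \<Longrightarrow> linked (types ! j ! k) (types ! j ! (Suc k mod 130))"
  using table_rows table_length types_length[of j] list_all2_nthD[of linked "types ! j" "rotate1 (types ! j)" k]
  by (auto simp: list_all_length nth_rotate1)

lemma types_column: "j < 8 \<Longrightarrow> k < 130 \<Longrightarrow> linked (types ! j ! k) (types ! Suc j ! k)"
proof -
  assume j: "j < 8" "k < 130"
  have "list_all2 linked (butlast types ! j) (inner_rows ! j)"
    by (rule list_all2_nthD[OF table_columns]) (use j table_length in simp)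
  moreover have "butlast types ! j = types ! j" using j table_length by (intro nth_butlast) simp
  moreover have "inner_rows ! j = types ! Suc j" by (simp add: types_def)
  ultimately have "list_all2 linked (types ! j) (types ! Suc j)" by simp
  then show ?thesis by (rule list_all2_nthD) (use j types_length[of j] in simp)
qed

lemma node_type_arc:
  assumes "j \<le> 8" shows "linked (node_type j k) (node_type j (Suc k))"
proof -
  \<comment> \<open>The link used by the extra columns: the next entry of column 0, or, on the last
    level, the next entry of the row.\<close>
  have 0: "linked (types ! j ! 0) (if j < 8 then types ! Suc j ! 0 else types ! 8 ! 1)"
    using types_column[of j 0] types_row[of 8 0] assms by (cases "j < 8") (auto simp: le_less)
  consider "k < 129" | "k = 129" | "130 \<le> k" "even k" | "130 \<le> k" "odd k" by linarith
  then show ?thesis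
  proof cases
    case 1
    then show ?thesis using types_row[OF assms, of k] by (simp add: node_type_def)
  next
    case 2
    then show ?thesis using types_row[OF assms, of 129] by (simp add: node_type_def)
  next
    case 3
    then show ?thesis using 0 by (simp add: node_type_def)
  next
    case 4
    then show ?thesis using 0 linked_sym by (simp add: node_type_def)
  qed
qed

lemma node_type_radius:
  assumes "j < 8" shows "linked (node_type j k) (node_type (Suc j) k)"
proof -
  have "linked (types ! Suc j ! 0) (if Suc j < 8 then types ! Suc (Suc j) ! 0 else types ! 8 ! 1)"
  proof (cases "Suc j < 8")
    case False
    then have "Suc j = 8" using assms by simp
    then show ?thesis using types_row[of 8 0] by simp
  qed (use types_column[of "Suc j" 0] in simp)
  then show ?thesis using types_column[OF assms, of k] types_column[OF assms, of 0] assms by (simp add: node_type_def)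
qed

lemma node_type_spoke: "linked centre_type (node_type 8 (2 * k))"
proof -
  have "types ! 8 = last inner_rows" using inner_rows_length by (simp add: types_def last_conv_nth flip: length_greater_0_conv)
  then have "linked centre_type (types ! 8 ! (2 * l))" if "l < 65" for l
    using list_all2_nthD[OF table_centre, of "2 * l"] that by simp
  from this[of k] this[of 0] show ?thesis by (simp add: node_type_def)
qed

section \<open>Columns and the boundary identifications\<close>

text \<open>Every arc has angle \<open>pi / real g\<close>. The first ten arcs are divided into 13
  columns each, the remaining ones into two.\<close>

definition column_angle :: "nat \<Rightarrow> real \<Rightarrow> real" where
  "column_angle g x = pi / real g * (min x 130 / 13 + max 0 (x - 130) / 2)"

lemma column_angle_low: "x \<le> 130 \<Longrightarrow> column_angle g x = pi / real g * (x / 13)"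
  by (simp add: column_angle_def)

lemma column_angle_high: "130 \<le> x \<Longrightarrow> column_angle g x = pi / real g * (x / 2 - 55)"
  by (simp add: column_angle_def diff_divide_distrib)

lemma column_angle_less:
  assumes "1 \<le> g" "x < y" shows "column_angle g x < column_angle g y"
proof -
  have p: "pi / real g > 0" using assms(1) by simp
  have m: "pi / real g * a < pi / real g * b" if "a < b" for a b
    using mult_strict_left_mono[OF that p] .
  consider "y \<le> 130" | "130 \<le> x" | "x \<le> 130" "130 < y" by linarith
  then show ?thesis
  proof cases
    case 1
    then show ?thesis using m[of "x / 13" "y / 13"] column_angle_low[of x g] column_angle_low[of y g] assms(2) by simp
  next
    case 2
    then show ?thesis using m[of "x / 2 - 55" "y / 2 - 55"] column_angle_high[of x g] column_angle_high[of y g] assms(2) by simp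
  next
    case 3
    then have "x / 13 < y / 2 - 55" by simp
    from m[OF this] show ?thesis using column_angle_low[of x g] column_angle_high[of y g] 3 by simp
  qed
qed

text \<open>As 130 is 2 modulo 4, beyond it the residues 2 and 3 belong to the first copy of an arc
  and 0 and 1 to the second.\<close>

definition partner :: "nat \<Rightarrow> nat" where
  "partner k = (if k < 130 then if even (k div 13) then k + 13 else k - 13
     else if k mod 4 < 2 then k - 2 else k + 2)"

definition columns :: "nat \<Rightarrow> nat" where "columns g = 130 + 4 * (g - 5)"

text \<open>For crosscap \<open>i\<close>, column \<open>a\<close> lies in the first copy of the arc
  and is glued to column \<open>a + d\<close> in the second. The offset \<open>110 + 4 * i\<close>
  starts at 130 for \<open>i = 5\<close>.\<close>

definition paired :: "nat \<Rightarrow> nat \<Rightarrow> nat \<Rightarrow> nat \<Rightarrow> bool" where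
  "paired g i a d \<longleftrightarrow> i < g \<and> (if i < 5 then d = 13 \<and> (\<exists>e<13. a = 26 * i + e) else d = 2 \<and> (\<exists>e<2. a = 110 + 4 * i + e))"

lemma paired_partner:
  assumes "paired g i a d" shows "partner a = a + d \<and> partner (a + d) = a \<and> a + d < columns g \<and> 0 < d"
proof (cases "i < 5")
  case True
  then obtain e where e: "d = 13" "e < 13" "a = 26 * i + e" using assms by (auto simp: paired_def)
  have "a div 13 = 2 * i" "(a + 13) div 13 = 2 * i + 1" by (rule div_nat_eqI; use e in simp)+
  moreover have "a + 13 < 130" using e True by simp
  ultimately show ?thesis using e(1) by (simp add: partner_def columns_def)
next
  case False
  then obtain e where e: "i < g" "d = 2" "e < 2" "a = 110 + 4 * i + e" using assms by (auto simp: paired_def)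
  have "a mod 4 = 2 + e" "(a + 2) mod 4 = e"
    using mod_mult_self1[of "2 + e" "27 + i" 4] mod_mult_self1[of e "28 + i" 4] e by (simp_all add: algebra_simps)
  then show ?thesis using e False by (simp add: partner_def columns_def)
qed

lemma paired_exists:
  assumes "k < columns g" "5 \<le> g" shows "\<exists>i a d. paired g i a d \<and> (k = a \<or> k = a + d)"
proof (cases "k < 130")
  case True
  define i e where "i = k div 26" and "e = k mod 26"
  have "k = 26 * i + e" "e < 26" "i < 5" using True by (simp_all add: i_def e_def div_less_iff_less_mult)
  then have "paired g i (26 * i + (if e < 13 then e else e - 13)) 13" using assms(2) by (auto simp: paired_def)
  moreover have "k = 26 * i + (if e < 13 then e else e - 13) \<or> k = 26 * i + (if e < 13 then e else e - 13) + 13"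
    using \<open>k = 26 * i + e\<close> by auto
  ultimately show ?thesis by blast
next
  case False
  define i e where "i = 5 + (k - 130) div 4" and "e = (k - 130) mod 4"
  have m: "k - 130 = 4 * ((k - 130) div 4) + e" by (simp add: e_def)
  then have k: "k = 110 + 4 * i + e" "e < 4" using False unfolding i_def e_def by simp_all
  then have "paired g i (110 + 4 * i + (if e < 2 then e else e - 2)) 2"
    using assms False unfolding paired_def columns_def i_def by auto
  moreover have "k = 110 + 4 * i + (if e < 2 then e else e - 2) \<or> k = 110 + 4 * i + (if e < 2 then e else e - 2) + 2"
    using k by auto
  ultimately show ?thesis by blast
qed

lemma partner_involution:
  assumes "k < columns g" "5 \<le> g" shows "partner k < columns g \<and> partner (partner k) = k \<and> partner k \<noteq> k"
proof -
  obtain i a d where "paired g i a d" "k = a \<or> k = a + d" using paired_exists[OF assms] by blast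
  then show ?thesis using paired_partner[of g i a d] by auto
qed

lemma node_type_partner:
  assumes "k < columns g" "5 \<le> g"
  shows "node_type 0 (partner k) = node_type 0 k \<and> node_type 0 (Suc (partner k)) = node_type 0 (Suc k)"
proof -
  obtain i a d where a: "paired g i a d" "k = a \<or> k = a + d" using paired_exists[OF assms] by blast
  have "node_type 0 (a + d) = node_type 0 a \<and> node_type 0 (Suc (a + d)) = node_type 0 (Suc a)"
  proof (cases "i < 5")
    case True
    then obtain e where e: "d = 13" "e < 13" "a = 26 * i + e" using a(1) by (auto simp: paired_def)
    have 1: "node_type 0 (26 * i + f) = boundary_walks ! i ! f" "node_type 0 (26 * i + 13 + f) = boundary_walks ! i ! f" if "f < 13" for f
      using boundary_row[OF True that] True that by (simp_all add: node_type_def)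
    have "node_type 0 (26 * i + 26) = boundary_walks ! 0 ! 0"
    proof (cases "i = 4")
      case True
      then show ?thesis using boundary_row(1)[of 0 0] by (simp add: node_type_def)
    next
      case False
      then show ?thesis using boundary_row(1)[of "Suc i" 0] boundary_walk_base[of "Suc i"] True
        by (simp add: node_type_def add.commute)
    qed
    then show ?thesis using 1[of e] 1[of "Suc e"] 1[of 0] e boundary_walk_base[OF True]
      by (cases "e = 12") (simp_all add: add.commute add.left_commute)
  next
    case False
    then show ?thesis using a(1) by (auto simp: paired_def node_type_def)
  qed
  then show ?thesis using a(2) paired_partner[OF a(1)] by auto
qed

lemma paired_angle:
  assumes a: "paired g i a d" and u: "u \<in> {0..1}"
  shows "2 * real i * pi / real g \<le> column_angle g (real a + u) \<and>
     column_angle g (real a + u) \<le> (2 * real i + 1) * pi / real g \<and>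
     column_angle g (real (a + d) + u) = column_angle g (real a + u) + pi / real g"
proof -
  have gp: "real g > 0" using a by (simp add: paired_def)
  have "\<exists>y. 2 * real i \<le> y \<and> y \<le> 2 * real i + 1 \<and> column_angle g (real a + u) = pi / real g * y \<and>
      column_angle g (real (a + d) + u) = pi / real g * (y + 1)"
  proof (cases "i < 5")
    case True
    then obtain e where e: "d = 13" "e < 13" "a = 26 * i + e" using a by (auto simp: paired_def)
    then have r: "26 * real i \<le> real a" "real a + 1 \<le> 26 * real i + 13" "real a + 14 \<le> 130" using True by auto
    have eq: "(real (a + d) + u) / 13 = (real a + u) / 13 + 1" by (simp add: e(1))
    have "column_angle g (real a + u) = pi / real g * ((real a + u) / 13)"
      "column_angle g (real (a + d) + u) = pi / real g * ((real a + u) / 13 + 1)"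
      unfolding eq[symmetric] by (intro column_angle_low, use r u e(1) in simp)+
    then show ?thesis using r u by (intro exI[of _ "(real a + u) / 13"]) auto
  next
    case False
    then obtain e where e: "d = 2" "e < 2" "a = 110 + 4 * i + e" using a by (auto simp: paired_def)
    then have r: "110 + 4 * real i \<le> real a" "real a + 1 \<le> 112 + 4 * real i" "130 \<le> real a" using False by auto
    have eq: "(real (a + d) + u) / 2 - 55 = ((real a + u) / 2 - 55) + 1" by (simp add: e(1))
    have "column_angle g (real a + u) = pi / real g * ((real a + u) / 2 - 55)"
      "column_angle g (real (a + d) + u) = pi / real g * (((real a + u) / 2 - 55) + 1)"
      unfolding eq[symmetric] by (intro column_angle_high, use r u e(1) in simp)+
    moreover have "2 * real i \<le> (real a + u) / 2 - 55" "(real a + u) / 2 - 55 \<le> 2 * real i + 1"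
      using r u by (auto simp: field_simps)
    ultimately show ?thesis by blast
  qed
  then obtain y where y: "2 * real i \<le> y" "y \<le> 2 * real i + 1" "column_angle g (real a + u) = pi / real g * y"
      "column_angle g (real (a + d) + u) = pi / real g * (y + 1)" by blast
  have "pi / real g * (2 * real i) \<le> pi / real g * y" "pi / real g * y \<le> pi / real g * (2 * real i + 1)"
    using mult_left_mono[OF y(1), of "pi / real g"] mult_left_mono[OF y(2), of "pi / real g"] gp by simp_all
  moreover have "2 * real i * pi / real g = pi / real g * (2 * real i)" "(2 * real i + 1) * pi / real g = pi / real g * (2 * real i + 1)"
    "pi / real g * (y + 1) = pi / real g * y + pi / real g" by (simp_all add: distrib_left mult.commute add_divide_distrib)
  ultimately show ?thesis unfolding y(3,4) by (simp only: simp_thms)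
qed

text \<open>Columns are closed, so the right end can be counted to the last column with
  \<open>u = 1\<close>; rounding down would leave the range.\<close>

lemma split_interval:
  fixes x :: real
  assumes "real a \<le> x" "x \<le> real b" "a < b"
  obtains k u where "a \<le> k" "k < b" "u \<in> {0..1}" "x = real k + u"
proof (cases "x = real b")
  case True
  then have "x = real (b - 1) + 1" using assms(3) by simp
  then show ?thesis using that[of "b - 1" 1] assms(3) by simp
next
  case False
  define k where "k = nat \<lfloor>x\<rfloor>"
  have "real k \<le> x" "x < real k + 1" using assms(1) unfolding k_def by linarith+
  then show ?thesis using that[of k "x - real k"] assms False by auto
qed

lemma gluing_columns:
  assumes g: "5 \<le> g" and ab: "(a, b) \<in> crosscap_gluing g"
  shows "\<exists>k<columns g. \<exists>u\<in>{0..1}. a = cis (column_angle g (real k + u)) \<and> b = cis (column_angle g (real (partner k) + u))"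
proof -
  obtain t i where t: "a = cis t" "b = cis (t + pi / real g)" "i < g" "2 * real i * pi / real g \<le> t" "t \<le> (2 * real i + 1) * pi / real g"
    using ab unfolding crosscap_gluing_def by blast
  have gp: "real g > 0" using g by simp
  define y where "y = t * real g / pi"
  have y: "2 * real i \<le> y" "y \<le> 2 * real i + 1" "t = pi / real g * y" using t(4,5) gp by (simp_all add: y_def field_simps)
  have "\<exists>k d. paired g i k d \<and> (\<exists>u\<in>{0..1}. column_angle g (real k + u) = t)"
  proof (cases "i < 5")
    case True
    obtain k u where k: "26 * i \<le> k" "k < 26 * i + 13" "u \<in> {0..1}" "13 * y = real k + u"
      by (rule split_interval[of "26 * i" "13 * y" "26 * i + 13"]) (use y in auto)
    have "k + 1 \<le> 130" using k(1,2) True by linarith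
    then have "real k + u \<le> 130" using k(3) by auto
    then have "column_angle g (real k + u) = t" using column_angle_low[of "13 * y" g] unfolding k(4)[symmetric] y(3) by simp
    moreover have "paired g i k 13" using True t(3) k(1,2) by (auto simp: paired_def intro!: exI[of _ "k - 26 * i"])
    ultimately show ?thesis using k(3) by blast
  next
    case False
    obtain k u where k: "110 + 4 * i \<le> k" "k < 110 + 4 * i + 2" "u \<in> {0..1}" "110 + 2 * y = real k + u"
      by (rule split_interval[of "110 + 4 * i" "110 + 2 * y" "110 + 4 * i + 2"]) (use y in auto)
    have "130 \<le> k" using k(1) False by linarith
    then have "130 \<le> 110 + 2 * y" using k(3,4) by simp
    then have "column_angle g (real k + u) = t"
      using column_angle_high[of "110 + 2 * y" g] unfolding k(4)[symmetric] y(3) by (simp add: add_divide_distrib)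
    moreover have "paired g i k 2" using False t(3) k(1,2) by (auto simp: paired_def intro!: exI[of _ "k - (110 + 4 * i)"])
    ultimately show ?thesis using k(3) by blast
  qed
  then obtain k d u where k: "paired g i k d" "u \<in> {0..1}" "column_angle g (real k + u) = t" by blast
  then have "column_angle g (real (partner k) + u) = t + pi / real g" "k < columns g"
    using paired_angle[OF k(1,2)] paired_partner[OF k(1)] by auto
  then show ?thesis using k(2,3) t(1,2) by (intro exI[of _ k] conjI bexI[of _ u]) simp_all
qed

theorem odd_quadrangulation_six_colours:
  assumes X: "nonorientable_surface g X" and g: "5 \<le> g"
  shows "\<exists>V E. odd_quadrangulation X V E \<and>
     (\<exists>c :: 'a \<Rightarrow> nat. local_coloring V (adjacent V E) 3 c \<and> card (c ` V) = 6)"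
proof -
  obtain q where q: "quotient_map (top_of_set (cball (0::complex) 1)) X q"
    "\<And>x y. x \<in> cball 0 1 \<Longrightarrow> y \<in> cball 0 1 \<Longrightarrow> q x = q y \<longleftrightarrow> (x, y) \<in> (crosscap_gluing g \<union> (crosscap_gluing g)\<inverse>)\<^sup>*"
    using X unfolding nonorientable_surface_def by blast
  interpret Q: crosscap_model X g q
    using X q by unfold_locales (auto simp: nonorientable_surface_def)
  have glue: "q (cis (column_angle g (real (a + d) + u))) = q (cis (column_angle g (real a + u)))"
    if a: "paired g i a d" and u: "u \<in> {0..1}" for i a d u
  proof -
    have "i < g" using a by (simp add: paired_def)
    then show ?thesis using paired_angle[OF a u] Q.q_glue[of i "column_angle g (real a + u)"] by simp
  qed
  interpret G: polar_grid X g q 8 "columns g" "column_angle g" partner centre_type node_type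
  proof unfold_locales
    show "continuous_on {0..real (columns g)} (column_angle g)"
      unfolding column_angle_def by (intro continuous_intros) auto
    show "strict_mono_on {0..real (columns g)} (column_angle g)"
      using column_angle_less g by (auto simp: strict_mono_on_def)
    have "real (columns g) = 110 + 4 * real g" using g by (simp add: columns_def of_nat_diff)
    then show "column_angle g (real (columns g)) = 2 * pi" using g column_angle_high[of "real (columns g)" g] by (simp add: field_simps)
    show "column_angle g 0 = 0" by (simp add: column_angle_def)
    show "even (columns g)" "4 \<le> columns g" "node_type j (columns g) = node_type j 0" for j
      by (simp_all add: columns_def node_type_def)
    show "q (cis (column_angle g (real k + u))) = q (cis (column_angle g (real (partner k) + u)))"
      if k: "k < columns g" "u \<in> {0..1}" for k u
    proof -
      obtain i a d where a: "paired g i a d" "k = a \<or> k = a + d" using paired_exists[OF k(1) g] by blast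
      then show ?thesis using glue[OF a(1) k(2)] paired_partner[OF a(1)] by auto
    qed
  qed (use partner_involution[OF _ g] gluing_columns[OF g] node_type_arc node_type_radius node_type_spoke node_type_partner[OF _ g] in \<open>auto simp del: of_nat_add\<close>)
  \<comment> \<open>Five walks of length 13 give 65 breaking edges, and every further crosscap adds
    two.\<close>
  have "(columns g) div 2 = 65 + 2 * (g - 5)" by (simp add: columns_def)
  then have "odd (columns g div 2)" by simp
  then have odd: "odd_quadrangulation X G.grid_vertices G.grid_edges" by (rule G.odd_grid)
  have "fst ` G.type_of ` {n. G.valid_node n} = fst ` set (concat types)"
  proof
    have mem: "types ! j ! k \<in> set (concat types)" if "j \<le> 8" "k < 130" for j k
      using that types_length[of j] table_length by (auto intro!: bexI[of _ "types ! j"])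
    have "fst (G.type_of n) \<in> fst ` set (concat types)" if "G.valid_node n" for n
    proof (cases n)
      case Centre
      then have "G.type_of n = centre_type" by simp
      then show ?thesis unfolding table_colours by (simp add: centre_type_def)
    next
      case (Node j k)
      then have j: "j \<le> 8" using that by simp
      have "node_type j k \<in> set (concat types)" unfolding node_type_def using mem j by (auto simp del: set_concat)
      then show ?thesis using Node by (simp del: set_concat)
    qed
    then show "fst ` G.type_of ` {n. G.valid_node n} \<subseteq> fst ` set (concat types)" by blast
    show "fst ` set (concat types) \<subseteq> fst ` G.type_of ` {n. G.valid_node n}"
    proof
      fix b assume "b \<in> fst ` set (concat types)"
      then obtain r where r: "r \<in> set types" "b \<in> fst ` set r" by auto
      obtain j where "j < length types" "types ! j = r" using r(1) by (auto simp: in_set_conv_nth)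
      then have j: "j \<le> 8" "r = types ! j" using table_length by auto
      obtain x where x: "x \<in> set r" "b = fst x" using r(2) by blast
      obtain k where k: "k < 130" "b = fst (types ! j ! k)"
        using x types_length[OF j(1)] unfolding j(2) by (metis in_set_conv_nth)
      have "k < columns g" using k(1) by (simp add: columns_def)
      then have "G.valid_node (Node j k)" "fst (G.type_of (Node j k)) = b" using j k by (simp_all add: node_type_def)
      then show "b \<in> fst ` G.type_of ` {n. G.valid_node n}" by blast
    qed
  qed
  then have "card (G.grid_colour ` G.grid_vertices) = 6"
    unfolding G.grid_colours image_image table_colours by simp
  then show ?thesis using odd G.local_coloring_grid by blast
qed

theorem theorem1p4:
  shows "(\<forall>(X :: 'a topology) g V E.
            nonorientable_surface g X \<and> g \<le> 4 \<and> odd_quadrangulation X V E \<longrightarrow>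
            4 \<le> local_chromatic_number V (adjacent V E))
       \<and> (\<forall>(X :: 'a topology) g.
            nonorientable_surface g X \<and> 5 \<le> g \<longrightarrow>
            (\<exists>V E. odd_quadrangulation X V E \<and>
               (\<exists>c :: 'a \<Rightarrow> nat. local_coloring V (adjacent V E) 3 c \<and> card (c ` V) = 6)))"
  using local_chromatic_ge_4 odd_quadrangulation_six_colours by blast

end
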